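(* Let $\alpha$ be such that $1-\beta<\alpha<\frac12$. Assume that there exist $M>0$ and $0<\gamma<1-2\alpha$ such that for every $k\ge1$ and every word $I\in\{0,\dots,d\}^k$, $$\|P_I\|\le\Gamma(\gamma|I|)\,M^{|I|}.$$ Then for every $r>1$ one has $T_C(r)>0$, and there exists a constant $K_{\alpha,\gamma,M,d}>0$ depending only on $\alpha,\gamma,M,d$ such that for every $0\le t<T_C(r)$ and every $N\ge1$, $$\Big\|X_t-\Big(x_0+\sum_{k=1}^{N}g_k(t)\Big)\Big\|\le K_{\alpha,\gamma,M,d}\,\|y\|_{\alpha,t,\infty}\,\frac{\big(M(d+1)\Lambda_\alpha(t,y)C_\alpha(t)\big)^N}{\Gamma((1-2\alpha-\gamma)N)}\,e^{2\left(M(d+1)\Lambda_\alpha(t,y)C_\alpha(t)\right)^{\frac{1}{1-2\alpha-\gamma}}}.\qquad(\ast)$$ In particular, for every $0\le t<T_C(r)$, $$X_t=x_0+\sum_{k=1}^{+\infty}g_k(t).\qquad(\ast\ast)$$ Moreover, if $C=+\infty$, that is, if the $V_i$'s are analytic on $\mathbb{R}^n$, then $(\ast)$ and $(\ast\ast)$ hold for every $t\ge0$.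
   Context: Standing assumptions: $x_0\in\mathbb{R}^n$; $V_0,\dots,V_d$ are Lipschitz $C^\infty$ vector fields on $\mathbb{R}^n$ with Lipschitz derivatives, analytic on $\{x:\|x-x_0\|\le C\}$ for some $C>0$; $y=(y^0,\dots,y^d):\mathbb{R}_{\ge0}\to\mathbb{R}^{d+1}$ is $\beta$-Hölder continuous with Hölder exponent $\beta>1/2$. $X$ is the unique solution of $dX_t=\sum_{i=0}^dV_i(X_t)\,dy^i_t$, $X_0=x_0$ (Young integrals). For a word $I=(i_1,\dots,i_k)\in\{0,\dots,d\}^k$ of length $|I|=k$: $\int_{\triangle^k[0,t]}dy^I=\int_{0\le t_1\le\cdots\le t_k\le t}dy^{i_1}_{t_1}\cdots dy^{i_k}_{t_k}$; $P_I\in\mathbb{R}^n$ is the vector with coordinates $P_I^j=(V_{i_1}\cdots V_{i_k}\pi^j)(x_0)$, where $\pi^j(x)=x_j$ and vector fields act as differential operators; $g_k(t)\in\mathbb{R}^n$ has coordinates $g_k^j(t)=\sum_{|I|=k}P_I^j\int_{\triangle^k[0,t]}dy^I$. For $r>1$, $$T_C(r)=\inf\Big\{t\ge0:\ \sum_{k=1}^\infty r^k\|g_k(t)\|\ge C\Big\}\qquad(\inf\emptyset=+\infty).$$ For $T>0$ (used with $T=t$ in the claim): $$\Lambda_\alpha(T,y)=\frac{1}{\Gamma(1-\alpha)}\sup_{0<s<t<T}\|(D^{1-\alpha}_{t-}y_{t-})(s)\|,$$ $$C_\alpha(T)=\Big(\frac{1}{\alpha(1-\alpha)}+T^\alpha\Big)(1+T^\alpha)\,\Gamma(1-2\alpha)\,T^{1-2\alpha},$$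 $$\|y\|_{\alpha,T,\infty}=\sup_{0\le t\le T}\Big(\|y(t)\|+\int_0^t\frac{\|y(t)-y(s)\|}{(t-s)^{1+\alpha}}\,ds\Big).$$ Here $y_{t-}(s)=y(s)-y(t)$ and, for $0<\theta<1$, the right-sided Weyl derivative is $$D^\theta_{b-}f(x)=\frac{(-1)^\theta}{\Gamma(1-\theta)}\Big(\frac{f(x)}{(b-x)^\theta}+\theta\int_x^b\frac{f(x)-f(u)}{(u-x)^{\theta+1}}\,du\Big),$$ where $(-1)^{\theta}$ is a complex number of modulus one. At $t=0$ the convention $\Lambda_\alpha(0,y)=0$ is used (both sides of $(\ast)$ are then $0$). *)

theory Defs
  imports "HOL-Analysis.Analysis"
begin

text \<open>
  The dimension \<open>n\<close> of the state space has to be quantified inside the statement, since the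
  constant in the remainder estimate must not depend on it. Vectors are therefore functions
  \<open>nat \<Rightarrow> real\<close>, and \<open>\<real>\<^sup>n\<close> is the carrier of the library topology \<^const>\<open>Euclidean_space\<close>,
  that is, the set of all \<open>x\<close> with \<open>x i = 0\<close> for \<open>i \<ge> n\<close>. Coordinates of \<open>\<real>\<^sup>n\<close> are numbered
  from \<open>0\<close> to \<open>n - 1\<close>.
\<close>

abbreviation Rn :: "nat \<Rightarrow> (nat \<Rightarrow> real) set"
  where "Rn n \<equiv> topspace (Euclidean_space n)"

definition enorm :: "nat \<Rightarrow> (nat \<Rightarrow> real) \<Rightarrow> real"
  where "enorm n x = L2_set x {..<n}"

definition edist :: "nat \<Rightarrow> (nat \<Rightarrow> real) \<Rightarrow> (nat \<Rightarrow> real) \<Rightarrow> real"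
  where "edist n x z = enorm n (\<lambda>j. x j - z j)"

definition ecball :: "nat \<Rightarrow> (nat \<Rightarrow> real) \<Rightarrow> real \<Rightarrow> (nat \<Rightarrow> real) set"
  where "ecball n a C = {x \<in> Rn n. edist n x a \<le> C}"


subsection \<open>Scalar functions and vector fields on \<open>\<real>\<^sup>n\<close>\<close>

definition partial_deriv :: "nat \<Rightarrow> ((nat \<Rightarrow> real) \<Rightarrow> real) \<Rightarrow> (nat \<Rightarrow> real) \<Rightarrow> real"
  where "partial_deriv j f x = deriv (\<lambda>s. f (x(j := s))) (x j)"

text \<open>\<open>C\<^sup>\<infinity>\<close>: the iterated partial derivatives of all orders exist and are continuous.\<close>

definition smooth_fun :: "nat \<Rightarrow> ((nat \<Rightarrow> real) \<Rightarrow> real) \<Rightarrow> bool"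
  where "smooth_fun n f \<longleftrightarrow>
    (\<forall>js. set js \<subseteq> {..<n} \<longrightarrow>
      continuous_map (Euclidean_space n) euclideanreal (foldr partial_deriv js f) \<and>
      (\<forall>j<n. \<forall>x\<in>Rn n.
        (\<lambda>s. foldr partial_deriv js f (x(j := s))) differentiable (at (x j))))"

text \<open>
  Real analyticity on a set: around each of its points, \<open>f\<close> is the sum of an (absolutely)
  convergent power series; \<open>m\<close> ranges over the multi-indices in \<open>\<nat>\<^sup>n\<close>.
\<close>

definition real_analytic_at :: "nat \<Rightarrow> ((nat \<Rightarrow> real) \<Rightarrow> real) \<Rightarrow> (nat \<Rightarrow> real) \<Rightarrow> bool"
  where "real_analytic_at n f a \<longleftrightarrow>
    (\<exists>\<epsilon>>0. \<exists>c :: (nat \<Rightarrow> nat) \<Rightarrow> real. \<forall>x\<in>Rn n. edist n x a < \<epsilon> \<longrightarrow>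
      ((\<lambda>m. c m * (\<Prod>i<n. (x i - a i) ^ m i)) has_sum f x) {m. \<forall>i\<ge>n. m i = 0})"

definition analytic_field_on ::
  "nat \<Rightarrow> ((nat \<Rightarrow> real) \<Rightarrow> (nat \<Rightarrow> real)) \<Rightarrow> (nat \<Rightarrow> real) set \<Rightarrow> bool"
  where "analytic_field_on n W S \<longleftrightarrow> (\<forall>a\<in>S. \<forall>j<n. real_analytic_at n (\<lambda>x. W x j) a)"

text \<open>
  A Lipschitz \<open>C\<^sup>\<infinity>\<close> vector field on \<open>\<real>\<^sup>n\<close> whose derivative is Lipschitz; the latter is expressed
  through the entries of the Jacobian matrix.
\<close>

definition lipschitz_smooth_field :: "nat \<Rightarrow> ((nat \<Rightarrow> real) \<Rightarrow> (nat \<Rightarrow> real)) \<Rightarrow> bool"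
  where "lipschitz_smooth_field n W \<longleftrightarrow>
    W \<in> Rn n \<rightarrow> Rn n \<and>
    (\<forall>j<n. smooth_fun n (\<lambda>x. W x j)) \<and>
    (\<exists>L. \<forall>x\<in>Rn n. \<forall>z\<in>Rn n. edist n (W x) (W z) \<le> L * edist n x z) \<and>
    (\<exists>L. \<forall>x\<in>Rn n. \<forall>z\<in>Rn n. \<forall>i<n. \<forall>j<n.
      \<bar>partial_deriv i (\<lambda>u. W u j) x - partial_deriv i (\<lambda>u. W u j) z\<bar> \<le> L * edist n x z)"

text \<open>A vector field acting as a first order differential operator.\<close>

definition field_apply ::
  "nat \<Rightarrow> ((nat \<Rightarrow> real) \<Rightarrow> (nat \<Rightarrow> real)) \<Rightarrow> ((nat \<Rightarrow> real) \<Rightarrow> real) \<Rightarrow> (nat \<Rightarrow> real) \<Rightarrow> real"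
  where "field_apply n W f x = (\<Sum>j<n. W x j * partial_deriv j f x)"

text \<open>\<open>P_word n V x0 I\<close> has the coordinates \<open>(V i1 \<dots> V ik \<pi>\<^sup>j)(x0)\<close> for \<open>I = [i1, \<dots>, ik]\<close>.\<close>

definition P_word ::
  "nat \<Rightarrow> (nat \<Rightarrow> (nat \<Rightarrow> real) \<Rightarrow> (nat \<Rightarrow> real)) \<Rightarrow> (nat \<Rightarrow> real) \<Rightarrow> nat list \<Rightarrow> nat \<Rightarrow> real"
  where "P_word n V x0 I j = foldr (\<lambda>i. field_apply n (V i)) I (\<lambda>x. x j) x0"


subsection \<open>Paths, Young integrals and iterated integrals\<close>

text \<open>
  A path in \<open>\<real>\<^sup>m\<close> is written \<open>z t i\<close> with time \<open>t \<ge> 0\<close> and coordinate \<open>i < m\<close>. Hoelder continuity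
  of a path on the unbounded time axis is meant on each compact time interval.
\<close>

definition holder_path :: "nat \<Rightarrow> real \<Rightarrow> (real \<Rightarrow> nat \<Rightarrow> real) \<Rightarrow> bool"
  where "holder_path m \<beta> z \<longleftrightarrow>
    (\<forall>T\<ge>0. \<exists>A. \<forall>s\<in>{0..T}. \<forall>t\<in>{0..T}. edist m (z s) (z t) \<le> A * \<bar>s - t\<bar> powr \<beta>)"

text \<open>
  The Young integral is the limit of the Riemann-Stieltjes sums as the mesh tends to zero;
  \<open>p\<close> are the partition points, \<open>\<xi>\<close> the evaluation points.
\<close>

definition has_young_integral ::
  "(real \<Rightarrow> real) \<Rightarrow> (real \<Rightarrow> real) \<Rightarrow> real \<Rightarrow> real \<Rightarrow> real \<Rightarrow> bool"
  where "has_young_integral f g a b J \<longleftrightarrow>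
    (\<forall>\<epsilon>>0. \<exists>\<delta>>0. \<forall>(N::nat) p \<xi>.
      p 0 = a \<and> p N = b \<and>
      (\<forall>k<N. p k \<le> \<xi> k \<and> \<xi> k \<le> p (Suc k) \<and> p (Suc k) - p k < \<delta>) \<longrightarrow>
      \<bar>(\<Sum>k<N. f (\<xi> k) * (g (p (Suc k)) - g (p k))) - J\<bar> < \<epsilon>)"

definition young_integral :: "(real \<Rightarrow> real) \<Rightarrow> (real \<Rightarrow> real) \<Rightarrow> real \<Rightarrow> real \<Rightarrow> real"
  where "young_integral f g a b = (THE J. has_young_integral f g a b J)"

text \<open>
  The integral of \<open>dy i1 (t1) \<dots> dy ik (tk)\<close> over \<open>0 \<le> t1 \<le> \<dots> \<le> tk \<le> t\<close>: the first letter of the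
  word is integrated first (innermost), the last letter last.
\<close>

definition simplex_integral :: "(real \<Rightarrow> nat \<Rightarrow> real) \<Rightarrow> nat list \<Rightarrow> real \<Rightarrow> real"
  where "simplex_integral y I =
    foldl (\<lambda>F i t. young_integral F (\<lambda>s. y s i) 0 t) (\<lambda>t. 1) I"

definition g_term ::
  "nat \<Rightarrow> nat \<Rightarrow> (nat \<Rightarrow> (nat \<Rightarrow> real) \<Rightarrow> (nat \<Rightarrow> real)) \<Rightarrow> (nat \<Rightarrow> real) \<Rightarrow>
    (real \<Rightarrow> nat \<Rightarrow> real) \<Rightarrow> nat \<Rightarrow> real \<Rightarrow> nat \<Rightarrow> real"
  where "g_term n d V x0 y k t j =
    (\<Sum>I | set I \<subseteq> {..d} \<and> length I = k. P_word n V x0 I j * simplex_integral y I t)"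

definition T_time ::
  "nat \<Rightarrow> nat \<Rightarrow> (nat \<Rightarrow> (nat \<Rightarrow> real) \<Rightarrow> (nat \<Rightarrow> real)) \<Rightarrow> (nat \<Rightarrow> real) \<Rightarrow>
    (real \<Rightarrow> nat \<Rightarrow> real) \<Rightarrow> real \<Rightarrow> real \<Rightarrow> ereal"
  where "T_time n d V x0 y C r =
    Inf {ereal t |t. t \<ge> 0 \<and>
      (\<Sum>k. ereal (r ^ Suc k * enorm n (g_term n d V x0 y (Suc k) t))) \<ge> ereal C}"

text \<open>
  Solutions of \<open>dX = \<Sum>\<^sub>i V\<^sub>i(X) dy\<^sup>i\<close>, \<open>X\<^sub>0 = x0\<close>, for a \<open>\<beta>\<close>-Hoelder driver \<open>y\<close>. The solution is sought
  among the paths whose Hoelder exponent \<open>\<kappa>\<close> satisfies Young's condition \<open>\<kappa> + \<beta> > 1\<close>, which is what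
  makes the integrals exist.
\<close>

definition young_solution ::
  "nat \<Rightarrow> nat \<Rightarrow> real \<Rightarrow> (nat \<Rightarrow> (nat \<Rightarrow> real) \<Rightarrow> (nat \<Rightarrow> real)) \<Rightarrow> (nat \<Rightarrow> real) \<Rightarrow>
    (real \<Rightarrow> nat \<Rightarrow> real) \<Rightarrow> (real \<Rightarrow> nat \<Rightarrow> real) \<Rightarrow> bool"
  where "young_solution n d \<beta> V x0 y X \<longleftrightarrow>
    (\<forall>t\<ge>0. X t \<in> Rn n) \<and>
    (\<exists>\<kappa>. \<kappa> + \<beta> > 1 \<and> holder_path n \<kappa> X) \<and>
    (\<forall>t\<ge>0. \<forall>j<n. X t j = x0 j + (\<Sum>i\<le>d. young_integral (\<lambda>s. V i (X s) j) (\<lambda>s. y s i) 0 t))"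


subsection \<open>Fractional quantities\<close>

text \<open>The factor \<open>(-1)\<^sup>\<theta>\<close> is taken with the principal branch, i.e. it equals \<open>exp (i \<pi> \<theta>)\<close>.\<close>

definition weyl_deriv_right :: "real \<Rightarrow> real \<Rightarrow> (real \<Rightarrow> real) \<Rightarrow> real \<Rightarrow> complex"
  where "weyl_deriv_right \<theta> b f x =
    (- 1) powr (complex_of_real \<theta>) / complex_of_real (Gamma (1 - \<theta>)) *
    complex_of_real (f x / (b - x) powr \<theta> +
      \<theta> * integral {x..b} (\<lambda>u. (f x - f u) / (u - x) powr (\<theta> + 1)))"

definition Lambda_const :: "nat \<Rightarrow> real \<Rightarrow> real \<Rightarrow> (real \<Rightarrow> nat \<Rightarrow> real) \<Rightarrow> real"
  where "Lambda_const d \<alpha> T y =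
    (if T = 0 then 0
     else 1 / Gamma (1 - \<alpha>) *
       (SUP (s, t) \<in> {(s, t). 0 < s \<and> s < t \<and> t < T}.
         L2_set (\<lambda>i. cmod (weyl_deriv_right (1 - \<alpha>) t (\<lambda>u. y u i - y t i) s)) {..d}))"

definition C_const :: "real \<Rightarrow> real \<Rightarrow> real"
  where "C_const \<alpha> T =
    (1 / (\<alpha> * (1 - \<alpha>)) + T powr \<alpha>) * (1 + T powr \<alpha>) * Gamma (1 - 2 * \<alpha>) * T powr (1 - 2 * \<alpha>)"

definition path_norm :: "nat \<Rightarrow> real \<Rightarrow> real \<Rightarrow> (real \<Rightarrow> nat \<Rightarrow> real) \<Rightarrow> real"
  where "path_norm d \<alpha> T y =
    (SUP t\<in>{0..T}. enorm (Suc d) (y t) +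
      integral {0..t} (\<lambda>s. edist (Suc d) (y t) (y s) / (t - s) powr (1 + \<alpha>)))"


subsection \<open>The estimate and the expansion\<close>

definition taylor_estimate ::
  "real \<Rightarrow> real \<Rightarrow> real \<Rightarrow> real \<Rightarrow> nat \<Rightarrow> nat \<Rightarrow> (nat \<Rightarrow> (nat \<Rightarrow> real) \<Rightarrow> (nat \<Rightarrow> real)) \<Rightarrow>
    (nat \<Rightarrow> real) \<Rightarrow> (real \<Rightarrow> nat \<Rightarrow> real) \<Rightarrow> (real \<Rightarrow> nat \<Rightarrow> real) \<Rightarrow> real \<Rightarrow> nat \<Rightarrow> bool"
  where "taylor_estimate K \<alpha> \<gamma> M d n V x0 y X t N \<longleftrightarrow>
    (let z = M * (real d + 1) * Lambda_const d \<alpha> t y * C_const \<alpha> t in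
      edist n (X t) (\<lambda>j. x0 j + (\<Sum>k=1..N. g_term n d V x0 y k t j))
      \<le> K * path_norm d \<alpha> t y * (z ^ N / Gamma ((1 - 2 * \<alpha> - \<gamma>) * real N))
          * exp (2 * z powr (1 / (1 - 2 * \<alpha> - \<gamma>))))"

definition taylor_expansion ::
  "nat \<Rightarrow> nat \<Rightarrow> (nat \<Rightarrow> (nat \<Rightarrow> real) \<Rightarrow> (nat \<Rightarrow> real)) \<Rightarrow>
    (nat \<Rightarrow> real) \<Rightarrow> (real \<Rightarrow> nat \<Rightarrow> real) \<Rightarrow> (real \<Rightarrow> nat \<Rightarrow> real) \<Rightarrow> real \<Rightarrow> bool"
  where "taylor_expansion n d V x0 y X t \<longleftrightarrow>
    (\<forall>j<n. (\<lambda>k. g_term n d V x0 y (Suc k) t j) sums (X t j - x0 j))"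

end

theory Submission
  imports Defs "HOL-Complex_Analysis.Complex_Analysis"
begin

text \<open>
  Let \<open>Phi k f s\<close> be the sum over all words \<open>I\<close> of length \<open>k\<close> of \<open>(V\<^sub>I f)(x0)\<close> times the iterated
  integral of \<open>I\<close> over \<open>[0, s]\<close>. By the Leibniz rule and integration by parts for Young integrals,
  \<open>f \<mapsto> \<Sum>\<^sub>k \<epsilon>\<^sup>k Phi k f s\<close> is multiplicative, hence for analytic \<open>f\<close> it is the Taylor series at
  \<open>\<epsilon> = 0\<close> of \<open>f (S \<epsilon>)\<close>, where \<open>S \<epsilon> = x0 + \<Sum>\<^sub>k \<epsilon>\<^sup>k g\<^sub>k(s)\<close>. The bound on \<open>P\<^sub>I\<close> makes these series
  entire in \<open>\<epsilon>\<close> for \<open>f = V\<^sub>i\<close>, and before the time \<open>T\<^sub>C(r)\<close> the point \<open>S \<epsilon>\<close> stays in the domain of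
  analyticity for \<open>\<bar>\<epsilon>\<bar> < r\<close>. Since \<open>r > 1\<close>, the identity theorem gives
  \<open>V\<^sub>i (S 1) = \<Sum>\<^sub>k Phi k V\<^sub>i s\<close>; integrating term by term shows that \<open>S 1\<close> solves the equation, and
  solutions are unique by a contraction argument in an exponentially weighted Hoelder norm.

  For the remainder, \<open>\<Lambda>\<^sub>\<alpha>\<close> bounds the Hoelder seminorm of order \<open>1 - \<alpha>\<close> of \<open>y\<close> by a maximum
  principle: where \<open>y - y t\<close> is maximal, the integral in the Weyl derivative is nonnegative. The
  weight \<open>exp (\<nu> u)\<close> with \<open>\<nu> = k / t\<close> then yields the decay \<open>k powr (- (1 - \<alpha>) k)\<close> of the iterated
  integrals of order \<open>k\<close>. This beats \<open>1 / \<Gamma>((1 - 2\<alpha>) k)\<close> by more than any geometric factor, so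
  that all geometric constants are absorbed into \<open>K\<close>. The factor \<open>path_norm\<close> comes from a
  Sobolev-type bound for the double integrals.
\<close>

section \<open>Growth of the Gamma function\<close>

text \<open>Two demands shape the quantitative half. The constant K must not see the dimension n,
  the fields or the path; hence vectors are estimated word by word in the Euclidean norm, and
  whatever depends on n or on a Hoelder constant of order \<beta> is confined to qualitative
  statements. Moreover the remainder of order N starts with words of length N + 1, while the claim
  offers only N factors \<open>\<Lambda> * C\<close>: the missing one is paid by
  \<open>path_norm\<close>, which is linear in y. This is why the first two letters of a word are
  treated apart, by an estimate in which the integrand enters through its fractional kernel and the
  integrator through \<open>\<Lambda>\<close>.

  The qualitative half meets another obstacle. Analyticity is given at real points only, so no
  complex domain containing the segment from 0 to 1 is available in advance on which both sides of
  the identity are holomorphic. The comparison therefore runs along a real interval by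
  connectedness, and complex discs are used only locally.\<close>

lemma Gamma_le_powr:
  fixes c :: real
  assumes c: "c > 0"
  shows "\<exists>K>0. \<forall>x\<ge>c. Gamma x \<le> K * (x + 1) powr x"
proof -
  have "continuous_on {c..c+1} (Gamma :: real \<Rightarrow> real)"
    using c by (intro continuous_intros) (auto elim!: nonpos_Ints_cases)
  then obtain x0 where x0: "x0 \<in> {c..c+1}" "\<And>x. x \<in> {c..c+1} \<Longrightarrow> Gamma x \<le> Gamma x0"
    using continuous_attains_sup[of "{c..c+1}" Gamma] by auto
  define K where "K = Gamma x0"
  have K: "K > 0" using x0 c by (auto simp: K_def)
  \<comment> \<open>Induction over unit steps to the right of the compact interval on which
    continuity provides K. One step multiplies by w \<le> x + 1, which is what the right-hand side
    allows.\<close>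
  have "Gamma x \<le> K * (x + 1) powr x" if "x \<ge> c" "x \<le> c + 1 + real n" for x n
    using that
  proof (induction n arbitrary: x)
    case 0
    have "1 \<le> (x + 1) powr x" using 0 c by (intro ge_one_powr_ge_zero) auto
    hence "K * 1 \<le> K * (x + 1) powr x" using K by (intro mult_left_mono) auto
    thus ?case using x0(2)[of x] 0 by (simp add: K_def)
  next
    case (Suc n)
    show ?case
    proof (cases "x \<le> c + 1")
      case True
      have "1 \<le> (x + 1) powr x" using Suc.prems c by (intro ge_one_powr_ge_zero) auto
      hence "K * 1 \<le> K * (x + 1) powr x" using K by (intro mult_left_mono) auto
      thus ?thesis using x0(2)[of x] True Suc.prems by (simp add: K_def)
    next
      case False
      define w where "w = x - 1"
      have w: "w \<ge> c" "w \<le> c + 1 + real n" "x = w + 1" "w > 0" using False Suc.prems c by (auto simp: w_def)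
      have "w \<notin> \<int>\<^sub>\<le>\<^sub>0" using w by (auto elim!: nonpos_Ints_cases)
      hence "Gamma x = w * Gamma w" using w by (simp add: Gamma_plus1)
      also have "\<dots> \<le> w * (K * (w + 1) powr w)" using Suc.IH[of w] w by (intro mult_left_mono) auto
      also have "\<dots> \<le> (x + 1) * (K * (x + 1) powr w)"
        using w K by (intro mult_mono mult_left_mono powr_mono2) auto
      also have "\<dots> = K * (x + 1) powr x" using w by (simp add: powr_add)
      finally show ?thesis .
    qed
  qed
  moreover have "\<exists>n. x \<le> c + 1 + real n" for x
    using real_arch_simple[of "x - (c + 1)"] by (auto simp: algebra_simps)
  ultimately show ?thesis using K by blast
qed

text \<open>A crude form of Stirling's bound: what counts is the exact exponent \<open>c * k\<close>
  of k, since the geometric factor \<open>B ^ k\<close> is absorbed in every later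
  comparison.\<close>

lemma Gamma_mult_nat_le:
  fixes c :: real
  assumes c: "c > 0"
  shows "\<exists>K B. K > 0 \<and> B \<ge> 1 \<and> (\<forall>k::nat. k \<ge> 1 \<longrightarrow> Gamma (c * real k) \<le> K * B ^ k * real k powr (c * real k))"
proof -
  obtain K where K: "K > 0" "\<And>x. x \<ge> c \<Longrightarrow> Gamma x \<le> K * (x + 1) powr x"
    using Gamma_le_powr[OF c] by blast
  define B where "B = (c + 1) powr c"
  have B: "B \<ge> 1" using c by (simp add: B_def ge_one_powr_ge_zero)
  have "Gamma (c * real k) \<le> K * B ^ k * real k powr (c * real k)" if k: "k \<ge> 1" for k :: nat
  proof -
    have "Gamma (c * real k) \<le> K * (c * real k + 1) powr (c * real k)" using K(2) c k by simp
    also have "\<dots> \<le> K * ((c + 1) * real k) powr (c * real k)"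
      using K c k by (intro mult_left_mono powr_mono2) (auto simp: algebra_simps)
    also have "((c + 1) * real k) powr (c * real k) = (c + 1) powr (c * real k) * real k powr (c * real k)"
      using c by (simp add: powr_mult)
    also have "(c + 1) powr (c * real k) = B ^ k"
      using c by (simp add: B_def powr_powr[symmetric] powr_realpow)
    finally show ?thesis by simp
  qed
  thus ?thesis using K B by blast
qed

text \<open>\<open>A \<le> k powr \<delta>\<close> as soon as k exceeds
  \<open>(A + 1) powr (1 / \<delta>)\<close>; the finitely many smaller k are paid by K.\<close>

lemma power_le_powr_self:
  fixes A \<delta> :: real
  assumes A: "A \<ge> 0" and d: "\<delta> > 0"
  shows "\<exists>K>0. \<forall>k::nat. k \<ge> 1 \<longrightarrow> A ^ k \<le> K * real k powr (\<delta> * real k)"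
proof -
  obtain k0 :: nat where k0: "(A + 1) powr (1 / \<delta>) < real k0" using reals_Archimedean2 by blast
  define K where "K = (A + 1) ^ k0"
  have K1: "K \<ge> 1" using A by (simp add: K_def)
  have "A ^ k \<le> K * real k powr (\<delta> * real k)" if k: "k \<ge> 1" for k :: nat
  proof (cases "k \<le> k0")
    case True
    have "A ^ k \<le> (A + 1) ^ k" using A by (intro power_mono) auto
    also have "\<dots> \<le> K" unfolding K_def using A True by (intro power_increasing) auto
    also have "\<dots> = K * 1" by simp
    also have "\<dots> \<le> K * real k powr (\<delta> * real k)"
      using K1 k d by (intro mult_left_mono ge_one_powr_ge_zero) auto
    finally show ?thesis .
  next
    case False
    have "A \<le> A + 1" by simp
    also have "\<dots> = ((A + 1) powr (1 / \<delta>)) powr \<delta>" using A d by (simp add: powr_powr)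
    also have "\<dots> \<le> real k powr \<delta>" using k0 False d A by (intro powr_mono2) auto
    finally have "A ^ k \<le> (real k powr \<delta>) ^ k" using A by (intro power_mono)
    also have "\<dots> = real k powr (\<delta> * real k)" using k by (simp add: powr_realpow[symmetric] powr_powr)
    also have "\<dots> = 1 * real k powr (\<delta> * real k)" by simp
    also have "\<dots> \<le> K * real k powr (\<delta> * real k)" using K1 by (intro mult_right_mono) auto
    finally show ?thesis .
  qed
  thus ?thesis using K1 by (intro exI[of _ K]) auto
qed

text \<open>The qualitative version, used with \<theta> = 1 - \<alpha> to sum majorants against an
  arbitrary geometric sequence. The factor \<open>(1/2) ^ k\<close> is gained by comparing powers of
  2AB instead of AB.\<close>

lemma Gamma_superexponential_decay:
  fixes \<gamma> \<theta> A :: real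
  assumes "0 < \<gamma>" "\<gamma> < \<theta>" "A \<ge> 0"
  shows "\<exists>K>0. \<forall>k::nat. k \<ge> 1 \<longrightarrow> A ^ k * Gamma (\<gamma> * real k) * real k powr (- \<theta> * real k) \<le> K * (1/2) ^ k"
proof -
  obtain K1 B where K1: "K1 > 0" "B \<ge> 1"
    "\<And>k::nat. k \<ge> 1 \<Longrightarrow> Gamma (\<gamma> * real k) \<le> K1 * B ^ k * real k powr (\<gamma> * real k)"
    using Gamma_mult_nat_le[OF assms(1)] by blast
  obtain K2 where K2: "K2 > 0" "\<And>k::nat. k \<ge> 1 \<Longrightarrow> (2 * A * B) ^ k \<le> K2 * real k powr ((\<theta> - \<gamma>) * real k)"
    using power_le_powr_self[of "2 * A * B" "\<theta> - \<gamma>"] assms K1 by auto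
  have "A ^ k * Gamma (\<gamma> * real k) * real k powr (- \<theta> * real k) \<le> K1 * K2 * (1/2) ^ k" if k: "k \<ge> 1" for k :: nat
  proof -
    have "A ^ k * Gamma (\<gamma> * real k) * real k powr (- \<theta> * real k)
       \<le> A ^ k * (K1 * B ^ k * real k powr (\<gamma> * real k)) * real k powr (- \<theta> * real k)"
      using K1(3)[OF k] assms by (intro mult_right_mono mult_left_mono) auto
    also have "\<dots> = K1 * (1/2) ^ k * (2 * A * B) ^ k * (real k powr (\<gamma> * real k) * real k powr (- \<theta> * real k))"
      by (simp add: power_mult_distrib power_one_over field_simps)
    also have "real k powr (\<gamma> * real k) * real k powr (- \<theta> * real k) = real k powr (- ((\<theta> - \<gamma>) * real k))"
      by (simp add: powr_add[symmetric] algebra_simps)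
    also have "K1 * (1/2) ^ k * (2 * A * B) ^ k * real k powr (- ((\<theta> - \<gamma>) * real k))
       \<le> K1 * (1/2) ^ k * (K2 * real k powr ((\<theta> - \<gamma>) * real k)) * real k powr (- ((\<theta> - \<gamma>) * real k))"
      using K1 K2(2)[OF k] by (intro mult_right_mono mult_left_mono) auto
    also have "\<dots> = K1 * K2 * (1/2) ^ k * (real k powr ((\<theta> - \<gamma>) * real k) * real k powr (- ((\<theta> - \<gamma>) * real k)))"
      by simp
    also have "real k powr ((\<theta> - \<gamma>) * real k) * real k powr (- ((\<theta> - \<gamma>) * real k)) = 1"
      using k by (simp add: powr_add[symmetric])
    finally show ?thesis by simp
  qed
  thus ?thesis using K1 K2 by (intro exI[of _ "K1 * K2"]) auto
qed

text \<open>The exponential of the final estimate originates here. For z > 0 and w = z powr (1 / c),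
  the left-hand side is the c-th power of (w / (m + 1)) ^ m, which is at most w ^ m / m! and hence
  at most exp w.\<close>

lemma power_le_powr_exp:
  fixes z c :: real and m :: nat
  assumes z: "z \<ge> 0" and c: "0 < c" "c \<le> 1"
  shows "z ^ m * real (m + 1) powr (- (c * real m)) \<le> exp (2 * z powr (1 / c))"
proof (cases "z = 0")
  case True
  then show ?thesis by (cases m) auto
next
  case False
  define w where "w = z powr (1 / c)"
  have w: "w > 0" "z = w powr c" using False z c by (auto simp: w_def powr_powr)
  have "w ^ m / real (m + 1) ^ m \<le> w ^ m / fact m"
  proof -
    have "(fact m :: real) \<le> real m ^ m" using fact_le_power[of m, where 'a = real] by simp
    also have "\<dots> \<le> real (m + 1) ^ m" by (intro power_mono) auto
    finally have "(fact m :: real) \<le> real (m + 1) ^ m" .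
    thus ?thesis using w by (intro divide_left_mono) auto
  qed
  also have "\<dots> \<le> exp w"
  proof -
    have "sum (\<lambda>n. w ^ n / fact n) {m} \<le> (\<Sum>n. w ^ n / fact n)"
      using summable_exp[of w] w by (intro sum_le_suminf) (auto simp: divide_inverse mult.commute)
    thus ?thesis by (simp add: exp_def divide_inverse mult.commute)
  qed
  finally have le: "(w / real (m + 1)) ^ m \<le> exp w" by (simp add: power_divide)
  have "z ^ m * real (m + 1) powr (- (c * real m)) = ((w / real (m + 1)) ^ m) powr c"
  proof -
    have "z ^ m = w powr (c * real m)" using w by (simp add: powr_realpow[symmetric] powr_powr)
    moreover have "((w / real (m + 1)) ^ m) powr c = (w / real (m + 1)) powr (real m * c)"
      using w by (simp add: powr_realpow[symmetric] powr_powr)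
    ultimately show ?thesis using w by (simp add: powr_divide powr_minus_divide mult.commute)
  qed
  also have "\<dots> \<le> exp w powr c" using le w c by (intro powr_mono2) auto
  also have "\<dots> = exp (c * w)" by (simp add: powr_def)
  also have "\<dots> \<le> exp (2 * w)" using w c by (simp add: mult_right_mono)
  finally show ?thesis by (simp add: w_def)
qed

text \<open>Since \<open>\<gamma> + c < \<theta>\<close>, the factor \<open>k powr (- \<theta> k)\<close> beats every geometric factor, in
  particular those coming from Stirling-type bounds for the two Gamma values.\<close>

lemma mittag_leffler_tail_term:
  fixes \<gamma> \<theta> c A :: real
  assumes "0 < \<gamma>" "0 < c" "c \<le> 1" "\<gamma> + c < \<theta>" "A \<ge> 0"
  shows "\<exists>K>0. \<forall>N m (z::real). N \<ge> 1 \<longrightarrow> z \<ge> 0 \<longrightarrow>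
    A ^ (N + 1 + m) * Gamma (\<gamma> * real (N + 1 + m)) * real (N + 1 + m) powr (- \<theta> * real (N + 1 + m)) * z ^ m
     \<le> K / Gamma (c * real N) * exp (2 * z powr (1 / c)) * (1/2) ^ m"
proof -
  define \<delta> where "\<delta> = \<theta> - \<gamma> - c"
  have d: "\<delta> > 0" using assms by (simp add: \<delta>_def)
  obtain K1 B1 where K1: "K1 > 0" "B1 \<ge> 1"
    "\<And>k::nat. k \<ge> 1 \<Longrightarrow> Gamma (\<gamma> * real k) \<le> K1 * B1 ^ k * real k powr (\<gamma> * real k)"
    using Gamma_mult_nat_le[OF assms(1)] by blast
  obtain K2 B2 where K2: "K2 > 0" "B2 \<ge> 1"
    "\<And>k::nat. k \<ge> 1 \<Longrightarrow> Gamma (c * real k) \<le> K2 * B2 ^ k * real k powr (c * real k)"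
    using Gamma_mult_nat_le[OF assms(2)] by blast
  obtain K3 where K3: "K3 > 0" "\<And>k::nat. k \<ge> 1 \<Longrightarrow> (2 * A * B1 * B2) ^ k \<le> K3 * real k powr (\<delta> * real k)"
    using power_le_powr_self[of "2 * A * B1 * B2" \<delta>] assms K1 K2 d by auto
  have "A ^ (N + 1 + m) * Gamma (\<gamma> * real (N + 1 + m)) * real (N + 1 + m) powr (- \<theta> * real (N + 1 + m)) * z ^ m
     \<le> (K1 * K2 * K3) / Gamma (c * real N) * exp (2 * z powr (1 / c)) * (1/2) ^ m"
    if N: "N \<ge> 1" and z: "z \<ge> 0" for N m :: nat and z :: real
  proof -
    define k where "k = N + 1 + m"
    have k: "k \<ge> 1" "k \<ge> m + 1" "k \<ge> N" by (auto simp: k_def)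
    have G: "Gamma (c * real N) > 0" using assms N by simp
    have "A ^ k * Gamma (\<gamma> * real k) * real k powr (- \<theta> * real k) * z ^ m
       \<le> A ^ k * (K1 * B1 ^ k * real k powr (\<gamma> * real k)) * real k powr (- \<theta> * real k) * z ^ m"
      using K1(3)[OF k(1)] assms z by (intro mult_right_mono mult_left_mono) auto
    also have "\<dots> = K1 * (2 * A * B1 * B2) ^ k * (1 / (2 * B2)) ^ k
         * (real k powr (\<gamma> * real k) * real k powr (- \<theta> * real k)) * z ^ m"
      using K2(2) by (simp add: power_mult_distrib power_divide field_simps)
    also have "real k powr (\<gamma> * real k) * real k powr (- \<theta> * real k) = real k powr (- (\<delta> * real k)) * real k powr (- (c * real k))"
      by (simp add: powr_add[symmetric] algebra_simps \<delta>_def)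
    also have "K1 * (2 * A * B1 * B2) ^ k * (1 / (2 * B2)) ^ k * (real k powr (- (\<delta> * real k)) * real k powr (- (c * real k))) * z ^ m
       \<le> K1 * (K3 * real k powr (\<delta> * real k)) * (1 / (2 * B2)) ^ k * (real k powr (- (\<delta> * real k)) * real k powr (- (c * real k))) * z ^ m"
      using K3(2)[OF k(1)] K1 K2 z by (intro mult_right_mono mult_left_mono) auto
    also have "\<dots> = K1 * K3 * (1 / (2 * B2)) ^ k * real k powr (- (c * real k)) * z ^ m"
      using k(1) by (simp add: powr_minus field_simps)
    \<comment> \<open>As k = N + 1 + m is at least N and at least m + 1,
      \<open>k powr (c * k)\<close> dominates the product of \<open>N powr (c * N)\<close> and
      \<open>(m + 1) powr (c * m)\<close>. The first factor will become the Gamma value in the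
      denominator, the second one the exponential.\<close>
    also have "\<dots> \<le> K1 * K3 * ((1/2) ^ m * (1 / B2) ^ N) * (real N powr (- (c * real N)) * real (m + 1) powr (- (c * real m))) * z ^ m"
    proof (intro mult_right_mono mult_mono)
      have "(1 / (2 * B2)) ^ k = (1/2) ^ k * (1 / B2) ^ k" by (simp add: power_mult_distrib[symmetric])
      also have "\<dots> \<le> (1/2) ^ m * (1 / B2) ^ N"
        using K2(2) k by (intro mult_mono power_decreasing) auto
      finally show "(1 / (2 * B2)) ^ k \<le> (1/2) ^ m * (1 / B2) ^ N" .
      have "real N powr (c * real N) * real (m + 1) powr (c * real m) \<le> real k powr (c * real N) * real k powr (c * real m)"
        using k assms by (intro mult_mono powr_mono2) auto
      also have "\<dots> = real k powr (c * (real N + real m))" by (simp add: powr_add[symmetric] algebra_simps)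
      also have "\<dots> \<le> real k powr (c * real k)" using k assms by (intro powr_mono mult_left_mono) (auto simp: k_def)
      finally have le: "real N powr (c * real N) * real (m + 1) powr (c * real m) \<le> real k powr (c * real k)" .
      have "real N powr (- (c * real N)) * real (m + 1) powr (- (c * real m))
          = inverse (real N powr (c * real N) * real (m + 1) powr (c * real m))"
        by (simp add: powr_minus)
      moreover have "real k powr (- (c * real k)) = inverse (real k powr (c * real k))" by (simp add: powr_minus)
      moreover have "0 < real N powr (c * real N) * real (m + 1) powr (c * real m)" using N by simp
      ultimately show "real k powr (- (c * real k)) \<le> real N powr (- (c * real N)) * real (m + 1) powr (- (c * real m))"
        using le le_imp_inverse_le by metis
    qed (use K1 K2 K3 z in auto)
    also have "\<dots> = K1 * K3 * (1/2) ^ m * ((1 / B2) ^ N * real N powr (- (c * real N))) * (z ^ m * real (m + 1) powr (- (c * real m)))"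
      by (simp add: mult_ac)
    also have "\<dots> \<le> K1 * K3 * (1/2) ^ m * (K2 / Gamma (c * real N)) * exp (2 * z powr (1 / c))"
    proof (intro mult_mono)
      have "Gamma (c * real N) * ((1 / B2) ^ N * real N powr (- (c * real N)))
          \<le> (K2 * B2 ^ N * real N powr (c * real N)) * ((1 / B2) ^ N * real N powr (- (c * real N)))"
        using K2(3)[OF N] K2(2) by (intro mult_right_mono) auto
      also have "\<dots> = K2" using K2(2) N by (simp add: power_divide powr_minus field_simps)
      finally show "(1 / B2) ^ N * real N powr (- (c * real N)) \<le> K2 / Gamma (c * real N)"
        using G by (simp add: pos_le_divide_eq mult.commute)
      show "z ^ m * real (m + 1) powr (- (c * real m)) \<le> exp (2 * z powr (1 / c))"
        using power_le_powr_exp[OF z assms(2,3)] .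
    qed (use K1 K2 K3 z G in auto)
    also have "\<dots> = (K1 * K2 * K3) / Gamma (c * real N) * exp (2 * z powr (1 / c)) * (1/2) ^ m" by (simp add: field_simps)
    finally show ?thesis by (simp add: k_def)
  qed
  thus ?thesis using K1 K2 K3 by (intro exI[of _ "K1 * K2 * K3"]) auto
qed

section \<open>Young integrals\<close>

text \<open>The constant is an explicit argument because it is tracked through all estimates. Its
  sign is part of the predicate: on a degenerate interval the inequalities do not force it.\<close>

definition holder_on :: "real \<Rightarrow> real \<Rightarrow> real \<Rightarrow> real \<Rightarrow> (real \<Rightarrow> real) \<Rightarrow> bool" where
  "holder_on a b \<kappa> H f \<longleftrightarrow> 0 \<le> H \<and>
     (\<forall>u v. a \<le> u \<longrightarrow> u \<le> v \<longrightarrow> v \<le> b \<longrightarrow> \<bar>f v - f u\<bar> \<le> H * (v - u) powr \<kappa>)"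

lemma holder_onI:
  assumes "0 \<le> H" "\<And>u v. a \<le> u \<Longrightarrow> u \<le> v \<Longrightarrow> v \<le> b \<Longrightarrow> \<bar>f v - f u\<bar> \<le> H * (v - u) powr \<kappa>"
  shows "holder_on a b \<kappa> H f"
  using assms by (auto simp: holder_on_def)

lemma holder_onD:
  assumes "holder_on a b \<kappa> H f" "a \<le> u" "u \<le> v" "v \<le> b"
  shows "\<bar>f v - f u\<bar> \<le> H * (v - u) powr \<kappa>"
  using assms by (auto simp: holder_on_def)

lemma holder_on_nonneg: "holder_on a b \<kappa> H f \<Longrightarrow> 0 \<le> H"
  by (simp add: holder_on_def)

lemma holder_on_subset: "holder_on a b \<kappa> H f \<Longrightarrow> a \<le> c \<Longrightarrow> d \<le> b \<Longrightarrow> holder_on c d \<kappa> H f"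
  by (auto simp: holder_on_def)

lemma holder_on_continuous_on:
  assumes "holder_on a b \<kappa> H f" "\<kappa> > 0"
  shows "continuous_on {a..b} f"
proof -
  have H: "0 \<le> H" using assms holder_on_nonneg by blast
  have bd: "\<bar>f u - f v\<bar> \<le> H * \<bar>u - v\<bar> powr \<kappa>" if "u \<in> {a..b}" "v \<in> {a..b}" for u v
  proof (cases "u \<le> v")
    case True
    then show ?thesis using holder_onD[OF assms(1), of u v] that by (simp add: abs_minus_commute)
  next
    case False
    then show ?thesis using holder_onD[OF assms(1), of v u] that by simp
  qed
  show ?thesis
    unfolding continuous_on_def
  proof
    fix x assume x: "x \<in> {a..b}"
    have "((\<lambda>u. H * \<bar>u - x\<bar> powr \<kappa>) \<longlongrightarrow> H * 0 powr \<kappa>) (at x within {a..b})"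
      using assms(2) by (auto intro!: tendsto_intros tendsto_powr' tendsto_eq_intros)
    hence lim: "((\<lambda>u. H * \<bar>u - x\<bar> powr \<kappa>) \<longlongrightarrow> 0) (at x within {a..b})" using assms(2) by simp
    have "((\<lambda>u. f u - f x) \<longlongrightarrow> 0) (at x within {a..b})"
      by (rule Lim_null_comparison[OF _ lim]) (use bd x in \<open>auto simp: eventually_at intro!: exI[of _ 1]\<close>)
    thus "(f \<longlongrightarrow> f x) (at x within {a..b})" by (simp add: LIM_zero_iff)
  qed
qed

text \<open>2 is the cost of one splitting and q = 2 powr (1 - \<mu>) the ratio between two dyadic
  levels: the constant is the geometric series 2 / (1 - q), which solves Y * q + 2 = Y.\<close>

definition young_const :: "real \<Rightarrow> real" where
  "young_const \<mu> = 2 / (1 - 2 powr (1 - \<mu>))"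

lemma young_const_pos: "\<mu> > 1 \<Longrightarrow> young_const \<mu> > 0"
  unfolding young_const_def by (simp add: powr_less_one)

text \<open>Induction on the number of points: the cell containing the midpoint of the interval splits the
  partition into two partitions of intervals of at most half the length, and \<open>2 powr (1 - \<mu>) < 1\<close>.\<close>

lemma young_maximal_inequality:
  assumes f: "holder_on a b \<kappa> H f" and g: "holder_on a b \<beta> L g" and pos: "\<kappa> > 0" "\<beta> > 0" "\<kappa> + \<beta> > 1"
  assumes "lo \<le> hi" "a \<le> p lo" "p hi \<le> b" "\<And>k. lo \<le> k \<Longrightarrow> k < hi \<Longrightarrow> p k \<le> p (Suc k)"
  shows "\<bar>(\<Sum>k=lo..<hi. f (p k) * (g (p (Suc k)) - g (p k))) - f (p lo) * (g (p hi) - g (p lo))\<bar>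
     \<le> young_const (\<kappa> + \<beta>) * H * L * (p hi - p lo) powr (\<kappa> + \<beta>)"
  using assms(6-9)
proof (induction "hi - lo" arbitrary: lo hi rule: less_induct)
  case less
  define \<mu> where "\<mu> = \<kappa> + \<beta>"
  define Y where "Y = young_const \<mu>"
  have Ypos: "Y > 0" using pos young_const_pos by (simp add: Y_def \<mu>_def)
  have H0: "0 \<le> H" and L0: "0 \<le> L" using f g holder_on_nonneg by blast+
  have mono: "p i \<le> p j" if "lo \<le> i" "i \<le> j" "j \<le> hi" for i j
    using that(2,3)
  proof (induction j rule: dec_induct)
    case (step k)
    then show ?case using less.prems(4)[of k] that(1) by simp
  qed simp
  show ?case
  proof (cases "lo = hi")
    case True
    then show ?thesis by simp
  next
    case False
    hence lt: "lo < hi" using less.prems by simp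
    define D where "D = p hi - p lo"
    have D0: "D \<ge> 0" using mono[of lo hi] lt by (simp add: D_def)
    define mid where "mid = (p lo + p hi) / 2"
    have "\<exists>k. lo \<le> k \<and> k < hi \<and> p k \<le> mid \<and> mid \<le> p (Suc k)"
    proof -
      define k where "k = Max {k. lo \<le> k \<and> k < hi \<and> p k \<le> mid}"
      have ne: "lo \<in> {k. lo \<le> k \<and> k < hi \<and> p k \<le> mid}"
        using lt D0 by (simp add: mid_def D_def)
      have fin: "finite {k. lo \<le> k \<and> k < hi \<and> p k \<le> mid}" by simp
      have k: "k \<in> {k. lo \<le> k \<and> k < hi \<and> p k \<le> mid}"
        unfolding k_def using ne fin by (intro Max_in) auto
      have "mid \<le> p (Suc k)"
      proof (rule ccontr)
        assume c: "\<not> mid \<le> p (Suc k)"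
        show False
        proof (cases "Suc k < hi")
          case True
          hence "Suc k \<in> {k. lo \<le> k \<and> k < hi \<and> p k \<le> mid}" using c k by auto
          hence "Suc k \<le> k" unfolding k_def using Max_ge[OF fin] by blast
          thus False by simp
        next
          case False
          hence "Suc k = hi" using k by simp
          thus False using c D0 by (simp add: mid_def D_def)
        qed
      qed
      thus ?thesis using k by blast
    qed
    then obtain k where k: "lo \<le> k" "k < hi" "p k \<le> mid" "mid \<le> p (Suc k)" by blast
    have IH1: "\<bar>(\<Sum>k=lo..<k. f (p k) * (g (p (Suc k)) - g (p k))) - f (p lo) * (g (p k) - g (p lo))\<bar>
        \<le> Y * H * L * (p k - p lo) powr \<mu>"
      unfolding Y_def \<mu>_def
      by (rule less.hyps) (use k less.prems mono[of k hi] in auto)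
    have IH2: "\<bar>(\<Sum>k=Suc k..<hi. f (p k) * (g (p (Suc k)) - g (p k))) - f (p (Suc k)) * (g (p hi) - g (p (Suc k)))\<bar>
        \<le> Y * H * L * (p hi - p (Suc k)) powr \<mu>"
      unfolding Y_def \<mu>_def
      by (rule less.hyps) (use k less.prems mono[of lo "Suc k"] in auto)
    have m1: "p lo \<le> p k" "p k \<le> p (Suc k)" "p (Suc k) \<le> p hi" using mono k by auto
    have half: "x powr \<mu> \<le> 2 powr (- \<mu>) * D powr \<mu>" if "0 \<le> x" "x \<le> D / 2" for x
    proof -
      have "x powr \<mu> \<le> (D / 2) powr \<mu>" using that pos by (intro powr_mono2) (auto simp: \<mu>_def)
      also have "\<dots> = 2 powr (- \<mu>) * D powr \<mu>" using D0 by (simp add: powr_divide powr_minus field_simps)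
      finally show ?thesis .
    qed
    have h1: "(p k - p lo) powr \<mu> \<le> 2 powr (- \<mu>) * D powr \<mu>"
      by (rule half) (use m1 k in \<open>auto simp: D_def mid_def field_simps\<close>)
    have h2: "(p hi - p (Suc k)) powr \<mu> \<le> 2 powr (- \<mu>) * D powr \<mu>"
      by (rule half) (use m1 k in \<open>auto simp: D_def mid_def field_simps\<close>)
    have prodbd: "\<bar>(f v - f u) * (g w' - g w)\<bar> \<le> H * L * D powr \<mu>"
      if "p lo \<le> u" "u \<le> v" "v \<le> p hi" "p lo \<le> w" "w \<le> w'" "w' \<le> p hi" for u v w w'
    proof -
      have a: "\<bar>f v - f u\<bar> \<le> H * D powr \<kappa>"
        using holder_onD[OF f, of u v] that less.prems powr_mono2[of \<kappa> "v - u" D] pos H0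
        by (smt (verit, best) D_def mult_left_mono)
      have b: "\<bar>g w' - g w\<bar> \<le> L * D powr \<beta>"
        using holder_onD[OF g, of w w'] that less.prems powr_mono2[of \<beta> "w' - w" D] pos L0
        by (smt (verit, best) D_def mult_left_mono)
      have "\<bar>(f v - f u) * (g w' - g w)\<bar> \<le> (H * D powr \<kappa>) * (L * D powr \<beta>)"
        unfolding abs_mult by (rule mult_mono[OF a b]) (use H0 in auto)
      also have "\<dots> = H * L * D powr \<mu>" by (simp add: \<mu>_def powr_add)
      finally show ?thesis .
    qed
    have split: "(\<Sum>k=lo..<hi. f (p k) * (g (p (Suc k)) - g (p k))) =
       (\<Sum>k=lo..<k. f (p k) * (g (p (Suc k)) - g (p k))) + f (p k) * (g (p (Suc k)) - g (p k))
       + (\<Sum>k=Suc k..<hi. f (p k) * (g (p (Suc k)) - g (p k)))"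
    proof -
      have "(\<Sum>k=lo..<hi. f (p k) * (g (p (Suc k)) - g (p k))) =
         (\<Sum>k=lo..<Suc k. f (p k) * (g (p (Suc k)) - g (p k))) + (\<Sum>k=Suc k..<hi. f (p k) * (g (p (Suc k)) - g (p k)))"
        using k by (intro sum.atLeastLessThan_concat[symmetric]) auto
      thus ?thesis using k by simp
    qed
    let ?S1 = "(\<Sum>k=lo..<k. f (p k) * (g (p (Suc k)) - g (p k)))"
    let ?S2 = "(\<Sum>k=Suc k..<hi. f (p k) * (g (p (Suc k)) - g (p k)))"
    \<comment> \<open>Re-basing the middle cell and the right half at the left end costs two
      products of increments, each of order \<open>D powr \<mu>\<close>: the 2 in
      \<open>young_const\<close>.\<close>
    have eq: "(\<Sum>k=lo..<hi. f (p k) * (g (p (Suc k)) - g (p k))) - f (p lo) * (g (p hi) - g (p lo))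
      = (?S1 - f (p lo) * (g (p k) - g (p lo))) + (?S2 - f (p (Suc k)) * (g (p hi) - g (p (Suc k))))
        + (f (p k) - f (p lo)) * (g (p (Suc k)) - g (p k))
        + (f (p (Suc k)) - f (p lo)) * (g (p hi) - g (p (Suc k)))"
      unfolding split by (simp add: algebra_simps)
    have "\<bar>(\<Sum>k=lo..<hi. f (p k) * (g (p (Suc k)) - g (p k))) - f (p lo) * (g (p hi) - g (p lo))\<bar>
       \<le> Y * H * L * (p k - p lo) powr \<mu> + Y * H * L * (p hi - p (Suc k)) powr \<mu> + H * L * D powr \<mu> + H * L * D powr \<mu>"
      unfolding eq using IH1 IH2
        prodbd[of "p lo" "p k" "p k" "p (Suc k)"] prodbd[of "p lo" "p (Suc k)" "p (Suc k)" "p hi"] m1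
      by linarith
    also have "\<dots> \<le> Y * H * L * (2 powr (- \<mu>) * D powr \<mu>) + Y * H * L * (2 powr (- \<mu>) * D powr \<mu>) + H * L * D powr \<mu> + H * L * D powr \<mu>"
      using h1 h2 Ypos H0 L0 by (intro add_mono mult_left_mono) auto
    also have "\<dots> = (Y * (2 * 2 powr (- \<mu>)) + 2) * (H * L * D powr \<mu>)" by (simp add: algebra_simps)
    also have "2 * 2 powr (- \<mu>) = (2::real) powr (1 - \<mu>)" by (simp add: powr_diff powr_minus field_simps)
    also have "Y * 2 powr (1 - \<mu>) + 2 = Y"
    proof -
      have "1 - 2 powr (1 - \<mu>) > (0::real)" using pos by (simp add: \<mu>_def powr_less_one)
      hence nz: "1 - 2 powr (1 - \<mu>) \<noteq> (0::real)" by linarith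
      have "Y * (1 - 2 powr (1 - \<mu>)) = 2"
        by (simp only: Y_def young_const_def nonzero_eq_divide_eq[OF nz, symmetric])
      thus ?thesis by (simp add: algebra_simps)
    qed
    finally show ?thesis by (simp add: Y_def \<mu>_def D_def mult.assoc)
  qed
qed

section \<open>Tagged partitions and existence of the Young integral\<close>

definition is_tagged_partition :: "real \<Rightarrow> real \<Rightarrow> real \<Rightarrow> nat \<Rightarrow> (nat \<Rightarrow> real) \<Rightarrow> (nat \<Rightarrow> real) \<Rightarrow> bool" where
  "is_tagged_partition a b \<delta> N p \<xi> \<longleftrightarrow> p 0 = a \<and> p N = b \<and>
     (\<forall>k<N. p k \<le> \<xi> k \<and> \<xi> k \<le> p (Suc k) \<and> p (Suc k) - p k < \<delta>)"

definition rs_sum :: "(real \<Rightarrow> real) \<Rightarrow> (real \<Rightarrow> real) \<Rightarrow> nat \<times> (nat \<Rightarrow> real) \<times> (nat \<Rightarrow> real) \<Rightarrow> real" where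
  "rs_sum f g = (\<lambda>(N, p, \<xi>). \<Sum>k<N. f (\<xi> k) * (g (p (Suc k)) - g (p k)))"

lemma rs_sum_eq: "rs_sum f g (N, p, \<xi>) = (\<Sum>k<N. f (\<xi> k) * (g (p (Suc k)) - g (p k)))"
  by (simp add: rs_sum_def)

text \<open>A filter that encodes the passage to mesh zero, so that the limit laws for
  \<open>tendsto\<close> become laws for Young integrals.\<close>

definition partitions :: "real \<Rightarrow> real \<Rightarrow> (nat \<times> (nat \<Rightarrow> real) \<times> (nat \<Rightarrow> real)) filter" where
  "partitions a b = (INF \<delta>\<in>{0<..}. principal {(N, p, \<xi>). is_tagged_partition a b \<delta> N p \<xi>})"

lemma is_tagged_partition_left: "is_tagged_partition a b \<delta> N p \<xi> \<Longrightarrow> is_tagged_partition a b \<delta> N p p"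
  by (force simp: is_tagged_partition_def)

lemma is_tagged_partition_right:
  "is_tagged_partition a b \<delta> N p \<xi> \<Longrightarrow> is_tagged_partition a b \<delta> N p (\<lambda>k. p (Suc k))"
  by (force simp: is_tagged_partition_def)

lemma is_tagged_partition_le: "is_tagged_partition a b \<delta> N p \<xi> \<Longrightarrow> \<delta> \<le> \<delta>' \<Longrightarrow> is_tagged_partition a b \<delta>' N p \<xi>"
  by (force simp: is_tagged_partition_def)

lemma eventually_partitions:
  "eventually P (partitions a b) \<longleftrightarrow> (\<exists>\<delta>>0. \<forall>N p \<xi>. is_tagged_partition a b \<delta> N p \<xi> \<longrightarrow> P (N, p, \<xi>))"
  unfolding partitions_def
proof (subst eventually_INF_base)
  fix \<delta> \<delta>' :: real assume "\<delta> \<in> {0<..}" "\<delta>' \<in> {0<..}"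
  thus "\<exists>\<eta>\<in>{0<..}. principal {(N, p, \<xi>). is_tagged_partition a b \<eta> N p \<xi>} \<le>
      inf (principal {(N, p, \<xi>). is_tagged_partition a b \<delta> N p \<xi>}) (principal {(N, p, \<xi>). is_tagged_partition a b \<delta>' N p \<xi>})"
    by (intro bexI[of _ "min \<delta> \<delta>'"]) (auto intro: is_tagged_partition_le)
qed (auto simp: eventually_principal)

lemma has_young_integral_iff_tendsto:
  "has_young_integral f g a b J \<longleftrightarrow> (rs_sum f g \<longlongrightarrow> J) (partitions a b)"
  unfolding has_young_integral_def tendsto_iff eventually_partitions is_tagged_partition_def rs_sum_eq dist_real_def ..

lemma eventually_partition: "\<forall>\<^sub>F (N, p, \<xi>) in partitions a b. is_tagged_partition a b 1 N p \<xi>"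
  unfolding eventually_partitions by (intro exI[of _ 1]) auto

text \<open>Once an integral exists, it may be computed with left tags alone, and likewise with
  right tags; both choices are needed for the integration by parts.\<close>

lemma filterlim_left_tags: "filterlim (\<lambda>(N, p, \<xi>). (N, p, p)) (partitions a b) (partitions a b)"
  unfolding filterlim_iff eventually_partitions using is_tagged_partition_left by simp blast

lemma filterlim_right_tags: "filterlim (\<lambda>(N, p, \<xi>). (N, p, \<lambda>k. p (Suc k))) (partitions a b) (partitions a b)"
  unfolding filterlim_iff eventually_partitions using is_tagged_partition_right by simp blast

lemma is_tagged_partition_mono:
  assumes "is_tagged_partition a b \<delta> N p \<xi>" "i \<le> j" "j \<le> N"
  shows "p i \<le> p j"
  using assms(2,3)
proof (induction j rule: dec_induct)
  case (step k)
  then show ?case using assms(1) unfolding is_tagged_partition_def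
    by (smt (verit, best) Suc_le_eq less_imp_le_nat)
qed simp

lemma tagged_partition_exists:
  assumes "a \<le> b" "\<delta> > 0"
  shows "\<exists>N p. is_tagged_partition a b \<delta> N p p"
proof -
  obtain N :: nat where N: "(b - a) / \<delta> < N" using reals_Archimedean2 by blast
  define M where "M = Suc N"
  have M: "(b - a) / real M < \<delta>"
  proof -
    have "(b - a) / \<delta> < real M" using N by (simp add: M_def)
    thus ?thesis using assms by (simp add: field_simps M_def)
  qed
  define h where "h = (b - a) / real M"
  have h: "0 \<le> h" "h < \<delta>" "real M * h = b - a" using M assms by (auto simp: h_def M_def)
  have "is_tagged_partition a b \<delta> M (\<lambda>k. a + real k * h) (\<lambda>k. a + real k * h)"
    unfolding is_tagged_partition_def using h by (auto simp: distrib_right)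
  thus ?thesis by blast
qed

lemma partitions_neq_bot: "a \<le> b \<Longrightarrow> partitions a b \<noteq> bot"
  unfolding trivial_limit_def eventually_partitions using tagged_partition_exists by blast

lemma has_young_integral_unique:
  assumes "a \<le> b" "has_young_integral f g a b J" "has_young_integral f g a b J'"
  shows "J = J'"
  using assms tendsto_unique[OF partitions_neq_bot] unfolding has_young_integral_iff_tendsto by blast

lemma young_integral_eqI:
  assumes "a \<le> b" "has_young_integral f g a b J"
  shows "young_integral f g a b = J"
  unfolding young_integral_def using assms has_young_integral_unique by blast

lemma has_young_integral_left_tags:
  assumes "has_young_integral f g a b J"
  shows "((\<lambda>(N, p, \<xi>). rs_sum f g (N, p, p)) \<longlongrightarrow> J) (partitions a b)"
  using filterlim_compose[OF assms[unfolded has_young_integral_iff_tendsto] filterlim_left_tags]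
  by (simp add: split_def)

lemma has_young_integral_right_tags:
  assumes "has_young_integral f g a b J"
  shows "((\<lambda>(N, p, \<xi>). rs_sum f g (N, p, \<lambda>k. p (Suc k))) \<longlongrightarrow> J) (partitions a b)"
  using filterlim_compose[OF assms[unfolded has_young_integral_iff_tendsto] filterlim_right_tags]
  by (simp add: split_def)

text \<open>An exponent above 1 leaves a positive power of the mesh over. This is what makes the
  accumulated local errors of order \<mu> vanish in the limit.\<close>

lemma sum_partition_powr:
  assumes p: "is_tagged_partition a b \<delta> N p \<xi>" and mu: "\<mu> > 1"
  shows "(\<Sum>k<N. (p (Suc k) - p k) powr \<mu>) \<le> \<delta> powr (\<mu> - 1) * (b - a)"
proof -
  have "(\<Sum>k<N. (p (Suc k) - p k) powr \<mu>) \<le> (\<Sum>k<N. \<delta> powr (\<mu> - 1) * (p (Suc k) - p k))"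
  proof (rule sum_mono)
    fix k assume k: "k \<in> {..<N}"
    define D where "D = p (Suc k) - p k"
    have D: "0 \<le> D" "D < \<delta>" using p k unfolding D_def is_tagged_partition_def
      by (smt (verit, best) lessThan_iff)+
    show "D powr \<mu> \<le> \<delta> powr (\<mu> - 1) * D"
    proof (cases "D = 0")
      case False
      hence "D powr \<mu> = D powr (\<mu> - 1) * D" using D by (simp add: powr_diff)
      also have "\<dots> \<le> \<delta> powr (\<mu> - 1) * D" using D mu by (intro mult_right_mono powr_mono2) auto
      finally show ?thesis .
    qed (use mu in simp)
  qed
  also have "\<dots> = \<delta> powr (\<mu> - 1) * (p N - p 0)"
    by (simp only: sum_distrib_left[symmetric] sum_lessThan_telescope)
  finally show ?thesis using p by (simp add: is_tagged_partition_def)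
qed

text \<open>Clamping the points of the second partition into a cell of the first one gives a partition of
  that cell. The doubly indexed sums over all cells of both partitions agree term by term, because
  degenerate cells do not contribute.\<close>

lemma rs_sum_refine:
  assumes f: "holder_on a b \<kappa> H f" and g: "holder_on a b \<beta> L g" and pos: "\<kappa> > 0" "\<beta> > 0" "\<kappa> + \<beta> > 1"
  assumes p: "is_tagged_partition a b \<delta> N p \<xi>" and q: "is_tagged_partition a b \<delta>' N' q \<eta>"
  defines "c \<equiv> \<lambda>k l. max (p k) (min (q l) (p (Suc k)))"
  shows "\<bar>rs_sum f g (N, p, \<xi>) - (\<Sum>k<N. \<Sum>l<N'. f (c k l) * (g (c k (Suc l)) - g (c k l)))\<bar>
     \<le> (1 + young_const (\<kappa> + \<beta>)) * H * L * (b - a) * \<delta> powr (\<kappa> + \<beta> - 1)"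
proof -
  define \<mu> where "\<mu> = \<kappa> + \<beta>"
  define Y where "Y = young_const \<mu>"
  have Ypos: "Y > 0" using pos young_const_pos by (simp add: Y_def \<mu>_def)
  have H0: "0 \<le> H" and L0: "0 \<le> L" using f g holder_on_nonneg by blast+
  have p0: "p 0 = a" "p N = b" and q0: "q 0 = a" "q N' = b"
    using p q by (auto simp: is_tagged_partition_def)
  have one: "\<bar>f (\<xi> k) * (g (p (Suc k)) - g (p k)) - (\<Sum>l<N'. f (c k l) * (g (c k (Suc l)) - g (c k l)))\<bar>
     \<le> (1 + Y) * H * L * (p (Suc k) - p k) powr \<mu>" if k: "k < N" for k
  proof -
    have pk: "a \<le> p k" "p k \<le> p (Suc k)" "p (Suc k) \<le> b"
      using is_tagged_partition_mono[OF p, of 0 k] is_tagged_partition_mono[OF p, of k "Suc k"]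
        is_tagged_partition_mono[OF p, of "Suc k" N] k p0 by auto
    have xi: "p k \<le> \<xi> k" "\<xi> k \<le> p (Suc k)" and del: "p (Suc k) - p k < \<delta>"
      using p k by (auto simp: is_tagged_partition_def)
    define D where "D = p (Suc k) - p k"
    have D0: "0 \<le> D" using pk by (simp add: D_def)
    have c0: "c k 0 = p k" "c k N' = p (Suc k)" using pk q0 by (auto simp: c_def)
    have cm: "c k l \<le> c k (Suc l)" if "l < N'" for l
      using is_tagged_partition_mono[OF q, of l "Suc l"] that by (auto simp: c_def)
    have "\<bar>(\<Sum>l=0..<N'. f (c k l) * (g (c k (Suc l)) - g (c k l))) - f (c k 0) * (g (c k N') - g (c k 0))\<bar>
       \<le> young_const (\<kappa> + \<beta>) * H * L * (c k N' - c k 0) powr (\<kappa> + \<beta>)"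
      by (rule young_maximal_inequality[OF f g pos]) (use c0 pk cm in auto)
    hence A: "\<bar>(\<Sum>l<N'. f (c k l) * (g (c k (Suc l)) - g (c k l))) - f (p k) * (g (p (Suc k)) - g (p k))\<bar>
       \<le> Y * H * L * D powr \<mu>"
      unfolding c0 by (simp add: lessThan_atLeast0 Y_def \<mu>_def D_def)
    have fx: "\<bar>f (\<xi> k) - f (p k)\<bar> \<le> H * D powr \<kappa>"
      using holder_onD[OF f, of "p k" "\<xi> k"] xi pk powr_mono2[of \<kappa> "\<xi> k - p k" D] pos H0
      by (smt (verit, best) D_def mult_left_mono)
    have gx: "\<bar>g (p (Suc k)) - g (p k)\<bar> \<le> L * D powr \<beta>"
      using holder_onD[OF g, of "p k" "p (Suc k)"] pk by (simp add: D_def)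
    have B: "\<bar>(f (\<xi> k) - f (p k)) * (g (p (Suc k)) - g (p k))\<bar> \<le> H * L * D powr \<mu>"
    proof -
      have "\<bar>(f (\<xi> k) - f (p k)) * (g (p (Suc k)) - g (p k))\<bar> \<le> (H * D powr \<kappa>) * (L * D powr \<beta>)"
        unfolding abs_mult by (rule mult_mono[OF fx gx]) (use H0 in auto)
      also have "\<dots> = H * L * D powr \<mu>" by (simp add: \<mu>_def powr_add)
      finally show ?thesis .
    qed
    have "\<bar>f (\<xi> k) * (g (p (Suc k)) - g (p k)) - (\<Sum>l<N'. f (c k l) * (g (c k (Suc l)) - g (c k l)))\<bar>
       \<le> Y * H * L * D powr \<mu> + H * L * D powr \<mu>"
      using A B by (simp add: algebra_simps abs_le_iff)
    also have "\<dots> = (1 + Y) * H * L * D powr \<mu>" by (simp add: algebra_simps)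
    finally show ?thesis by (simp add: D_def)
  qed
  have "\<bar>rs_sum f g (N, p, \<xi>) - (\<Sum>k<N. \<Sum>l<N'. f (c k l) * (g (c k (Suc l)) - g (c k l)))\<bar>
    = \<bar>\<Sum>k<N. f (\<xi> k) * (g (p (Suc k)) - g (p k)) - (\<Sum>l<N'. f (c k l) * (g (c k (Suc l)) - g (c k l)))\<bar>"
    by (simp add: rs_sum_eq sum_subtractf)
  also have "\<dots> \<le> (\<Sum>k<N. (1 + Y) * H * L * (p (Suc k) - p k) powr \<mu>)"
    by (rule order_trans[OF sum_abs sum_mono]) (use one in auto)
  also have "\<dots> = (1 + Y) * H * L * (\<Sum>k<N. (p (Suc k) - p k) powr \<mu>)"
    by (simp only: sum_distrib_left)
  also have "\<dots> \<le> (1 + Y) * H * L * (\<delta> powr (\<mu> - 1) * (b - a))"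
    using sum_partition_powr[OF p, of \<mu>] pos H0 L0 Ypos by (intro mult_left_mono) (auto simp: \<mu>_def)
  finally show ?thesis by (simp add: \<mu>_def Y_def mult_ac)
qed

lemma rs_sum_close:
  assumes f: "holder_on a b \<kappa> H f" and g: "holder_on a b \<beta> L g" and pos: "\<kappa> > 0" "\<beta> > 0" "\<kappa> + \<beta> > 1"
  assumes p: "is_tagged_partition a b \<delta> N p \<xi>" and q: "is_tagged_partition a b \<delta>' N' q \<eta>"
  shows "\<bar>rs_sum f g (N, p, \<xi>) - rs_sum f g (N', q, \<eta>)\<bar>
     \<le> (1 + young_const (\<kappa> + \<beta>)) * H * L * (b - a) * (\<delta> powr (\<kappa> + \<beta> - 1) + \<delta>' powr (\<kappa> + \<beta> - 1))"
proof -
  define c where "c = (\<lambda>k l. max (p k) (min (q l) (p (Suc k))))"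
  define e where "e = (\<lambda>l k. max (q l) (min (p k) (q (Suc l))))"
  have eq: "f (c k l) * (g (c k (Suc l)) - g (c k l)) = f (e l k) * (g (e l (Suc k)) - g (e l k))"
    if "k < N" "l < N'" for k l
  proof -
    have pk: "p k \<le> p (Suc k)" and ql: "q l \<le> q (Suc l)"
      using is_tagged_partition_mono[OF p, of k "Suc k"] is_tagged_partition_mono[OF q, of l "Suc l"] that by auto
    consider "max (p k) (q l) \<le> min (p (Suc k)) (q (Suc l))" | "p (Suc k) < q l" | "q (Suc l) < p k"
      using pk ql by linarith
    thus ?thesis
    proof cases
      case 1
      hence "c k l = e l k" "c k (Suc l) = e l (Suc k)" using pk ql by (auto simp: c_def e_def)
      thus ?thesis by simp
    next
      case 2
      hence "c k (Suc l) = c k l" "e l (Suc k) = e l k" using pk ql by (auto simp: c_def e_def)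
      thus ?thesis by simp
    next
      case 3
      hence "c k (Suc l) = c k l" "e l (Suc k) = e l k" using pk ql by (auto simp: c_def e_def)
      thus ?thesis by simp
    qed
  qed
  have "(\<Sum>k<N. \<Sum>l<N'. f (c k l) * (g (c k (Suc l)) - g (c k l)))
      = (\<Sum>k<N. \<Sum>l<N'. f (e l k) * (g (e l (Suc k)) - g (e l k)))"
    by (intro sum.cong refl) (use eq in auto)
  also have "\<dots> = (\<Sum>l<N'. \<Sum>k<N. f (e l k) * (g (e l (Suc k)) - g (e l k)))"
    by (rule sum.swap)
  finally have sw: "(\<Sum>k<N. \<Sum>l<N'. f (c k l) * (g (c k (Suc l)) - g (c k l)))
      = (\<Sum>l<N'. \<Sum>k<N. f (e l k) * (g (e l (Suc k)) - g (e l k)))" .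
  have "\<bar>rs_sum f g (N, p, \<xi>) - (\<Sum>k<N. \<Sum>l<N'. f (c k l) * (g (c k (Suc l)) - g (c k l)))\<bar>
     \<le> (1 + young_const (\<kappa> + \<beta>)) * H * L * (b - a) * \<delta> powr (\<kappa> + \<beta> - 1)"
    unfolding c_def by (rule rs_sum_refine[OF f g pos p q])
  moreover have "\<bar>rs_sum f g (N', q, \<eta>) - (\<Sum>l<N'. \<Sum>k<N. f (e l k) * (g (e l (Suc k)) - g (e l k)))\<bar>
     \<le> (1 + young_const (\<kappa> + \<beta>)) * H * L * (b - a) * \<delta>' powr (\<kappa> + \<beta> - 1)"
    unfolding e_def by (rule rs_sum_refine[OF f g pos q p])
  ultimately show ?thesis unfolding sw by (simp add: distrib_left)
qed

text \<open>The sums along one sequence of partitions of mesh below 1 / (n + 1) are Cauchy by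
  \<open>rs_sum_close\<close>; the same bound then carries their limit over to arbitrary tagged
  partitions.\<close>

theorem young_integral_exists:
  assumes ab: "a \<le> b" and f: "holder_on a b \<kappa> H f" and g: "holder_on a b \<beta> L g" and pos: "\<kappa> > 0" "\<beta> > 0" "\<kappa> + \<beta> > 1"
  shows "has_young_integral f g a b (young_integral f g a b)"
proof -
  define \<mu> where "\<mu> = \<kappa> + \<beta> - 1"
  have mu: "\<mu> > 0" using pos by (simp add: \<mu>_def)
  define K where "K = (1 + young_const (\<kappa> + \<beta>)) * H * L * (b - a)"
  have K0: "K \<ge> 0" using holder_on_nonneg[OF f] holder_on_nonneg[OF g] ab young_const_pos[of "\<kappa> + \<beta>"] pos
    by (simp add: K_def)
  have "\<exists>N p. is_tagged_partition a b (1 / real (Suc n)) N p p" for n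
    by (rule tagged_partition_exists) (use ab in auto)
  then obtain N p where P: "\<And>n. is_tagged_partition a b (1 / real (Suc n)) (N n) (p n) (p n)"
    by metis
  define S where "S = (\<lambda>n. rs_sum f g (N n, p n, p n))"
  have dl: "(\<lambda>n. K * ((1 / real (Suc n)) powr \<mu>)) \<longlonglongrightarrow> 0"
  proof -
    have "(\<lambda>n. 1 / real (Suc n)) \<longlonglongrightarrow> 0" using LIMSEQ_Suc[OF lim_1_over_n] by simp
    hence "(\<lambda>n. K * ((1 / real (Suc n)) powr \<mu>)) \<longlonglongrightarrow> K * 0 powr \<mu>"
      using mu by (intro tendsto_intros tendsto_powr') auto
    thus ?thesis using mu by simp
  qed
  have "Cauchy S"
    unfolding Cauchy_def
  proof (intro allI impI)
    fix e :: real assume e: "e > 0"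
    from dl[THEN LIMSEQ_D, of "e / 2"] e obtain n0 where
      n0: "\<And>n. n \<ge> n0 \<Longrightarrow> norm (K * ((1 / real (Suc n)) powr \<mu>) - 0) < e / 2" by auto
    show "\<exists>M. \<forall>m\<ge>M. \<forall>n\<ge>M. dist (S m) (S n) < e"
    proof (intro exI allI impI)
      fix m n assume mn: "n0 \<le> m" "n0 \<le> n"
      have "\<bar>S m - S n\<bar> \<le> K * ((1 / real (Suc m)) powr \<mu> + (1 / real (Suc n)) powr \<mu>)"
        unfolding S_def K_def \<mu>_def by (rule rs_sum_close[OF f g pos P P])
      also have "\<dots> < e" using n0[OF mn(1)] n0[OF mn(2)] unfolding distrib_left
        by (simp add: abs_less_iff)
      finally show "dist (S m) (S n) < e" by (simp add: dist_real_def)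
    qed
  qed
  then obtain J where J: "S \<longlonglongrightarrow> J" using Cauchy_convergent convergent_def by blast
  have close: "\<bar>rs_sum f g (N', q, \<eta>) - J\<bar> \<le> K * \<delta> powr \<mu>" if q: "is_tagged_partition a b \<delta> N' q \<eta>" for N' q \<eta> \<delta>
  proof -
    have "(\<lambda>n. \<bar>rs_sum f g (N', q, \<eta>) - S n\<bar>) \<longlonglongrightarrow> \<bar>rs_sum f g (N', q, \<eta>) - J\<bar>"
      using J by (intro tendsto_intros)
    moreover have "(\<lambda>n. K * \<delta> powr \<mu> + K * ((1 / real (Suc n)) powr \<mu>)) \<longlonglongrightarrow> K * \<delta> powr \<mu> + 0"
      by (intro tendsto_add tendsto_const dl)
    moreover have "\<bar>rs_sum f g (N', q, \<eta>) - S n\<bar> \<le> K * \<delta> powr \<mu> + K * ((1 / real (Suc n)) powr \<mu>)" for n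
      unfolding S_def K_def \<mu>_def using rs_sum_close[OF f g pos q P[of n]] by (simp add: distrib_left)
    ultimately show ?thesis by (metis (no_types, lifting) LIMSEQ_le add_0_right)
  qed
  have "has_young_integral f g a b J"
    unfolding has_young_integral_iff_tendsto tendsto_iff eventually_partitions dist_real_def
  proof (intro allI impI)
    fix e :: real assume e: "e > 0"
    from dl[THEN LIMSEQ_D, of e] e obtain n0 where
      n0: "norm (K * ((1 / real (Suc n0)) powr \<mu>) - 0) < e" by auto
    hence "K * ((1 / real (Suc n0)) powr \<mu>) < e" by (simp add: abs_less_iff)
    thus "\<exists>\<delta>>0. \<forall>N p \<xi>. is_tagged_partition a b \<delta> N p \<xi> \<longrightarrow> \<bar>rs_sum f g (N, p, \<xi>) - J\<bar> < e"
      using close by (intro exI[of _ "1 / real (Suc n0)"])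
        (auto simp del: of_nat_Suc intro: le_less_trans[of _ "K * (1 / real (Suc n0)) powr \<mu>"])
  qed
  thus ?thesis using young_integral_eqI[OF ab] by simp
qed

text \<open>The maximal inequality holds for every partition with left tags, uniformly in the mesh,
  and therefore passes to the limit.\<close>

theorem young_integral_estimate:
  assumes ab: "a \<le> b" and f: "holder_on a b \<kappa> H f" and g: "holder_on a b \<beta> L g" and pos: "\<kappa> > 0" "\<beta> > 0" "\<kappa> + \<beta> > 1"
  shows "\<bar>young_integral f g a b - f a * (g b - g a)\<bar> \<le> young_const (\<kappa> + \<beta>) * H * L * (b - a) powr (\<kappa> + \<beta>)"
proof (rule tendsto_upperbound)
  let ?B = "young_const (\<kappa> + \<beta>) * H * L * (b - a) powr (\<kappa> + \<beta>)"
  show "((\<lambda>P. \<bar>(case P of (N, p, \<xi>) \<Rightarrow> rs_sum f g (N, p, p)) - f a * (g b - g a)\<bar>) \<longlongrightarrow>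
      \<bar>young_integral f g a b - f a * (g b - g a)\<bar>) (partitions a b)"
    by (intro tendsto_intros has_young_integral_left_tags young_integral_exists[OF assms])
  have bd: "\<bar>rs_sum f g (N, p, p) - f a * (g b - g a)\<bar> \<le> ?B" if p: "is_tagged_partition a b 1 N p \<xi>" for N p \<xi>
  proof -
    have pp: "p 0 = a" "p N = b" using p by (auto simp: is_tagged_partition_def)
    have "\<bar>(\<Sum>k=0..<N. f (p k) * (g (p (Suc k)) - g (p k))) - f (p 0) * (g (p N) - g (p 0))\<bar>
       \<le> young_const (\<kappa> + \<beta>) * H * L * (p N - p 0) powr (\<kappa> + \<beta>)"
    proof (rule young_maximal_inequality[OF f g pos])
      show "p k \<le> p (Suc k)" if "0 \<le> k" "k < N" for k
        using is_tagged_partition_mono[OF p, of k "Suc k"] that by simp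
    qed (use pp in auto)
    thus ?thesis by (simp add: pp rs_sum_eq lessThan_atLeast0)
  qed
  show "\<forall>\<^sub>F P in partitions a b. \<bar>(case P of (N, p, \<xi>) \<Rightarrow> rs_sum f g (N, p, p)) - f a * (g b - g a)\<bar> \<le> ?B"
    by (rule eventually_mono[OF eventually_partition]) (use bd in auto)
qed (rule partitions_neq_bot[OF ab])

lemma is_tagged_partition_concat:
  assumes p: "is_tagged_partition a b \<delta> N p p" and q: "is_tagged_partition b c \<delta> N' q q"
  defines "r \<equiv> \<lambda>k. if k \<le> N then p k else q (k - N)"
  shows "is_tagged_partition a c \<delta> (N + N') r r"
    and "rs_sum f g (N + N', r, r) = rs_sum f g (N, p, p) + rs_sum f g (N', q, q)"
proof -
  have b: "p N = b" "q 0 = b" using p q by (auto simp: is_tagged_partition_def)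
  have r1: "r k = p k" if "k \<le> N" for k using that by (simp add: r_def)
  have r2: "r (N + k) = q k" for k using b by (cases k) (auto simp: r_def)
  show "is_tagged_partition a c \<delta> (N + N') r r"
    unfolding is_tagged_partition_def
  proof (intro conjI allI impI)
    show "r 0 = a" using p by (simp add: r1 is_tagged_partition_def)
    show "r (N + N') = c" using q by (simp add: r2 is_tagged_partition_def)
    fix k assume k: "k < N + N'"
    show "r k \<le> r (Suc k)" "r (Suc k) - r k < \<delta>"
    proof (atomize(full), cases "k < N")
      case True
      thus "r k \<le> r (Suc k) \<and> r (Suc k) - r k < \<delta>" using p by (simp add: r1 is_tagged_partition_def)
    next
      case False
      then obtain l where l: "k = N + l" "l < N'" using k by (metis nat_add_left_cancel_less le_Suc_ex not_less)
      thus "r k \<le> r (Suc k) \<and> r (Suc k) - r k < \<delta>"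
        using q r2[of l] r2[of "Suc l"] by (simp add: is_tagged_partition_def)
    qed
  qed simp
  have "rs_sum f g (N + N', r, r) = (\<Sum>k<N. f (r k) * (g (r (Suc k)) - g (r k)))
      + (\<Sum>k<N'. f (r (N + k)) * (g (r (Suc (N + k))) - g (r (N + k))))"
    unfolding rs_sum_eq by (induction N') (auto simp: algebra_simps)
  also have "\<dots> = rs_sum f g (N, p, p) + rs_sum f g (N', q, q)"
    unfolding rs_sum_eq using r2[of "Suc _"] by (simp add: r1 r2)
  finally show "rs_sum f g (N + N', r, r) = rs_sum f g (N, p, p) + rs_sum f g (N', q, q)" .
qed

text \<open>Two fine partitions of the halves concatenate to a fine partition of the whole interval,
  whose sum is the sum of the two.\<close>

lemma young_integral_combine:
  assumes ab: "a \<le> b" "b \<le> c" and f: "holder_on a c \<kappa> H f" and g: "holder_on a c \<beta> L g" and pos: "\<kappa> > 0" "\<beta> > 0" "\<kappa> + \<beta> > 1"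
  shows "young_integral f g a c = young_integral f g a b + young_integral f g b c"
proof (rule ccontr)
  let ?x = "young_integral f g a c" let ?y = "young_integral f g a b" let ?z = "young_integral f g b c"
  assume ne: "?x \<noteq> ?y + ?z"
  define e where "e = \<bar>?x - (?y + ?z)\<bar> / 3"
  have e: "e > 0" using ne by (simp add: e_def)
  have 1: "has_young_integral f g a c ?x" using young_integral_exists[OF _ f g pos] ab by simp
  have 2: "has_young_integral f g a b ?y"
    by (rule young_integral_exists[OF _ holder_on_subset[OF f] holder_on_subset[OF g] pos]) (use ab in auto)
  have 3: "has_young_integral f g b c ?z"
    by (rule young_integral_exists[OF _ holder_on_subset[OF f] holder_on_subset[OF g] pos]) (use ab in auto)
  obtain d1 where d1: "d1 > 0" "\<And>N p \<xi>. is_tagged_partition a c d1 N p \<xi> \<Longrightarrow> \<bar>rs_sum f g (N, p, \<xi>) - ?x\<bar> < e"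
    using 1 e unfolding has_young_integral_iff_tendsto tendsto_iff eventually_partitions dist_real_def by blast
  obtain d2 where d2: "d2 > 0" "\<And>N p \<xi>. is_tagged_partition a b d2 N p \<xi> \<Longrightarrow> \<bar>rs_sum f g (N, p, \<xi>) - ?y\<bar> < e"
    using 2 e unfolding has_young_integral_iff_tendsto tendsto_iff eventually_partitions dist_real_def by blast
  obtain d3 where d3: "d3 > 0" "\<And>N p \<xi>. is_tagged_partition b c d3 N p \<xi> \<Longrightarrow> \<bar>rs_sum f g (N, p, \<xi>) - ?z\<bar> < e"
    using 3 e unfolding has_young_integral_iff_tendsto tendsto_iff eventually_partitions dist_real_def by blast
  define d where "d = min d1 (min d2 d3)"
  have d: "d > 0" "d \<le> d1" "d \<le> d2" "d \<le> d3" using d1 d2 d3 by (auto simp: d_def)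
  obtain N p where p: "is_tagged_partition a b d N p p" using tagged_partition_exists ab d by blast
  obtain N' q where q: "is_tagged_partition b c d N' q q" using tagged_partition_exists ab d by blast
  let ?r = "\<lambda>k. if k \<le> N then p k else q (k - N)"
  have "\<bar>rs_sum f g (N + N', ?r, ?r) - ?x\<bar> < e"
    using is_tagged_partition_concat(1)[OF p q] d1(2) d(2) is_tagged_partition_le by blast
  moreover have "\<bar>rs_sum f g (N, p, p) - ?y\<bar> < e" using p d2(2) d(3) is_tagged_partition_le by blast
  moreover have "\<bar>rs_sum f g (N', q, q) - ?z\<bar> < e" using q d3(2) d(4) is_tagged_partition_le by blast
  ultimately have "\<bar>?x - (?y + ?z)\<bar> < 3 * e" unfolding is_tagged_partition_concat(2)[OF p q] by linarith
  thus False by (simp add: e_def)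
qed

lemma has_young_integral_refl: "has_young_integral f g a a 0"
  unfolding has_young_integral_iff_tendsto
proof (rule tendsto_eventually, rule eventually_mono[OF eventually_partition], clarify)
  fix N p \<xi> assume p: "is_tagged_partition a a 1 N p \<xi>"
  have "p k = a" if "k \<le> N" for k
    using is_tagged_partition_mono[OF p, of 0 k] is_tagged_partition_mono[OF p, of k N] that p
    by (auto simp: is_tagged_partition_def)
  thus "rs_sum f g (N, p, \<xi>) = 0" unfolding rs_sum_eq by (intro sum.neutral) auto
qed

lemma young_integral_refl [simp]: "young_integral f g a a = 0"
  by (rule young_integral_eqI[OF order_refl has_young_integral_refl])

section \<open>Linearity and congruence rules\<close>

lemma rs_sum_add_left: "rs_sum (\<lambda>x. f x + f' x) g = (\<lambda>P. rs_sum f g P + rs_sum f' g P)"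
  by (auto simp: rs_sum_def distrib_right sum.distrib)

lemma rs_sum_cmult_left: "rs_sum (\<lambda>x. c * f x) g = (\<lambda>P. c * rs_sum f g P)"
  by (auto simp: rs_sum_def sum_distrib_left mult.assoc)

lemma rs_sum_add_right: "rs_sum f (\<lambda>x. g x + g' x) = (\<lambda>P. rs_sum f g P + rs_sum f g' P)"
  by (auto simp: rs_sum_def algebra_simps sum.distrib[symmetric])

lemma has_young_integral_add:
  assumes "has_young_integral f g a b J" "has_young_integral f' g a b J'"
  shows "has_young_integral (\<lambda>x. f x + f' x) g a b (J + J')"
  using assms unfolding has_young_integral_iff_tendsto rs_sum_add_left by (rule tendsto_add)

lemma has_young_integral_cmult:
  assumes "has_young_integral f g a b J"
  shows "has_young_integral (\<lambda>x. c * f x) g a b (c * J)"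
  using assms unfolding has_young_integral_iff_tendsto rs_sum_cmult_left by (rule tendsto_mult_left)

lemma has_young_integral_diff:
  assumes "has_young_integral f g a b J" "has_young_integral f' g a b J'"
  shows "has_young_integral (\<lambda>x. f x - f' x) g a b (J - J')"
  using has_young_integral_add[OF assms(1) has_young_integral_cmult[OF assms(2), of "-1"]] by simp

lemma has_young_integral_zero: "has_young_integral (\<lambda>x. 0) g a b 0"
  by (simp add: has_young_integral_iff_tendsto rs_sum_def split_def)

lemma has_young_integral_sum:
  assumes "finite A" "\<And>i. i \<in> A \<Longrightarrow> has_young_integral (f i) g a b (J i)"
  shows "has_young_integral (\<lambda>x. \<Sum>i\<in>A. f i x) g a b (\<Sum>i\<in>A. J i)"
  using assms by (induction A rule: finite_induct) (auto intro: has_young_integral_add has_young_integral_zero)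

lemma has_young_integral_integrator_add:
  assumes "has_young_integral f g a b J" "has_young_integral f g' a b J'"
  shows "has_young_integral f (\<lambda>x. g x + g' x) a b (J + J')"
  using assms unfolding has_young_integral_iff_tendsto rs_sum_add_right by (rule tendsto_add)

lemma has_young_integral_integrator_const: "has_young_integral f (\<lambda>x. c) a b 0"
  by (simp add: has_young_integral_iff_tendsto rs_sum_def split_def)

lemma has_young_integral_integrator_sum:
  assumes "finite A" "\<And>i. i \<in> A \<Longrightarrow> has_young_integral f (g i) a b (J i)"
  shows "has_young_integral f (\<lambda>x. \<Sum>i\<in>A. g i x) a b (\<Sum>i\<in>A. J i)"
  using assms
  by (induction A rule: finite_induct) (auto intro: has_young_integral_integrator_add has_young_integral_integrator_const)

lemma rs_sum_cong:
  assumes p: "is_tagged_partition a b \<delta> N p \<xi>"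
    and "\<And>x. a \<le> x \<Longrightarrow> x \<le> b \<Longrightarrow> f x = f' x" "\<And>x. a \<le> x \<Longrightarrow> x \<le> b \<Longrightarrow> g x = g' x"
  shows "rs_sum f g (N, p, \<xi>) = rs_sum f' g' (N, p, \<xi>)"
  unfolding rs_sum_eq
proof (intro sum.cong refl)
  fix k assume "k \<in> {..<N}"
  hence "a \<le> p k" "p k \<le> \<xi> k" "\<xi> k \<le> p (Suc k)" "p (Suc k) \<le> b"
    using p is_tagged_partition_mono[OF p, of 0 k] is_tagged_partition_mono[OF p, of "Suc k" N]
    by (auto simp: is_tagged_partition_def)
  thus "f (\<xi> k) * (g (p (Suc k)) - g (p k)) = f' (\<xi> k) * (g' (p (Suc k)) - g' (p k))"
    using assms(2)[of "\<xi> k"] assms(3)[of "p k"] assms(3)[of "p (Suc k)"] by auto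
qed

lemma has_young_integral_cong:
  assumes "\<And>x. a \<le> x \<Longrightarrow> x \<le> b \<Longrightarrow> f x = f' x" "\<And>x. a \<le> x \<Longrightarrow> x \<le> b \<Longrightarrow> g x = g' x"
  shows "has_young_integral f g a b J \<longleftrightarrow> has_young_integral f' g' a b J"
  unfolding has_young_integral_iff_tendsto
  by (intro tendsto_cong eventually_mono[OF eventually_partition]) (auto intro: rs_sum_cong assms)

lemma young_integral_cong:
  assumes "\<And>x. a \<le> x \<Longrightarrow> x \<le> b \<Longrightarrow> f x = f' x"
  shows "young_integral f g a b = young_integral f' g a b"
  using has_young_integral_cong[of a b f f' g g] assms by (simp add: young_integral_def)

lemma young_integral_one:
  assumes "a \<le> b"
  shows "young_integral (\<lambda>_. 1) g a b = g b - g a"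
proof (rule young_integral_eqI[OF assms])
  have "rs_sum (\<lambda>_. 1) g (N, p, \<xi>) = g b - g a" if "is_tagged_partition a b \<delta> N p \<xi>" for \<delta> N p \<xi>
    using that sum_lessThan_telescope[of "\<lambda>k. g (p k)" N] by (simp add: rs_sum_eq is_tagged_partition_def)
  thus "has_young_integral (\<lambda>_. 1) g a b (g b - g a)"
    unfolding has_young_integral_iff_tendsto
    by (intro tendsto_eventually eventually_mono[OF eventually_partition]) auto
qed

section \<open>Calculus of Hoelder functions\<close>

lemma holder_on_const: "holder_on a b \<kappa> 0 (\<lambda>_. c)"
  by (auto simp: holder_on_def)

lemma holder_on_cong: "(\<And>x. a \<le> x \<Longrightarrow> x \<le> b \<Longrightarrow> f x = g x) \<Longrightarrow> holder_on a b \<kappa> H f \<longleftrightarrow> holder_on a b \<kappa> H g"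
  unfolding holder_on_def by (intro conj_cong refl all_cong1 imp_cong) auto

lemma holder_on_mono: "holder_on a b \<kappa> H f \<Longrightarrow> H \<le> H' \<Longrightarrow> holder_on a b \<kappa> H' f"
  unfolding holder_on_def by (meson order_trans mult_right_mono powr_ge_zero)

lemma holder_on_add:
  assumes "holder_on a b \<kappa> H f" "holder_on a b \<kappa> H' g"
  shows "holder_on a b \<kappa> (H + H') (\<lambda>x. f x + g x)"
proof (rule holder_onI)
  show "0 \<le> H + H'" using assms by (auto simp: holder_on_def)
  fix u v assume "a \<le> u" "u \<le> v" "v \<le> b"
  hence "\<bar>f v - f u\<bar> \<le> H * (v - u) powr \<kappa>" "\<bar>g v - g u\<bar> \<le> H' * (v - u) powr \<kappa>"
    using assms holder_onD by blast+
  thus "\<bar>f v + g v - (f u + g u)\<bar> \<le> (H + H') * (v - u) powr \<kappa>" unfolding distrib_right by linarith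
qed

lemma holder_on_cmult:
  assumes "holder_on a b \<kappa> H f"
  shows "holder_on a b \<kappa> (\<bar>c\<bar> * H) (\<lambda>x. c * f x)"
proof (rule holder_onI)
  show "0 \<le> \<bar>c\<bar> * H" using assms by (auto simp: holder_on_def)
  fix u v assume "a \<le> u" "u \<le> v" "v \<le> b"
  hence "\<bar>f v - f u\<bar> \<le> H * (v - u) powr \<kappa>" using assms holder_onD by blast
  hence "\<bar>c\<bar> * \<bar>f v - f u\<bar> \<le> \<bar>c\<bar> * (H * (v - u) powr \<kappa>)" by (rule mult_left_mono) simp
  thus "\<bar>c * f v - c * f u\<bar> \<le> \<bar>c\<bar> * H * (v - u) powr \<kappa>"
    by (simp add: abs_mult[symmetric] right_diff_distrib mult.assoc)
qed

lemma holder_on_diff: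
  assumes "holder_on a b \<kappa> H f" "holder_on a b \<kappa> H' g"
  shows "holder_on a b \<kappa> (H + H') (\<lambda>x. f x - g x)"
  using holder_on_add[OF assms(1) holder_on_cmult[OF assms(2), of "-1"]] by simp

lemma holder_on_sum:
  assumes "finite A" "\<And>i. i \<in> A \<Longrightarrow> holder_on a b \<kappa> (H i) (f i)"
  shows "holder_on a b \<kappa> (\<Sum>i\<in>A. H i) (\<lambda>x. \<Sum>i\<in>A. f i x)"
  using assms by (induction A rule: finite_induct) (auto intro: holder_on_const holder_on_add)

lemma holder_on_bounded:
  assumes "holder_on a b \<kappa> H f" "\<kappa> > 0" "a \<le> u" "u \<le> b"
  shows "\<bar>f u\<bar> \<le> \<bar>f a\<bar> + H * (b - a) powr \<kappa>"
proof -
  have "\<bar>f u - f a\<bar> \<le> H * (u - a) powr \<kappa>" using holder_onD[OF assms(1)] assms by simp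
  also have "\<dots> \<le> H * (b - a) powr \<kappa>"
    using assms holder_on_nonneg[OF assms(1)] by (intro mult_left_mono powr_mono2) auto
  finally show ?thesis by linarith
qed

lemma holder_on_mult:
  assumes f: "holder_on a b \<kappa> H f" and g: "holder_on a b \<kappa> H' g"
    and B: "\<And>x. a \<le> x \<Longrightarrow> x \<le> b \<Longrightarrow> \<bar>f x\<bar> \<le> B" "\<And>x. a \<le> x \<Longrightarrow> x \<le> b \<Longrightarrow> \<bar>g x\<bar> \<le> B'"
    and B0: "0 \<le> B" "0 \<le> B'"
  shows "holder_on a b \<kappa> (B * H' + B' * H) (\<lambda>x. f x * g x)"
proof (rule holder_onI)
  show "0 \<le> B * H' + B' * H" using assms by (auto simp: holder_on_def)
  fix u v assume uv: "a \<le> u" "u \<le> v" "v \<le> b"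
  have "f v * g v - f u * g u = f v * (g v - g u) + g u * (f v - f u)" by (simp add: algebra_simps)
  hence "\<bar>f v * g v - f u * g u\<bar> \<le> \<bar>f v\<bar> * \<bar>g v - g u\<bar> + \<bar>g u\<bar> * \<bar>f v - f u\<bar>"
    by (metis abs_mult abs_triangle_ineq)
  also have "\<dots> \<le> B * (H' * (v - u) powr \<kappa>) + B' * (H * (v - u) powr \<kappa>)"
    using uv holder_onD[OF f] holder_onD[OF g] B B0 by (intro add_mono mult_mono) auto
  finally show "\<bar>f v * g v - f u * g u\<bar> \<le> (B * H' + B' * H) * (v - u) powr \<kappa>"
    by (simp add: algebra_simps)
qed

lemma holder_on_weaken:
  assumes "holder_on a b \<beta> H f" "0 < \<kappa>" "\<kappa> \<le> \<beta>"
  shows "holder_on a b \<kappa> (H * (b - a) powr (\<beta> - \<kappa>)) f"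
proof (rule holder_onI)
  show "0 \<le> H * (b - a) powr (\<beta> - \<kappa>)" using holder_on_nonneg[OF assms(1)] by simp
  fix u v assume uv: "a \<le> u" "u \<le> v" "v \<le> b"
  show "\<bar>f v - f u\<bar> \<le> H * (b - a) powr (\<beta> - \<kappa>) * (v - u) powr \<kappa>"
  proof (cases "u = v")
    case False
    have "\<bar>f v - f u\<bar> \<le> H * (v - u) powr \<beta>" using holder_onD[OF assms(1)] uv by simp
    also have "\<dots> = H * ((v - u) powr (\<beta> - \<kappa>) * (v - u) powr \<kappa>)"
      by (simp add: powr_add[symmetric])
    also have "\<dots> \<le> H * ((b - a) powr (\<beta> - \<kappa>) * (v - u) powr \<kappa>)"
      using assms uv holder_on_nonneg[OF assms(1)] by (intro mult_left_mono mult_right_mono powr_mono2) auto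
    finally show ?thesis by (simp add: mult.assoc)
  qed (use holder_on_nonneg[OF assms(1)] in simp)
qed

lemma young_integral_difference:
  assumes "holder_on a b \<kappa> H f" "holder_on a b \<beta> L g" "\<kappa> > 0" "\<beta> > 0" "\<kappa> + \<beta> > 1" "a \<le> u" "u \<le> v" "v \<le> b"
  shows "young_integral f g a v - young_integral f g a u = young_integral f g u v"
proof -
  have "young_integral f g a v = young_integral f g a u + young_integral f g u v"
    by (rule young_integral_combine[OF _ _ holder_on_subset[OF assms(1)] holder_on_subset[OF assms(2)] assms(3-5)])
      (use assms in auto)
  thus ?thesis by simp
qed

lemma young_integral_bound:
  assumes ab: "a \<le> b" and f: "holder_on a b \<kappa> H f" and g: "holder_on a b \<beta> L g" and pos: "\<kappa> > 0" "\<beta> > 0" "\<kappa> + \<beta> > 1"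
    and B: "\<bar>f a\<bar> \<le> B"
  shows "\<bar>young_integral f g a b\<bar> \<le> (B + young_const (\<kappa> + \<beta>) * H * (b - a) powr \<kappa>) * L * (b - a) powr \<beta>"
proof -
  have "\<bar>f a * (g b - g a)\<bar> \<le> B * (L * (b - a) powr \<beta>)"
    unfolding abs_mult using holder_onD[OF g] ab B by (intro mult_mono) auto
  with young_integral_estimate[OF ab f g pos] show ?thesis by (simp add: powr_add algebra_simps)
qed

text \<open>The integral inherits the exponent of the integrator, whatever that of the integrand.
  This gain of regularity later lifts a solution of low regularity to the exponent \<beta>.\<close>

lemma holder_on_young_integral:
  assumes f: "holder_on a b \<kappa> H f" and g: "holder_on a b \<beta> L g" and pos: "\<kappa> > 0" "\<beta> > 0" "\<kappa> + \<beta> > 1"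
    and B: "\<And>x. a \<le> x \<Longrightarrow> x \<le> b \<Longrightarrow> \<bar>f x\<bar> \<le> B" "0 \<le> B"
  shows "holder_on a b \<beta> ((B + young_const (\<kappa> + \<beta>) * H * (b - a) powr \<kappa>) * L) (\<lambda>t. young_integral f g a t)"
proof (rule holder_onI)
  have H0: "0 \<le> H" "0 \<le> L" using f g holder_on_nonneg by blast+
  have Y: "young_const (\<kappa> + \<beta>) > 0" using young_const_pos pos by simp
  show "0 \<le> (B + young_const (\<kappa> + \<beta>) * H * (b - a) powr \<kappa>) * L"
    using H0 Y B by (intro mult_nonneg_nonneg add_nonneg_nonneg) auto
  fix u v assume uv: "a \<le> u" "u \<le> v" "v \<le> b"
  have "\<bar>young_integral f g a v - young_integral f g a u\<bar> = \<bar>young_integral f g u v\<bar>"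
    using young_integral_difference[OF f g pos uv] by simp
  also have "\<dots> \<le> (B + young_const (\<kappa> + \<beta>) * H * (v - u) powr \<kappa>) * L * (v - u) powr \<beta>"
    by (rule young_integral_bound[OF _ holder_on_subset[OF f] holder_on_subset[OF g] pos]) (use uv B in auto)
  also have "\<dots> \<le> (B + young_const (\<kappa> + \<beta>) * H * (b - a) powr \<kappa>) * L * (v - u) powr \<beta>"
    using H0 Y B pos uv by (intro mult_right_mono add_left_mono mult_left_mono powr_mono2) auto
  finally show "\<bar>young_integral f g a v - young_integral f g a u\<bar>
     \<le> (B + young_const (\<kappa> + \<beta>) * H * (b - a) powr \<kappa>) * L * (v - u) powr \<beta>" .
qed

section \<open>Associativity and integration by parts\<close>

lemma small_powr:
  fixes K \<mu> e :: real
  assumes "K \<ge> 0" "\<mu> > 0" "e > 0"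
  shows "\<exists>\<delta>>0. K * \<delta> powr \<mu> < e"
proof (intro exI conjI)
  show "(e / (K + 1)) powr (1 / \<mu>) > 0" using assms by simp
  have "K * ((e / (K + 1)) powr (1 / \<mu>)) powr \<mu> = K * (e / (K + 1))" using assms by (simp add: powr_powr)
  also have "\<dots> < e" using assms by (simp add: field_simps)
  finally show "K * ((e / (K + 1)) powr (1 / \<mu>)) powr \<mu> < e" .
qed

text \<open>On each cell the increment of the inner integral differs from \<open>h (p k)\<close>
  times the increment of g by a term of order 2\<theta> > 1 in the length. These errors sum to 0, so
  the left-tagged sums of the two integrals have the same limit.\<close>

lemma young_integral_associative:
  assumes ab: "a \<le> b" and th: "\<theta> > 1/2"
    and f: "holder_on a b \<theta> Hf f" and h: "holder_on a b \<theta> Hh h" and g: "holder_on a b \<theta> L g"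
  shows "young_integral f (\<lambda>t. young_integral h g a t) a b = young_integral (\<lambda>x. f x * h x) g a b"
proof -
  define F where "F = (\<lambda>t. young_integral h g a t)"
  define Bf where "Bf = \<bar>f a\<bar> + Hf * (b - a) powr \<theta>"
  define Bh where "Bh = \<bar>h a\<bar> + Hh * (b - a) powr \<theta>"
  have pos: "\<theta> > 0" "\<theta> > 0" "\<theta> + \<theta> > 1" using th by auto
  have H0: "0 \<le> Hf" "0 \<le> Hh" "0 \<le> L" using f h g holder_on_nonneg by blast+
  have bf: "\<bar>f x\<bar> \<le> Bf" if "a \<le> x" "x \<le> b" for x using holder_on_bounded[OF f] that th by (simp add: Bf_def)
  have bh: "\<bar>h x\<bar> \<le> Bh" if "a \<le> x" "x \<le> b" for x using holder_on_bounded[OF h] that th by (simp add: Bh_def)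
  have B0: "0 \<le> Bf" "0 \<le> Bh" using H0 by (auto simp: Bf_def Bh_def)
  define Y where "Y = young_const (\<theta> + \<theta>)"
  have Y: "Y > 0" using young_const_pos pos by (simp add: Y_def)
  have F: "holder_on a b \<theta> ((Bh + Y * Hh * (b - a) powr \<theta>) * L) F"
    unfolding F_def Y_def by (rule holder_on_young_integral[OF h g pos bh B0(2)])
  have fh: "holder_on a b \<theta> (Bf * Hh + Bh * Hf) (\<lambda>x. f x * h x)" by (rule holder_on_mult[OF f h bf bh B0])
  let ?d = "\<lambda>(N, p, \<xi>). rs_sum f F (N, p, p) - rs_sum (\<lambda>x. f x * h x) g (N, p, p)"
  define K where "K = Bf * (Y * Hh * L) * (b - a)"
  have K0: "K \<ge> 0" using B0 Y H0 ab by (simp add: K_def)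
  have close: "\<bar>?d (N, p, \<xi>)\<bar> \<le> K * \<delta> powr (\<theta> + \<theta> - 1)" if p: "is_tagged_partition a b \<delta> N p \<xi>" for N p \<xi> \<delta>
  proof -
    have "?d (N, p, \<xi>) = (\<Sum>k<N. f (p k) * (F (p (Suc k)) - F (p k) - h (p k) * (g (p (Suc k)) - g (p k))))"
      unfolding split_conv rs_sum_eq sum_subtractf[symmetric] by (intro sum.cong) (auto simp: algebra_simps)
    also have "\<bar>\<dots>\<bar> \<le> (\<Sum>k<N. Bf * (Y * Hh * L * (p (Suc k) - p k) powr (\<theta> + \<theta>)))"
    proof (rule order_trans[OF sum_abs sum_mono])
      fix k assume k: "k \<in> {..<N}"
      have pk: "a \<le> p k" "p k \<le> p (Suc k)" "p (Suc k) \<le> b"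
        using is_tagged_partition_mono[OF p, of 0 k] is_tagged_partition_mono[OF p, of k "Suc k"]
          is_tagged_partition_mono[OF p, of "Suc k" N] k p by (auto simp: is_tagged_partition_def)
      have "F (p (Suc k)) - F (p k) = young_integral h g (p k) (p (Suc k))"
        unfolding F_def by (rule young_integral_difference[OF h g pos pk])
      moreover have "\<bar>young_integral h g (p k) (p (Suc k)) - h (p k) * (g (p (Suc k)) - g (p k))\<bar>
         \<le> Y * Hh * L * (p (Suc k) - p k) powr (\<theta> + \<theta>)"
        unfolding Y_def
        by (rule young_integral_estimate[OF pk(2) holder_on_subset[OF h] holder_on_subset[OF g] pos]) (use pk in auto)
      ultimately show "\<bar>f (p k) * (F (p (Suc k)) - F (p k) - h (p k) * (g (p (Suc k)) - g (p k)))\<bar>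
         \<le> Bf * (Y * Hh * L * (p (Suc k) - p k) powr (\<theta> + \<theta>))"
        unfolding abs_mult using bf[of "p k"] pk B0 by (intro mult_mono) auto
    qed
    also have "\<dots> = Bf * (Y * Hh * L) * (\<Sum>k<N. (p (Suc k) - p k) powr (\<theta> + \<theta>))"
      by (simp add: sum_distrib_left mult.assoc)
    also have "\<dots> \<le> Bf * (Y * Hh * L) * (\<delta> powr (\<theta> + \<theta> - 1) * (b - a))"
      using sum_partition_powr[OF p pos(3)] B0 Y H0 by (intro mult_left_mono) auto
    also have "\<dots> = K * \<delta> powr (\<theta> + \<theta> - 1)" by (simp add: K_def)
    finally show ?thesis .
  qed
  have "(?d \<longlongrightarrow> 0) (partitions a b)"
    unfolding tendsto_iff eventually_partitions dist_real_def diff_0_right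
  proof (intro allI impI)
    fix e :: real assume "e > 0"
    then obtain \<delta> where "\<delta> > 0" "K * \<delta> powr (\<theta> + \<theta> - 1) < e"
      using small_powr[OF K0, of "\<theta> + \<theta> - 1" e] pos(3) by (metis diff_gt_0_iff_gt)
    thus "\<exists>\<delta>>0. \<forall>N p \<xi>. is_tagged_partition a b \<delta> N p \<xi> \<longrightarrow> \<bar>?d (N, p, \<xi>)\<bar> < e"
      using close by (meson le_less_trans)
  qed
  moreover have "(?d \<longlongrightarrow> young_integral f F a b - young_integral (\<lambda>x. f x * h x) g a b) (partitions a b)"
    using tendsto_diff[OF has_young_integral_left_tags[OF young_integral_exists[OF ab f F pos]]
        has_young_integral_left_tags[OF young_integral_exists[OF ab fh g pos]]]
    by (simp add: split_def)
  ultimately have "young_integral f F a b - young_integral (\<lambda>x. f x * h x) g a b = 0"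
    using tendsto_unique[OF partitions_neq_bot[OF ab]] by blast
  thus ?thesis by (simp add: F_def)
qed

text \<open>Left tags in the first sum and right tags in the second one make the two sums telescope.\<close>

lemma young_integration_by_parts:
  assumes ab: "a \<le> b" and th: "\<theta> > 1/2" and f: "holder_on a b \<theta> H f" and g: "holder_on a b \<theta> L g"
  shows "young_integral f g a b + young_integral g f a b = f b * g b - f a * g a"
proof -
  have pos: "\<theta> > 0" "\<theta> > 0" "\<theta> + \<theta> > 1" using th by auto
  have "rs_sum f g (N, p, p) + rs_sum g f (N, p, \<lambda>k. p (Suc k)) = f b * g b - f a * g a"
    if p: "is_tagged_partition a b 1 N p \<xi>" for N p \<xi>
  proof -
    have "rs_sum f g (N, p, p) + rs_sum g f (N, p, \<lambda>k. p (Suc k))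
      = (\<Sum>k<N. f (p (Suc k)) * g (p (Suc k)) - f (p k) * g (p k))"
      unfolding rs_sum_eq sum.distrib[symmetric] by (intro sum.cong) (auto simp: algebra_simps)
    also have "\<dots> = f (p N) * g (p N) - f (p 0) * g (p 0)" by (rule sum_lessThan_telescope)
    finally show ?thesis using p by (simp add: is_tagged_partition_def)
  qed
  hence "((\<lambda>(N, p, \<xi>). rs_sum f g (N, p, p) + rs_sum g f (N, p, \<lambda>k. p (Suc k))) \<longlongrightarrow> f b * g b - f a * g a) (partitions a b)"
    by (intro tendsto_eventually eventually_mono[OF eventually_partition]) auto
  moreover have "((\<lambda>(N, p, \<xi>). rs_sum f g (N, p, p) + rs_sum g f (N, p, \<lambda>k. p (Suc k))) \<longlongrightarrow>
      young_integral f g a b + young_integral g f a b) (partitions a b)"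
    using tendsto_add[OF has_young_integral_left_tags[OF young_integral_exists[OF ab f g pos]]
        has_young_integral_right_tags[OF young_integral_exists[OF ab g f pos]]]
    by (simp add: split_def)
  ultimately show ?thesis using tendsto_unique[OF partitions_neq_bot[OF ab]] by blast
qed

section \<open>Exponentially weighted Hoelder norms\<close>

text \<open>The factor \<open>\<nu> powr \<theta>\<close> makes values and increments comparable on
  the time scale 1 / \<nu>, so that a single number N can be propagated through an
  integration.\<close>

definition bielecki :: "real \<Rightarrow> real \<Rightarrow> real \<Rightarrow> real \<Rightarrow> (real \<Rightarrow> real) \<Rightarrow> bool" where
  "bielecki \<nu> \<theta> N T f \<longleftrightarrow> (\<forall>u. 0 \<le> u \<longrightarrow> u \<le> T \<longrightarrow> \<bar>f u\<bar> \<le> N * exp (\<nu> * u)) \<and>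
     (\<forall>u v. 0 \<le> v \<longrightarrow> v \<le> u \<longrightarrow> u \<le> T \<longrightarrow> \<bar>f u - f v\<bar> \<le> N * \<nu> powr \<theta> * exp (\<nu> * u) * (u - v) powr \<theta>)"

lemma bieleckiD1: "bielecki \<nu> \<theta> N T f \<Longrightarrow> 0 \<le> u \<Longrightarrow> u \<le> T \<Longrightarrow> \<bar>f u\<bar> \<le> N * exp (\<nu> * u)"
  by (simp add: bielecki_def)

lemma bieleckiD2: "bielecki \<nu> \<theta> N T f \<Longrightarrow> 0 \<le> v \<Longrightarrow> v \<le> u \<Longrightarrow> u \<le> T \<Longrightarrow>
    \<bar>f u - f v\<bar> \<le> N * \<nu> powr \<theta> * exp (\<nu> * u) * (u - v) powr \<theta>"
  by (simp add: bielecki_def)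

lemma bielecki_hol:
  assumes "bielecki \<nu> \<theta> N T f" "0 \<le> N" "0 < \<nu>" "0 \<le> a" "b \<le> T"
  shows "holder_on a b \<theta> (N * \<nu> powr \<theta> * exp (\<nu> * b)) f"
proof (rule holder_onI)
  show "0 \<le> N * \<nu> powr \<theta> * exp (\<nu> * b)" using assms by simp
  fix u v assume uv: "a \<le> u" "u \<le> v" "v \<le> b"
  have "\<bar>f v - f u\<bar> \<le> N * \<nu> powr \<theta> * exp (\<nu> * v) * (v - u) powr \<theta>"
    using bieleckiD2[OF assms(1)] uv assms by auto
  also have "\<dots> \<le> N * \<nu> powr \<theta> * exp (\<nu> * b) * (v - u) powr \<theta>"
    using uv assms by (intro mult_right_mono mult_left_mono) auto
  finally show "\<bar>f v - f u\<bar> \<le> N * \<nu> powr \<theta> * exp (\<nu> * b) * (v - u) powr \<theta>" .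
qed

text \<open>Summing over blocks of length 1 / \<nu> costs a factor 2, because exp (-1) \<le> 1/2. An
  increment over a longer distance is bounded by two values of the integral, which doubles it to
  4.\<close>

definition bielecki_const :: "real \<Rightarrow> real" where
  "bielecki_const \<theta> = 4 * (1 + young_const (\<theta> + \<theta>))"

lemma bielecki_const_pos: "\<theta> > 1/2 \<Longrightarrow> bielecki_const \<theta> > 0"
  using young_const_pos[of "\<theta> + \<theta>"] by (simp add: bielecki_const_def)

text \<open>On intervals of length at most \<open>1/\<nu>\<close> the Young estimate applies directly; the contributions of
  consecutive such intervals form a geometric series.\<close>

lemma bielecki_young_integral:
  assumes f: "bielecki \<nu> \<theta> N T f" and g: "holder_on 0 T \<theta> L g" and th: "\<theta> > 1/2" and lam: "\<nu> > 0" and N: "N \<ge> 0"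
  shows "bielecki \<nu> \<theta> (bielecki_const \<theta> * L * \<nu> powr (- \<theta>) * N) T (\<lambda>t. young_integral f g 0 t)"
proof -
  define Y where "Y = young_const (\<theta> + \<theta>)"
  define F where "F = (\<lambda>t. young_integral f g 0 t)"
  have pos: "\<theta> > 0" "\<theta> > 0" "\<theta> + \<theta> > 1" using th by auto
  have Y: "Y > 0" using young_const_pos pos by (simp add: Y_def)
  have L0: "0 \<le> L" using g holder_on_nonneg by blast
  define c where "c = (1 + Y) * (N * L)"
  have c0: "c \<ge> 0" using Y N L0 by (simp add: c_def)
  have local: "\<bar>F t - F s\<bar> \<le> c * exp (\<nu> * t) * (t - s) powr \<theta>" if st: "0 \<le> s" "s \<le> t" "t \<le> T" "t - s \<le> 1 / \<nu>" for s t
  proof -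
    have hf: "holder_on 0 t \<theta> (N * \<nu> powr \<theta> * exp (\<nu> * t)) f"
      by (rule bielecki_hol[OF f N lam]) (use st in auto)
    have hg: "holder_on 0 t \<theta> L g" using holder_on_subset[OF g] st by simp
    have "F t - F s = young_integral f g s t"
      unfolding F_def by (rule young_integral_difference[OF hf hg pos]) (use st in auto)
    moreover have "\<bar>young_integral f g s t\<bar> \<le> (N * exp (\<nu> * t) + Y * (N * \<nu> powr \<theta> * exp (\<nu> * t)) * (t - s) powr \<theta>) * L * (t - s) powr \<theta>"
      unfolding Y_def
    proof (rule young_integral_bound[OF st(2) holder_on_subset[OF hf] holder_on_subset[OF hg] pos])
      have "\<bar>f s\<bar> \<le> N * exp (\<nu> * s)" by (rule bieleckiD1[OF f]) (use st in auto)
      also have "\<dots> \<le> N * exp (\<nu> * t)" using N lam st by (intro mult_left_mono) auto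
      finally show "\<bar>f s\<bar> \<le> N * exp (\<nu> * t)" .
    qed (use st in auto)
    moreover have "\<nu> powr \<theta> * (t - s) powr \<theta> \<le> 1"
    proof -
      have "\<nu> powr \<theta> * (t - s) powr \<theta> = (\<nu> * (t - s)) powr \<theta>" using lam st by (simp add: powr_mult)
      also have "\<dots> \<le> 1" using lam st pos by (intro powr_le1) (auto simp: field_simps)
      finally show ?thesis .
    qed
    hence "(N * exp (\<nu> * t) + Y * (N * \<nu> powr \<theta> * exp (\<nu> * t)) * (t - s) powr \<theta>) * L * (t - s) powr \<theta>
       \<le> (N * exp (\<nu> * t) + Y * (N * exp (\<nu> * t)) * 1) * L * (t - s) powr \<theta>"
    proof (intro mult_right_mono add_left_mono)
      assume le: "\<nu> powr \<theta> * (t - s) powr \<theta> \<le> 1"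
      have "Y * (N * \<nu> powr \<theta> * exp (\<nu> * t)) * (t - s) powr \<theta> = Y * (N * exp (\<nu> * t)) * (\<nu> powr \<theta> * (t - s) powr \<theta>)" by simp
      also have "\<dots> \<le> Y * (N * exp (\<nu> * t)) * 1" using le Y N by (intro mult_left_mono) auto
      finally show "Y * (N * \<nu> powr \<theta> * exp (\<nu> * t)) * (t - s) powr \<theta> \<le> Y * (N * exp (\<nu> * t)) * 1" .
    qed (use L0 in auto)
    ultimately show ?thesis by (simp add: c_def algebra_simps)
  qed
  have F0: "F 0 = 0" by (simp add: F_def)
  have e: "exp (-1) \<le> (1/2::real)"
  proof -
    have "2 \<le> exp (1::real)" using exp_ge_add_one_self[of 1] by simp
    thus ?thesis by (simp add: exp_minus field_simps)
  qed
  have sup: "\<bar>F t\<bar> \<le> 2 * c * \<nu> powr (- \<theta>) * exp (\<nu> * t)" if "0 \<le> t" "t \<le> T" "t \<le> real n / \<nu>" for n t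
    using that
  proof (induction n arbitrary: t)
    case 0
    hence "t = 0" by simp
    thus ?case using c0 F0 by simp
  next
    case (Suc n)
    show ?case
    proof (cases "t \<le> 1 / \<nu>")
      case True
      have "\<bar>F t - F 0\<bar> \<le> c * exp (\<nu> * t) * (t - 0) powr \<theta>" by (rule local) (use Suc True in auto)
      also have "\<dots> \<le> c * exp (\<nu> * t) * (1 / \<nu>) powr \<theta>"
        using c0 True Suc pos by (intro mult_left_mono powr_mono2) auto
      also have "(1 / \<nu>) powr \<theta> = \<nu> powr (- \<theta>)" using lam by (simp add: powr_minus_divide powr_divide)
      finally have "\<bar>F t\<bar> \<le> c * exp (\<nu> * t) * \<nu> powr (- \<theta>)" by (simp add: F0)
      moreover have "0 \<le> c * exp (\<nu> * t) * \<nu> powr (- \<theta>)" using c0 by simp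
      ultimately show ?thesis by (simp add: mult_ac)
    next
      case False
      define s where "s = t - 1 / \<nu>"
      have "real (Suc n) / \<nu> = 1 / \<nu> + real n / \<nu>" by (simp add: add_divide_distrib)
      moreover have "1 / \<nu> > 0" using lam by simp
      ultimately have s: "0 \<le> s" "s \<le> t" "s \<le> T" "s \<le> real n / \<nu>" using False Suc(2-4)
        unfolding s_def by linarith+
      have "\<bar>F t - F s\<bar> \<le> c * exp (\<nu> * t) * (t - s) powr \<theta>" by (rule local) (use Suc s in \<open>auto simp: s_def\<close>)
      also have "(t - s) powr \<theta> = \<nu> powr (- \<theta>)" using lam by (simp add: s_def powr_minus_divide powr_divide)
      finally have 1: "\<bar>F t - F s\<bar> \<le> c * exp (\<nu> * t) * \<nu> powr (- \<theta>)" .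
      have 2: "\<bar>F s\<bar> \<le> 2 * c * \<nu> powr (- \<theta>) * exp (\<nu> * s)" by (rule Suc.IH) (use s in auto)
      have "exp (\<nu> * s) = exp (\<nu> * t) * exp (-1)" using lam by (simp add: s_def exp_add[symmetric] algebra_simps)
      also have "\<dots> \<le> exp (\<nu> * t) * (1/2)" using e by (intro mult_left_mono) auto
      finally have "2 * c * \<nu> powr (- \<theta>) * exp (\<nu> * s) \<le> 2 * c * \<nu> powr (- \<theta>) * (exp (\<nu> * t) * (1/2))"
        using c0 by (intro mult_left_mono) auto
      hence "\<bar>F s\<bar> \<le> c * exp (\<nu> * t) * \<nu> powr (- \<theta>)" using 2 by (simp add: mult_ac)
      with 1 show ?thesis by (simp add: mult_ac)
    qed
  qed
  have sup': "\<bar>F t\<bar> \<le> 2 * c * \<nu> powr (- \<theta>) * exp (\<nu> * t)" if "0 \<le> t" "t \<le> T" for t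
  proof -
    obtain n :: nat where "t * \<nu> < real n" using reals_Archimedean2 by blast
    hence "t \<le> real n / \<nu>" using lam by (simp add: field_simps)
    thus ?thesis using sup that by blast
  qed
  have C: "bielecki_const \<theta> * L * \<nu> powr (- \<theta>) * N = 4 * c * \<nu> powr (- \<theta>)"
    by (simp add: bielecki_const_def c_def Y_def)
  show ?thesis
    unfolding bielecki_def C F_def[symmetric]
  proof (intro conjI allI impI)
    fix u assume u: "0 \<le> u" "u \<le> T"
    have "0 \<le> 2 * c * \<nu> powr (- \<theta>) * exp (\<nu> * u)" using c0 by simp
    thus "\<bar>F u\<bar> \<le> 4 * c * \<nu> powr (- \<theta>) * exp (\<nu> * u)" using sup'[OF u] by linarith
  next
    fix u v assume uv: "0 \<le> v" "v \<le> u" "u \<le> T"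
    have lt: "\<nu> powr (- \<theta>) * \<nu> powr \<theta> = 1" using lam by (simp add: powr_add[symmetric])
    have R: "4 * c * \<nu> powr (- \<theta>) * \<nu> powr \<theta> * exp (\<nu> * u) * (u - v) powr \<theta> = 4 * (c * exp (\<nu> * u) * (u - v) powr \<theta>)"
      using lt by (simp add: mult.assoc mult.left_commute)
    show "\<bar>F u - F v\<bar> \<le> 4 * c * \<nu> powr (- \<theta>) * \<nu> powr \<theta> * exp (\<nu> * u) * (u - v) powr \<theta>"
    proof (cases "u - v \<le> 1 / \<nu>")
      case True
      have "0 \<le> c * exp (\<nu> * u) * (u - v) powr \<theta>" using c0 by simp
      thus ?thesis unfolding R using local[OF uv True] by linarith
    next
      case False
      have "(1 / \<nu>) powr \<theta> \<le> (u - v) powr \<theta>" using False lam pos by (intro powr_mono2) auto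
      hence ge: "\<nu> powr (- \<theta>) \<le> (u - v) powr \<theta>" using lam by (simp add: powr_minus_divide powr_divide)
      have "\<bar>F v\<bar> \<le> 2 * c * \<nu> powr (- \<theta>) * exp (\<nu> * v)" using sup' uv by auto
      also have "\<dots> \<le> 2 * c * \<nu> powr (- \<theta>) * exp (\<nu> * u)" using c0 uv lam by (intro mult_left_mono) auto
      finally have "\<bar>F u - F v\<bar> \<le> 4 * (c * exp (\<nu> * u) * \<nu> powr (- \<theta>))"
        using sup'[of u] uv by (simp add: mult_ac)
      also have "\<dots> \<le> 4 * (c * exp (\<nu> * u) * (u - v) powr \<theta>)"
        using ge c0 by (intro mult_left_mono) auto
      finally show ?thesis unfolding R .
    qed
  qed
qed

section \<open>Iterated integrals in weighted norms\<close>

lemma simplex_integral_Nil [simp]: "simplex_integral y [] = (\<lambda>t. 1)"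
  by (simp add: simplex_integral_def)

lemma simplex_integral_snoc:
  "simplex_integral y (I @ [i]) = (\<lambda>t. young_integral (simplex_integral y I) (\<lambda>s. y s i) 0 t)"
  by (simp add: simplex_integral_def)

text \<open>A general prefix \<open>I0\<close> is allowed because the first two letters will be
  estimated by another method. Every further letter gains
  \<open>\<nu> powr (- \<theta>)\<close>.\<close>

lemma bielecki_simplex_integral_append:
  assumes "bielecki \<nu> \<theta> N T (simplex_integral y I0)" "\<theta> > 1/2" "\<nu> > 0" "N \<ge> 0" "L \<ge> 0"
    and "\<And>i. i \<in> set I \<Longrightarrow> holder_on 0 T \<theta> L (\<lambda>s. y s i)"
  shows "bielecki \<nu> \<theta> ((bielecki_const \<theta> * L * \<nu> powr (- \<theta>)) ^ length I * N) T (simplex_integral y (I0 @ I))"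
  using assms(6)
proof (induction I rule: rev_induct)
  case (snoc i I)
  have "bielecki \<nu> \<theta> (bielecki_const \<theta> * L * \<nu> powr (- \<theta>) * ((bielecki_const \<theta> * L * \<nu> powr (- \<theta>)) ^ length I * N)) T
     (\<lambda>t. young_integral (simplex_integral y (I0 @ I)) (\<lambda>s. y s i) 0 t)"
    by (rule bielecki_young_integral) (use snoc assms bielecki_const_pos[of \<theta>] in auto)
  thus ?case using simplex_integral_snoc[of y "I0 @ I" i] by (simp add: mult.assoc)
qed (use assms in simp)

lemma bielecki_simplex_integral:
  assumes "\<theta> > 1/2" "\<nu> > 0" "L \<ge> 0" "\<And>i. i \<in> set I \<Longrightarrow> holder_on 0 T \<theta> L (\<lambda>s. y s i)"
  shows "bielecki \<nu> \<theta> ((bielecki_const \<theta> * L * \<nu> powr (- \<theta>)) ^ length I) T (simplex_integral y I)"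
proof -
  have "bielecki \<nu> \<theta> 1 T (simplex_integral y [])"
    using assms by (auto simp: bielecki_def)
  from bielecki_simplex_integral_append[OF this] show ?thesis using assms by simp
qed

section \<open>Singular kernels and a Sobolev-type bound for Young integrals\<close>

lemma has_integral_powr_singular_right:
  fixes p :: real
  assumes "p > 0" "x \<le> t"
  shows "((\<lambda>s. (t - s) powr (p - 1)) has_integral ((t - x) powr p / p)) {x..t}"
proof -
  have "((\<lambda>s. (t - s) powr (p - 1)) has_integral ((- ((t - t) powr p / p)) - (- ((t - x) powr p / p)))) {x..t}"
  proof (rule fundamental_theorem_of_calculus_interior[OF assms(2)])
    show "continuous_on {x..t} (\<lambda>s. - ((t - s) powr p / p))"
      using assms by (intro continuous_intros continuous_on_powr') auto
    fix s assume s: "s \<in> {x<..<t}"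
    show "((\<lambda>s. - ((t - s) powr p / p)) has_vector_derivative (t - s) powr (p - 1)) (at s)"
      unfolding has_real_derivative_iff_has_vector_derivative[symmetric]
      using s assms by (auto intro!: derivative_eq_intros simp: powr_diff)
  qed
  thus ?thesis using assms by simp
qed

lemma has_integral_powr_singular_left:
  fixes p :: real
  assumes "p > 0" "x \<le> t"
  shows "((\<lambda>s. (s - x) powr (p - 1)) has_integral ((t - x) powr p / p)) {x..t}"
proof -
  have "((\<lambda>s. (s - x) powr (p - 1)) has_integral (((t - x) powr p / p) - ((x - x) powr p / p))) {x..t}"
  proof (rule fundamental_theorem_of_calculus_interior[OF assms(2)])
    show "continuous_on {x..t} (\<lambda>s. ((s - x) powr p / p))"
      using assms by (intro continuous_intros continuous_on_powr') auto
    fix s assume s: "s \<in> {x<..<t}"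
    show "((\<lambda>s. ((s - x) powr p / p)) has_vector_derivative (s - x) powr (p - 1)) (at s)"
      unfolding has_real_derivative_iff_has_vector_derivative[symmetric]
      using s assms by (auto intro!: derivative_eq_intros simp: powr_diff)
  qed
  thus ?thesis using assms by simp
qed

text \<open>A Hoelder exponent above \<alpha> leaves the integrable singularity
  \<open>(t - s) powr (\<beta> - \<alpha> - 1)\<close>. This covers the kernel of
  \<open>path_norm\<close> as well as that of a single component of the path.\<close>

lemma singular_kernel_integrable:
  fixes N :: "real \<Rightarrow> real"
  assumes "x \<le> t" and cont: "continuous_on {x..t} N"
    and N: "\<And>s. x \<le> s \<Longrightarrow> s \<le> t \<Longrightarrow> \<bar>N s\<bar> \<le> A * (t - s) powr \<beta>" and ab: "\<beta> > \<alpha>"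
  shows "(\<lambda>s. N s / (t - s) powr (1 + \<alpha>)) integrable_on {x..t}"
    and "\<bar>integral {x..t} (\<lambda>s. N s / (t - s) powr (1 + \<alpha>))\<bar> \<le> A * ((t - x) powr (\<beta> - \<alpha>) / (\<beta> - \<alpha>))"
proof -
  let ?k = "\<lambda>s. N s / (t - s) powr (1 + \<alpha>)"
  have bd: "norm (?k s) \<le> A * (t - s) powr (\<beta> - \<alpha> - 1)" if "s \<in> {x..t}" for s
  proof (cases "s = t")
    case False
    have "norm (?k s) = \<bar>N s\<bar> / (t - s) powr (1 + \<alpha>)" by simp
    also have "\<dots> \<le> (A * (t - s) powr \<beta>) / (t - s) powr (1 + \<alpha>)"
      using N that by (intro divide_right_mono) auto
    also have "\<dots> = A * (t - s) powr (\<beta> - (1 + \<alpha>))" by (simp add: powr_diff)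
    finally show ?thesis by (simp add: algebra_simps)
  qed simp
  have gi: "((\<lambda>s. A * (t - s) powr (\<beta> - \<alpha> - 1)) has_integral A * ((t - x) powr (\<beta> - \<alpha>) / (\<beta> - \<alpha>))) {x..t}"
    using has_integral_powr_singular_right[of "\<beta> - \<alpha>" x t] ab assms(1)
    by (intro has_integral_mult_right) simp
  have gi': "(\<lambda>s. A * (t - s) powr (\<beta> - \<alpha> - 1)) integrable_on {x..<t}"
    by (rule integrable_spike_set[OF has_integral_integrable[OF gi]])
      (rule negligible_subset[of "{t}"]; auto)+
  \<comment> \<open>Measurability comes from continuity away from the endpoint; the endpoint itself,
    where division by zero yields the value 0, is a null set.\<close>
  have "?k integrable_on {x..<t}"
  proof (rule measurable_bounded_by_integrable_imp_integrable[OF _ gi'])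
    have "continuous_on {x..<t} N" by (rule continuous_on_subset[OF cont]) auto
    hence "continuous_on {x..<t} ?k" by (intro continuous_intros) auto
    thus "?k \<in> borel_measurable (lebesgue_on {x..<t})"
      by (intro continuous_imp_measurable_on_sets_lebesgue) auto
  qed (use bd in auto)
  thus i: "?k integrable_on {x..t}"
    by (rule integrable_spike_set) (rule negligible_subset[of "{t}"]; auto)+
  have "norm (integral {x..t} ?k) \<le> integral {x..t} (\<lambda>s. A * (t - s) powr (\<beta> - \<alpha> - 1))"
    by (rule integral_norm_bound_integral[OF i has_integral_integrable[OF gi] bd])
  thus "\<bar>integral {x..t} ?k\<bar> \<le> A * ((t - x) powr (\<beta> - \<alpha>) / (\<beta> - \<alpha>))"
    using integral_unique[OF gi] by simp
qed

section \<open>Dyadic sums with mean values\<close>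

text \<open>A dyadic Riemann-Stieltjes sum in which tags are replaced by mean values of f. The means
  over two neighbouring cells differ by a double integral of \<open>f t - f s\<close>, which is
  exactly what the fractional kernel controls.\<close>

fun haar_sum :: "(real \<Rightarrow> real) \<Rightarrow> (real \<Rightarrow> real) \<Rightarrow> nat \<Rightarrow> real \<Rightarrow> real \<Rightarrow> real" where
  "haar_sum f g 0 p q = integral {p..q} f / (q - p) * (g q - g p)"
| "haar_sum f g (Suc n) p q = haar_sum f g n p ((p + q) / 2) + haar_sum f g n ((p + q) / 2) q"

lemma integral_average_close:
  fixes f :: "real \<Rightarrow> real"
  assumes "p < q" and f: "continuous_on {p..q} f" and b: "\<And>t. p \<le> t \<Longrightarrow> t \<le> q \<Longrightarrow> \<bar>f t - c\<bar> \<le> e"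
  shows "\<bar>integral {p..q} f / (q - p) - c\<bar> \<le> e"
proof -
  have fi: "f integrable_on {p..q}" using f integrable_continuous_interval by blast
  have "integral {p..q} (\<lambda>t. f t - c) = integral {p..q} f - c * (q - p)"
    using fi assms(1) by (subst integral_diff) auto
  moreover have "norm (integral {p..q} (\<lambda>t. f t - c)) \<le> integral {p..q} (\<lambda>t. e)"
    using fi b by (intro integral_norm_bound_integral) (auto intro!: integrable_diff)
  ultimately have "\<bar>integral {p..q} f - c * (q - p)\<bar> \<le> e * (q - p)" using assms(1) by (simp add: mult.commute)
  moreover have "integral {p..q} f / (q - p) - c = (integral {p..q} f - c * (q - p)) / (q - p)"
    using assms(1) by (simp add: field_simps)
  ultimately show ?thesis using assms(1) by (simp add: abs_divide pos_divide_le_eq)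
qed

text \<open>Replacing \<open>f p\<close> by a mean value costs no more than the Young error of the
  cell. There are 2 ^ n cells with an error of order 2\<theta> in their length, so the total tends
  to 0.\<close>

lemma haar_sum_close:
  assumes f: "holder_on a b \<theta> H f" and g: "holder_on a b \<theta> L g" and th: "\<theta> > 1/2" and "a \<le> p" "p < q" "q \<le> b"
  shows "\<bar>haar_sum f g n p q - young_integral f g p q\<bar>
    \<le> (1 + young_const (\<theta> + \<theta>)) * H * L * (2 ^ n * ((q - p) / 2 ^ n) powr (\<theta> + \<theta>))"
  using assms(4-6)
proof (induction n arbitrary: p q)
  case 0
  have pos: "\<theta> > 0" "\<theta> > 0" "\<theta> + \<theta> > 1" using th by auto
  have H0: "0 \<le> H" "0 \<le> L" using f g holder_on_nonneg by blast+
  have "\<bar>young_integral f g p q - f p * (g q - g p)\<bar> \<le> young_const (\<theta> + \<theta>) * H * L * (q - p) powr (\<theta> + \<theta>)"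
    by (rule young_integral_estimate[OF _ holder_on_subset[OF f] holder_on_subset[OF g] pos]) (use 0 in auto)
  moreover have "\<bar>(integral {p..q} f / (q - p) - f p) * (g q - g p)\<bar> \<le> (H * (q - p) powr \<theta>) * (L * (q - p) powr \<theta>)"
    unfolding abs_mult
  proof (rule mult_mono)
    show "\<bar>integral {p..q} f / (q - p) - f p\<bar> \<le> H * (q - p) powr \<theta>"
    proof (rule integral_average_close[OF 0(2)])
      show "continuous_on {p..q} f" using holder_on_continuous_on[OF holder_on_subset[OF f]] 0 pos by auto
      fix t assume t: "p \<le> t" "t \<le> q"
      have "\<bar>f t - f p\<bar> \<le> H * (t - p) powr \<theta>" using holder_onD[OF f] t 0 by auto
      also have "\<dots> \<le> H * (q - p) powr \<theta>" using t H0 pos by (intro mult_left_mono powr_mono2) auto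
      finally show "\<bar>f t - f p\<bar> \<le> H * (q - p) powr \<theta>" .
    qed
    show "\<bar>g q - g p\<bar> \<le> L * (q - p) powr \<theta>" using holder_onD[OF g] 0 by auto
  qed (use H0 in auto)
  ultimately have "\<bar>haar_sum f g 0 p q - young_integral f g p q\<bar>
     \<le> young_const (\<theta> + \<theta>) * H * L * (q - p) powr (\<theta> + \<theta>) + H * L * ((q - p) powr \<theta> * (q - p) powr \<theta>)"
    by (simp add: algebra_simps abs_le_iff)
  thus ?case by (simp add: powr_add[symmetric] algebra_simps)
next
  case (Suc n)
  have pos: "\<theta> > 0" "\<theta> > 0" "\<theta> + \<theta> > 1" using th by auto
  define m where "m = (p + q) / 2"
  have m: "a \<le> p" "p < m" "m < q" "q \<le> b" "m \<le> b" "a \<le> m" using Suc.prems by (auto simp: m_def)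
  have h: "(m - p) / 2 ^ n = (q - p) / 2 ^ Suc n" "(q - m) / 2 ^ n = (q - p) / 2 ^ Suc n"
    by (auto simp: m_def field_simps)
  have "young_integral f g p q = young_integral f g p m + young_integral f g m q"
    by (rule young_integral_combine[OF _ _ holder_on_subset[OF f] holder_on_subset[OF g] pos]) (use m in auto)
  hence "\<bar>haar_sum f g (Suc n) p q - young_integral f g p q\<bar>
      \<le> \<bar>haar_sum f g n p m - young_integral f g p m\<bar> + \<bar>haar_sum f g n m q - young_integral f g m q\<bar>"
    by (simp add: m_def[symmetric])
  also have "\<dots> \<le> (1 + young_const (\<theta> + \<theta>)) * H * L * (2 ^ n * ((m - p) / 2 ^ n) powr (\<theta> + \<theta>))
     + (1 + young_const (\<theta> + \<theta>)) * H * L * (2 ^ n * ((q - m) / 2 ^ n) powr (\<theta> + \<theta>))"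
    by (intro add_mono Suc.IH) (use m in auto)
  also have "\<dots> = (1 + young_const (\<theta> + \<theta>)) * H * L * (2 ^ Suc n * ((q - p) / 2 ^ Suc n) powr (\<theta> + \<theta>))"
    unfolding h by simp
  finally show ?case .
qed

lemma haar_sum_limit:
  assumes f: "holder_on a b \<theta> H f" and g: "holder_on a b \<theta> L g" and th: "\<theta> > 1/2" and "a < b"
  shows "(\<lambda>n. haar_sum f g n a b) \<longlonglongrightarrow> young_integral f g a b"
proof -
  have "(\<lambda>n. (1 + young_const (\<theta> + \<theta>)) * H * L * ((b - a) powr (\<theta> + \<theta>) * (2 powr (1 - (\<theta> + \<theta>))) ^ n)) \<longlonglongrightarrow>
     (1 + young_const (\<theta> + \<theta>)) * H * L * ((b - a) powr (\<theta> + \<theta>) * 0)"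
    using th by (intro tendsto_intros LIMSEQ_power_zero) (simp add: powr_less_one)
  moreover have "2 ^ n * ((b - a) / 2 ^ n) powr (\<theta> + \<theta>) = (b - a) powr (\<theta> + \<theta>) * (2 powr (1 - (\<theta> + \<theta>))) ^ n" for n
  proof -
    have "2 ^ n * ((b - a) / 2 ^ n) powr (\<theta> + \<theta>) = 2 ^ n * ((b - a) powr (\<theta> + \<theta>) / ((2 ^ n) powr (\<theta> + \<theta>)))"
      using assms by (simp add: powr_divide)
    also have "(2 ^ n) powr (\<theta> + \<theta>) = (2::real) powr (real n * (\<theta> + \<theta>))"
      by (simp add: powr_realpow[symmetric] powr_powr)
    also have "2 ^ n * ((b - a) powr (\<theta> + \<theta>) / 2 powr (real n * (\<theta> + \<theta>)))
       = (b - a) powr (\<theta> + \<theta>) * (2 powr real n / 2 powr (real n * (\<theta> + \<theta>)))"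
      by (simp add: powr_realpow)
    also have "2 powr real n / 2 powr (real n * (\<theta> + \<theta>)) = (2 powr (1 - (\<theta> + \<theta>)) :: real) powr real n"
      by (simp add: powr_diff[symmetric] powr_powr algebra_simps)
    also have "\<dots> = (2 powr (1 - (\<theta> + \<theta>))) ^ n" by (simp add: powr_realpow)
    finally show ?thesis .
  qed
  ultimately have lim: "(\<lambda>n. (1 + young_const (\<theta> + \<theta>)) * H * L * (2 ^ n * ((b - a) / 2 ^ n) powr (\<theta> + \<theta>))) \<longlonglongrightarrow> 0"
    by simp
  have "(\<lambda>n. haar_sum f g n a b - young_integral f g a b) \<longlonglongrightarrow> 0"
    by (rule Lim_null_comparison[OF _ lim]) (use haar_sum_close[OF f g th] assms in auto)
  thus ?thesis by (simp add: LIM_zero_iff)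
qed

text \<open>Each pair \<open>s < t\<close> is separated at exactly one dyadic level, and there the kernel \<open>(t - s)\<close> is
  at most the length of the cell.\<close>

lemma haar_sum_bound:
  assumes f: "holder_on a b \<theta> H f" and g: "holder_on a b (1 - \<alpha>) L g" and th: "\<theta> > 0" and al: "0 < \<alpha>" "\<alpha> < 1"
    and int: "\<And>t. a \<le> t \<Longrightarrow> t \<le> b \<Longrightarrow> (\<lambda>s. \<bar>f t - f s\<bar> / (t - s) powr (1 + \<alpha>)) integrable_on {a..t}"
    and "a \<le> p" "p < q" "q \<le> b"
  shows "\<exists>\<psi> I. (\<psi> has_integral I) {p..q} \<and> \<bar>haar_sum f g n p q - haar_sum f g 0 p q\<bar> \<le> 2 powr (1 + \<alpha>) * L * I \<and>
     (\<forall>t\<in>{p..q}. \<psi> t \<le> integral {p..t} (\<lambda>s. \<bar>f t - f s\<bar> / (t - s) powr (1 + \<alpha>)))"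
  using assms(7-9)
proof (induction n arbitrary: p q)
  case 0
  have "0 \<le> integral {p..t} (\<lambda>s. \<bar>f t - f s\<bar> / (t - s) powr (1 + \<alpha>))" for t
    by (cases "(\<lambda>s. \<bar>f t - f s\<bar> / (t - s) powr (1 + \<alpha>)) integrable_on {p..t}")
      (auto intro!: integral_nonneg simp: not_integrable_integral)
  hence "((\<lambda>_. 0) has_integral 0) {p..q} \<and> \<bar>haar_sum f g 0 p q - haar_sum f g 0 p q\<bar> \<le> 2 powr (1 + \<alpha>) * L * 0 \<and>
     (\<forall>t\<in>{p..q}. 0 \<le> integral {p..t} (\<lambda>s. \<bar>f t - f s\<bar> / (t - s) powr (1 + \<alpha>)))" by simp
  thus ?case by blast
next
  case (Suc n)
  define m where "m = (p + q) / 2"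
  define h where "h = q - p"
  have m: "a \<le> p" "p < m" "m < q" "q \<le> b" "m \<le> b" "a \<le> m" "h > 0" "m - p = h / 2" "q - m = h / 2"
    using Suc.prems by (auto simp: m_def h_def field_simps)
  have L0: "L \<ge> 0" using g holder_on_nonneg by blast
  obtain \<psi>1 I1 where 1: "(\<psi>1 has_integral I1) {p..m}"
    "\<bar>haar_sum f g n p m - haar_sum f g 0 p m\<bar> \<le> 2 powr (1 + \<alpha>) * L * I1"
    "\<And>t. t \<in> {p..m} \<Longrightarrow> \<psi>1 t \<le> integral {p..t} (\<lambda>s. \<bar>f t - f s\<bar> / (t - s) powr (1 + \<alpha>))"
    using Suc.IH[of p m] m by auto
  obtain \<psi>2 I2 where 2: "(\<psi>2 has_integral I2) {m..q}"
    "\<bar>haar_sum f g n m q - haar_sum f g 0 m q\<bar> \<le> 2 powr (1 + \<alpha>) * L * I2"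
    "\<And>t. t \<in> {m..q} \<Longrightarrow> \<psi>2 t \<le> integral {m..t} (\<lambda>s. \<bar>f t - f s\<bar> / (t - s) powr (1 + \<alpha>))"
    using Suc.IH[of m q] m by auto
  have fc: "continuous_on {a..b} f" using holder_on_continuous_on[OF f th] .
  define D where "D = (\<lambda>t. integral {p..m} (\<lambda>s. \<bar>f t - f s\<bar>))"
  have Dc: "continuous_on {m..q} D"
  proof -
    have "continuous_on {m..q} (\<lambda>t. integral (cbox p m) (\<lambda>s. \<bar>f t - f s\<bar>))"
    proof (rule integral_continuous_on_param)
      have A: "continuous_on ({m..q} \<times> cbox p m) (\<lambda>z. f (fst z))"
        by (rule continuous_on_compose2[OF fc continuous_on_fst[OF continuous_on_id]]) (use m in auto)
      have B: "continuous_on ({m..q} \<times> cbox p m) (\<lambda>z. f (snd z))"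
        by (rule continuous_on_compose2[OF fc continuous_on_snd[OF continuous_on_id]]) (use m in auto)
      show "continuous_on ({m..q} \<times> cbox p m) (\<lambda>(t, s). \<bar>f t - f s\<bar>)"
        unfolding split_def by (intro continuous_intros A B)
    qed
    thus ?thesis by (simp add: D_def)
  qed
  define I3 where "I3 = integral {m..q} (\<lambda>t. D t / h powr (1 + \<alpha>))"
  have D3: "((\<lambda>t. D t / h powr (1 + \<alpha>)) has_integral I3) {m..q}"
    unfolding I3_def using Dc m
    by (intro integrable_integral integrable_continuous_interval continuous_intros) auto
  have 23: "((\<lambda>t. \<psi>2 t + D t / h powr (1 + \<alpha>)) has_integral (I2 + I3)) {m..q}"
    by (rule has_integral_add[OF 2(1) D3])
  \<comment> \<open>The integrable minorant \<psi> stands in for the inner kernel integral. Working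
    below it spares a proof that this integral depends measurably on t.\<close>
  define \<psi> where "\<psi> = (\<lambda>t. if t \<le> m then \<psi>1 t else \<psi>2 t + D t / h powr (1 + \<alpha>))"
  have a: "(\<psi> has_integral I1) {p..m}"
    by (rule has_integral_eq[OF _ 1(1)]) (auto simp: \<psi>_def)
  have b: "(\<psi> has_integral (I2 + I3)) {m..q}"
    by (rule has_integral_spike_finite[OF _ _ 23, of "{m}"]) (auto simp: \<psi>_def)
  have c: "(\<psi> has_integral (I1 + (I2 + I3))) {p..q}"
    by (rule has_integral_combine[OF _ _ a b]) (use m in auto)
  have fi: "f integrable_on {u..v}" if "a \<le> u" "v \<le> b" for u v
    using continuous_on_subset[OF fc, of "{u..v}"] that by (intro integrable_continuous_interval) auto
  define Al where "Al = integral {p..m} f / (m - p)"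
  define Ar where "Ar = integral {m..q} f / (q - m)"
  have Ap: "integral {p..q} f / (q - p) = (Al + Ar) / 2"
  proof -
    have "integral {p..q} f = integral {p..m} f + integral {m..q} f"
      using m fi[of p q] by (intro Henstock_Kurzweil_Integration.integral_combine[symmetric]) auto
    thus ?thesis unfolding Al_def Ar_def m(8,9) h_def[symmetric] by (simp add: add_divide_distrib)
  qed
  have Al': "integral {p..m} f = h / 2 * Al" and Ar': "integral {m..q} f = h / 2 * Ar"
    using m(7) unfolding Al_def Ar_def m(8,9) by simp_all
  \<comment> \<open>The mean over the parent cell is the average of the means over its halves, so a
    splitting changes the sum only by the difference of these two means.\<close>
  have step: "haar_sum f g 0 p m + haar_sum f g 0 m q - haar_sum f g 0 p q
      = (Al - Ar) / 2 * (g m - g p) + (Ar - Al) / 2 * (g q - g m)"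
    unfolding haar_sum.simps Ap Al_def[symmetric] Ar_def[symmetric] by (simp add: field_simps)
  have AA: "\<bar>Ar - Al\<bar> \<le> 4 / h\<^sup>2 * integral {m..q} D"
  proof -
    have ft: "\<bar>f t - Al\<bar> \<le> 2 / h * D t" if "t \<in> {m..q}" for t
    proof -
      have abs_int: "(\<lambda>s. \<bar>f t - f s\<bar>) integrable_on {p..m}"
        using continuous_on_subset[OF fc, of "{p..m}"] m
        by (intro integrable_continuous_interval continuous_intros) auto
      have "f t - Al = 2 / h * integral {p..m} (\<lambda>s. f t - f s)"
        using fi[of p m] m(1,2,5,7) by (subst integral_diff) (auto simp: Al' m(8) algebra_simps)
      moreover have "norm (integral {p..m} (\<lambda>s. f t - f s)) \<le> D t"
        unfolding D_def using fi[of p m] m abs_int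
        by (intro integral_norm_bound_integral integrable_diff) auto
      ultimately show ?thesis using m by (simp add: abs_mult mult_left_mono divide_right_mono)
    qed
    have "Ar - Al = 2 / h * integral {m..q} (\<lambda>t. f t - Al)"
      using fi[of m q] m(3,4,6,7) by (subst integral_diff) (auto simp: Ar' m(9) algebra_simps)
    moreover have "norm (integral {m..q} (\<lambda>t. f t - Al)) \<le> integral {m..q} (\<lambda>t. 2 / h * D t)"
      using m ft Dc continuous_on_subset[OF fc, of "{m..q}"]
      by (intro integral_norm_bound_integral integrable_continuous_interval continuous_intros) auto
    ultimately have "\<bar>Ar - Al\<bar> = 2 / h * \<bar>integral {m..q} (\<lambda>t. f t - Al)\<bar>"
      and "\<bar>integral {m..q} (\<lambda>t. f t - Al)\<bar> \<le> 2 / h * integral {m..q} D"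
      using m(7) by (simp_all add: abs_mult)
    hence "\<bar>Ar - Al\<bar> \<le> 2 / h * (2 / h * integral {m..q} D)"
      using m(7) by (metis mult_left_mono zero_le_divide_iff zero_le_numeral less_imp_le)
    thus ?thesis by (simp add: power2_eq_square)
  qed
  have I3: "I3 = integral {m..q} D / h powr (1 + \<alpha>)" by (simp add: I3_def)
  have gl: "\<bar>g m - g p\<bar> \<le> L * (h / 2) powr (1 - \<alpha>)" "\<bar>g q - g m\<bar> \<le> L * (h / 2) powr (1 - \<alpha>)"
    using holder_onD[OF g, of p m] holder_onD[OF g, of m q] m by auto
  have "\<bar>haar_sum f g 0 p m + haar_sum f g 0 m q - haar_sum f g 0 p q\<bar>
     \<le> \<bar>Al - Ar\<bar> / 2 * (L * (h / 2) powr (1 - \<alpha>)) + \<bar>Ar - Al\<bar> / 2 * (L * (h / 2) powr (1 - \<alpha>))"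
    unfolding step using gl by (intro order_trans[OF abs_triangle_ineq] add_mono) (auto simp: abs_mult intro!: mult_left_mono)
  also have "\<dots> = \<bar>Ar - Al\<bar> * (L * (h / 2) powr (1 - \<alpha>))" by (simp add: abs_minus_commute)
  also have "\<dots> \<le> 4 / h\<^sup>2 * integral {m..q} D * (L * (h / 2) powr (1 - \<alpha>))"
    using L0 by (intro mult_right_mono AA) auto
  also have "\<dots> = 2 powr (1 + \<alpha>) * L * I3"
  proof -
    \<comment> \<open>The scaling balance: h ^ 2 from the means against
      \<open>h powr (1 - \<alpha>)\<close> from the increment of g leaves
      \<open>h powr (1 + \<alpha>)\<close>, the exponent of the kernel.\<close>
    have "(h / 2) powr (1 - \<alpha>) * h powr (1 + \<alpha>) * 4 = h powr 2 * (2 powr (1 + \<alpha>))"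
    proof -
      have "(h / 2) powr (1 - \<alpha>) = h powr (1 - \<alpha>) / 2 powr (1 - \<alpha>)" using m by (simp add: powr_divide)
      moreover have "h powr (1 - \<alpha>) * h powr (1 + \<alpha>) = h powr 2" by (simp add: powr_add[symmetric])
      moreover have "4 / 2 powr (1 - \<alpha>) = 2 powr (1 + \<alpha>)"
      proof -
        have "2 powr (1 + \<alpha>) * 2 powr (1 - \<alpha>) = (2::real) powr 2" by (simp add: powr_add[symmetric])
        hence "2 powr (1 + \<alpha>) * 2 powr (1 - \<alpha>) = (4::real)" by simp
        thus ?thesis by (simp add: field_simps)
      qed
      ultimately show ?thesis by (metis (no_types, opaque_lifting) mult.assoc mult.commute times_divide_eq_right)
    qed
    moreover have "h powr 2 = h\<^sup>2" using m by simp
    ultimately have "4 / h\<^sup>2 * (h / 2) powr (1 - \<alpha>) = 2 powr (1 + \<alpha>) / h powr (1 + \<alpha>)"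
      using m by (simp add: divide_simps mult_ac)
    note E = this
    have "4 / h\<^sup>2 * integral {m..q} D * (L * (h / 2) powr (1 - \<alpha>))
       = (4 / h\<^sup>2 * (h / 2) powr (1 - \<alpha>)) * (L * integral {m..q} D)" by (simp only: mult_ac)
    also have "\<dots> = 2 powr (1 + \<alpha>) * L * I3" unfolding E I3 by simp
    finally show ?thesis .
  qed
  finally have 3: "\<bar>haar_sum f g 0 p m + haar_sum f g 0 m q - haar_sum f g 0 p q\<bar> \<le> 2 powr (1 + \<alpha>) * L * I3" .
  have d: "\<bar>haar_sum f g (Suc n) p q - haar_sum f g 0 p q\<bar> \<le> 2 powr (1 + \<alpha>) * L * (I1 + (I2 + I3))"
    using 1(2) 2(2) 3 unfolding haar_sum.simps(2) m_def[symmetric] distrib_left by linarith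
  have e: "\<psi> t \<le> integral {p..t} (\<lambda>s. \<bar>f t - f s\<bar> / (t - s) powr (1 + \<alpha>))" if t: "t \<in> {p..q}" for t
  proof (cases "t \<le> m")
    case True
    thus ?thesis using 1(3)[of t] t by (simp add: \<psi>_def)
  next
    case False
    let ?k = "\<lambda>s. \<bar>f t - f s\<bar> / (t - s) powr (1 + \<alpha>)"
    have ki: "?k integrable_on {p..t}"
      by (rule integrable_subinterval_real[OF int[of t]]) (use t m in auto)
    have "integral {p..t} ?k = integral {p..m} ?k + integral {m..t} ?k"
      using False m t ki by (intro Henstock_Kurzweil_Integration.integral_combine[symmetric]) auto
    moreover have "D t / h powr (1 + \<alpha>) \<le> integral {p..m} ?k"
    proof -
      have "D t / h powr (1 + \<alpha>) = integral {p..m} (\<lambda>s. \<bar>f t - f s\<bar> / h powr (1 + \<alpha>))"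
        by (simp add: D_def)
      also have "\<dots> \<le> integral {p..m} ?k"
      proof (rule integral_le)
        show "(\<lambda>s. \<bar>f t - f s\<bar> / h powr (1 + \<alpha>)) integrable_on {p..m}"
          using continuous_on_subset[OF fc, of "{p..m}"] m
          by (intro integrable_continuous_interval continuous_intros) auto
        show "?k integrable_on {p..m}" by (rule integrable_subinterval_real[OF ki]) (use False in auto)
        fix s assume s: "s \<in> {p..m}"
        show "\<bar>f t - f s\<bar> / h powr (1 + \<alpha>) \<le> ?k s"
          using s False t m al by (intro divide_left_mono powr_mono2 mult_pos_pos) (auto simp: h_def)
      qed
      finally show ?thesis .
    qed
    ultimately show ?thesis using 2(3)[of t] t False by (simp add: \<psi>_def)
  qed
  show ?case using c d e by blast
qed

text \<open>In the bound, f enters through its size and its kernel integral rather than through its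
  Hoelder constant. Applied to a component of the driving path this gives one factor
  \<open>path_norm\<close> where a Young estimate would give a second Hoelder constant.\<close>

lemma young_integral_sobolev_bound:
  assumes ab: "a < b" and al: "0 < \<alpha>" "\<alpha> < 1/2"
    and f: "holder_on a b (1 - \<alpha>) H f" and g: "holder_on a b (1 - \<alpha>) L g"
    and int: "\<And>t. a \<le> t \<Longrightarrow> t \<le> b \<Longrightarrow> (\<lambda>s. \<bar>f t - f s\<bar> / (t - s) powr (1 + \<alpha>)) integrable_on {a..t}"
    and bd: "\<And>t. a \<le> t \<Longrightarrow> t \<le> b \<Longrightarrow> integral {a..t} (\<lambda>s. \<bar>f t - f s\<bar> / (t - s) powr (1 + \<alpha>)) \<le> \<Phi>"
    and B: "\<And>t. a \<le> t \<Longrightarrow> t \<le> b \<Longrightarrow> \<bar>f t\<bar> \<le> B"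
  shows "\<bar>young_integral f g a b\<bar> \<le> L * (b - a) powr (1 - \<alpha>) * B + 2 powr (1 + \<alpha>) * L * ((b - a) * \<Phi>)"
proof -
  have L0: "L \<ge> 0" using g holder_on_nonneg by blast
  have th: "1 - \<alpha> > 1/2" using al by simp
  have fc: "continuous_on {a..b} f" using holder_on_continuous_on[OF f] al by simp
  have av: "\<bar>integral {a..b} f / (b - a) - 0\<bar> \<le> B"
    by (rule integral_average_close[OF ab fc]) (use B in auto)
  have "\<bar>haar_sum f g 0 a b\<bar> \<le> B * (L * (b - a) powr (1 - \<alpha>))"
    (is "?h \<le> _")
    unfolding haar_sum.simps abs_mult
  proof (rule mult_mono)
    show "0 \<le> B" using B[of a] ab by auto
  qed (use av holder_onD[OF g, of a b] ab in auto)
  hence first: "?h \<le> L * (b - a) powr (1 - \<alpha>) * B" by (simp only: mult.commute)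
  have rest: "\<bar>haar_sum f g n a b - haar_sum f g 0 a b\<bar> \<le> 2 powr (1 + \<alpha>) * L * ((b - a) * \<Phi>)" for n
  proof -
    obtain \<psi> I where I: "(\<psi> has_integral I) {a..b}" "\<bar>haar_sum f g n a b - haar_sum f g 0 a b\<bar> \<le> 2 powr (1 + \<alpha>) * L * I"
       "\<And>t. t\<in>{a..b} \<Longrightarrow> \<psi> t \<le> integral {a..t} (\<lambda>s. \<bar>f t - f s\<bar> / (t - s) powr (1 + \<alpha>))"
      using haar_sum_bound[OF f g _ _ _ int, of a b n] al ab by auto
    have "((\<lambda>t. \<Phi>) has_integral ((b - a) * \<Phi>)) {a..b}" using has_integral_const_real[of \<Phi> a b] ab by simp
    hence "I \<le> (b - a) * \<Phi>"
      by (rule has_integral_le[OF I(1)]) (use I(3) bd in force)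
    hence "2 powr (1 + \<alpha>) * L * I \<le> 2 powr (1 + \<alpha>) * L * ((b - a) * \<Phi>)"
      using L0 by (intro mult_left_mono) auto
    thus ?thesis using I(2) by linarith
  qed
  have "\<bar>haar_sum f g n a b\<bar> \<le> L * (b - a) powr (1 - \<alpha>) * B + 2 powr (1 + \<alpha>) * L * ((b - a) * \<Phi>)" for n
    using first rest[of n] by linarith
  moreover have "(\<lambda>n. \<bar>haar_sum f g n a b\<bar>) \<longlonglongrightarrow> \<bar>young_integral f g a b\<bar>"
    by (intro tendsto_rabs haar_sum_limit[OF f g th ab])
  ultimately show ?thesis by (intro LIMSEQ_le_const2) auto
qed

text \<open>The bound on the bracket of the Weyl derivative is one-sided, so that the principle can
  be applied to a function and to its negative.\<close>

lemma fractional_maximum_principle: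
  fixes \<phi> :: "real \<Rightarrow> real"
  assumes "s < t" and c: "continuous_on {s..t} \<phi>" and "\<phi> t = 0" and th: "0 < \<theta>" and Q: "Q \<ge> 0"
    and bd: "\<And>x. s \<le> x \<Longrightarrow> x < t \<Longrightarrow>
      \<phi> x / (t - x) powr \<theta> + \<theta> * integral {x..t} (\<lambda>u. (\<phi> x - \<phi> u) / (u - x) powr (\<theta> + 1)) \<le> Q"
  shows "\<phi> s \<le> Q * (t - s) powr \<theta>"
proof -
  obtain x where x: "x \<in> {s..t}" "\<And>u. u \<in> {s..t} \<Longrightarrow> \<phi> u \<le> \<phi> x"
    using continuous_attains_sup[OF compact_Icc _ c] assms(1) by auto
  show ?thesis
  proof (cases "x = t")
    case True
    hence "\<phi> s \<le> 0" using x(2)[of s] assms by simp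
    moreover have "0 \<le> Q * (t - s) powr \<theta>" using Q by simp
    ultimately show ?thesis by linarith
  next
    case False
    hence xt: "x < t" "s \<le> x" using x by auto
    have "0 \<le> integral {x..t} (\<lambda>u. (\<phi> x - \<phi> u) / (u - x) powr (\<theta> + 1))"
    \<comment> \<open>For a non-integrable integrand \<open>integral\<close> has the default value
      0, and the sign is still right.\<close>
    proof (cases "(\<lambda>u. (\<phi> x - \<phi> u) / (u - x) powr (\<theta> + 1)) integrable_on {x..t}")
      case True
      thus ?thesis using x xt by (intro integral_nonneg) auto
    qed (simp add: not_integrable_integral)
    hence "\<phi> x / (t - x) powr \<theta> \<le> Q" using bd[of x] xt th
      by (smt (verit, ccfv_SIG) mult_nonneg_nonneg)
    hence "\<phi> x \<le> Q * (t - x) powr \<theta>" using xt by (simp add: divide_le_eq)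
    also have "\<dots> \<le> Q * (t - s) powr \<theta>" using xt Q th by (intro mult_left_mono powr_mono2) auto
    finally show ?thesis using x(2)[of s] assms by auto
  qed
qed

section \<open>The driving path\<close>

lemma abs_component_le_L2_set:
  assumes "finite A" "i \<in> A"
  shows "\<bar>f i\<bar> \<le> L2_set f A"
proof -
  have "(f i)\<^sup>2 \<le> (\<Sum>j\<in>A. (f j)\<^sup>2)" using assms by (intro member_le_sum) auto
  thus ?thesis unfolding L2_set_def by (metis real_sqrt_abs real_sqrt_le_iff)
qed

lemma abs_component_le_enorm: "j < n \<Longrightarrow> \<bar>x j\<bar> \<le> enorm n x"
  unfolding enorm_def by (rule abs_component_le_L2_set) auto

lemma abs_component_le_edist: "j < n \<Longrightarrow> \<bar>x j - z j\<bar> \<le> edist n x z"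
  unfolding edist_def by (rule abs_component_le_enorm)

lemma enorm_nonneg [simp]: "0 \<le> enorm n x"
  by (simp add: enorm_def)

lemma edist_nonneg [simp]: "0 \<le> edist n x z"
  by (simp add: edist_def)

lemma enorm_le_sum: "enorm n x \<le> (\<Sum>j<n. \<bar>x j\<bar>)"
  unfolding enorm_def by (rule L2_set_le_sum_abs)

text \<open>The power of -1 has modulus one, so only a real bracket remains; real-variable arguments
  apply from here on.\<close>

lemma cmod_weyl_deriv_right:
  assumes "0 < \<theta>" "\<theta> < 1"
  shows "cmod (weyl_deriv_right \<theta> b f x) =
    \<bar>f x / (b - x) powr \<theta> + \<theta> * integral {x..b} (\<lambda>u. (f x - f u) / (u - x) powr (\<theta> + 1))\<bar> / Gamma (1 - \<theta>)"
proof -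
  have "cmod ((- 1) powr complex_of_real \<theta>) = 1"
    by (simp add: powr_def)
  moreover have "Gamma (1 - \<theta>) > 0" using assms by simp
  ultimately show ?thesis
    unfolding weyl_deriv_right_def norm_mult norm_divide norm_of_real by simp
qed

locale holder_driver =
  fixes d :: nat and \<alpha> \<beta> :: real and y :: "real \<Rightarrow> nat \<Rightarrow> real"
  assumes al_half: "\<alpha> < 1/2" and be_half: "1/2 < \<beta>" and be_one: "\<beta> \<le> 1" and be_al: "1 - \<beta> < \<alpha>"
    and holder: "holder_path (Suc d) \<beta> y"
begin

lemma al_pos: "\<alpha> > 0"
  using be_one be_al by simp

text \<open>A Hoelder constant of order \<beta> on [0, T]. It serves qualitative facts such as
  finite suprema and integrability, and never enters the final constant.\<close>

definition holder_bound :: "real \<Rightarrow> real" where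
  "holder_bound T = (SOME A. 0 \<le> A \<and> (\<forall>s\<in>{0..T}. \<forall>t\<in>{0..T}. edist (Suc d) (y s) (y t) \<le> A * \<bar>s - t\<bar> powr \<beta>))"

lemma holder_bound:
  assumes "T \<ge> 0"
  shows "0 \<le> holder_bound T"
    and "\<And>s t. 0 \<le> s \<Longrightarrow> s \<le> T \<Longrightarrow> 0 \<le> t \<Longrightarrow> t \<le> T \<Longrightarrow> edist (Suc d) (y s) (y t) \<le> holder_bound T * \<bar>s - t\<bar> powr \<beta>"
proof -
  obtain A where A: "\<And>s t. s \<in> {0..T} \<Longrightarrow> t \<in> {0..T} \<Longrightarrow> edist (Suc d) (y s) (y t) \<le> A * \<bar>s - t\<bar> powr \<beta>"
    using holder assms unfolding holder_path_def by metis
  have "0 \<le> max A 0 \<and> (\<forall>s\<in>{0..T}. \<forall>t\<in>{0..T}. edist (Suc d) (y s) (y t) \<le> max A 0 * \<bar>s - t\<bar> powr \<beta>)"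
  proof (intro conjI ballI)
    fix s t assume st: "s \<in> {0..T}" "t \<in> {0..T}"
    have "A * \<bar>s - t\<bar> powr \<beta> \<le> max A 0 * \<bar>s - t\<bar> powr \<beta>" by (intro mult_right_mono) auto
    thus "edist (Suc d) (y s) (y t) \<le> max A 0 * \<bar>s - t\<bar> powr \<beta>" using A[OF st] by linarith
  qed simp
  hence *: "0 \<le> holder_bound T \<and> (\<forall>s\<in>{0..T}. \<forall>t\<in>{0..T}. edist (Suc d) (y s) (y t) \<le> holder_bound T * \<bar>s - t\<bar> powr \<beta>)"
    unfolding holder_bound_def by (rule someI)
  show "0 \<le> holder_bound T" using * by simp
  show "\<And>s t. 0 \<le> s \<Longrightarrow> s \<le> T \<Longrightarrow> 0 \<le> t \<Longrightarrow> t \<le> T \<Longrightarrow> edist (Suc d) (y s) (y t) \<le> holder_bound T * \<bar>s - t\<bar> powr \<beta>"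
    using * by simp
qed

lemma holder_on_driver: "T \<ge> 0 \<Longrightarrow> i \<le> d \<Longrightarrow> holder_on 0 T \<beta> (holder_bound T) (\<lambda>s. y s i)"
proof (rule holder_onI)
  assume T: "T \<ge> 0" and i: "i \<le> d"
  show "0 \<le> holder_bound T" by (rule holder_bound[OF T])
  fix u v assume uv: "0 \<le> u" "u \<le> v" "v \<le> T"
  have "\<bar>y v i - y u i\<bar> \<le> edist (Suc d) (y v) (y u)" by (rule abs_component_le_edist) (use i in simp)
  also have "\<dots> \<le> holder_bound T * \<bar>v - u\<bar> powr \<beta>" by (rule holder_bound[OF T]) (use uv in auto)
  finally show "\<bar>y v i - y u i\<bar> \<le> holder_bound T * (v - u) powr \<beta>" using uv by simp
qed

lemma continuous_driver: "T \<ge> 0 \<Longrightarrow> i \<le> d \<Longrightarrow> continuous_on {0..T} (\<lambda>s. y s i)"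
  using holder_on_continuous_on[OF holder_on_driver] be_half by simp

text \<open>A supremum of reals bounds its members only when it is finite. Finiteness holds since
  \<beta> > 1 - \<alpha>: the positive surplus p = \<beta> - (1 - \<alpha>) makes the singularity of
  the Weyl derivative integrable.\<close>

lemma Lambda_bdd_above:
  assumes T: "T > 0"
  shows "bdd_above ((\<lambda>(s, t). L2_set (\<lambda>i. cmod (weyl_deriv_right (1 - \<alpha>) t (\<lambda>u. y u i - y t i) s)) {..d})
     ` {(s, t). 0 < s \<and> s < t \<and> t < T})"
proof -
  define A where "A = holder_bound T"
  have A0: "A \<ge> 0" using holder_bound T by (simp add: A_def)
  define \<theta> where "\<theta> = 1 - \<alpha>"
  define p where "p = \<beta> - \<theta>"
  have th: "0 < \<theta>" "\<theta> < 1" and p: "p > 0" using al_half al_pos be_al by (auto simp: \<theta>_def p_def)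
  define B where "B = (A * T powr p + \<theta> * (A * (T powr p / p))) / Gamma \<alpha>"
  have G: "Gamma \<alpha> > 0" using al_pos by simp
  have "L2_set (\<lambda>i. cmod (weyl_deriv_right \<theta> t (\<lambda>u. y u i - y t i) s)) {..d} \<le> (\<Sum>i\<le>d. B)"
    if st: "0 < s" "s < t" "t < T" for s t
  proof -
    have one: "cmod (weyl_deriv_right \<theta> t (\<lambda>u. y u i - y t i) s) \<le> B" if i: "i \<le> d" for i
    proof -
      have hd: "holder_on 0 T \<beta> A (\<lambda>s. y s i)" unfolding A_def using holder_on_driver T i by simp
      define I where "I = integral {s..t} (\<lambda>u. (y s i - y u i) / (u - s) powr (\<theta> + 1))"
      have gi: "((\<lambda>u. A * (u - s) powr (p - 1)) has_integral A * ((t - s) powr p / p)) {s..t}"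
        using st p by (intro has_integral_mult_right has_integral_powr_singular_left) auto
      have pm: "(t - s) powr p \<le> T powr p" using st p by (intro powr_mono2) auto
      have I: "\<bar>I\<bar> \<le> A * (T powr p / p)"
      proof (cases "(\<lambda>u. (y s i - y u i) / (u - s) powr (\<theta> + 1)) integrable_on {s..t}")
        case True
        have "norm I \<le> integral {s..t} (\<lambda>u. A * (u - s) powr (p - 1))"
          unfolding I_def
        proof (rule integral_norm_bound_integral[OF True has_integral_integrable[OF gi]])
          fix u assume u: "u \<in> {s..t}"
          show "norm ((y s i - y u i) / (u - s) powr (\<theta> + 1)) \<le> A * (u - s) powr (p - 1)"
          proof (cases "u = s")
            case False
            have "norm ((y s i - y u i) / (u - s) powr (\<theta> + 1)) = \<bar>y u i - y s i\<bar> / (u - s) powr (\<theta> + 1)"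
              by (simp add: abs_minus_commute)
            also have "\<dots> \<le> (A * (u - s) powr \<beta>) / (u - s) powr (\<theta> + 1)"
              using holder_onD[OF hd, of s u] u st by (intro divide_right_mono) auto
            also have "\<dots> = A * (u - s) powr (\<beta> - (\<theta> + 1))" by (simp add: powr_diff)
            finally show ?thesis by (simp add: p_def algebra_simps)
          qed (use A0 in simp)
        qed
        also have "\<dots> = A * ((t - s) powr p / p)" by (rule integral_unique[OF gi])
        also have "\<dots> \<le> A * (T powr p / p)" using pm A0 p by (intro mult_left_mono divide_right_mono) auto
        finally show ?thesis by simp
      next
        case False
        hence "I = 0" unfolding I_def by (rule not_integrable_integral)
        thus ?thesis using A0 p by simp
      qed
      have "\<bar>(y s i - y t i) / (t - s) powr \<theta>\<bar> = \<bar>y t i - y s i\<bar> / (t - s) powr \<theta>"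
        by (simp add: abs_minus_commute)
      also have "\<dots> \<le> (A * (t - s) powr \<beta>) / (t - s) powr \<theta>"
        using holder_onD[OF hd, of s t] st by (intro divide_right_mono) auto
      also have "\<dots> = A * (t - s) powr p" by (simp add: p_def powr_diff)
      also have "\<dots> \<le> A * T powr p" using pm A0 by (intro mult_left_mono) auto
      finally have J: "\<bar>(y s i - y t i) / (t - s) powr \<theta>\<bar> \<le> A * T powr p" .
      have "\<bar>\<theta> * I\<bar> \<le> \<theta> * (A * (T powr p / p))"
        unfolding abs_mult using mult_left_mono[OF I, of \<theta>] th by simp
      hence "\<bar>(y s i - y t i) / (t - s) powr \<theta> + \<theta> * I\<bar> \<le> A * T powr p + \<theta> * (A * (T powr p / p))"
        using J by linarith
      thus ?thesis unfolding cmod_weyl_deriv_right[OF th] B_def I_def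
        using G by (simp add: \<theta>_def divide_right_mono)
    qed
    have "L2_set (\<lambda>i. cmod (weyl_deriv_right \<theta> t (\<lambda>u. y u i - y t i) s)) {..d}
       \<le> (\<Sum>i\<le>d. cmod (weyl_deriv_right \<theta> t (\<lambda>u. y u i - y t i) s))"
      by (rule L2_set_le_sum) simp
    also have "\<dots> \<le> (\<Sum>i\<le>d. B)" by (rule sum_mono) (use one in auto)
    finally show ?thesis .
  qed
  thus ?thesis unfolding \<theta>_def[symmetric] by (intro bdd_aboveI[of _ "\<Sum>i\<le>d. B"]) auto
qed

definition \<Lambda> :: "real \<Rightarrow> real" where "\<Lambda> T = Lambda_const d \<alpha> T y"

text \<open>\<open>Gamma \<alpha>\<close> undoes the normalisation of the Weyl derivative of order 1
  - \<alpha>, and \<open>Gamma (1 - \<alpha>)\<close> that of \<open>Lambda_const\<close>.\<close>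

definition holder_factor :: real where "holder_factor = Gamma \<alpha> * Gamma (1 - \<alpha>)"

lemma holder_factor_pos: "holder_factor > 0"
  unfolding holder_factor_def using al_pos al_half by simp

lemma weyl_component_le_Lambda:
  assumes "i \<le> d" "0 < s" "s < t" "t < T"
  shows "cmod (weyl_deriv_right (1 - \<alpha>) t (\<lambda>u. y u i - y t i) s) \<le> Gamma (1 - \<alpha>) * \<Lambda> T"
proof -
  have "cmod (weyl_deriv_right (1 - \<alpha>) t (\<lambda>u. y u i - y t i) s)
     \<le> L2_set (\<lambda>i. cmod (weyl_deriv_right (1 - \<alpha>) t (\<lambda>u. y u i - y t i) s)) {..d}"
    using abs_component_le_L2_set[of "{..d}" i "\<lambda>i. cmod (weyl_deriv_right (1 - \<alpha>) t (\<lambda>u. y u i - y t i) s)"] assms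
    by simp
  also have "\<dots> \<le> (SUP (s, t) \<in> {(s, t). 0 < s \<and> s < t \<and> t < T}.
         L2_set (\<lambda>i. cmod (weyl_deriv_right (1 - \<alpha>) t (\<lambda>u. y u i - y t i) s)) {..d})"
    using cSUP_upper[OF _ Lambda_bdd_above[of T], of "(s, t)"] assms by auto
  also have "\<dots> = Gamma (1 - \<alpha>) * \<Lambda> T"
  proof -
    have "Gamma (1 - \<alpha>) > 0" using al_half by simp
    thus ?thesis using assms by (simp add: \<Lambda>_def Lambda_const_def)
  qed
  finally show ?thesis .
qed

lemma Lambda_nonneg: "T \<ge> 0 \<Longrightarrow> \<Lambda> T \<ge> 0"
proof (cases "T = 0")
  case False
  assume "T \<ge> 0"
  hence "0 \<le> Gamma (1 - \<alpha>) * \<Lambda> T"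
    using weyl_component_le_Lambda[of 0 "T / 3" "T / 2" T] False by (auto intro: order_trans[OF norm_ge_zero])
  moreover have "Gamma (1 - \<alpha>) > 0" using al_half by simp
  ultimately show ?thesis by (simp add: zero_le_mult_iff)
qed (simp add: \<Lambda>_def Lambda_const_def)

lemma holder_on_driver_Lambda:
  assumes T: "T > 0" and i: "i \<le> d"
  shows "holder_on 0 T (1 - \<alpha>) (holder_factor * \<Lambda> T) (\<lambda>s. y s i)"
proof (rule holder_onI)
  define \<theta> where "\<theta> = 1 - \<alpha>"
  have th: "0 < \<theta>" "\<theta> < 1" using al_half al_pos by (auto simp: \<theta>_def)
  define Q where "Q = holder_factor * \<Lambda> T"
  show Q0: "0 \<le> holder_factor * \<Lambda> T" using holder_factor_pos Lambda_nonneg T by simp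
  have G: "Gamma \<alpha> > 0" using al_pos by simp
  have cont: "continuous_on {0..T} (\<lambda>s. y s i)" using continuous_driver T i by simp
  have inner: "\<bar>y t i - y s i\<bar> \<le> Q * (t - s) powr \<theta>" if st: "0 < s" "s < t" "t < T" for s t
  proof -
    have c: "continuous_on {s..t} (\<lambda>u. y u i)" by (rule continuous_on_subset[OF cont]) (use st in auto)
    \<comment> \<open>The right endpoint t stays fixed while x runs through [s, t): the supremum in
      \<open>Lambda_const\<close> bounds the bracket at all these points, as the maximum principle
      demands.\<close>
    have X: "\<bar>(y x i - y t i) / (t - x) powr \<theta> + \<theta> * integral {x..t} (\<lambda>u. ((y x i - y t i) - (y u i - y t i)) / (u - x) powr (\<theta> + 1))\<bar> \<le> Q"
      if x: "s \<le> x" "x < t" for x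
    proof -
      have "cmod (weyl_deriv_right \<theta> t (\<lambda>u. y u i - y t i) x) \<le> Gamma (1 - \<alpha>) * \<Lambda> T"
        unfolding \<theta>_def by (rule weyl_component_le_Lambda[OF i]) (use x st in auto)
      thus ?thesis unfolding cmod_weyl_deriv_right[OF th] using G
        by (simp add: \<theta>_def Q_def holder_factor_def pos_divide_le_eq mult_ac)
    qed
    have "y s i - y t i \<le> Q * (t - s) powr \<theta>"
    proof (rule fractional_maximum_principle[where \<phi> = "\<lambda>u. y u i - y t i"])
      show "continuous_on {s..t} (\<lambda>u. y u i - y t i)" by (intro continuous_intros c)
    qed (use st th Q0 X in \<open>auto simp: Q_def abs_le_iff\<close>)
    moreover have "- (y s i - y t i) \<le> Q * (t - s) powr \<theta>"
    proof (rule fractional_maximum_principle[where \<phi> = "\<lambda>u. - (y u i - y t i)"])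
      show "continuous_on {s..t} (\<lambda>u. - (y u i - y t i))" by (intro continuous_intros c)
      fix x assume x: "s \<le> x" "x < t"
      have "integral {x..t} (\<lambda>u. (- (y x i - y t i) - - (y u i - y t i)) / (u - x) powr (\<theta> + 1))
          = - integral {x..t} (\<lambda>u. ((y x i - y t i) - (y u i - y t i)) / (u - x) powr (\<theta> + 1))"
        by (simp add: integral_neg[symmetric] minus_divide_left)
      thus "- (y x i - y t i) / (t - x) powr \<theta> +
         \<theta> * integral {x..t} (\<lambda>u. (- (y x i - y t i) - - (y u i - y t i)) / (u - x) powr (\<theta> + 1)) \<le> Q"
        using X[OF x] by (simp add: abs_le_iff diff_divide_distrib)
    qed (use st th Q0 in \<open>auto simp: Q_def\<close>)
    ultimately show ?thesis by linarith
  qed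
  fix u v assume uv: "0 \<le> u" "u \<le> v" "v \<le> T"
  show "\<bar>y v i - y u i\<bar> \<le> holder_factor * \<Lambda> T * (v - u) powr (1 - \<alpha>)"
  proof (cases "u = v")
    case False
    \<comment> \<open>The supremum runs over 0 < s < t < T only. The closed interval is reached by
      moving both points inwards by e n and using continuity; a third of the distance keeps them in
      order.\<close>
    define e where "e = (\<lambda>n. (v - u) / 3 * (1 / real (Suc n)))"
    have e0: "e \<longlonglongrightarrow> 0"
      unfolding e_def using tendsto_mult[OF tendsto_const[of "(v - u) / 3"] LIMSEQ_Suc[OF lim_1_over_n]] by simp
    have e: "0 < e n" "e n < (v - u) / 2" for n
    proof -
      show "0 < e n" using False uv by (simp add: e_def)
      have "e n \<le> (v - u) / 3 * 1" unfolding e_def using uv by (intro mult_left_mono) (auto simp: divide_simps)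
      thus "e n < (v - u) / 2" using False uv by simp
    qed
    have ve: "0 \<le> v - e n" "v - e n \<le> T" "0 \<le> u + e n" "u + e n \<le> T" for n
      using e[of n] uv unfolding atomize_conj by (simp add: field_simps)
    have l1: "(\<lambda>n. y (v - e n) i) \<longlonglongrightarrow> y v i"
    proof (rule continuous_on_tendsto_compose[OF cont])
      show "(\<lambda>n. v - e n) \<longlonglongrightarrow> v" using tendsto_diff[OF tendsto_const e0] by simp
      show "\<forall>\<^sub>F n in sequentially. v - e n \<in> {0..T}" using ve by simp
    qed (use uv in auto)
    have l2: "(\<lambda>n. y (u + e n) i) \<longlonglongrightarrow> y u i"
    proof (rule continuous_on_tendsto_compose[OF cont])
      show "(\<lambda>n. u + e n) \<longlonglongrightarrow> u" using tendsto_add[OF tendsto_const e0] by simp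
      show "\<forall>\<^sub>F n in sequentially. u + e n \<in> {0..T}" using ve by simp
    qed (use uv in auto)
    have "(\<lambda>n. \<bar>y (v - e n) i - y (u + e n) i\<bar>) \<longlonglongrightarrow> \<bar>y v i - y u i\<bar>"
      by (intro tendsto_intros l1 l2)
    moreover have "\<bar>y (v - e n) i - y (u + e n) i\<bar> \<le> Q * (v - u) powr \<theta>" for n
    proof -
      have "\<bar>y (v - e n) i - y (u + e n) i\<bar> \<le> Q * ((v - e n) - (u + e n)) powr \<theta>"
        by (rule inner) (use e[of n] uv in auto)
      also have "\<dots> \<le> Q * (v - u) powr \<theta>"
        using e[of n] Q0 th by (intro mult_left_mono powr_mono2) (auto simp: Q_def)
      finally show ?thesis .
    qed
    ultimately have "\<bar>y v i - y u i\<bar> \<le> Q * (v - u) powr \<theta>" by (intro LIMSEQ_le_const2) auto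
    thus ?thesis by (simp add: Q_def \<theta>_def)
  qed (use Q0 in simp)
qed

section \<open>The fractional path norm\<close>

lemma continuous_on_edist_driver:
  assumes "0 \<le> T"
  shows "continuous_on {0..T} (\<lambda>s. edist (Suc d) z (y s))"
  unfolding edist_def enorm_def L2_set_def
  by (intro continuous_intros continuous_driver assms) auto

definition driver_norm :: "real \<Rightarrow> real" where "driver_norm T = path_norm d \<alpha> T y"

text \<open>As for \<open>Lambda_const\<close>, the real supremum has to be shown finite before it
  bounds its members; \<beta> > \<alpha> makes the kernel integrals uniformly bounded.\<close>

lemma path_norm_ge:
  assumes t: "0 \<le> t" "t \<le> T"
  shows "enorm (Suc d) (y t) + integral {0..t} (\<lambda>s. edist (Suc d) (y t) (y s) / (t - s) powr (1 + \<alpha>)) \<le> driver_norm T"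
proof -
  define A where "A = holder_bound T"
  have T0: "T \<ge> 0" using t by simp
  have A0: "A \<ge> 0" using holder_bound T0 by (simp add: A_def)
  define B where "B = (\<Sum>i<Suc d. \<bar>y 0 i\<bar> + A * T powr \<beta>) + A * (T powr (\<beta> - \<alpha>) / (\<beta> - \<alpha>))"
  have ba: "\<beta> > \<alpha>" using al_half be_half by simp
  have "enorm (Suc d) (y t) + integral {0..t} (\<lambda>s. edist (Suc d) (y t) (y s) / (t - s) powr (1 + \<alpha>)) \<le> B"
    if t: "t \<in> {0..T}" for t
    unfolding B_def
  proof (rule add_mono)
    have "enorm (Suc d) (y t) \<le> (\<Sum>i<Suc d. \<bar>y t i\<bar>)" by (rule enorm_le_sum)
    also have "\<dots> \<le> (\<Sum>i<Suc d. \<bar>y 0 i\<bar> + A * T powr \<beta>)"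
      using holder_on_bounded[OF holder_on_driver[OF T0], of _ t] be_half t by (intro sum_mono) (auto simp: A_def)
    finally show "enorm (Suc d) (y t) \<le> (\<Sum>i<Suc d. \<bar>y 0 i\<bar> + A * T powr \<beta>)" .
    have "\<bar>integral {0..t} (\<lambda>s. edist (Suc d) (y t) (y s) / (t - s) powr (1 + \<alpha>))\<bar> \<le> A * ((t - 0) powr (\<beta> - \<alpha>) / (\<beta> - \<alpha>))"
    proof (rule singular_kernel_integrable(2)[OF _ _ _ ba])
      show "continuous_on {0..t} (\<lambda>s. edist (Suc d) (y t) (y s))" using continuous_on_edist_driver t by simp
      show "\<bar>edist (Suc d) (y t) (y s)\<bar> \<le> A * (t - s) powr \<beta>" if "0 \<le> s" "s \<le> t" for s
        using holder_bound(2)[OF T0, of t s] that t by (simp add: A_def)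
    qed (use t in auto)
    also have "\<dots> \<le> A * (T powr (\<beta> - \<alpha>) / (\<beta> - \<alpha>))"
      using A0 t ba by (intro mult_left_mono divide_right_mono powr_mono2) auto
    finally show "integral {0..t} (\<lambda>s. edist (Suc d) (y t) (y s) / (t - s) powr (1 + \<alpha>)) \<le> A * (T powr (\<beta> - \<alpha>) / (\<beta> - \<alpha>))"
      by linarith
  qed
  hence "bdd_above ((\<lambda>t. enorm (Suc d) (y t) + integral {0..t} (\<lambda>s. edist (Suc d) (y t) (y s) / (t - s) powr (1 + \<alpha>))) ` {0..T})"
    by (intro bdd_aboveI[of _ B]) auto
  from cSUP_upper[OF _ this, of t] show ?thesis using t by (simp add: driver_norm_def path_norm_def)
qed

lemma edist_kernel_integrable:
  assumes t: "0 \<le> t"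
  shows "(\<lambda>s. edist (Suc d) (y t) (y s) / (t - s) powr (1 + \<alpha>)) integrable_on {0..t}"
proof (rule singular_kernel_integrable(1))
  show "continuous_on {0..t} (\<lambda>s. edist (Suc d) (y t) (y s))" using continuous_on_edist_driver t by simp
  show "\<bar>edist (Suc d) (y t) (y s)\<bar> \<le> holder_bound t * (t - s) powr \<beta>" if "0 \<le> s" "s \<le> t" for s
    using holder_bound(2)[OF t, of t s] that t by simp
qed (use t al_half be_half in auto)

text \<open>The kernel is nonnegative, so its integral shrinks when the lower limit moves up. Thus
  the path norm, with lower limit 0, controls all subintervals.\<close>

lemma component_kernel:
  assumes t: "0 \<le> a" "a \<le> t" "t \<le> T" and i: "i \<le> d"
  shows "(\<lambda>s. \<bar>y t i - y s i\<bar> / (t - s) powr (1 + \<alpha>)) integrable_on {a..t}"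
    and "integral {a..t} (\<lambda>s. \<bar>y t i - y s i\<bar> / (t - s) powr (1 + \<alpha>)) \<le> driver_norm T"
proof -
  have t0: "0 \<le> t" using t by simp
  let ?k = "\<lambda>s. \<bar>y t i - y s i\<bar> / (t - s) powr (1 + \<alpha>)"
  let ?e = "\<lambda>s. edist (Suc d) (y t) (y s) / (t - s) powr (1 + \<alpha>)"
  have i0: "?k integrable_on {0..t}"
  proof (rule singular_kernel_integrable(1))
    show "continuous_on {0..t} (\<lambda>s. \<bar>y t i - y s i\<bar>)"
      by (intro continuous_intros continuous_driver t0 i)
    show "\<bar>\<bar>y t i - y s i\<bar>\<bar> \<le> holder_bound t * (t - s) powr \<beta>" if "0 \<le> s" "s \<le> t" for s
      using holder_onD[OF holder_on_driver[OF t0 i], of s t] that by simp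
  qed (use t0 al_half be_half in auto)
  show i1: "?k integrable_on {a..t}" by (rule integrable_subinterval_real[OF i0]) (use t in auto)
  have "integral {a..t} ?k \<le> integral {0..t} ?k"
    by (rule integral_subset_le[OF _ i1 i0]) (use t in auto)
  also have "\<dots> \<le> integral {0..t} ?e"
    by (rule integral_le[OF i0 edist_kernel_integrable[OF t0]])
      (use i in \<open>auto intro!: divide_right_mono abs_component_le_edist\<close>)
  also have "\<dots> \<le> driver_norm T" using path_norm_ge[OF t0 t(3)] by (smt (verit) enorm_nonneg)
  finally show "integral {a..t} ?k \<le> driver_norm T" .
qed

lemma component_le_driver_norm:
  assumes t: "0 \<le> t" "t \<le> T" and i: "i \<le> d"
  shows "\<bar>y t i\<bar> \<le> driver_norm T"
proof -
  have "0 \<le> integral {0..t} (\<lambda>s. edist (Suc d) (y t) (y s) / (t - s) powr (1 + \<alpha>))"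
    by (intro integral_nonneg edist_kernel_integrable t) auto
  moreover have "\<bar>y t i\<bar> \<le> enorm (Suc d) (y t)" using i by (intro abs_component_le_enorm) simp
  ultimately show ?thesis using path_norm_ge[OF t] by linarith
qed

lemma driver_norm_nonneg: "0 \<le> T \<Longrightarrow> 0 \<le> driver_norm T"
  using component_le_driver_norm[of 0 T 0] by (auto intro: order_trans[OF abs_ge_zero])

text \<open>The inner integral is \<open>y s i - y 0 i\<close>, so the Sobolev-type bound gives a
  constant linear in \<open>driver_norm\<close> with a single factor
  \<open>\<Lambda> T\<close>.\<close>

lemma holder_on_second_order_integral:
  assumes T: "T > 0" and ij: "i \<le> d" "j \<le> d"
  shows "holder_on 0 T (1 - \<alpha>) (4 * (holder_factor * \<Lambda> T) * driver_norm T * (1 + T powr \<alpha>)) (simplex_integral y [i, j])"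
proof (rule holder_onI)
  define L where "L = holder_factor * \<Lambda> T"
  define \<theta> where "\<theta> = 1 - \<alpha>"
  have th: "\<theta> > 1/2" using al_half by (simp add: \<theta>_def)
  have L0: "L \<ge> 0" using holder_factor_pos Lambda_nonneg T by (simp add: L_def)
  have p0: "driver_norm T \<ge> 0" using driver_norm_nonneg T by simp
  show "0 \<le> 4 * (holder_factor * \<Lambda> T) * driver_norm T * (1 + T powr \<alpha>)" using L0 p0 by (simp add: L_def)
  define f where "f = simplex_integral y [i]"
  have f: "f s = y s i - y 0 i" if "0 \<le> s" for s
    using simplex_integral_snoc[of y "[]" i] young_integral_one[OF that] by (simp add: f_def)
  have hy: "holder_on 0 T \<theta> L (\<lambda>s. y s k)" if "k \<le> d" for k
    using holder_on_driver_Lambda[OF T that] by (simp add: L_def \<theta>_def)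
  have hf: "holder_on 0 T \<theta> L f"
  proof -
    have "holder_on 0 T \<theta> (L + 0) (\<lambda>s. y s i - y 0 i)" by (rule holder_on_diff[OF hy[OF ij(1)] holder_on_const])
    thus ?thesis using holder_on_cong[of 0 T f "\<lambda>s. y s i - y 0 i"] f by simp
  qed
  have F: "simplex_integral y [i, j] = (\<lambda>t. young_integral f (\<lambda>s. y s j) 0 t)"
    using simplex_integral_snoc[of y "[i]" j] by (simp add: f_def)
  fix u v assume uv: "0 \<le> u" "u \<le> v" "v \<le> T"
  show "\<bar>simplex_integral y [i, j] v - simplex_integral y [i, j] u\<bar>
     \<le> 4 * (holder_factor * \<Lambda> T) * driver_norm T * (1 + T powr \<alpha>) * (v - u) powr (1 - \<alpha>)"
  proof (cases "u = v")
    case False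
    have "simplex_integral y [i, j] v - simplex_integral y [i, j] u = young_integral f (\<lambda>s. y s j) u v"
      unfolding F by (rule young_integral_difference[OF hf hy[OF ij(2)]]) (use uv th in auto)
    also have "\<bar>\<dots>\<bar> \<le> L * (v - u) powr (1 - \<alpha>) * (2 * driver_norm T) + 2 powr (1 + \<alpha>) * L * ((v - u) * driver_norm T)"
    proof (rule young_integral_sobolev_bound)
      show "holder_on u v (1 - \<alpha>) L f" using holder_on_subset[OF hf] uv by (simp add: \<theta>_def)
      show "holder_on u v (1 - \<alpha>) L (\<lambda>s. y s j)" using holder_on_subset[OF hy[OF ij(2)]] uv by (simp add: \<theta>_def)
      fix t assume t: "u \<le> t" "t \<le> v"
      have eq: "\<bar>f t - f s\<bar> / (t - s) powr (1 + \<alpha>) = \<bar>y t i - y s i\<bar> / (t - s) powr (1 + \<alpha>)" if "s \<in> {u..t}" for s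
        using that t uv f by simp
      have t': "0 \<le> u" "u \<le> t" "t \<le> T" using t uv by auto
      show "(\<lambda>s. \<bar>f t - f s\<bar> / (t - s) powr (1 + \<alpha>)) integrable_on {u..t}"
        using component_kernel(1)[OF t' ij(1)] eq by (subst integrable_cong[OF eq]) auto
      show "integral {u..t} (\<lambda>s. \<bar>f t - f s\<bar> / (t - s) powr (1 + \<alpha>)) \<le> driver_norm T"
        using component_kernel(2)[OF t' ij(1)] eq
          Henstock_Kurzweil_Integration.integral_cong[OF eq, of "{u..t}"] by simp
      show "\<bar>f t\<bar> \<le> 2 * driver_norm T"
        using f[of t] component_le_driver_norm[of t T i] component_le_driver_norm[of 0 T i] t' T ij by auto
    qed (use False uv al_half al_pos in auto)
    \<comment> \<open>The full power of v - u is traded for the Hoelder power at the price of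
      \<open>T powr \<alpha>\<close>: the source of the factor \<open>1 + T powr \<alpha>\<close>,
      to be matched with the one in \<open>C_const\<close>.\<close>
    also have "2 powr (1 + \<alpha>) * L * ((v - u) * driver_norm T) \<le> 4 * L * ((v - u) powr (1 - \<alpha>) * T powr \<alpha> * driver_norm T)"
    proof (intro mult_mono)
      have "2 powr (1 + \<alpha>) \<le> 2 powr (2::real)" using al_half by (intro powr_mono) auto
      thus "2 powr (1 + \<alpha>) \<le> (4::real)" by simp
      have "v - u = (v - u) powr (1 - \<alpha>) * (v - u) powr \<alpha>" using False uv by (simp add: powr_add[symmetric])
      also have "\<dots> \<le> (v - u) powr (1 - \<alpha>) * T powr \<alpha>"
        using uv al_pos by (intro mult_left_mono powr_mono2) auto
      finally show "v - u \<le> (v - u) powr (1 - \<alpha>) * T powr \<alpha>" .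
    qed (use L0 p0 uv in auto)
    finally have "\<bar>simplex_integral y [i, j] v - simplex_integral y [i, j] u\<bar> \<le>
       L * (v - u) powr (1 - \<alpha>) * (2 * driver_norm T) + 4 * L * ((v - u) powr (1 - \<alpha>) * T powr \<alpha> * driver_norm T)" by simp
    also have "\<dots> \<le> L * (v - u) powr (1 - \<alpha>) * (4 * driver_norm T) + 4 * L * ((v - u) powr (1 - \<alpha>) * T powr \<alpha> * driver_norm T)"
      using L0 p0 by (intro add_right_mono mult_left_mono) auto
    finally show ?thesis by (simp add: L_def algebra_simps)
  qed (use L0 p0 in \<open>simp add: L_def\<close>)
qed

end

section \<open>Decay of the iterated integrals\<close>

text \<open>The numerator converts \<open>Lambda_const\<close> into a Hoelder constant; the
  denominator matches the factor \<open>Gamma (1 - 2 * \<alpha>)\<close> contained in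
  \<open>C_const\<close>.\<close>

definition word_const :: "real \<Rightarrow> real" where
  "word_const \<alpha> = Gamma \<alpha> * Gamma (1 - \<alpha>) / Gamma (1 - 2 * \<alpha>)"

context holder_driver
begin

lemma word_const_pos: "word_const \<alpha> > 0"
  unfolding word_const_def using al_half al_pos by simp

text \<open>The summand \<open>T powr \<alpha>\<close> of the bracket supplies the right power of T:
  multiplied by \<open>T powr (1 - 2 * \<alpha>)\<close> it is the factor
  \<open>T powr (1 - \<alpha>)\<close> which one integration against a Hoelder path of order 1 -
  \<alpha> produces.\<close>

lemma C_const_ge:
  assumes "T > 0"
  shows "Gamma (1 - 2 * \<alpha>) * ((1 + T powr \<alpha>) * T powr (1 - \<alpha>)) \<le> C_const \<alpha> T"
proof -
  have G: "Gamma (1 - 2 * \<alpha>) > 0" using al_half by simp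
  have "Gamma (1 - 2 * \<alpha>) * ((1 + T powr \<alpha>) * T powr (1 - \<alpha>)) = T powr \<alpha> * (1 + T powr \<alpha>) * Gamma (1 - 2 * \<alpha>) * T powr (1 - 2 * \<alpha>)"
    using assms by (simp add: powr_add[symmetric] mult_ac)
  also have "\<dots> \<le> C_const \<alpha> T"
    unfolding C_const_def using al_half al_pos G by (intro mult_right_mono) auto
  finally show ?thesis .
qed

lemma C_const_nonneg: "T \<ge> 0 \<Longrightarrow> C_const \<alpha> T \<ge> 0"
  unfolding C_const_def using al_half al_pos by simp

text \<open>The power of \<open>\<Lambda> T * C_const \<alpha> T\<close> is one less than the length
  because one letter is paid by \<open>driver_norm\<close>. The decay in the length is kept
  explicit: it has to absorb the Gamma value in the bound on the coefficients.\<close>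

theorem simplex_integral_bound:
  assumes T: "T > 0" and I: "I \<noteq> []" "set I \<subseteq> {..d}"
  shows "\<bar>simplex_integral y I T\<bar> \<le> (4 * word_const \<alpha> + 2) * driver_norm T *
     (((1 + bielecki_const (1 - \<alpha>) * word_const \<alpha>) * (4 * exp 1)) ^ length I *
      (\<Lambda> T * C_const \<alpha> T) ^ (length I - 1) * real (length I) powr (- (1 - \<alpha>) * real (length I)))"
proof -
  define \<theta> where "\<theta> = 1 - \<alpha>"
  have th: "\<theta> > 1/2" "\<theta> \<le> 1" using al_half al_pos by (auto simp: \<theta>_def)
  define w where "w = word_const \<alpha>"
  define bc where "bc = bielecki_const \<theta>"
  have w0: "w > 0" using word_const_pos by (simp add: w_def)
  have bc0: "bc > 0" using bielecki_const_pos th by (simp add: bc_def)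
  define A where "A = (1 + bc * w) * (4 * exp 1)"
  have A1: "A \<ge> 1"
  proof -
    have "1 * 1 \<le> (1 + bc * w) * (4 * exp 1)"
      using w0 bc0 exp_ge_add_one_self[of 1] by (intro mult_mono) auto
    thus ?thesis by (simp add: A_def)
  qed
  define P where "P = driver_norm T"
  have P0: "P \<ge> 0" using driver_norm_nonneg T by (simp add: P_def)
  define Z where "Z = \<Lambda> T * C_const \<alpha> T"
  have Z0: "Z \<ge> 0" using Lambda_nonneg C_const_nonneg T by (simp add: Z_def)
  define k where "k = length I"
  have "\<bar>simplex_integral y I T\<bar> \<le> (4 * w + 2) * P * (A ^ k * Z ^ (k - 1) * real k powr (- \<theta> * real k))"
  proof (cases "k = 1")
    case True
    then obtain i where i: "I = [i]" by (metis One_nat_def Suc_length_conv k_def length_0_conv)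
    have "simplex_integral y I T = y T i - y 0 i"
      using simplex_integral_snoc[of y "[]" i] young_integral_one[of 0 T] T i by simp
    hence "\<bar>simplex_integral y I T\<bar> \<le> 2 * P"
      using component_le_driver_norm[of T T i] component_le_driver_norm[of 0 T i] T I i by (auto simp: P_def)
    also have "\<dots> \<le> (4 * w + 2) * P * A"
    proof -
      have "2 * P * 1 \<le> (4 * w + 2) * P * A" using w0 P0 A1 by (intro mult_mono) auto
      thus ?thesis by simp
    qed
    finally show ?thesis by (simp add: True)
  next
    case False
    then obtain i j J where J: "I = i # j # J"
      using I(1) unfolding k_def by (metis One_nat_def length_Cons list.size(3) neq_Nil_conv)
    define m where "m = length J"
    have k: "k = m + 2" by (simp add: k_def J m_def)
    define L where "L = holder_factor * \<Lambda> T"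
    have L0: "L \<ge> 0" using holder_factor_pos Lambda_nonneg T by (simp add: L_def)
    define H where "H = 4 * L * P * (1 + T powr \<alpha>)"
    have H0: "H \<ge> 0" using L0 P0 by (simp add: H_def)
    have h: "holder_on 0 T \<theta> H (simplex_integral y [i, j])"
      using holder_on_second_order_integral[OF T, of i j] I J by (simp add: H_def L_def P_def \<theta>_def)
    \<comment> \<open>With this weight \<open>exp (\<nu> * T) = exp k\<close> is merely geometric,
      while each letter after the second gains \<open>\<nu> powr (- \<theta>) = T powr \<theta> * k
      powr (- \<theta>)\<close>.\<close>
    define \<nu> where "\<nu> = real k / T"
    have nu: "\<nu> > 0" "\<nu> * T = real k" using T k by (auto simp: \<nu>_def)
    have z: "simplex_integral y [i, j] 0 = 0" using simplex_integral_snoc[of y "[i]" j] by simp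
    \<comment> \<open>The double integral vanishes at time 0, so \<open>H * T powr \<theta>\<close>
      bounds its values. For the increments it is enough that \<open>T powr \<theta> * \<nu> powr
      \<theta> = k powr \<theta> \<ge> 1\<close>.\<close>
    have start: "bielecki \<nu> \<theta> (H * T powr \<theta>) T (simplex_integral y [i, j])"
      unfolding bielecki_def
    proof (intro conjI allI impI)
      fix u assume u: "0 \<le> u" "u \<le> T"
      have "\<bar>simplex_integral y [i, j] u\<bar> \<le> H * u powr \<theta>" using holder_onD[OF h, of 0 u] u z by simp
      also have "\<dots> \<le> H * T powr \<theta>" using H0 u th by (intro mult_left_mono powr_mono2) auto
      also have "\<dots> = H * T powr \<theta> * 1" by simp
      also have "\<dots> \<le> H * T powr \<theta> * exp (\<nu> * u)" using H0 nu u by (intro mult_left_mono) auto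
      finally show "\<bar>simplex_integral y [i, j] u\<bar> \<le> H * T powr \<theta> * exp (\<nu> * u)" .
    next
      fix u v assume uv: "0 \<le> v" "v \<le> u" "u \<le> T"
      have "\<bar>simplex_integral y [i, j] u - simplex_integral y [i, j] v\<bar> \<le> H * (u - v) powr \<theta>"
        using holder_onD[OF h, of v u] uv by simp
      also have "\<dots> = H * 1 * 1 * (u - v) powr \<theta>" by simp
      also have "\<dots> \<le> H * (T powr \<theta> * \<nu> powr \<theta>) * exp (\<nu> * u) * (u - v) powr \<theta>"
      proof (intro mult_right_mono mult_mono)
        have "T powr \<theta> * \<nu> powr \<theta> = real k powr \<theta>" using nu T by (simp add: powr_mult[symmetric] mult.commute)
        also have "\<dots> \<ge> 1" using k th by (intro ge_one_powr_ge_zero) auto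
        finally show "1 \<le> T powr \<theta> * \<nu> powr \<theta>" .
      qed (use H0 nu uv in auto)
      finally show "\<bar>simplex_integral y [i, j] u - simplex_integral y [i, j] v\<bar>
          \<le> H * T powr \<theta> * \<nu> powr \<theta> * exp (\<nu> * u) * (u - v) powr \<theta>" by (simp add: mult.assoc)
    qed
    have "bielecki \<nu> \<theta> ((bielecki_const \<theta> * L * \<nu> powr (- \<theta>)) ^ length J * (H * T powr \<theta>)) T (simplex_integral y ([i, j] @ J))"
    proof (rule bielecki_simplex_integral_append[OF start th(1) nu(1) _ L0])
      show "holder_on 0 T \<theta> L (\<lambda>s. y s l)" if "l \<in> set J" for l
        using holder_on_driver_Lambda[OF T, of l] that I J by (auto simp: L_def \<theta>_def)
    qed (use H0 in simp)
    from bieleckiD1[OF this, of T] have 1: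
      "\<bar>simplex_integral y I T\<bar> \<le> (bc * L * \<nu> powr (- \<theta>)) ^ m * (H * T powr \<theta>) * exp (real k)"
      using T J nu(2) by (simp add: bc_def m_def)
    have LT: "L * ((1 + T powr \<alpha>) * T powr \<theta>) \<le> w * Z"
    proof -
      have G: "Gamma (1 - 2 * \<alpha>) > 0" using al_half by simp
      have "L * ((1 + T powr \<alpha>) * T powr \<theta>) = (L / Gamma (1 - 2 * \<alpha>)) * (Gamma (1 - 2 * \<alpha>) * ((1 + T powr \<alpha>) * T powr (1 - \<alpha>)))"
        using G by (simp add: \<theta>_def)
      also have "\<dots> \<le> (L / Gamma (1 - 2 * \<alpha>)) * C_const \<alpha> T"
        using C_const_ge[OF T] L0 G by (intro mult_left_mono) auto
      also have "\<dots> = w * Z" by (simp add: L_def w_def Z_def word_const_def holder_factor_def)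
      finally show ?thesis .
    qed
    have LT': "L * T powr \<theta> \<le> w * Z"
    proof -
      have "L * (1 * T powr \<theta>) \<le> L * ((1 + T powr \<alpha>) * T powr \<theta>)"
        using L0 by (intro mult_left_mono mult_right_mono) auto
      thus ?thesis using LT by simp
    qed
    have nuT: "\<nu> powr (- \<theta>) = T powr \<theta> * real k powr (- \<theta>)"
      using T k by (simp add: \<nu>_def powr_divide powr_minus field_simps)
    have "(bc * L * \<nu> powr (- \<theta>)) ^ m * (H * T powr \<theta>) * exp (real k)
       = (bc * (L * T powr \<theta>) * real k powr (- \<theta>)) ^ m * (4 * P * (L * ((1 + T powr \<alpha>) * T powr \<theta>))) * exp (real k)"
      unfolding nuT H_def by (simp add: mult_ac)
    also have "\<dots> \<le> (bc * (w * Z) * real k powr (- \<theta>)) ^ m * (4 * P * (w * Z)) * exp (real k)"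
    proof -
      have "(bc * a * r) ^ m * (4 * P * a') * exp (real k) \<le> (bc * b * r) ^ m * (4 * P * b) * exp (real k)"
        if "0 \<le> a" "a \<le> b" "0 \<le> a'" "a' \<le> b" "0 \<le> r" for a a' b r :: real
        using that bc0 P0 by (intro mult_right_mono mult_mono power_mono mult_left_mono) auto
      from this[OF _ LT' _ LT] show ?thesis using L0 by simp
    qed
    also have "\<dots> = (bc * w) ^ m * Z ^ (m + 1) * (4 * w * P) * exp (real k) * (real k powr (- \<theta>)) ^ m"
      by (simp add: power_mult_distrib mult_ac)
    \<comment> \<open>Only k - 2 letters carry the gain \<open>k powr (- \<theta>)\<close>. The
      missing factor \<open>k powr (2 * \<theta>)\<close> is at most k ^ 2 \<le> 4 ^ k, whence the 4
      in \<open>4 * exp 1\<close>; the other factor is the e-th power left by the weight.\<close>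
    also have "\<dots> \<le> (1 + bc * w) ^ k * Z ^ (m + 1) * ((4 * w + 2) * P) * exp (real k) * (4 ^ k * real k powr (- \<theta> * real k))"
    proof (intro mult_right_mono mult_mono)
      have "(bc * w) ^ m \<le> (1 + bc * w) ^ m" using bc0 w0 by (intro power_mono) auto
      also have "\<dots> \<le> (1 + bc * w) ^ k" using bc0 w0 k by (intro power_increasing) auto
      finally show "(bc * w) ^ m \<le> (1 + bc * w) ^ k" .
      have "(real k powr (- \<theta>)) ^ m = real k powr (- \<theta> * real m)" using k by (simp add: powr_realpow[symmetric] powr_powr)
      also have "\<dots> = real k powr (2 * \<theta>) * real k powr (- \<theta> * real k)"
        using k by (simp add: powr_add[symmetric] algebra_simps)
      also have "\<dots> \<le> real k powr 2 * real k powr (- \<theta> * real k)"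
        using k th by (intro mult_right_mono powr_mono) auto
      also have "real k powr 2 = (real k)\<^sup>2" using k by simp
      also have "(real k)\<^sup>2 \<le> (2 ^ k)\<^sup>2" using of_nat_less_two_power[of k, where 'a = real] by (intro power_mono) auto
      also have "(2 ^ k)\<^sup>2 = (4::real) ^ k" by (simp add: power2_eq_square power_mult_distrib[symmetric])
      finally show "(real k powr (- \<theta>)) ^ m \<le> 4 ^ k * real k powr (- \<theta> * real k)"
        by (simp add: mult_right_mono)
    qed (use bc0 w0 Z0 P0 in auto)
    also have "exp (real k) = exp 1 ^ k" by (simp add: exp_of_nat_mult[symmetric])
    also have "(1 + bc * w) ^ k * Z ^ (m + 1) * ((4 * w + 2) * P) * exp 1 ^ k * (4 ^ k * real k powr (- \<theta> * real k))
        = (4 * w + 2) * P * (A ^ k * Z ^ (k - 1) * real k powr (- \<theta> * real k))"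
    proof -
      have "A ^ k = (1 + bc * w) ^ k * (4 ^ k * exp 1 ^ k)" by (simp only: A_def power_mult_distrib)
      moreover have "k - 1 = m + 1" by (simp add: k)
      ultimately show ?thesis by (simp only: mult_ac)
    qed
    finally show ?thesis using 1 by (simp only: exp_of_nat_mult[of k "1::real", simplified])
  qed
  thus ?thesis by (simp add: w_def P_def A_def bc_def Z_def k_def \<theta>_def)
qed

end

section \<open>Coordinatewise calculus\<close>

lemma Rn_iff: "x \<in> Rn n \<longleftrightarrow> (\<forall>i\<ge>n. x i = 0)"
  by (simp add: topspace_Euclidean_space)

lemma Rn_fun_upd: "x \<in> Rn n \<Longrightarrow> j < n \<Longrightarrow> x(j := s) \<in> Rn n"
  by (auto simp: Rn_iff)

lemma edist_triangle: "edist n x z \<le> edist n x w + edist n w z"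
proof -
  have "edist n x z = L2_set (\<lambda>j. (x j - w j) + (w j - z j)) {..<n}" by (simp add: edist_def enorm_def)
  also have "\<dots> \<le> edist n x w + edist n w z" unfolding edist_def enorm_def by (rule L2_set_triangle_ineq)
  finally show ?thesis .
qed

lemma edist_fun_upd: "j < n \<Longrightarrow> edist n (x(j := s)) x = \<bar>s - x j\<bar>"
proof -
  assume j: "j < n"
  have "(\<Sum>i<n. ((x(j := s)) i - x i)\<^sup>2) = (\<Sum>i<n. if i = j then (s - x j)\<^sup>2 else 0)"
    by (intro sum.cong) auto
  also have "\<dots> = (s - x j)\<^sup>2" using j by simp
  finally show ?thesis by (simp add: edist_def enorm_def L2_set_def)
qed

lemma edist_refl [simp]: "edist n x x = 0"
  by (simp add: edist_def enorm_def L2_set_def)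

definition coord_diff :: "nat \<Rightarrow> ((nat \<Rightarrow> real) \<Rightarrow> real) \<Rightarrow> bool" where
  "coord_diff n f \<longleftrightarrow> (\<forall>x\<in>Rn n. \<forall>j<n. (\<lambda>s. f (x(j := s))) differentiable (at (x j)))"

text \<open>Existence of iterated one-variable derivatives is stable under sums, products and the
  action of the fields, and the sum and Leibniz rules are all that the algebra of words asks
  for.\<close>

primrec coord_smooth_upto :: "nat \<Rightarrow> nat \<Rightarrow> ((nat \<Rightarrow> real) \<Rightarrow> real) \<Rightarrow> bool" where
  "coord_smooth_upto n 0 f \<longleftrightarrow> True"
| "coord_smooth_upto n (Suc k) f \<longleftrightarrow> coord_diff n f \<and> (\<forall>j<n. coord_smooth_upto n k (partial_deriv j f))"

definition coord_smooth :: "nat \<Rightarrow> ((nat \<Rightarrow> real) \<Rightarrow> real) \<Rightarrow> bool" where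
  "coord_smooth n f \<longleftrightarrow> (\<forall>k. coord_smooth_upto n k f)"

text \<open>Identities between functions are available on \<open>Rn n\<close> only. The carrier is
  stable under changing a coordinate below n, so derivatives respect such identities.\<close>

lemma partial_deriv_cong:
  assumes "\<And>x. x \<in> Rn n \<Longrightarrow> f x = g x" "x \<in> Rn n" "j < n"
  shows "partial_deriv j f x = partial_deriv j g x"
proof -
  have "(\<lambda>s. f (x(j := s))) = (\<lambda>s. g (x(j := s)))" using assms Rn_fun_upd by auto
  thus ?thesis by (simp add: partial_deriv_def)
qed

lemma coord_diff_cong:
  assumes "\<And>x. x \<in> Rn n \<Longrightarrow> f x = g x"
  shows "coord_diff n f \<longleftrightarrow> coord_diff n g"
proof -
  have "(\<lambda>s. f (x(j := s))) = (\<lambda>s. g (x(j := s)))" if "x \<in> Rn n" "j < n" for x j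
    using assms Rn_fun_upd that by auto
  thus ?thesis by (simp add: coord_diff_def)
qed

lemma coord_smooth_upto_cong:
  assumes "\<And>x. x \<in> Rn n \<Longrightarrow> f x = g x"
  shows "coord_smooth_upto n k f \<longleftrightarrow> coord_smooth_upto n k g"
  using assms
proof (induction k arbitrary: f g)
  case (Suc k)
  have "coord_smooth_upto n k (partial_deriv j f) \<longleftrightarrow> coord_smooth_upto n k (partial_deriv j g)" if "j < n" for j
    using that partial_deriv_cong[OF Suc.prems] by (intro Suc.IH) auto
  thus ?case using coord_diff_cong[OF Suc.prems] by auto
qed simp

lemma coord_diff_DERIV:
  assumes "coord_diff n f" "x \<in> Rn n" "j < n"
  shows "((\<lambda>s. f (x(j := s))) has_real_derivative partial_deriv j f x) (at (x j))"
  unfolding partial_deriv_def DERIV_deriv_iff_real_differentiable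
  using assms by (simp add: coord_diff_def)

lemma coord_diffI:
  assumes "\<And>x j. x \<in> Rn n \<Longrightarrow> j < n \<Longrightarrow> ((\<lambda>s. f (x(j := s))) has_real_derivative f' x j) (at (x j))"
  shows "coord_diff n f"
  unfolding coord_diff_def real_differentiable_def using assms by blast

lemma coord_diff_const [simp]: "coord_diff n (\<lambda>x. c)"
  by (rule coord_diffI[where f' = "\<lambda>_ _. 0"]) auto

lemma partial_deriv_const [simp]: "partial_deriv j (\<lambda>x. c) = (\<lambda>x. 0)"
  by (auto simp: partial_deriv_def)

lemma coord_smooth_upto_const: "coord_smooth_upto n k (\<lambda>x. c)"
  by (induction k arbitrary: c) auto

lemma partial_deriv_coord: "partial_deriv j (\<lambda>x. x i) = (\<lambda>x. if i = j then 1 else 0)"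
proof
  fix x :: "nat \<Rightarrow> real"
  show "partial_deriv j (\<lambda>x. x i) x = (if i = j then 1 else 0)"
  proof (cases "i = j")
    case True
    hence "(\<lambda>s. (x(j := s)) i) = (\<lambda>s. s)" by auto
    thus ?thesis using True by (simp add: partial_deriv_def)
  next
    case False
    hence "(\<lambda>s. (x(j := s)) i) = (\<lambda>s. x i)" by auto
    thus ?thesis using False by (simp add: partial_deriv_def)
  qed
qed

lemma coord_diff_coord: "coord_diff n (\<lambda>x. x i)"
proof (rule coord_diffI[where f' = "\<lambda>_ j. if i = j then 1 else 0"])
  fix x :: "nat \<Rightarrow> real" and j
  show "((\<lambda>s. (x(j := s)) i) has_real_derivative (if i = j then 1 else 0)) (at (x j))"
    by (cases "i = j") auto
qed

lemma coord_smooth_upto_coord: "coord_smooth_upto n k (\<lambda>x. x i)"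
  by (cases k) (auto simp: coord_diff_coord partial_deriv_coord coord_smooth_upto_const)

lemma coord_diff_add:
  assumes "coord_diff n f" "coord_diff n g"
  shows "coord_diff n (\<lambda>x. f x + g x)"
  by (rule coord_diffI[OF DERIV_add[OF coord_diff_DERIV[OF assms(1)] coord_diff_DERIV[OF assms(2)]]])

lemma partial_deriv_add:
  assumes "coord_diff n f" "coord_diff n g" "x \<in> Rn n" "j < n"
  shows "partial_deriv j (\<lambda>x. f x + g x) x = partial_deriv j f x + partial_deriv j g x"
  using DERIV_imp_deriv[OF DERIV_add[OF coord_diff_DERIV[OF assms(1,3,4)] coord_diff_DERIV[OF assms(2,3,4)]]]
  by (simp add: partial_deriv_def[of j "\<lambda>x. f x + g x"])

lemma coord_diff_mult:
  assumes "coord_diff n f" "coord_diff n g"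
  shows "coord_diff n (\<lambda>x. f x * g x)"
  by (rule coord_diffI[OF DERIV_mult[OF coord_diff_DERIV[OF assms(1)] coord_diff_DERIV[OF assms(2)]]])

lemma partial_deriv_mult:
  assumes "coord_diff n f" "coord_diff n g" "x \<in> Rn n" "j < n"
  shows "partial_deriv j (\<lambda>x. f x * g x) x = partial_deriv j f x * g x + f x * partial_deriv j g x"
  using DERIV_imp_deriv[OF DERIV_mult[OF coord_diff_DERIV[OF assms(1,3,4)] coord_diff_DERIV[OF assms(2,3,4)]]]
  by (simp add: partial_deriv_def[of j "\<lambda>x. f x * g x"] mult.commute)

lemma coord_smooth_upto_add:
  "coord_smooth_upto n k f \<Longrightarrow> coord_smooth_upto n k g \<Longrightarrow> coord_smooth_upto n k (\<lambda>x. f x + g x)"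
proof (induction k arbitrary: f g)
  case (Suc k)
  have "coord_smooth_upto n k (partial_deriv j (\<lambda>x. f x + g x))" if "j < n" for j
  proof -
    have "coord_smooth_upto n k (\<lambda>x. partial_deriv j f x + partial_deriv j g x)"
      using Suc that by auto
    thus ?thesis
      by (subst coord_smooth_upto_cong[OF partial_deriv_add]) (use Suc.prems that in auto)
  qed
  thus ?case using Suc.prems by (auto intro: coord_diff_add)
qed simp

lemma coord_smooth_upto_SucD: "coord_smooth_upto n (Suc k) f \<Longrightarrow> coord_smooth_upto n k f"
proof (induction k arbitrary: f)
  case (Suc k)
  from Suc.prems have "coord_diff n f" "\<And>j. j < n \<Longrightarrow> coord_smooth_upto n (Suc k) (partial_deriv j f)" by auto
  thus ?case using Suc.IH by auto
qed simp

lemma coord_smooth_upto_mult: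
  "coord_smooth_upto n k f \<Longrightarrow> coord_smooth_upto n k g \<Longrightarrow> coord_smooth_upto n k (\<lambda>x. f x * g x)"
proof (induction k arbitrary: f g)
  case (Suc k)
  note lower = Suc.prems[THEN coord_smooth_upto_SucD]
  have "coord_smooth_upto n k (partial_deriv j (\<lambda>x. f x * g x))" if "j < n" for j
  proof -
    have "coord_smooth_upto n k (\<lambda>x. partial_deriv j f x * g x + f x * partial_deriv j g x)"
      using Suc.prems that lower by (intro coord_smooth_upto_add Suc.IH) auto
    thus ?thesis
      by (subst coord_smooth_upto_cong[OF partial_deriv_mult]) (use Suc.prems that in auto)
  qed
  thus ?case using Suc.prems by (auto intro: coord_diff_mult)
qed simp

lemma coord_smooth_const: "coord_smooth n (\<lambda>x. c)"
  by (simp add: coord_smooth_def coord_smooth_upto_const)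

lemma coord_smooth_coord: "coord_smooth n (\<lambda>x. x i)"
  by (simp add: coord_smooth_def coord_smooth_upto_coord)

lemma coord_smooth_add: "coord_smooth n f \<Longrightarrow> coord_smooth n g \<Longrightarrow> coord_smooth n (\<lambda>x. f x + g x)"
  by (simp add: coord_smooth_def coord_smooth_upto_add)

lemma coord_smooth_mult: "coord_smooth n f \<Longrightarrow> coord_smooth n g \<Longrightarrow> coord_smooth n (\<lambda>x. f x * g x)"
  by (simp add: coord_smooth_def coord_smooth_upto_mult)

lemma coord_smooth_diff: "coord_smooth n f \<Longrightarrow> coord_smooth n g \<Longrightarrow> coord_smooth n (\<lambda>x. f x - g x)"
  using coord_smooth_add[OF _ coord_smooth_mult[OF coord_smooth_const[of n "-1"]], of f g] by simp

lemma coord_smooth_sum: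
  "finite A \<Longrightarrow> (\<And>i. i \<in> A \<Longrightarrow> coord_smooth n (f i)) \<Longrightarrow> coord_smooth n (\<lambda>x. \<Sum>i\<in>A. f i x)"
  by (induction A rule: finite_induct) (auto intro: coord_smooth_const coord_smooth_add)

lemma coord_smooth_power: "coord_smooth n f \<Longrightarrow> coord_smooth n (\<lambda>x. f x ^ k)"
  by (induction k) (auto intro: coord_smooth_const coord_smooth_mult)

lemma coord_smooth_prod:
  "finite A \<Longrightarrow> (\<And>i. i \<in> A \<Longrightarrow> coord_smooth n (f i)) \<Longrightarrow> coord_smooth n (\<lambda>x. \<Prod>i\<in>A. f i x)"
  by (induction A rule: finite_induct) (auto intro: coord_smooth_const coord_smooth_mult)

lemma coord_smooth_coord_diff: "coord_smooth n f \<Longrightarrow> coord_diff n f"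
  unfolding coord_smooth_def by (metis coord_smooth_upto.simps(2))

lemma coord_smooth_partial_deriv: "coord_smooth n f \<Longrightarrow> j < n \<Longrightarrow> coord_smooth n (partial_deriv j f)"
  unfolding coord_smooth_def by (metis coord_smooth_upto.simps(2))

lemma smooth_fun_coord_smooth:
  assumes "smooth_fun n f"
  shows "coord_smooth n f"
proof -
  have "coord_smooth_upto n k (foldr partial_deriv js f)" if "set js \<subseteq> {..<n}" for js k
    using that
  proof (induction k arbitrary: js)
    case (Suc k)
    have "coord_diff n (foldr partial_deriv js f)"
      using assms Suc.prems unfolding smooth_fun_def coord_diff_def by blast
    moreover have "coord_smooth_upto n k (partial_deriv j (foldr partial_deriv js f))" if "j < n" for j
      using Suc.IH[of "j # js"] Suc.prems that by simp
    ultimately show ?case by simp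
  qed simp
  from this[of "[]"] show ?thesis by (simp add: coord_smooth_def)
qed

lemma field_apply_cong:
  assumes "\<And>x. x \<in> Rn n \<Longrightarrow> f x = g x" "x \<in> Rn n"
  shows "field_apply n W f x = field_apply n W g x"
  unfolding field_apply_def using partial_deriv_cong[OF assms(1,2)] by (intro sum.cong) auto

lemma field_apply_add:
  assumes "coord_smooth n f" "coord_smooth n g" "x \<in> Rn n"
  shows "field_apply n W (\<lambda>x. f x + g x) x = field_apply n W f x + field_apply n W g x"
  unfolding field_apply_def using partial_deriv_add[OF assms(1,2)[THEN coord_smooth_coord_diff] assms(3)]
  by (simp add: distrib_left sum.distrib)

lemma field_apply_mult:
  assumes "coord_smooth n f" "coord_smooth n g" "x \<in> Rn n"
  shows "field_apply n W (\<lambda>x. f x * g x) x = field_apply n W f x * g x + f x * field_apply n W g x"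
  unfolding field_apply_def using partial_deriv_mult[OF assms(1,2)[THEN coord_smooth_coord_diff] assms(3)]
  by (simp add: algebra_simps sum.distrib sum_distrib_left)

lemma field_apply_const [simp]: "field_apply n W (\<lambda>x. c) = (\<lambda>x. 0)"
  by (auto simp: field_apply_def)

lemma field_apply_coord: "j < n \<Longrightarrow> field_apply n W (\<lambda>x. x j) = (\<lambda>x. W x j)"
proof
  fix x assume "j < n"
  have "field_apply n W (\<lambda>x. x j) x = (\<Sum>i<n. if i = j then W x i else 0)"
    unfolding field_apply_def partial_deriv_coord by (intro sum.cong) auto
  thus "field_apply n W (\<lambda>x. x j) x = W x j" using \<open>j < n\<close> by simp
qed

lemma coord_smooth_field_apply:
  assumes "coord_smooth n f" "\<And>j. j < n \<Longrightarrow> coord_smooth n (\<lambda>x. W x j)"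
  shows "coord_smooth n (field_apply n W f)"
  unfolding field_apply_def[abs_def] using assms
  by (intro coord_smooth_sum coord_smooth_mult coord_smooth_partial_deriv) auto

text \<open>\<open>Suc k\<close> stands for the vanishing of all derivatives of order at most k, and
  0 for no condition. The recursion follows the letters of a word, each of which differentiates
  once.\<close>

primrec vanishes_upto :: "nat \<Rightarrow> (nat \<Rightarrow> real) \<Rightarrow> nat \<Rightarrow> ((nat \<Rightarrow> real) \<Rightarrow> real) \<Rightarrow> bool" where
  "vanishes_upto n a 0 f \<longleftrightarrow> True"
| "vanishes_upto n a (Suc k) f \<longleftrightarrow> f a = 0 \<and> (\<forall>j<n. vanishes_upto n a k (partial_deriv j f))"

lemma vanishes_upto_cong:
  assumes "\<And>x. x \<in> Rn n \<Longrightarrow> f x = g x" "a \<in> Rn n"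
  shows "vanishes_upto n a k f \<longleftrightarrow> vanishes_upto n a k g"
  using assms
proof (induction k arbitrary: f g)
  case (Suc k)
  have "vanishes_upto n a k (partial_deriv j f) \<longleftrightarrow> vanishes_upto n a k (partial_deriv j g)" if "j < n" for j
    using that partial_deriv_cong[OF Suc.prems(1)] Suc.prems by (intro Suc.IH) auto
  thus ?case using Suc.prems by auto
qed simp

lemma vanishes_upto_SucD: "vanishes_upto n a (Suc k) f \<Longrightarrow> vanishes_upto n a k f"
proof (induction k arbitrary: f)
  case (Suc k)
  from Suc.prems have "f a = 0" "\<And>j. j < n \<Longrightarrow> vanishes_upto n a (Suc k) (partial_deriv j f)" by auto
  thus ?case using Suc.IH by auto
qed simp

lemma vanishes_upto_zero: "vanishes_upto n a k (\<lambda>x. 0)"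
  by (induction k) auto

lemma vanishes_upto_add:
  "coord_smooth n f \<Longrightarrow> coord_smooth n g \<Longrightarrow> a \<in> Rn n \<Longrightarrow> vanishes_upto n a k f \<Longrightarrow> vanishes_upto n a k g \<Longrightarrow>
   vanishes_upto n a k (\<lambda>x. f x + g x)"
proof (induction k arbitrary: f g)
  case (Suc k)
  have "vanishes_upto n a k (partial_deriv j (\<lambda>x. f x + g x))" if "j < n" for j
  proof -
    have "vanishes_upto n a k (\<lambda>x. partial_deriv j f x + partial_deriv j g x)"
      using Suc that by (intro Suc.IH coord_smooth_partial_deriv) auto
    thus ?thesis
      by (subst vanishes_upto_cong[OF partial_deriv_add])
        (use Suc.prems that coord_smooth_coord_diff in auto)
  qed
  thus ?case using Suc.prems by auto
qed simp

lemma vanishes_upto_mult: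
  "coord_smooth n f \<Longrightarrow> coord_smooth n g \<Longrightarrow> a \<in> Rn n \<Longrightarrow> vanishes_upto n a k g \<Longrightarrow>
   vanishes_upto n a k (\<lambda>x. f x * g x)"
proof (induction k arbitrary: f g)
  case (Suc k)
  have "vanishes_upto n a k (partial_deriv j (\<lambda>x. f x * g x))" if "j < n" for j
  proof -
    have "vanishes_upto n a k (\<lambda>x. partial_deriv j f x * g x + f x * partial_deriv j g x)"
      using Suc.prems that vanishes_upto_SucD[OF Suc.prems(4)]
      by (intro vanishes_upto_add Suc.IH coord_smooth_mult coord_smooth_partial_deriv) auto
    thus ?thesis
      by (subst vanishes_upto_cong[OF partial_deriv_mult])
        (use Suc.prems that coord_smooth_coord_diff in auto)
  qed
  thus ?case using Suc.prems by auto
qed simp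

lemma vanishes_upto_sum:
  assumes "finite A" "\<And>i. i \<in> A \<Longrightarrow> coord_smooth n (f i)" "a \<in> Rn n" "\<And>i. i \<in> A \<Longrightarrow> vanishes_upto n a k (f i)"
  shows "vanishes_upto n a k (\<lambda>x. \<Sum>i\<in>A. f i x)"
  using assms
proof (induction A rule: finite_induct)
  case (insert i A)
  have "vanishes_upto n a k (\<lambda>x. f i x + (\<Sum>i\<in>A. f i x))"
    using insert by (intro vanishes_upto_add coord_smooth_sum) auto
  thus ?case using insert by simp
qed (simp add: vanishes_upto_zero)

lemma vanishes_upto_field_apply:
  assumes "coord_smooth n f" "\<And>j. j < n \<Longrightarrow> coord_smooth n (\<lambda>x. W x j)" "a \<in> Rn n" "vanishes_upto n a (Suc k) f"
  shows "vanishes_upto n a k (field_apply n W f)"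
  unfolding field_apply_def[abs_def] using assms
  by (intro vanishes_upto_sum vanishes_upto_mult coord_smooth_mult coord_smooth_partial_deriv) auto

subsection \<open>Power series in several variables\<close>

definition multi_idx :: "nat \<Rightarrow> (nat \<Rightarrow> nat) set" where
  "multi_idx n = {m. \<forall>i\<ge>n. m i = 0}"

definition power_series_at ::
  "nat \<Rightarrow> (nat \<Rightarrow> real) \<Rightarrow> real \<Rightarrow> ((nat \<Rightarrow> nat) \<Rightarrow> real) \<Rightarrow> ((nat \<Rightarrow> real) \<Rightarrow> real) \<Rightarrow> bool" where
  "power_series_at n a e c f \<longleftrightarrow> (\<forall>x\<in>Rn n. edist n x a < e \<longrightarrow>
      ((\<lambda>m. c m * (\<Prod>i<n. (x i - a i) ^ m i)) has_sum f x) (multi_idx n))"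

lemma real_analytic_at_alt: "real_analytic_at n f a \<longleftrightarrow> (\<exists>e>0. \<exists>c. power_series_at n a e c f)"
  by (simp add: real_analytic_at_def power_series_at_def multi_idx_def)

lemma edist_le_mult:
  assumes "\<And>j. j < n \<Longrightarrow> \<bar>x j - z j\<bar> \<le> r"
  shows "edist n x z \<le> real n * r"
proof -
  have "edist n x z \<le> (\<Sum>j<n. \<bar>x j - z j\<bar>)" unfolding edist_def by (rule enorm_le_sum)
  also have "\<dots> \<le> (\<Sum>j<n. r)" using assms by (intro sum_mono) auto
  finally show ?thesis by simp
qed

text \<open>Evaluation at the corner a + (r, ..., r): for real series unconditional summability is
  absolute summability. The condition on r puts the corner inside the Euclidean ball.\<close>

lemma power_series_at_abs_summable:
  assumes ps: "power_series_at n a e c f" and a: "a \<in> Rn n" and r: "0 \<le> r" "real n * r < e"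
  shows "(\<lambda>m. \<bar>c m\<bar> * (\<Prod>i<n. r ^ m i)) summable_on multi_idx n"
proof -
  define x where "x = (\<lambda>i. if i < n then a i + r else 0)"
  have x: "x \<in> Rn n" by (simp add: x_def Rn_iff)
  have "edist n x a \<le> real n * r" by (rule edist_le_mult) (use r in \<open>auto simp: x_def\<close>)
  hence "((\<lambda>m. c m * (\<Prod>i<n. (x i - a i) ^ m i)) has_sum f x) (multi_idx n)"
    using x r by (intro ps[unfolded power_series_at_def, rule_format]) auto
  hence "(\<lambda>m. c m * (\<Prod>i<n. (x i - a i) ^ m i)) summable_on multi_idx n" by (rule has_sum_imp_summable)
  hence "(\<lambda>m. norm (c m * (\<Prod>i<n. (x i - a i) ^ m i))) summable_on multi_idx n"
    by (rule iffD1[OF summable_on_iff_abs_summable_on_real])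
  moreover have "norm (c m * (\<Prod>i<n. (x i - a i) ^ m i)) = \<bar>c m\<bar> * (\<Prod>i<n. r ^ m i)" for m
  proof -
    have "(\<Prod>i<n. (x i - a i) ^ m i) = (\<Prod>i<n. r ^ m i)" by (intro prod.cong) (auto simp: x_def)
    moreover have "0 \<le> (\<Prod>i<n. r ^ m i)" using r by (intro prod_nonneg) auto
    ultimately show ?thesis by (simp add: abs_mult)
  qed
  ultimately show ?thesis by (simp only:)
qed

lemma has_real_derivative_Re_of_real:
  assumes "(F has_field_derivative D) (at (complex_of_real t))"
  shows "((\<lambda>s. Re (F (complex_of_real s))) has_real_derivative Re D) (at t)"
  unfolding has_real_derivative_iff_has_vector_derivative
  by (rule bounded_linear.has_vector_derivative[OF bounded_linear_Re])
    (rule has_vector_derivative_real_field[OF assms])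

text \<open>Only the j-th variable is made complex. The theorem on uniform limits of holomorphic
  functions then differentiates the series term by term, without an estimate of the derived
  series.\<close>

lemma power_series_at_partial_deriv:
  assumes ps: "power_series_at n a e c f" and a: "a \<in> Rn n" and e: "e > 0" and j: "j < n"
  shows "\<exists>e'>0. power_series_at n a e' (\<lambda>m. real (Suc (m j)) * c (m(j := Suc (m j)))) (partial_deriv j f)"
proof -
  define r where "r = e / (2 * (real n + 1))"
  have r: "0 < r" "real n * r < e" using e by (auto simp: r_def field_simps intro!: add_nonneg_pos)
  have summ: "(\<lambda>m. \<bar>c m\<bar> * (\<Prod>i<n. r ^ m i)) summable_on multi_idx n"
    by (rule power_series_at_abs_summable[OF ps a]) (use r in auto)
  \<comment> \<open>A point within e' of a can still be moved by e' in the j-th coordinate without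
    leaving the ball of radius r \<le> e, so f is given by the series on a whole neighbourhood of x
    j.\<close>
  define e' where "e' = r / 2"
  have e': "0 < e'" "e' < r" using r by (auto simp: e'_def)
  have "((\<lambda>m. real (Suc (m j)) * c (m(j := Suc (m j))) * (\<Prod>i<n. (x i - a i) ^ m i)) has_sum partial_deriv j f x) (multi_idx n)"
    if x: "x \<in> Rn n" "edist n x a < e'" for x
  proof -
    have xi: "\<bar>x i - a i\<bar> \<le> r" if "i < n" for i
      using abs_component_le_edist[OF that, of x a] x e' by linarith
    define w where "w = (\<lambda>m. \<Prod>i\<in>{..<n}-{j}. (x i - a i) ^ m i)"
    have wb: "\<bar>c m * w m\<bar> * r ^ m j \<le> \<bar>c m\<bar> * (\<Prod>i<n. r ^ m i)" for m
    proof -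
      have "\<bar>w m\<bar> \<le> (\<Prod>i\<in>{..<n}-{j}. r ^ m i)"
        unfolding w_def abs_prod using xi by (intro prod_mono) (auto simp: power_abs intro!: power_mono)
      hence "\<bar>c m * w m\<bar> * r ^ m j \<le> \<bar>c m\<bar> * ((\<Prod>i\<in>{..<n}-{j}. r ^ m i)) * r ^ m j"
        using r by (intro mult_right_mono) (auto simp: abs_mult intro!: mult_left_mono)
      also have "\<dots> = \<bar>c m\<bar> * (r ^ m j * (\<Prod>i\<in>{..<n}-{j}. r ^ m i))" by simp
      also have "r ^ m j * (\<Prod>i\<in>{..<n}-{j}. r ^ m i) = (\<Prod>i<n. r ^ m i)"
        by (rule prod.remove[symmetric]) (use j in auto)
      finally show ?thesis .
    qed
    define T where "T = (\<lambda>m z. complex_of_real (c m * w m) * z ^ m j)"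
    define G where "G = (\<lambda>z. \<Sum>\<^sub>\<infinity>m\<in>multi_idx n. T m z)"
    have Tb: "norm (T m z) \<le> \<bar>c m\<bar> * (\<Prod>i<n. r ^ m i)" if "z \<in> cball 0 r" for m z
    proof -
      have "norm (T m z) = \<bar>c m * w m\<bar> * norm z ^ m j" by (simp add: T_def norm_mult norm_power abs_mult)
      also have "\<dots> \<le> \<bar>c m * w m\<bar> * r ^ m j" using that by (intro mult_left_mono power_mono) auto
      finally show ?thesis using wb[of m] by linarith
    qed
    have ul: "uniform_limit (cball 0 r) (\<lambda>X z. \<Sum>m\<in>X. T m z) G (finite_subsets_at_top (multi_idx n))"
      unfolding G_def by (rule Weierstrass_m_test_general[OF _ summ]) (use Tb in auto)
    define T' where "T' = (\<lambda>m z. complex_of_real (c m * w m) * (of_nat (m j) * z ^ (m j - 1)))"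
    have "\<forall>\<^sub>F X in finite_subsets_at_top (multi_idx n). continuous_on (cball 0 r) (\<lambda>z. \<Sum>m\<in>X. T m z) \<and>
        (\<forall>z\<in>ball 0 r. ((\<lambda>z. \<Sum>m\<in>X. T m z) has_field_derivative (\<Sum>m\<in>X. T' m z)) (at z))"
      unfolding T_def T'_def
      by (intro always_eventually allI conjI ballI continuous_intros DERIV_sum)
        (auto intro!: derivative_eq_intros)
    from has_complex_derivative_uniform_limit[OF this ul _ r(1)] obtain G' where
      G': "\<And>z. z \<in> ball 0 r \<Longrightarrow> (G has_field_derivative G' z) (at z) \<and>
           ((\<lambda>X. \<Sum>m\<in>X. T' m z) \<longlongrightarrow> G' z) (finite_subsets_at_top (multi_idx n))"
      by auto
    define t where "t = x j - a j"
    have t: "\<bar>t\<bar> < r" using abs_component_le_edist[OF j, of x a] x e' by (simp add: t_def)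
    hence tb: "complex_of_real t \<in> ball 0 r" by simp
    have hs: "((\<lambda>m. T' m (of_real t)) has_sum G' (of_real t)) (multi_idx n)"
      using G'[OF tb] by (simp add: has_sum_def)
    have Gf: "G (of_real (s - a j)) = of_real (f (x(j := s)))" if s: "\<bar>s - x j\<bar> < e'" for s
    proof -
      have "edist n (x(j := s)) a \<le> edist n (x(j := s)) x + edist n x a" by (rule edist_triangle)
      also have "\<dots> < e' + e'" using s x edist_fun_upd[OF j] by (intro add_strict_mono) auto
      also have "\<dots> = r" by (simp add: e'_def)
      also have "r \<le> e"
      proof -
        have "r * 1 \<le> r * (2 * (real n + 1))" using r by (intro mult_left_mono) auto
        also have "\<dots> = e" by (simp add: r_def)
        finally show ?thesis by simp
      qed
      finally have "edist n (x(j := s)) a < e" .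
      hence "((\<lambda>m. c m * (\<Prod>i<n. ((x(j := s)) i - a i) ^ m i)) has_sum f (x(j := s))) (multi_idx n)"
        by (intro ps[unfolded power_series_at_def, rule_format] Rn_fun_upd[OF x(1) j])
      moreover have "c m * (\<Prod>i<n. ((x(j := s)) i - a i) ^ m i) = c m * w m * (s - a j) ^ m j" for m
      proof -
        have "(\<Prod>i<n. ((x(j := s)) i - a i) ^ m i) = (s - a j) ^ m j * (\<Prod>i\<in>{..<n}-{j}. ((x(j := s)) i - a i) ^ m i)"
          using j by (subst prod.remove[of _ j]) auto
        also have "(\<Prod>i\<in>{..<n}-{j}. ((x(j := s)) i - a i) ^ m i) = w m"
          unfolding w_def by (intro prod.cong) auto
        finally show ?thesis by simp
      qed
      ultimately have "((\<lambda>m. c m * w m * (s - a j) ^ m j) has_sum f (x(j := s))) (multi_idx n)"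
        by (simp only:)
      hence "((\<lambda>m. complex_of_real (c m * w m * (s - a j) ^ m j)) has_sum of_real (f (x(j := s)))) (multi_idx n)"
        by (rule has_sum_of_real)
      hence "((\<lambda>m. T m (of_real (s - a j))) has_sum of_real (f (x(j := s)))) (multi_idx n)"
        by (simp add: T_def)
      thus ?thesis unfolding G_def by (rule infsumI)
    qed
    have d: "((\<lambda>s. Re (G (complex_of_real s))) has_real_derivative Re (G' (of_real t))) (at t)"
      by (rule has_real_derivative_Re_of_real) (use G'[OF tb] in auto)
    have "((\<lambda>s. Re (G (complex_of_real (s - a j)))) has_real_derivative Re (G' (of_real t)) * 1) (at (x j))"
      by (rule DERIV_chain2[where f = "\<lambda>s. Re (G (complex_of_real s))"])
        (use d in \<open>auto simp: t_def intro!: derivative_eq_intros\<close>)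
    hence d': "((\<lambda>s. Re (G (complex_of_real (s - a j)))) has_real_derivative Re (G' (of_real t))) (at (x j))"
      by (simp only: mult_1_right)
    have "((\<lambda>s. f (x(j := s))) has_real_derivative Re (G' (of_real t))) (at (x j))"
    proof (rule has_field_derivative_transform_within_open[OF d' open_ball[of "x j" e']])
      show "x j \<in> ball (x j) e'" using e' by simp
      show "Re (G (complex_of_real (s - a j))) = f (x(j := s))" if "s \<in> ball (x j) e'" for s
        using Gf[of s] that by (simp add: dist_real_def abs_minus_commute)
    qed
    hence pd: "partial_deriv j f x = Re (G' (of_real t))" unfolding partial_deriv_def by (rule DERIV_imp_deriv)
    define R where "R = (\<lambda>m. c m * w m * (real (m j) * t ^ (m j - 1)))"
    have "((\<lambda>m. Re (T' m (of_real t))) has_sum partial_deriv j f x) (multi_idx n)"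
      unfolding pd by (rule has_sum_Re[OF hs])
    moreover have "Re (T' m (of_real t)) = R m" for m
    proof -
      have "T' m (of_real t) = of_real (R m)" by (simp add: T'_def R_def)
      thus ?thesis by simp
    qed
    ultimately have hR: "(R has_sum partial_deriv j f x) (multi_idx n)" by simp
    \<comment> \<open>Raising the j-th exponent by one reaches exactly the indices with
      \<open>m j > 0\<close>; at the others R vanishes, as it contains the factor
      \<open>m j\<close>.\<close>
    define h :: "(nat \<Rightarrow> nat) \<Rightarrow> nat \<Rightarrow> nat" where "h = (\<lambda>m. m(j := Suc (m j)))"
    have hinj: "inj_on h (multi_idx n)"
    proof (rule inj_onI)
      fix m m' assume eq: "h m = h m'"
      show "m = m'"
      proof
        fix i show "m i = m' i" using fun_cong[OF eq, of i] by (cases "i = j") (auto simp: h_def)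
      qed
    qed
    have him: "h ` multi_idx n \<subseteq> multi_idx n" using j by (auto simp: h_def multi_idx_def)
    have "(R has_sum partial_deriv j f x) (h ` multi_idx n)"
    proof (rule iffD1[OF has_sum_cong_neutral hR])
      fix m assume m: "m \<in> multi_idx n - h ` multi_idx n"
      have "m j = 0"
      proof (rule ccontr)
        assume "m j \<noteq> 0"
        hence "m = h (m(j := m j - 1))" by (auto simp: h_def)
        moreover have "m(j := m j - 1) \<in> multi_idx n" using m j by (auto simp: multi_idx_def)
        ultimately show False using m by blast
      qed
      thus "R m = 0" by (simp add: R_def)
    qed (use him in auto)
    hence "((R \<circ> h) has_sum partial_deriv j f x) (multi_idx n)" using has_sum_reindex[OF hinj] by blast
    moreover have "R \<circ> h = (\<lambda>m. real (Suc (m j)) * c (m(j := Suc (m j))) * (\<Prod>i<n. (x i - a i) ^ m i))"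
    proof
      fix m
      have "w (h m) = w m" unfolding w_def h_def by (intro prod.cong) auto
      moreover have "(\<Prod>i<n. (x i - a i) ^ m i) = t ^ m j * w m"
        unfolding w_def t_def using j by (subst prod.remove[of _ j]) auto
      moreover have "(h m) j = Suc (m j)" by (simp add: h_def)
      ultimately show "(R \<circ> h) m = real (Suc (m j)) * c (m(j := Suc (m j))) * (\<Prod>i<n. (x i - a i) ^ m i)"
        by (simp add: R_def h_def mult_ac)
    qed
    ultimately show ?thesis by (simp only:)
  qed
  thus ?thesis using e' unfolding power_series_at_def by blast
qed

text \<open>At the centre only the constant coefficient survives, and a partial derivative lowers
  all degrees by one.\<close>

lemma vanishes_upto_power_series:
  assumes "power_series_at n a e c f" "a \<in> Rn n" "e > 0"
    and "\<And>m. m \<in> multi_idx n \<Longrightarrow> (\<Sum>i<n. m i) < k \<Longrightarrow> c m = 0"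
  shows "vanishes_upto n a k f"
  using assms
proof (induction k arbitrary: e c f)
  case (Suc k)
  have A: "((\<lambda>m. c m * (\<Prod>i<n. (a i - a i) ^ m i)) has_sum f a) (multi_idx n)"
    by (rule Suc.prems(1)[unfolded power_series_at_def, rule_format]) (use Suc.prems in auto)
  have B: "c m * (\<Prod>i<n. (a i - a i) ^ m i) = 0" if m: "m \<in> multi_idx n" for m
  proof (cases "\<forall>i<n. m i = 0")
    case True
    hence "c m = 0" using Suc.prems(4)[OF m] by simp
    thus ?thesis by simp
  next
    case False
    then obtain i where "i < n" "m i > 0" by auto
    hence "(\<Prod>i<n. (a i - a i) ^ m i) = 0" by (intro prod_zero) auto
    thus ?thesis by simp
  qed
  have "((\<lambda>m. 0) has_sum f a) (multi_idx n)" by (rule iffD1[OF has_sum_cong[OF B] A])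
  hence fa: "f a = 0" by (rule has_sum_unique) (simp add: has_sum_0)
  have "vanishes_upto n a k (partial_deriv j f)" if j: "j < n" for j
  proof -
    obtain e' where e': "e' > 0" "power_series_at n a e' (\<lambda>m. real (Suc (m j)) * c (m(j := Suc (m j)))) (partial_deriv j f)"
      using power_series_at_partial_deriv[OF Suc.prems(1-3) j] by blast
    show ?thesis
    proof (rule Suc.IH[OF e'(2) Suc.prems(2) e'(1)])
      fix m assume m: "m \<in> multi_idx n" "(\<Sum>i<n. m i) < k"
      have "(\<Sum>i<n. (m(j := Suc (m j))) i) = Suc (m j) + (\<Sum>i\<in>{..<n}-{j}. m i)"
        using j by (subst sum.remove[of _ j]) auto
      also have "\<dots> = Suc (\<Sum>i<n. m i)" using j by (subst sum.remove[of _ j, of _ m]) auto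
      finally have "c (m(j := Suc (m j))) = 0"
        using m j by (intro Suc.prems(4)) (auto simp: multi_idx_def)
      thus "real (Suc (m j)) * c (m(j := Suc (m j))) = 0" by simp
    qed
  qed
  thus ?case using fa by simp
qed simp

lemma finite_multi_idx_degree_le: "finite {m \<in> multi_idx n. (\<Sum>i<n. m i) \<le> k}"
proof (rule finite_subset)
  show "{m \<in> multi_idx n. (\<Sum>i<n. m i) \<le> k} \<subseteq> {f. \<forall>x. (x \<in> {..<n} \<longrightarrow> f x \<in> {..k}) \<and> (x \<notin> {..<n} \<longrightarrow> f x = 0)}"
  proof (intro subsetI CollectI allI conjI impI)
    fix m i assume m: "m \<in> {m \<in> multi_idx n. (\<Sum>i<n. m i) \<le> k}"
    { assume i: "i \<in> {..<n}"
      have "m i \<le> (\<Sum>i<n. m i)" by (rule member_le_sum) (use i in auto)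
      thus "m i \<in> {..k}" using m by auto }
    { assume i: "i \<notin> {..<n}"
      thus "m i = 0" using m by (auto simp: multi_idx_def) }
  qed
  show "finite {f. \<forall>x. (x \<in> {..<n} \<longrightarrow> f x \<in> {..k}) \<and> (x \<notin> {..<n} \<longrightarrow> f x = (0::nat))}"
    by (rule finite_set_of_finite_funs) auto
qed

text \<open>Words of length at most k do not see this difference. Hence the term of order k in the
  expansion of f depends only on its Taylor polynomial of degree k.\<close>

lemma taylor_remainder_vanishes:
  assumes ps: "power_series_at n a e c f" and a: "a \<in> Rn n" and e: "e > 0"
  shows "vanishes_upto n a (Suc k)
    (\<lambda>x. f x - (\<Sum>m\<in>{m \<in> multi_idx n. (\<Sum>i<n. m i) \<le> k}. c m * (\<Prod>i<n. (x i - a i) ^ m i)))"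
proof (rule vanishes_upto_power_series[OF _ a e])
  let ?A = "{m \<in> multi_idx n. (\<Sum>i<n. m i) \<le> k}"
  show "power_series_at n a e (\<lambda>m. if (\<Sum>i<n. m i) \<le> k then 0 else c m)
    (\<lambda>x. f x - (\<Sum>m\<in>?A. c m * (\<Prod>i<n. (x i - a i) ^ m i)))"
    unfolding power_series_at_def
  proof (intro ballI impI)
    fix x assume x: "x \<in> Rn n" "edist n x a < e"
    let ?t = "\<lambda>m. c m * (\<Prod>i<n. (x i - a i) ^ m i)"
    have 1: "(?t has_sum f x) (multi_idx n)" using ps x by (simp add: power_series_at_def)
    have "(?t has_sum (\<Sum>m\<in>?A. ?t m)) ?A" by (rule has_sum_finite[OF finite_multi_idx_degree_le])
    moreover have "(?t has_sum (\<Sum>m\<in>?A. ?t m)) ?A \<longleftrightarrow>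
        ((\<lambda>m. if (\<Sum>i<n. m i) \<le> k then ?t m else 0) has_sum (\<Sum>m\<in>?A. ?t m)) (multi_idx n)"
      by (rule has_sum_cong_neutral) auto
    ultimately have 2: "((\<lambda>m. if (\<Sum>i<n. m i) \<le> k then ?t m else 0) has_sum (\<Sum>m\<in>?A. ?t m)) (multi_idx n)"
      by blast
    have 3: "((\<lambda>m. ?t m - (if (\<Sum>i<n. m i) \<le> k then ?t m else 0)) has_sum (f x - (\<Sum>m\<in>?A. ?t m))) (multi_idx n)"
      using has_sum_add[OF 1 has_sum_cmult_right[OF 2, of "-1"]] by simp
    have 4: "?t m - (if (\<Sum>i<n. m i) \<le> k then ?t m else 0) =
        (if (\<Sum>i<n. m i) \<le> k then 0 else c m) * (\<Prod>i<n. (x i - a i) ^ m i)" for m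
      by simp
    show "((\<lambda>m. (if (\<Sum>i<n. m i) \<le> k then 0 else c m) * (\<Prod>i<n. (x i - a i) ^ m i)) has_sum
       (f x - (\<Sum>m\<in>?A. ?t m))) (multi_idx n)"
      using 3 unfolding 4 .
  qed
qed auto

section \<open>The formal Taylor expansion along the path\<close>

definition word_apply ::
  "nat \<Rightarrow> (nat \<Rightarrow> (nat \<Rightarrow> real) \<Rightarrow> (nat \<Rightarrow> real)) \<Rightarrow> nat list \<Rightarrow> ((nat \<Rightarrow> real) \<Rightarrow> real) \<Rightarrow> (nat \<Rightarrow> real) \<Rightarrow> real"
  where "word_apply n V I f = foldr (\<lambda>i. field_apply n (V i)) I f"

lemma word_apply_Nil [simp]: "word_apply n V [] f = f"
  by (simp add: word_apply_def)

lemma word_apply_Cons: "word_apply n V (i # I) f = field_apply n (V i) (word_apply n V I f)"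
  by (simp add: word_apply_def)

lemma word_apply_snoc: "word_apply n V (I @ [i]) f = word_apply n V I (field_apply n (V i) f)"
  by (simp add: word_apply_def)

definition words :: "nat \<Rightarrow> nat \<Rightarrow> nat list set" where
  "words d k = {I. set I \<subseteq> {..d} \<and> length I = k}"

lemma finite_words: "finite (words d k)"
  unfolding words_def by (rule finite_lists_length_eq) simp

lemma card_words: "card (words d k) = (d + 1) ^ k"
  unfolding words_def using card_lists_length_eq[of "{..d}" k] by simp

lemma words_0: "words d 0 = {[]}"
  by (auto simp: words_def)

lemma sum_words_Suc: "(\<Sum>I\<in>words d (Suc k). F I) = (\<Sum>i\<le>d. \<Sum>I\<in>words d k. F (I @ [i]))"
proof -
  have im: "words d (Suc k) = (\<lambda>(i, I). I @ [i]) ` ({..d} \<times> words d k)"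
  proof (intro equalityI subsetI)
    fix J assume J: "J \<in> words d (Suc k)"
    then obtain I i where "J = I @ [i]" by (cases J rule: rev_cases) (auto simp: words_def)
    thus "J \<in> (\<lambda>(i, I). I @ [i]) ` ({..d} \<times> words d k)" using J by (auto simp: words_def)
  qed (auto simp: words_def)
  have inj: "inj_on (\<lambda>(i, I). I @ [i]) ({..d} \<times> words d k)" by (auto simp: inj_on_def)
  show ?thesis unfolding im sum.reindex[OF inj] by (simp add: sum.cartesian_product split_def)
qed

locale driven_fields = holder_driver +
  fixes n :: nat and V :: "nat \<Rightarrow> (nat \<Rightarrow> real) \<Rightarrow> (nat \<Rightarrow> real)" and x0 :: "nat \<Rightarrow> real"
  assumes x0: "x0 \<in> Rn n" and V_smooth: "\<And>i j. i \<le> d \<Longrightarrow> j < n \<Longrightarrow> coord_smooth n (\<lambda>x. V i x j)"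
begin

definition Phi :: "nat \<Rightarrow> ((nat \<Rightarrow> real) \<Rightarrow> real) \<Rightarrow> real \<Rightarrow> real" where
  "Phi k f s = (\<Sum>I\<in>words d k. word_apply n V I f x0 * simplex_integral y I s)"

lemma Phi_0: "Phi 0 f s = f x0"
  by (simp add: Phi_def words_0)

lemma g_term_eq: "g_term n d V x0 y k t j = Phi k (\<lambda>x. x j) t"
  by (simp add: g_term_def Phi_def words_def P_word_def word_apply_def)

lemma th_half: "1 - \<alpha> > 1/2" and th_pos: "1 - \<alpha> > 0" "1 - \<alpha> > 0" "1 - \<alpha> + (1 - \<alpha>) > 1"
  using al_half by auto

lemma coord_smooth_V: "coord_smooth n f \<Longrightarrow> i \<le> d \<Longrightarrow> coord_smooth n (field_apply n (V i) f)"
  by (rule coord_smooth_field_apply) (auto intro: V_smooth)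

lemma word_apply_cong:
  assumes "\<And>x. x \<in> Rn n \<Longrightarrow> f x = g x" "x \<in> Rn n"
  shows "word_apply n V I f x = word_apply n V I g x"
  using assms(2)
proof (induction I arbitrary: x)
  case (Cons i I)
  thus ?case unfolding word_apply_Cons by (intro field_apply_cong) auto
qed (use assms in simp)

lemma word_apply_add:
  assumes "coord_smooth n f" "coord_smooth n g" "set I \<subseteq> {..d}"
  shows "word_apply n V I (\<lambda>x. f x + g x) x0 = word_apply n V I f x0 + word_apply n V I g x0"
  using assms
proof (induction I arbitrary: f g rule: rev_induct)
  case (snoc i I)
  have "word_apply n V I (field_apply n (V i) (\<lambda>x. f x + g x)) x0
      = word_apply n V I (\<lambda>x. field_apply n (V i) f x + field_apply n (V i) g x) x0"
    by (rule word_apply_cong[OF field_apply_add x0]) (use snoc in auto)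
  also have "\<dots> = word_apply n V I (field_apply n (V i) f) x0 + word_apply n V I (field_apply n (V i) g) x0"
    using snoc.prems by (intro snoc.IH coord_smooth_V) auto
  finally show ?case by (simp add: word_apply_snoc)
qed simp

lemma word_apply_const: "I \<noteq> [] \<Longrightarrow> word_apply n V I (\<lambda>x. c) x0 = 0"
proof (induction I arbitrary: c rule: rev_induct)
  case (snoc i I)
  thus ?case by (cases "I = []") (auto simp: word_apply_snoc word_apply_Cons)
qed simp

text \<open>Each letter spends one order of vanishing; from \<open>Suc k\<close> orders at least one
  is left for the evaluation at x0.\<close>

lemma word_apply_vanishes:
  assumes "coord_smooth n f" "vanishes_upto n x0 (Suc k) f" "length I \<le> k" "set I \<subseteq> {..d}"
  shows "word_apply n V I f x0 = 0"
  using assms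
proof (induction I arbitrary: f k rule: rev_induct)
  case (snoc i I)
  then obtain k' where k: "k = Suc k'" "length I \<le> k'" by (cases k) auto
  have "vanishes_upto n x0 (Suc k') (field_apply n (V i) f)"
    using snoc.prems k x0 V_smooth by (intro vanishes_upto_field_apply) auto
  thus ?case unfolding word_apply_snoc using snoc.prems k by (intro snoc.IH coord_smooth_V) auto
qed simp

lemma holder_on_simplex_integral:
  assumes T: "T > 0" and I: "set I \<subseteq> {..d}"
  shows "\<exists>H. holder_on 0 T (1 - \<alpha>) H (simplex_integral y I)"
proof -
  define L where "L = holder_factor * \<Lambda> T"
  have L0: "L \<ge> 0" using holder_factor_pos Lambda_nonneg T by (simp add: L_def)
  have "bielecki 1 (1 - \<alpha>) ((bielecki_const (1 - \<alpha>) * L * 1 powr (- (1 - \<alpha>))) ^ length I) T (simplex_integral y I)"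
  proof (rule bielecki_simplex_integral[OF th_half _ L0])
    show "holder_on 0 T (1 - \<alpha>) L (\<lambda>s. y s i)" if "i \<in> set I" for i
      unfolding L_def using holder_on_driver_Lambda[OF T, of i] that I by auto
  qed simp
  from bielecki_hol[OF this, of 0 T] show ?thesis using L0 bielecki_const_pos[OF th_half] by auto
qed

lemma holder_on_Phi:
  assumes T: "T > 0"
  shows "\<exists>H. holder_on 0 T (1 - \<alpha>) H (Phi k f)"
proof -
  have "\<forall>I\<in>words d k. \<exists>H. holder_on 0 T (1 - \<alpha>) H (simplex_integral y I)"
    using holder_on_simplex_integral[OF T] by (auto simp: words_def)
  then obtain H where H: "\<And>I. I \<in> words d k \<Longrightarrow> holder_on 0 T (1 - \<alpha>) (H I) (simplex_integral y I)" by metis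
  have "holder_on 0 T (1 - \<alpha>) (\<Sum>I\<in>words d k. \<bar>word_apply n V I f x0\<bar> * H I) (Phi k f)"
    unfolding Phi_def[abs_def] by (intro holder_on_sum finite_words holder_on_cmult H)
  thus ?thesis by blast
qed

lemma young_integral_exists_driver:
  assumes "holder_on 0 t (1 - \<alpha>) H f" "0 \<le> t" "i \<le> d"
  shows "has_young_integral f (\<lambda>s. y s i) 0 t (young_integral f (\<lambda>s. y s i) 0 t)"
proof (cases "t = 0")
  case True
  thus ?thesis by (simp add: has_young_integral_refl)
next
  case False
  hence t: "t > 0" using assms by simp
  show ?thesis by (rule young_integral_exists[OF _ assms(1) holder_on_driver_Lambda[OF t assms(3)] th_pos]) (use assms in auto)
qed

text \<open>The last letter acts first on f and is integrated last, so splitting it off serves both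
  factors at once. The result is the change of variables formula, graded by order: d Phi(f) is the
  sum of Phi(V i f) dy i.\<close>

lemma Phi_Suc:
  assumes t: "t \<ge> 0"
  shows "Phi (Suc k) f t = (\<Sum>i\<le>d. young_integral (Phi k (field_apply n (V i) f)) (\<lambda>s. y s i) 0 t)"
proof (cases "t = 0")
  case True
  thus ?thesis unfolding Phi_def sum_words_Suc simplex_integral_snoc by simp
next
  case False
  hence T: "t > 0" using t by simp
  have "young_integral (Phi k (field_apply n (V i) f)) (\<lambda>s. y s i) 0 t
      = (\<Sum>I\<in>words d k. word_apply n V (I @ [i]) f x0 * simplex_integral y (I @ [i]) t)" if i: "i \<le> d" for i
  proof (rule young_integral_eqI[OF t])
    show "has_young_integral (Phi k (field_apply n (V i) f)) (\<lambda>s. y s i) 0 t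
       (\<Sum>I\<in>words d k. word_apply n V (I @ [i]) f x0 * simplex_integral y (I @ [i]) t)"
      unfolding Phi_def[abs_def] word_apply_snoc simplex_integral_snoc
    proof (intro has_young_integral_sum finite_words has_young_integral_cmult)
      fix I assume "I \<in> words d k"
      then obtain H where "holder_on 0 t (1 - \<alpha>) H (simplex_integral y I)"
        using holder_on_simplex_integral[OF T, of I] by (auto simp: words_def)
      thus "has_young_integral (simplex_integral y I) (\<lambda>s. y s i) 0 t
          (young_integral (simplex_integral y I) (\<lambda>s. y s i) 0 t)"
        by (rule young_integral_exists_driver[OF _ t i])
    qed
  qed
  thus ?thesis unfolding Phi_def[of "Suc k"] sum_words_Suc by simp
qed

lemma Phi_Suc_zero_time: "Phi (Suc k) f 0 = 0"
  by (simp add: Phi_Suc)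

lemma Phi_add:
  assumes "coord_smooth n f" "coord_smooth n g"
  shows "Phi k (\<lambda>x. f x + g x) s = Phi k f s + Phi k g s"
  unfolding Phi_def sum.distrib[symmetric] using word_apply_add[OF assms]
  by (intro sum.cong) (auto simp: words_def algebra_simps)

lemma Phi_const: "Phi k (\<lambda>x. c) s = (if k = 0 then c else 0)"
proof (cases k)
  case (Suc k')
  have "Phi k (\<lambda>x. c) s = 0"
    unfolding Phi_def by (intro sum.neutral) (auto simp: words_def Suc intro!: word_apply_const)
  thus ?thesis using Suc by simp
qed (simp add: Phi_0)

lemma Phi_cong:
  assumes "\<And>x. x \<in> Rn n \<Longrightarrow> f x = g x"
  shows "Phi k f s = Phi k g s"
proof -
  have "word_apply n V I f x0 = word_apply n V I g x0" for I by (rule word_apply_cong[OF assms x0])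
  thus ?thesis by (simp add: Phi_def)
qed

lemma Phi_sum:
  assumes "finite A" "\<And>i. i \<in> A \<Longrightarrow> coord_smooth n (f i)"
  shows "Phi k (\<lambda>x. \<Sum>i\<in>A. f i x) s = (\<Sum>i\<in>A. Phi k (f i) s)"
  using assms
proof (induction A rule: finite_induct)
  case empty
  thus ?case using Phi_const[of k 0 s] by simp
next
  case (insert i A)
  thus ?case using Phi_add[of "f i" "\<lambda>x. \<Sum>i\<in>A. f i x"] coord_smooth_sum[of A n f] by auto
qed

lemma Phi_vanishes:
  assumes "coord_smooth n f" "vanishes_upto n x0 (Suc k) f"
  shows "Phi k f s = 0"
  unfolding Phi_def using word_apply_vanishes[OF assms] by (intro sum.neutral) (auto simp: words_def)

text \<open>Associativity rewrites an integral against \<open>Phi (Suc k) g\<close> as integrals of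
  products against y, the form in which it can be matched with the Leibniz rule.\<close>

lemma young_integral_Phi_Suc_integrator:
  assumes T: "T > 0" and f: "holder_on 0 T (1 - \<alpha>) H f"
  shows "young_integral f (Phi (Suc k) g) 0 T =
    (\<Sum>i\<le>d. young_integral (\<lambda>s. f s * Phi k (field_apply n (V i) g) s) (\<lambda>s. y s i) 0 T)"
proof -
  define G where "G = (\<lambda>i t. young_integral (Phi k (field_apply n (V i) g)) (\<lambda>s. y s i) 0 t)"
  have step: "has_young_integral f (G i) 0 T
      (young_integral (\<lambda>s. f s * Phi k (field_apply n (V i) g) s) (\<lambda>s. y s i) 0 T)" if i: "i \<le> d" for i
  proof -
    obtain H' where H': "holder_on 0 T (1 - \<alpha>) H' (Phi k (field_apply n (V i) g))" using holder_on_Phi[OF T] by blast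
    have B: "\<bar>Phi k (field_apply n (V i) g) u\<bar> \<le> \<bar>Phi k (field_apply n (V i) g) 0\<bar> + H' * (T - 0) powr (1 - \<alpha>)"
      if "0 \<le> u" "u \<le> T" for u by (rule holder_on_bounded[OF H' th_pos(1) that])
    have hG: "holder_on 0 T (1 - \<alpha>) ((\<bar>Phi k (field_apply n (V i) g) 0\<bar> + H' * (T - 0) powr (1 - \<alpha>) +
        young_const (1 - \<alpha> + (1 - \<alpha>)) * H' * (T - 0) powr (1 - \<alpha>)) * (holder_factor * \<Lambda> T)) (G i)"
      unfolding G_def using holder_on_nonneg[OF H']
      by (intro holder_on_young_integral[OF H' holder_on_driver_Lambda[OF T i] th_pos B]) auto
    have "has_young_integral f (G i) 0 T (young_integral f (G i) 0 T)"
      by (rule young_integral_exists[OF _ f hG th_pos]) (use T in auto)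
    also have "young_integral f (G i) 0 T = young_integral (\<lambda>s. f s * Phi k (field_apply n (V i) g) s) (\<lambda>s. y s i) 0 T"
      unfolding G_def
      by (rule young_integral_associative[OF _ th_half f H' holder_on_driver_Lambda[OF T i]]) (use T in auto)
    finally show ?thesis .
  qed
  have sum: "has_young_integral f (\<lambda>t. \<Sum>i\<le>d. G i t) 0 T
      (\<Sum>i\<le>d. young_integral (\<lambda>s. f s * Phi k (field_apply n (V i) g) s) (\<lambda>s. y s i) 0 T)"
    by (intro has_young_integral_integrator_sum step) auto
  have "has_young_integral f (Phi (Suc k) g) 0 T
      (\<Sum>i\<le>d. young_integral (\<lambda>s. f s * Phi k (field_apply n (V i) g) s) (\<lambda>s. y s i) 0 T)"
    using has_young_integral_cong[OF refl, of 0 T "\<lambda>t. \<Sum>i\<le>d. G i t" "Phi (Suc k) g" f] sum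
    by (simp add: Phi_Suc G_def)
  thus ?thesis using T by (intro young_integral_eqI) auto
qed

text \<open>Young integration by parts and the Leibniz rule: \<open>Phi\<close> is multiplicative. This replaces the
  shuffle relations between iterated integrals.\<close>

lemma Phi_mult:
  assumes "coord_smooth n f" "coord_smooth n g" "t \<ge> 0"
  shows "Phi k (\<lambda>x. f x * g x) t = (\<Sum>a\<le>k. Phi a f t * Phi (k - a) g t)"
  using assms
proof (induction k arbitrary: f g t)
  case 0
  thus ?case by (simp add: Phi_0)
next
  case (Suc k)
  note f = Suc.prems(1) and g = Suc.prems(2)
  show ?case
  proof (cases "t = 0")
    case True
    have "(\<Sum>a\<le>Suc k. Phi a f 0 * Phi (Suc k - a) g 0) = 0"
    proof (intro sum.neutral ballI)
      fix a assume "a \<in> {..Suc k}"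
      thus "Phi a f 0 * Phi (Suc k - a) g 0 = 0"
        by (cases a; cases "Suc k - a") (auto simp: Phi_Suc_zero_time)
    qed
    thus ?thesis using True by (simp add: Phi_Suc_zero_time)
  next
    case False
    hence T: "t > 0" using Suc.prems by simp
    have parts: "Phi a f t * Phi b g t - Phi a f 0 * Phi b g 0 =
        young_integral (Phi a f) (Phi b g) 0 t + young_integral (Phi b g) (Phi a f) 0 t" for a b
    proof -
      obtain H H' where "holder_on 0 t (1 - \<alpha>) H (Phi a f)" "holder_on 0 t (1 - \<alpha>) H' (Phi b g)"
        using holder_on_Phi[OF T] by metis
      from young_integration_by_parts[OF _ th_half this] T show ?thesis by simp
    qed
    \<comment> \<open>\<open>Phi 0\<close> is constant in time, so the summands in which it is the
      integrator drop out; this brings the range of summation from \<open>Suc k\<close> down to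
      k.\<close>
    have dconst: "young_integral h (Phi 0 f') 0 t = 0" for h f'
    proof -
      have "Phi 0 f' = (\<lambda>_. f' x0)" by (auto simp: Phi_0)
      thus ?thesis using T young_integral_eqI[OF _ has_young_integral_integrator_const] by simp
    qed
    define A where "A = (\<lambda>i a s. Phi a f s * Phi (k - a) (field_apply n (V i) g) s)"
    define B where "B = (\<lambda>i a s. Phi (k - a) g s * Phi a (field_apply n (V i) f) s)"
    have holp: "\<exists>H. holder_on 0 t (1 - \<alpha>) H (\<lambda>s. Phi a f1 s * Phi b f2 s)" for a b f1 f2
    proof -
      obtain H1 H2 where H: "holder_on 0 t (1 - \<alpha>) H1 (Phi a f1)" "holder_on 0 t (1 - \<alpha>) H2 (Phi b f2)"
        using holder_on_Phi[OF T] by metis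
      from holder_on_mult[OF H holder_on_bounded[OF H(1) th_pos(1)] holder_on_bounded[OF H(2) th_pos(1)]]
      show ?thesis using H[THEN holder_on_nonneg] by (intro exI) auto
    qed
    have hyA: "has_young_integral (A i a) (\<lambda>s. y s i) 0 t (young_integral (A i a) (\<lambda>s. y s i) 0 t)"
      and hyB: "has_young_integral (B i a) (\<lambda>s. y s i) 0 t (young_integral (B i a) (\<lambda>s. y s i) 0 t)"
      if i: "i \<le> d" for i a
    proof -
      obtain H where "holder_on 0 t (1 - \<alpha>) H (A i a)" using holp unfolding A_def by blast
      thus "has_young_integral (A i a) (\<lambda>s. y s i) 0 t (young_integral (A i a) (\<lambda>s. y s i) 0 t)"
        by (rule young_integral_exists_driver) (use T i in auto)
      obtain H where "holder_on 0 t (1 - \<alpha>) H (B i a)" using holp unfolding B_def by blast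
      thus "has_young_integral (B i a) (\<lambda>s. y s i) 0 t (young_integral (B i a) (\<lambda>s. y s i) 0 t)"
        by (rule young_integral_exists_driver) (use T i in auto)
    qed
    have "(\<Sum>a\<le>Suc k. Phi a f t * Phi (Suc k - a) g t)
        = (\<Sum>a\<le>Suc k. young_integral (Phi a f) (Phi (Suc k - a) g) 0 t)
        + (\<Sum>a\<le>Suc k. young_integral (Phi (Suc k - a) g) (Phi a f) 0 t)"
      unfolding sum.distrib[symmetric]
    proof (intro sum.cong refl)
      fix a assume "a \<in> {..Suc k}"
      hence "Phi a f 0 * Phi (Suc k - a) g 0 = 0"
        by (cases a; cases "Suc k - a") (auto simp: Phi_Suc_zero_time)
      thus "Phi a f t * Phi (Suc k - a) g t = young_integral (Phi a f) (Phi (Suc k - a) g) 0 t +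
          young_integral (Phi (Suc k - a) g) (Phi a f) 0 t"
        using parts[of a "Suc k - a"] by linarith
    qed
    also have "(\<Sum>a\<le>Suc k. young_integral (Phi a f) (Phi (Suc k - a) g) 0 t)
        = (\<Sum>a\<le>k. young_integral (Phi a f) (Phi (Suc (k - a)) g) 0 t)"
      by (simp add: dconst Suc_diff_le)
    also have "\<dots> = (\<Sum>a\<le>k. \<Sum>i\<le>d. young_integral (A i a) (\<lambda>s. y s i) 0 t)"
    proof (intro sum.cong refl)
      fix a
      obtain H where "holder_on 0 t (1 - \<alpha>) H (Phi a f)" using holder_on_Phi[OF T] by blast
      from young_integral_Phi_Suc_integrator[OF T this]
      show "young_integral (Phi a f) (Phi (Suc (k - a)) g) 0 t = (\<Sum>i\<le>d. young_integral (A i a) (\<lambda>s. y s i) 0 t)"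
        by (simp add: A_def)
    qed
    also have "(\<Sum>a\<le>Suc k. young_integral (Phi (Suc k - a) g) (Phi a f) 0 t)
        = (\<Sum>a\<le>k. young_integral (Phi (k - a) g) (Phi (Suc a) f) 0 t)"
      by (subst sum.atMost_Suc_shift) (simp add: dconst)
    also have "\<dots> = (\<Sum>a\<le>k. \<Sum>i\<le>d. young_integral (B i a) (\<lambda>s. y s i) 0 t)"
    proof (intro sum.cong refl)
      fix a
      obtain H where "holder_on 0 t (1 - \<alpha>) H (Phi (k - a) g)" using holder_on_Phi[OF T] by blast
      from young_integral_Phi_Suc_integrator[OF T this]
      show "young_integral (Phi (k - a) g) (Phi (Suc a) f) 0 t = (\<Sum>i\<le>d. young_integral (B i a) (\<lambda>s. y s i) 0 t)"
        by (simp add: B_def)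
    qed
    finally have R: "(\<Sum>a\<le>Suc k. Phi a f t * Phi (Suc k - a) g t) =
       (\<Sum>i\<le>d. (\<Sum>a\<le>k. young_integral (A i a) (\<lambda>s. y s i) 0 t) + (\<Sum>a\<le>k. young_integral (B i a) (\<lambda>s. y s i) 0 t))"
      unfolding sum.distrib sum.swap[of _ "{..k}" "{..d}"] .
    have "Phi (Suc k) (\<lambda>x. f x * g x) t =
       (\<Sum>i\<le>d. young_integral (Phi k (field_apply n (V i) (\<lambda>x. f x * g x))) (\<lambda>s. y s i) 0 t)"
      using T by (intro Phi_Suc) simp
    also have "\<dots> = (\<Sum>i\<le>d. (\<Sum>a\<le>k. young_integral (A i a) (\<lambda>s. y s i) 0 t) + (\<Sum>a\<le>k. young_integral (B i a) (\<lambda>s. y s i) 0 t))"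
    proof (intro sum.cong refl)
      fix i assume "i \<in> {..d}"
      hence i: "i \<le> d" by simp
      have vf: "coord_smooth n (field_apply n (V i) f)" and vg: "coord_smooth n (field_apply n (V i) g)"
        using f g i coord_smooth_V by auto
      have eq: "Phi k (field_apply n (V i) (\<lambda>x. f x * g x)) s = (\<Sum>a\<le>k. B i a s) + (\<Sum>a\<le>k. A i a s)" if s: "0 \<le> s" for s
      proof -
        have "Phi k (field_apply n (V i) (\<lambda>x. f x * g x)) s
           = Phi k (\<lambda>x. field_apply n (V i) f x * g x + f x * field_apply n (V i) g x) s"
          by (rule Phi_cong) (rule field_apply_mult[OF f g])
        also have "\<dots> = Phi k (\<lambda>x. field_apply n (V i) f x * g x) s + Phi k (\<lambda>x. f x * field_apply n (V i) g x) s"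
          by (intro Phi_add coord_smooth_mult f g vf vg)
        also have "\<dots> = (\<Sum>a\<le>k. Phi a (field_apply n (V i) f) s * Phi (k - a) g s) +
           (\<Sum>a\<le>k. Phi a f s * Phi (k - a) (field_apply n (V i) g) s)"
          using Suc.IH[OF vf g s] Suc.IH[OF f vg s] by simp
        finally show ?thesis by (simp add: A_def B_def mult.commute)
      qed
      have "has_young_integral (\<lambda>s. (\<Sum>a\<le>k. B i a s) + (\<Sum>a\<le>k. A i a s)) (\<lambda>s. y s i) 0 t
          ((\<Sum>a\<le>k. young_integral (B i a) (\<lambda>s. y s i) 0 t) + (\<Sum>a\<le>k. young_integral (A i a) (\<lambda>s. y s i) 0 t))"
        by (intro has_young_integral_add has_young_integral_sum hyA hyB i) auto
      hence "has_young_integral (Phi k (field_apply n (V i) (\<lambda>x. f x * g x))) (\<lambda>s. y s i) 0 t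
          ((\<Sum>a\<le>k. young_integral (B i a) (\<lambda>s. y s i) 0 t) + (\<Sum>a\<le>k. young_integral (A i a) (\<lambda>s. y s i) 0 t))"
        by (rule iffD1[OF has_young_integral_cong, rotated -1]) (simp_all add: eq)
      from young_integral_eqI[OF _ this] T
      show "young_integral (Phi k (field_apply n (V i) (\<lambda>x. f x * g x))) (\<lambda>s. y s i) 0 t =
        (\<Sum>a\<le>k. young_integral (A i a) (\<lambda>s. y s i) 0 t) + (\<Sum>a\<le>k. young_integral (B i a) (\<lambda>s. y s i) 0 t)"
        by simp
    qed
    finally show ?thesis using R by simp
  qed
qed

section \<open>Generating series in the scaling parameter\<close>

definition Psi :: "real \<Rightarrow> ((nat \<Rightarrow> real) \<Rightarrow> real) \<Rightarrow> complex fps" where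
  "Psi s f = Abs_fps (\<lambda>k. complex_of_real (Phi k f s))"

lemma Psi_nth [simp]: "Psi s f $ k = complex_of_real (Phi k f s)"
  by (simp add: Psi_def)

lemma Psi_mult:
  assumes "coord_smooth n f" "coord_smooth n g" "s \<ge> 0"
  shows "Psi s (\<lambda>x. f x * g x) = Psi s f * Psi s g"
  by (rule fps_ext) (simp add: Phi_mult[OF assms] fps_mult_nth atLeast0AtMost)

lemma Psi_const: "Psi s (\<lambda>x. c) = fps_const (complex_of_real c)"
  by (rule fps_ext) (simp add: Phi_const)

lemma Psi_diff_const:
  assumes "coord_smooth n f"
  shows "Psi s (\<lambda>x. f x - c) = Psi s f - fps_const (complex_of_real c)"
proof (rule fps_ext)
  fix k
  have "Phi k (\<lambda>x. f x + (- c)) s = Phi k f s + Phi k (\<lambda>x. - c) s"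
    by (rule Phi_add[OF assms coord_smooth_const])
  thus "Psi s (\<lambda>x. f x - c) $ k = (Psi s f - fps_const (complex_of_real c)) $ k" by (simp add: Phi_const)
qed

lemma Psi_power:
  assumes "coord_smooth n f" "s \<ge> 0"
  shows "Psi s (\<lambda>x. f x ^ m) = Psi s f ^ m"
  by (induction m) (use assms in \<open>auto simp: Psi_const Psi_mult coord_smooth_power\<close>)

lemma Psi_prod:
  assumes "finite A" "\<And>i. i \<in> A \<Longrightarrow> coord_smooth n (f i)" "s \<ge> 0"
  shows "Psi s (\<lambda>x. \<Prod>i\<in>A. f i x) = (\<Prod>i\<in>A. Psi s (f i))"
  using assms
  by (induction A rule: finite_induct) (auto simp: Psi_const Psi_mult coord_smooth_prod)

definition monomial_fps :: "real \<Rightarrow> (nat \<Rightarrow> nat) \<Rightarrow> complex fps" where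
  "monomial_fps s m = (\<Prod>i<n. (Psi s (\<lambda>x. x i) - fps_const (complex_of_real (x0 i))) ^ m i)"

lemma Psi_monomial:
  assumes "s \<ge> 0"
  shows "Psi s (\<lambda>x. \<Prod>i<n. (x i - x0 i) ^ m i) = monomial_fps s m"
proof -
  have "Psi s (\<lambda>x. \<Prod>i<n. (x i - x0 i) ^ m i) = (\<Prod>i<n. Psi s (\<lambda>x. (x i - x0 i) ^ m i))"
    by (intro Psi_prod assms coord_smooth_power coord_smooth_diff coord_smooth_coord coord_smooth_const) simp
  also have "\<dots> = monomial_fps s m"
    unfolding monomial_fps_def
    by (intro prod.cong refl, subst Psi_power)
      (auto simp: Psi_diff_const coord_smooth_coord assms intro!: coord_smooth_diff coord_smooth_const)
  finally show ?thesis .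
qed

text \<open>The term of order 0 of the coordinate x i is x0 i. So each factor has constant
  coefficient 0 and is divisible by \<open>fps_X\<close>.\<close>

lemma monomial_fps_nth_eq_0:
  assumes "k < (\<Sum>i<n. m i)"
  shows "monomial_fps s m $ k = 0"
proof -
  define Q where "Q = (\<lambda>i. Psi s (\<lambda>x. x i) - fps_const (complex_of_real (x0 i)))"
  have Q: "Q i = fps_X * fps_shift 1 (Q i)" for i
  proof (rule fps_ext)
    fix k show "Q i $ k = (fps_X * fps_shift 1 (Q i)) $ k"
      by (cases k) (auto simp: Q_def Phi_0)
  qed
  have "monomial_fps s m = (\<Prod>i<n. fps_X ^ m i * fps_shift 1 (Q i) ^ m i)"
  proof -
    have "Psi s (\<lambda>x. x i) - fps_const (complex_of_real (x0 i)) = Q i" for i by (simp add: Q_def)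
    moreover have "Q i ^ m i = fps_X ^ m i * fps_shift 1 (Q i) ^ m i" for i by (metis Q power_mult_distrib)
    ultimately show ?thesis unfolding monomial_fps_def by (intro prod.cong refl) (simp only:)
  qed
  also have "\<dots> = fps_X ^ (\<Sum>i<n. m i) * (\<Prod>i<n. fps_shift 1 (Q i) ^ m i)"
    by (simp add: prod.distrib power_sum)
  finally show ?thesis using assms by (simp add: fps_X_power_mult_nth)
qed

text \<open>A finite identity of coefficients: words of length k kill the Taylor remainder beyond
  degree k, and on polynomials the multiplicativity of \<open>Psi\<close> turns monomials into
  products of the coordinate series.\<close>

lemma Phi_eq_taylor:
  assumes f: "coord_smooth n f" and ps: "power_series_at n x0 e c f" and e: "e > 0" and s: "s \<ge> 0"
  shows "complex_of_real (Phi k f s) =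
    (\<Sum>m\<in>{m \<in> multi_idx n. (\<Sum>i<n. m i) \<le> k}. complex_of_real (c m) * monomial_fps s m $ k)"
proof -
  let ?A = "{m \<in> multi_idx n. (\<Sum>i<n. m i) \<le> k}"
  let ?mon = "\<lambda>m x. \<Prod>i<n. (x i - x0 i) ^ m i"
  let ?P = "\<lambda>x. \<Sum>m\<in>?A. c m * ?mon m x"
  have sm: "coord_smooth n (?mon m)" for m
    by (intro coord_smooth_prod coord_smooth_power coord_smooth_diff coord_smooth_coord coord_smooth_const) simp
  have sP: "coord_smooth n ?P"
    by (intro coord_smooth_sum coord_smooth_mult coord_smooth_const sm finite_multi_idx_degree_le)
  have sR: "coord_smooth n (\<lambda>x. f x - ?P x)" by (intro coord_smooth_diff f sP)
  have "Phi k f s = Phi k (\<lambda>x. (f x - ?P x) + ?P x) s" by simp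
  also have "\<dots> = Phi k (\<lambda>x. f x - ?P x) s + Phi k ?P s" by (rule Phi_add[OF sR sP])
  also have "Phi k (\<lambda>x. f x - ?P x) s = 0"
    by (rule Phi_vanishes[OF sR taylor_remainder_vanishes[OF ps x0 e]])
  also have "Phi k ?P s = (\<Sum>m\<in>?A. Phi k (\<lambda>x. c m * ?mon m x) s)"
    by (intro Phi_sum coord_smooth_mult coord_smooth_const sm finite_multi_idx_degree_le)
  finally have "Phi k f s = (\<Sum>m\<in>?A. Phi k (\<lambda>x. c m * ?mon m x) s)" by simp
  moreover have "complex_of_real (Phi k (\<lambda>x. c m * ?mon m x) s) = complex_of_real (c m) * monomial_fps s m $ k" for m
  proof -
    have "Psi s (\<lambda>x. c m * ?mon m x) = fps_const (complex_of_real (c m)) * monomial_fps s m"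
      using Psi_mult[OF coord_smooth_const sm s] Psi_monomial[OF s] by (simp add: Psi_const)
    hence "Psi s (\<lambda>x. c m * ?mon m x) $ k = (fps_const (complex_of_real (c m)) * monomial_fps s m) $ k"
      by (rule arg_cong)
    thus ?thesis by simp
  qed
  ultimately show ?thesis by simp
qed

end

section \<open>Composition with the formal expansion\<close>

context driven_fields
begin

definition entire_at :: "real \<Rightarrow> ((nat \<Rightarrow> real) \<Rightarrow> real) \<Rightarrow> bool" where
  "entire_at s f \<longleftrightarrow> (\<forall>R\<ge>0. summable (\<lambda>k. \<bar>Phi k f s\<bar> * R ^ k))"

definition real_series :: "real \<Rightarrow> ((nat \<Rightarrow> real) \<Rightarrow> real) \<Rightarrow> real \<Rightarrow> real" where
  "real_series s f \<epsilon> = (\<Sum>k. Phi k f s * \<epsilon> ^ k)"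

text \<open>x0 plus the sum of \<epsilon> ^ k times the k-th Taylor vector at time s. Coordinates
  from n on are set to 0 to stay in \<open>Rn n\<close>.\<close>

definition path_point :: "real \<Rightarrow> real \<Rightarrow> nat \<Rightarrow> real" where
  "path_point s \<epsilon> = (\<lambda>i. if i < n then real_series s (\<lambda>x. x i) \<epsilon> else 0)"

lemma path_point_Rn: "path_point s \<epsilon> \<in> Rn n"
  by (simp add: path_point_def Rn_iff)

lemma entire_at_summable:
  assumes "entire_at s f"
  shows "summable (\<lambda>k. Phi k f s * \<epsilon> ^ k)"
proof (rule summable_norm_cancel)
  have "summable (\<lambda>k. \<bar>Phi k f s\<bar> * \<bar>\<epsilon>\<bar> ^ k)" using assms by (simp add: entire_at_def)
  thus "summable (\<lambda>k. norm (Phi k f s * \<epsilon> ^ k))" by (simp add: abs_mult power_abs)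
qed

lemma fps_conv_radius_Psi:
  assumes "entire_at s f"
  shows "fps_conv_radius (Psi s f) = \<infinity>"
  unfolding fps_conv_radius_def
proof (rule conv_radius_inftyI'')
  fix z :: complex
  have "summable (\<lambda>k. \<bar>Phi k f s\<bar> * norm z ^ k)" using assms by (simp add: entire_at_def)
  hence "summable (\<lambda>k. norm (Psi s f $ k * z ^ k))" by (simp add: norm_mult norm_power)
  thus "summable (\<lambda>k. Psi s f $ k * z ^ k)" by (rule summable_norm_cancel)
qed

lemma eval_fps_Psi_of_real:
  assumes "entire_at s f"
  shows "eval_fps (Psi s f) (of_real \<epsilon>) = of_real (real_series s f \<epsilon>)"
proof -
  have "(\<lambda>k. complex_of_real (Phi k f s * \<epsilon> ^ k)) sums complex_of_real (real_series s f \<epsilon>)"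
    unfolding real_series_def by (intro sums_of_real summable_sums entire_at_summable assms)
  hence "(\<lambda>k. Psi s f $ k * of_real \<epsilon> ^ k) sums complex_of_real (real_series s f \<epsilon>)" by simp
  thus ?thesis unfolding eval_fps_def by (simp add: sums_iff)
qed

lemma holomorphic_Psi: "entire_at s f \<Longrightarrow> eval_fps (Psi s f) holomorphic_on A"
  by (rule holomorphic_on_eval_fps) (simp add: fps_conv_radius_Psi)

lemma Psi_expansion: "entire_at s f \<Longrightarrow> eval_fps (Psi s f) has_fps_expansion Psi s f"
  by (rule eval_fps_has_fps_expansion) (simp add: fps_conv_radius_Psi)

lemma real_series_0: "real_series s f 0 = f x0"
proof -
  have "(\<lambda>k. Phi k f s * 0 ^ k) = (\<lambda>k. if k = 0 then f x0 else 0)" by (auto simp: Phi_0)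
  thus ?thesis unfolding real_series_def using sums_unique[OF sums_single[of 0 "\<lambda>_. f x0"]] by simp
qed

lemma path_point_0: "path_point s 0 = x0"
  using x0 by (auto simp: path_point_def real_series_0 Rn_iff)

text \<open>The coordinates are entire in \<epsilon>, so the power series of f at the point of a
  real \<epsilon>0 can be composed with them on a small complex disc: where every coordinate stays
  within r of the centre, the majorant at radius r gives uniform convergence.\<close>

lemma local_composition:
  assumes coords: "\<And>i. i < n \<Longrightarrow> entire_at s (\<lambda>x. x i)"
    and ps: "power_series_at n (path_point s \<epsilon>0) e c f" and e: "e > 0"
  defines "tm \<equiv> \<lambda>m z. complex_of_real (c m) *
      (\<Prod>i<n. (eval_fps (Psi s (\<lambda>x. x i)) z - of_real (path_point s \<epsilon>0 i)) ^ m i)"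
  shows "\<exists>\<delta>>0. \<exists>F. F holomorphic_on ball (of_real \<epsilon>0) \<delta> \<and>
    uniform_limit (ball (of_real \<epsilon>0) \<delta>) (\<lambda>X z. \<Sum>m\<in>X. tm m z) F (finite_subsets_at_top (multi_idx n)) \<and>
    (\<forall>\<epsilon>. \<bar>\<epsilon> - \<epsilon>0\<bar> < \<delta> \<longrightarrow> F (of_real \<epsilon>) = of_real (f (path_point s \<epsilon>)))"
proof -
  define a where "a = path_point s \<epsilon>0"
  define u where "u = (\<lambda>i. eval_fps (Psi s (\<lambda>x. x i)))"
  have a: "a \<in> Rn n" by (simp add: a_def path_point_Rn)
  define r where "r = e / (2 * (real n + 1))"
  have r: "0 < r" "real n * r < e" using e by (auto simp: r_def field_simps intro!: add_nonneg_pos)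
  have summ: "(\<lambda>m. \<bar>c m\<bar> * (\<Prod>i<n. r ^ m i)) summable_on multi_idx n"
    by (rule power_series_at_abs_summable[OF _ a, of e c f]) (use ps r in \<open>auto simp: a_def\<close>)
  have hol_u: "u i holomorphic_on A" if "i < n" for i A
    unfolding u_def by (rule holomorphic_Psi[OF coords[OF that]])
  have ur: "u i (of_real \<epsilon>) = of_real (path_point s \<epsilon> i)" if "i < n" for i \<epsilon>
    unfolding u_def using eval_fps_Psi_of_real[OF coords[OF that]] that by (simp add: path_point_def)
  have "\<exists>\<delta>>0. \<forall>z. dist z (of_real \<epsilon>0) < \<delta> \<longrightarrow> dist (u i z) (u i (of_real \<epsilon>0)) < r" if i: "i < n" for i
  proof -
    have "isCont (u i) (of_real \<epsilon>0)"
      using holomorphic_on_imp_continuous_on[OF hol_u[OF i, of UNIV]] by (simp add: continuous_on_eq_continuous_at)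
    thus ?thesis using r(1) unfolding continuous_at_eps_delta by blast
  qed
  then obtain \<delta>i where \<delta>i: "\<And>i. i < n \<Longrightarrow> \<delta>i i > 0 \<and> (\<forall>z. dist z (of_real \<epsilon>0) < \<delta>i i \<longrightarrow> dist (u i z) (u i (of_real \<epsilon>0)) < r)"
    by metis
  \<comment> \<open>Inserting 1 keeps the set nonempty when n = 0.\<close>
  define \<delta> where "\<delta> = Min (insert 1 (\<delta>i ` {..<n}))"
  have \<delta>: "\<delta> > 0" unfolding \<delta>_def using \<delta>i by (subst Min_gr_iff) auto
  have \<delta>le: "\<delta> \<le> \<delta>i i" if "i < n" for i unfolding \<delta>_def using that by (intro Min_le) auto
  have ub: "norm (u i z - of_real (a i)) \<le> r" if "i < n" "z \<in> ball (of_real \<epsilon>0) \<delta>" for i z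
  proof -
    have "dist z (of_real \<epsilon>0) < \<delta>i i" using that \<delta>le[of i] by (simp add: dist_commute)
    hence "dist (u i z) (u i (of_real \<epsilon>0)) < r" using \<delta>i that by blast
    thus ?thesis using ur[OF that(1)] by (simp add: dist_norm a_def)
  qed
  have T: "tm m z = complex_of_real (c m) * (\<Prod>i<n. (u i z - of_real (a i)) ^ m i)" for m z
    by (simp add: tm_def u_def a_def)
  have Tb: "norm (tm m z) \<le> \<bar>c m\<bar> * (\<Prod>i<n. r ^ m i)" if "z \<in> ball (of_real \<epsilon>0) \<delta>" for m z
  proof -
    have "norm (tm m z) = \<bar>c m\<bar> * (\<Prod>i<n. norm (u i z - of_real (a i)) ^ m i)"
      unfolding T norm_mult by (simp add: prod_norm[symmetric] norm_power)
    also have "\<dots> \<le> \<bar>c m\<bar> * (\<Prod>i<n. r ^ m i)"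
      using ub that by (intro mult_left_mono prod_mono conjI power_mono) auto
    finally show ?thesis .
  qed
  define F where "F = (\<lambda>z. \<Sum>\<^sub>\<infinity>m\<in>multi_idx n. tm m z)"
  have ul: "uniform_limit (ball (of_real \<epsilon>0) \<delta>) (\<lambda>X z. \<Sum>m\<in>X. tm m z) F (finite_subsets_at_top (multi_idx n))"
    unfolding F_def by (rule Weierstrass_m_test_general[OF _ summ]) (use Tb in auto)
  have hT: "(\<lambda>z. \<Sum>m\<in>X. tm m z) holomorphic_on A" for X A
    unfolding T by (intro holomorphic_intros hol_u) auto
  \<comment> \<open>The limit theorem asks for uniform convergence on a closed disc, hence half the
    radius.\<close>
  define \<eta> where "\<eta> = \<delta> / 2"
  have \<eta>: "\<eta> > 0" "cball (complex_of_real \<epsilon>0) \<eta> \<subseteq> ball (of_real \<epsilon>0) \<delta>" using \<delta> by (auto simp: \<eta>_def)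
  have ulc: "uniform_limit (cball (of_real \<epsilon>0) \<eta>) (\<lambda>X z. \<Sum>m\<in>X. tm m z) F (finite_subsets_at_top (multi_idx n))"
    by (rule uniform_limit_on_subset[OF ul \<eta>(2)])
  have Fh: "F holomorphic_on ball (of_real \<epsilon>0) \<eta>"
  proof (rule holomorphic_uniform_limit[OF _ ulc])
    show "\<forall>\<^sub>F X in finite_subsets_at_top (multi_idx n).
        continuous_on (cball (complex_of_real \<epsilon>0) \<eta>) (\<lambda>z. \<Sum>m\<in>X. tm m z) \<and>
        (\<lambda>z. \<Sum>m\<in>X. tm m z) holomorphic_on ball (complex_of_real \<epsilon>0) \<eta>"
      by (intro always_eventually allI conjI hT holomorphic_on_imp_continuous_on)
  qed auto
  have ulb: "uniform_limit (ball (of_real \<epsilon>0) \<eta>) (\<lambda>X z. \<Sum>m\<in>X. tm m z) F (finite_subsets_at_top (multi_idx n))"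
    by (rule uniform_limit_on_subset[OF ulc]) auto
  have re: "F (of_real \<epsilon>) = of_real (f (path_point s \<epsilon>))" if \<epsilon>: "\<bar>\<epsilon> - \<epsilon>0\<bar> < \<eta>" for \<epsilon>
  proof -
    have zb: "complex_of_real \<epsilon> \<in> ball (of_real \<epsilon>0) \<delta>"
    proof -
      have "dist (complex_of_real \<epsilon>0) (of_real \<epsilon>) = \<bar>\<epsilon> - \<epsilon>0\<bar>"
        by (metis abs_minus_commute dist_norm norm_of_real of_real_diff)
      thus ?thesis using \<epsilon> \<eta> by (simp add: \<eta>_def)
    qed
    have "\<bar>path_point s \<epsilon> i - a i\<bar> \<le> r" if "i < n" for i
    proof -
      have "norm (of_real (path_point s \<epsilon> i) - complex_of_real (a i)) \<le> r" using ub[OF that zb] ur[OF that] by simp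
      thus ?thesis by (metis norm_of_real of_real_diff)
    qed
    hence "edist n (path_point s \<epsilon>) a \<le> real n * r" by (rule edist_le_mult)
    hence "edist n (path_point s \<epsilon>) a < e" using r by simp
    hence "((\<lambda>m. c m * (\<Prod>i<n. (path_point s \<epsilon> i - a i) ^ m i)) has_sum f (path_point s \<epsilon>)) (multi_idx n)"
      by (intro ps[unfolded power_series_at_def, rule_format, folded a_def] path_point_Rn)
    hence "((\<lambda>m. complex_of_real (c m * (\<Prod>i<n. (path_point s \<epsilon> i - a i) ^ m i))) has_sum of_real (f (path_point s \<epsilon>))) (multi_idx n)"
      by (rule has_sum_of_real)
    moreover have "complex_of_real (c m * (\<Prod>i<n. (path_point s \<epsilon> i - a i) ^ m i)) = tm m (of_real \<epsilon>)" for m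
      unfolding T by (auto simp: ur intro!: prod.cong)
    ultimately have "((\<lambda>m. tm m (of_real \<epsilon>)) has_sum of_real (f (path_point s \<epsilon>))) (multi_idx n)"
      by (simp only:)
    thus ?thesis unfolding F_def by (rule infsumI)
  qed
  show ?thesis using \<eta>(1) Fh ulb re by blast
qed

text \<open>Derivatives at 0 pass to the uniform limit. For a finite index set containing all
  degrees up to k, the k-th coefficient already equals \<open>Phi k f s\<close>, because monomials
  of higher degree start beyond \<epsilon> ^ k.\<close>

lemma local_composition_at_zero:
  assumes coords: "\<And>i. i < n \<Longrightarrow> entire_at s (\<lambda>x. x i)" and s: "s \<ge> 0"
    and f: "coord_smooth n f" and fe: "entire_at s f" and an: "real_analytic_at n f x0"
  shows "\<exists>\<delta>>0. \<forall>\<epsilon>. \<bar>\<epsilon>\<bar> < \<delta> \<longrightarrow> f (path_point s \<epsilon>) = real_series s f \<epsilon>"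
proof -
  obtain e c where e: "e > 0" and ps: "power_series_at n x0 e c f"
    using an unfolding real_analytic_at_alt by blast
  define u where "u = (\<lambda>i. eval_fps (Psi s (\<lambda>x. x i)))"
  define T where "T = (\<lambda>m z. complex_of_real (c m) * (\<Prod>i<n. (u i z - of_real (x0 i)) ^ m i))"
  obtain \<delta> F where \<delta>: "\<delta> > 0" and Fh: "F holomorphic_on ball 0 \<delta>"
    and ul: "uniform_limit (ball 0 \<delta>) (\<lambda>X z. \<Sum>m\<in>X. T m z) F (finite_subsets_at_top (multi_idx n))"
    and Fr: "\<And>\<epsilon>. \<bar>\<epsilon>\<bar> < \<delta> \<Longrightarrow> F (of_real \<epsilon>) = of_real (f (path_point s \<epsilon>))"
    using local_composition[OF coords, of 0 e c f] ps e unfolding path_point_0 T_def u_def by auto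
  have Te: "T m has_fps_expansion fps_const (of_real (c m)) * monomial_fps s m" for m
    unfolding T_def monomial_fps_def u_def
    by (intro has_fps_expansion_mult has_fps_expansion_prod has_fps_expansion_power has_fps_expansion_diff
        has_fps_expansion_const Psi_expansion coords) auto
  have coeff: "(deriv ^^ k) F 0 / fact k = of_real (Phi k f s)" for k
  proof -
    let ?A = "{m \<in> multi_idx n. (\<Sum>i<n. m i) \<le> k}"
    let ?L = "finite_subsets_at_top (multi_idx n)"
    have "((\<lambda>X. (deriv ^^ k) (\<lambda>z. \<Sum>m\<in>X. T m z) 0) \<longlongrightarrow> (deriv ^^ k) F 0) ?L"
    proof (rule higher_deriv_complex_uniform_limit[OF ul])
      show "\<forall>\<^sub>F X in ?L. (\<lambda>z. \<Sum>m\<in>X. T m z) holomorphic_on ball 0 \<delta>"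
        unfolding T_def u_def
        by (intro always_eventually allI holomorphic_intros holomorphic_Psi coords) auto
    qed (use \<delta> in auto)
    hence 1: "((\<lambda>X. (deriv ^^ k) (\<lambda>z. \<Sum>m\<in>X. T m z) 0 / fact k) \<longlongrightarrow> (deriv ^^ k) F 0 / fact k) ?L"
      by (intro tendsto_intros) auto
    have 2: "(deriv ^^ k) (\<lambda>z. \<Sum>m\<in>X. T m z) 0 / fact k = of_real (Phi k f s)"
      if X: "finite X" "?A \<subseteq> X" "X \<subseteq> multi_idx n" for X
    proof -
      have "(\<lambda>z. \<Sum>m\<in>X. T m z) has_fps_expansion (\<Sum>m\<in>X. fps_const (of_real (c m)) * monomial_fps s m)"
        by (intro has_fps_expansion_sum Te)
      hence "(deriv ^^ k) (\<lambda>z. \<Sum>m\<in>X. T m z) 0 / fact k = (\<Sum>m\<in>X. fps_const (of_real (c m)) * monomial_fps s m) $ k"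
        by (rule fps_nth_fps_expansion[symmetric])
      also have "\<dots> = (\<Sum>m\<in>X. of_real (c m) * monomial_fps s m $ k)" by (simp add: fps_sum_nth)
      also have "\<dots> = (\<Sum>m\<in>?A. of_real (c m) * monomial_fps s m $ k)"
        using X monomial_fps_nth_eq_0[of k _ s] by (intro sum.mono_neutral_right) (auto simp: not_le[symmetric])
      also have "\<dots> = of_real (Phi k f s)" by (rule Phi_eq_taylor[OF f ps e s, symmetric])
      finally show ?thesis .
    qed
    have "\<forall>\<^sub>F X in ?L. (deriv ^^ k) (\<lambda>z. \<Sum>m\<in>X. T m z) 0 / fact k = of_real (Phi k f s)"
      unfolding eventually_finite_subsets_at_top
      by (intro exI[of _ ?A] conjI allI impI 2 finite_multi_idx_degree_le) auto
    hence 3: "((\<lambda>X. (deriv ^^ k) (\<lambda>z. \<Sum>m\<in>X. T m z) 0 / fact k) \<longlongrightarrow> of_real (Phi k f s)) ?L"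
      by (rule tendsto_eventually)
    show ?thesis by (rule tendsto_unique[OF _ 1 3]) simp
  qed
  have "f (path_point s \<epsilon>) = real_series s f \<epsilon>" if \<epsilon>: "\<bar>\<epsilon>\<bar> < \<delta>" for \<epsilon>
  proof -
    have "(\<lambda>k. (deriv ^^ k) F 0 / fact k * (of_real \<epsilon> - 0) ^ k) sums F (of_real \<epsilon>)"
      by (rule holomorphic_power_series[OF Fh]) (use \<epsilon> in simp)
    hence "(\<lambda>k. Psi s f $ k * (of_real \<epsilon>) ^ k) sums F (of_real \<epsilon>)" unfolding coeff by simp
    hence "F (of_real \<epsilon>) = eval_fps (Psi s f) (of_real \<epsilon>)" unfolding eval_fps_def by (simp add: sums_iff)
    hence "complex_of_real (f (path_point s \<epsilon>)) = of_real (real_series s f \<epsilon>)"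
      using Fr[OF \<epsilon>] eval_fps_Psi_of_real[OF fe] by simp
    thus ?thesis by simp
  qed
  thus ?thesis using \<delta> by blast
qed

lemma open_real_ball_nhds: "(\<forall>\<^sub>F \<epsilon> in nhds x. P \<epsilon>) \<longleftrightarrow> (\<exists>\<delta>>0. \<forall>\<epsilon>::real. \<bar>\<epsilon> - x\<bar> < \<delta> \<longrightarrow> P \<epsilon>)"
  by (simp add: eventually_nhds_metric dist_real_def)

text \<open>Agreement near 0 is propagated along the real interval: the set of points of local
  agreement is open with open complement. The identity theorem is used in one disc at a time, and
  the discs may shrink arbitrarily.\<close>

theorem composition_identity:
  assumes coords: "\<And>i. i < n \<Longrightarrow> entire_at s (\<lambda>x. x i)" and s: "s \<ge> 0"
    and f: "coord_smooth n f" and fe: "entire_at s f"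
    and an: "\<And>\<epsilon>. \<epsilon> \<in> {-R<..<R} \<Longrightarrow> real_analytic_at n f (path_point s \<epsilon>)"
    and \<epsilon>: "\<epsilon> \<in> {-R<..<R}"
  shows "f (path_point s \<epsilon>) = real_series s f \<epsilon>"
proof -
  define A where "A = {-R<..<R}"
  have R: "R > 0" using \<epsilon> by auto
  \<comment> \<open>Agreement in a neighbourhood, not just at the point: this makes E open and
    supplies the accumulation point for the identity theorem.\<close>
  define E where "E = {x \<in> A. \<forall>\<^sub>F x' in nhds x. f (path_point s x') = real_series s f x'}"
  have dist_c: "dist (complex_of_real x) (of_real x') = \<bar>x' - x\<bar>" for x x'
    by (metis abs_minus_commute dist_norm norm_of_real of_real_diff)
  \<comment> \<open>A single point of E in the disc around x decides the whole disc. So a point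
    outside E has a neighbourhood free of E.\<close>
  have loc: "\<exists>\<delta>>0. (\<exists>x1\<in>E. \<bar>x1 - x\<bar> < \<delta>) \<longrightarrow> (\<forall>x'. \<bar>x' - x\<bar> < \<delta> \<longrightarrow> f (path_point s x') = real_series s f x')"
    if x: "x \<in> A" for x
  proof -
    obtain e c where e: "e > 0" and ps: "power_series_at n (path_point s x) e c f"
      using an[of x] x unfolding real_analytic_at_alt A_def by blast
    obtain \<delta> F where \<delta>: "\<delta> > 0" and Fh: "F holomorphic_on ball (of_real x) \<delta>"
      and Fr: "\<And>x'. \<bar>x' - x\<bar> < \<delta> \<Longrightarrow> F (of_real x') = of_real (f (path_point s x'))"
      using local_composition[OF coords ps e] by auto
    define D where "D = (\<lambda>z. F z - eval_fps (Psi s f) z)"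
    have Dh: "D holomorphic_on ball (of_real x) \<delta>"
      unfolding D_def by (intro holomorphic_intros Fh holomorphic_Psi fe)
    have Dr: "D (of_real x') = of_real (f (path_point s x') - real_series s f x')" if "\<bar>x' - x\<bar> < \<delta>" for x'
      using Fr[OF that] eval_fps_Psi_of_real[OF fe] by (simp add: D_def)
    have "f (path_point s x') = real_series s f x'"
      if x1: "x1 \<in> E" "\<bar>x1 - x\<bar> < \<delta>" and x': "\<bar>x' - x\<bar> < \<delta>" for x1 x'
    proof -
      obtain \<eta> where \<eta>: "\<eta> > 0" "\<And>w. \<bar>w - x1\<bar> < \<eta> \<Longrightarrow> f (path_point s w) = real_series s f w"
        using x1(1) unfolding E_def open_real_ball_nhds by auto
      define \<zeta> where "\<zeta> = min \<eta> (\<delta> - \<bar>x1 - x\<bar>)"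
      have \<zeta>: "\<zeta> > 0" using \<eta> x1 by (simp add: \<zeta>_def)
      define U where "U = complex_of_real ` {w. \<bar>w - x1\<bar> < \<zeta>}"
      have "D (of_real x') = 0"
      proof (rule analytic_continuation[OF Dh open_ball connected_ball, of U "of_real x1"])
        show "U \<subseteq> ball (of_real x) \<delta>" by (auto simp: U_def dist_real_def \<zeta>_def)
        show "complex_of_real x1 \<in> ball (of_real x) \<delta>" using x1(2) by (simp add: dist_real_def abs_minus_commute)
        show "complex_of_real x' \<in> ball (of_real x) \<delta>" using x' by (simp add: dist_real_def abs_minus_commute)
        show "complex_of_real x1 islimpt U"
          unfolding islimpt_approachable
        proof (intro allI impI)
          fix e' :: real assume e': "e' > 0"
          define w where "w = x1 + min e' \<zeta> / 2"
          have aw: "\<bar>w - x1\<bar> < \<zeta>" "\<bar>w - x1\<bar> < e'" using e' \<zeta> by (auto simp: w_def)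
          have "complex_of_real w \<in> U" unfolding U_def using aw by (intro imageI) simp
          moreover have "w \<noteq> x1" using e' \<zeta> by (auto simp: w_def)
          moreover have "dist (complex_of_real w) (of_real x1) < e'"
            using aw(2) by (simp add: dist_real_def)
          ultimately show "\<exists>x'\<in>U. x' \<noteq> complex_of_real x1 \<and> dist x' (complex_of_real x1) < e'"
            by (intro bexI[of _ "complex_of_real w"]) auto
        qed
        show "D z = 0" if zU: "z \<in> U" for z
        proof -
          obtain w where w: "z = of_real w" "\<bar>w - x1\<bar> < \<zeta>" using zU unfolding U_def by blast
          have "\<bar>w - x\<bar> < \<delta>" using w by (auto simp: \<zeta>_def)
          thus ?thesis using Dr[of w] \<eta>(2)[of w] w by (simp add: \<zeta>_def)
        qed
      qed
      thus ?thesis using Dr[OF x'] by simp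
    qed
    thus ?thesis using \<delta> by blast
  qed
  have openE: "open E"
    unfolding open_dist
  proof
    fix x assume x: "x \<in> E"
    obtain \<eta> where \<eta>: "\<eta> > 0" "\<And>w. \<bar>w - x\<bar> < \<eta> \<Longrightarrow> f (path_point s w) = real_series s f w"
      using x unfolding E_def open_real_ball_nhds by auto
    have "open A" by (simp add: A_def)
    then obtain \<eta>' where \<eta>': "\<eta>' > 0" "\<And>w. dist w x < \<eta>' \<Longrightarrow> w \<in> A"
      using x unfolding open_dist E_def by auto
    show "\<exists>e>0. \<forall>y. dist y x < e \<longrightarrow> y \<in> E"
    proof (intro exI[of _ "min \<eta> \<eta>' / 2"] conjI allI impI)
      fix w assume w: "dist w x < min \<eta> \<eta>' / 2"
      have "w \<in> A" by (rule \<eta>'(2)) (use w \<eta> \<eta>' in auto)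
      moreover have "\<forall>\<^sub>F x' in nhds w. f (path_point s x') = real_series s f x'"
        unfolding open_real_ball_nhds
      proof (intro exI[of _ "\<eta> / 2"] conjI allI impI)
        fix v assume "\<bar>v - w\<bar> < \<eta> / 2"
        moreover have "\<bar>w - x\<bar> < \<eta> / 2" using w by (auto simp: dist_real_def)
        ultimately have "\<bar>v - x\<bar> < \<eta>" by linarith
        thus "f (path_point s v) = real_series s f v" by (rule \<eta>(2))
      qed (use \<eta> in auto)
      ultimately show "w \<in> E" by (simp add: E_def)
    qed (use \<eta> \<eta>' in auto)
  qed
  have openC: "open (A - E)"
    unfolding open_dist
  proof
    fix x assume x: "x \<in> A - E"
    obtain \<delta> where \<delta>: "\<delta> > 0" "(\<exists>x1\<in>E. \<bar>x1 - x\<bar> < \<delta>) \<Longrightarrow> (\<forall>x'. \<bar>x' - x\<bar> < \<delta> \<longrightarrow> f (path_point s x') = real_series s f x')"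
      using loc[of x] x by blast
    have none: "\<not> (\<exists>x1\<in>E. \<bar>x1 - x\<bar> < \<delta>)"
    proof
      assume "\<exists>x1\<in>E. \<bar>x1 - x\<bar> < \<delta>"
      hence "\<forall>\<^sub>F x' in nhds x. f (path_point s x') = real_series s f x'"
        using \<delta> unfolding open_real_ball_nhds by blast
      thus False using x by (auto simp: E_def)
    qed
    have "open A" by (simp add: A_def)
    then obtain \<eta>' where \<eta>': "\<eta>' > 0" "\<And>w. dist w x < \<eta>' \<Longrightarrow> w \<in> A"
      using x unfolding open_dist by auto
    show "\<exists>e>0. \<forall>y. dist y x < e \<longrightarrow> y \<in> A - E"
      using none \<delta>(1) \<eta>' by (intro exI[of _ "min \<delta> \<eta>'"]) (auto simp: dist_real_def)
  qed
  have "0 \<in> E"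
  proof -
    have "real_analytic_at n f x0" using an[of 0] R by (simp add: path_point_0)
    from local_composition_at_zero[OF coords s f fe this] show ?thesis
      using R by (simp add: E_def A_def open_real_ball_nhds)
  qed
  have "connected A" by (simp add: A_def)
  from connectedD[OF this openE openC] have "E \<inter> A = {} \<or> (A - E) \<inter> A = {}" by (auto simp: E_def)
  hence "A - E = {}" using \<open>0 \<in> E\<close> R by (auto simp: A_def)
  hence "\<epsilon> \<in> E" using \<epsilon> by (auto simp: A_def)
  hence "\<forall>\<^sub>F x' in nhds \<epsilon>. f (path_point s x') = real_series s f x'" by (simp add: E_def)
  thus ?thesis by (rule eventually_nhds_x_imp_x)
qed

end

section \<open>Convergence of the expansion\<close>

lemma bielecki_linear_combination:
  assumes fin: "finite A" and F: "\<And>i. i \<in> A \<Longrightarrow> bielecki \<nu> \<theta> N T (F i)" and c: "\<And>i. i \<in> A \<Longrightarrow> \<bar>c i\<bar> \<le> W"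
    and N: "N \<ge> 0"
  shows "bielecki \<nu> \<theta> (real (card A) * (W * N)) T (\<lambda>t. \<Sum>i\<in>A. c i * F i t)"
  unfolding bielecki_def
proof (intro conjI allI impI)
  fix u assume u: "0 \<le> u" "u \<le> T"
  have "\<bar>\<Sum>i\<in>A. c i * F i u\<bar> \<le> (\<Sum>i\<in>A. W * (N * exp (\<nu> * u)))"
  proof (rule order_trans[OF sum_abs sum_mono])
    fix i assume i: "i \<in> A"
    show "\<bar>c i * F i u\<bar> \<le> W * (N * exp (\<nu> * u))"
      unfolding abs_mult using c[OF i] bieleckiD1[OF F[OF i] u] by (intro mult_mono) auto
  qed
  thus "\<bar>\<Sum>i\<in>A. c i * F i u\<bar> \<le> real (card A) * (W * N) * exp (\<nu> * u)" by (simp add: mult.assoc)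
next
  fix u v assume uv: "0 \<le> v" "v \<le> u" "u \<le> T"
  have "\<bar>(\<Sum>i\<in>A. c i * F i u) - (\<Sum>i\<in>A. c i * F i v)\<bar> = \<bar>\<Sum>i\<in>A. c i * (F i u - F i v)\<bar>"
    by (simp add: right_diff_distrib sum_subtractf)
  also have "\<dots> \<le> (\<Sum>i\<in>A. W * (N * \<nu> powr \<theta> * exp (\<nu> * u) * (u - v) powr \<theta>))"
  proof (rule order_trans[OF sum_abs sum_mono])
    fix i assume i: "i \<in> A"
    show "\<bar>c i * (F i u - F i v)\<bar> \<le> W * (N * \<nu> powr \<theta> * exp (\<nu> * u) * (u - v) powr \<theta>)"
      unfolding abs_mult using c[OF i] bieleckiD2[OF F[OF i] uv] by (intro mult_mono) auto
  qed
  finally show "\<bar>(\<Sum>i\<in>A. c i * F i u) - (\<Sum>i\<in>A. c i * F i v)\<bar>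
      \<le> real (card A) * (W * N) * \<nu> powr \<theta> * exp (\<nu> * u) * (u - v) powr \<theta>" by (simp add: mult.assoc)
qed

lemma tail_suminf_tendsto_0:
  fixes G :: "nat \<Rightarrow> real"
  assumes "summable G"
  shows "(\<lambda>m. \<Sum>k. G (k + m)) \<longlonglongrightarrow> 0"
proof -
  have "(\<lambda>m. suminf G - (\<Sum>k<m. G k)) \<longlonglongrightarrow> suminf G - suminf G"
    by (intro tendsto_intros summable_LIMSEQ assms)
  thus ?thesis by (simp add: suminf_minus_initial_segment[OF assms])
qed

lemma abs_suminf_le:
  fixes h G :: "nat \<Rightarrow> real"
  assumes "\<And>k. \<bar>h k\<bar> \<le> G k" "summable G"
  shows "summable h" "\<bar>suminf h\<bar> \<le> suminf G"
proof -
  have sn: "summable (\<lambda>k. norm (h k))" by (rule summable_comparison_test'[OF assms(2), of 0]) (use assms in auto)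
  thus "summable h" by (rule summable_norm_cancel)
  have "norm (suminf h) \<le> (\<Sum>k. norm (h k))" by (rule summable_norm[OF sn])
  also have "\<dots> \<le> suminf G" by (rule suminf_le[OF _ sn assms(2)]) (use assms in auto)
  finally show "\<bar>suminf h\<bar> \<le> suminf G" by simp
qed

lemma holder_on_suminf:
  assumes h: "\<And>k. holder_on a b \<kappa> (G k) (h k)" and bd: "\<And>k u. a \<le> u \<Longrightarrow> u \<le> b \<Longrightarrow> \<bar>h k u\<bar> \<le> G k" and G: "summable G"
  shows "holder_on a b \<kappa> (suminf G) (\<lambda>u. \<Sum>k. h k u)"
proof (rule holder_onI)
  show "0 \<le> suminf G" using holder_on_nonneg[OF h] by (intro suminf_nonneg G) auto
  fix u v assume uv: "a \<le> u" "u \<le> v" "v \<le> b"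
  have su: "summable (\<lambda>k. h k u)" and sv: "summable (\<lambda>k. h k v)"
    by (rule abs_suminf_le(1)[OF _ G]; use bd uv in auto)+
  have "(\<Sum>k. h k v) - (\<Sum>k. h k u) = (\<Sum>k. h k v - h k u)" by (rule suminf_diff[OF sv su])
  also have "\<bar>\<dots>\<bar> \<le> (\<Sum>k. G k * (v - u) powr \<kappa>)"
    by (rule abs_suminf_le(2)) (use holder_onD[OF h] uv G in \<open>auto intro: summable_mult2\<close>)
  also have "\<dots> = suminf G * (v - u) powr \<kappa>" by (rule suminf_mult2[OF G, symmetric])
  finally show "\<bar>(\<Sum>k. h k v) - (\<Sum>k. h k u)\<bar> \<le> suminf G * (v - u) powr \<kappa>" .
qed

text \<open>Uniform smallness of the tail would not control its Young integral. As G bounds values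
  and Hoelder constants alike, the tail is small in the Hoelder norm as well.\<close>

lemma young_integral_sums:
  assumes ab: "a \<le> b" and th: "\<theta> > 1/2" and g: "holder_on a b \<theta> L g"
    and h: "\<And>k. holder_on a b \<theta> (G k) (h k)" and bd: "\<And>k u. a \<le> u \<Longrightarrow> u \<le> b \<Longrightarrow> \<bar>h k u\<bar> \<le> G k" and G: "summable G"
  shows "(\<lambda>k. young_integral (h k) g a b) sums young_integral (\<lambda>u. \<Sum>k. h k u) g a b"
proof -
  have pos: "\<theta> > 0" "\<theta> > 0" "\<theta> + \<theta> > 1" using th by auto
  have L0: "L \<ge> 0" using g holder_on_nonneg by blast
  define H where "H = (\<lambda>u. \<Sum>k. h k u)"
  have hH: "holder_on a b \<theta> (suminf G) H" unfolding H_def by (rule holder_on_suminf[OF h bd G])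
  define R where "R = (\<lambda>m. \<Sum>k. G (k + m))"
  have R0: "R \<longlonglongrightarrow> 0" unfolding R_def by (rule tail_suminf_tendsto_0[OF G])
  define Y where "Y = young_const (\<theta> + \<theta>)"
  define K where "K = (1 + Y * (b - a) powr \<theta>) * L * (b - a) powr \<theta>"
  have est: "\<bar>young_integral H g a b - (\<Sum>k<m. young_integral (h k) g a b)\<bar> \<le> R m * K" for m
  proof -
    define Q where "Q = (\<lambda>u. \<Sum>k. h (k + m) u)"
    have Gm: "summable (\<lambda>k. G (k + m))" using G by (rule summable_ignore_initial_segment)
    have hQ: "holder_on a b \<theta> (R m) Q" unfolding Q_def R_def by (rule holder_on_suminf[OF h bd Gm])
    have Qb: "\<bar>Q a\<bar> \<le> R m" unfolding Q_def R_def by (rule abs_suminf_le(2)[OF _ Gm]) (use bd ab in auto)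
    have split: "(\<Sum>k<m. h k u) + Q u = H u" if "a \<le> u" "u \<le> b" for u
    proof -
      have "summable (\<lambda>k. h k u)" by (rule abs_suminf_le(1)[OF _ G]) (use bd that in auto)
      from suminf_split_initial_segment[OF this, of m] show ?thesis by (simp add: Q_def H_def)
    qed
    have "has_young_integral (\<lambda>u. (\<Sum>k<m. h k u) + Q u) g a b ((\<Sum>k<m. young_integral (h k) g a b) + young_integral Q g a b)"
      by (intro has_young_integral_add has_young_integral_sum young_integral_exists[OF ab h g pos]
          young_integral_exists[OF ab hQ g pos]) auto
    hence "has_young_integral H g a b ((\<Sum>k<m. young_integral (h k) g a b) + young_integral Q g a b)"
      by (rule iffD1[OF has_young_integral_cong, rotated -1]) (use split in auto)
    hence "young_integral H g a b = (\<Sum>k<m. young_integral (h k) g a b) + young_integral Q g a b"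
      by (rule young_integral_eqI[OF ab])
    moreover have "\<bar>young_integral Q g a b\<bar> \<le> (R m + Y * R m * (b - a) powr \<theta>) * L * (b - a) powr \<theta>"
      unfolding Y_def by (rule young_integral_bound[OF ab hQ g pos Qb])
    ultimately show ?thesis by (simp add: K_def algebra_simps)
  qed
  have "(\<lambda>m. R m * K) \<longlonglongrightarrow> 0" using tendsto_mult_right[OF R0, of K] by simp
  hence "(\<lambda>m. young_integral H g a b - (\<Sum>k<m. young_integral (h k) g a b)) \<longlonglongrightarrow> 0"
    by (rule Lim_null_comparison[rotated]) (use est in auto)
  hence "(\<lambda>m. young_integral H g a b - (young_integral H g a b - (\<Sum>k<m. young_integral (h k) g a b))) \<longlonglongrightarrow> young_integral H g a b - 0"
    by (intro tendsto_intros)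
  thus ?thesis unfolding sums_def H_def by simp
qed

lemma enorm_tendsto:
  assumes "\<And>j. j < n \<Longrightarrow> (\<lambda>m. x m j) \<longlonglongrightarrow> X j"
  shows "(\<lambda>m. enorm n (x m)) \<longlonglongrightarrow> enorm n X"
  unfolding enorm_def L2_set_def using assms by (intro tendsto_intros) auto

lemma enorm_sum_le: "finite A \<Longrightarrow> enorm n (\<lambda>j. \<Sum>k\<in>A. x k j) \<le> (\<Sum>k\<in>A. enorm n (x k))"
proof (induction A rule: finite_induct)
  case (insert k A)
  have "enorm n (\<lambda>j. \<Sum>k\<in>insert k A. x k j) = L2_set (\<lambda>j. x k j + (\<Sum>k\<in>A. x k j)) {..<n}"
    using insert by (simp add: enorm_def)
  also have "\<dots> \<le> enorm n (x k) + enorm n (\<lambda>j. \<Sum>k\<in>A. x k j)" unfolding enorm_def by (rule L2_set_triangle_ineq)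
  finally show ?case using insert by simp
qed (simp add: enorm_def L2_set_def)

lemma enorm_suminf_le:
  assumes s: "\<And>j. j < n \<Longrightarrow> (\<lambda>k. x k j) sums X j" and e: "\<And>k. enorm n (x k) \<le> E k" and sm: "summable E"
  shows "enorm n X \<le> suminf E"
proof -
  have "(\<lambda>m. enorm n (\<lambda>j. \<Sum>k<m. x k j)) \<longlonglongrightarrow> enorm n X"
    by (rule enorm_tendsto) (use s in \<open>auto simp: sums_def\<close>)
  moreover have "enorm n (\<lambda>j. \<Sum>k<m. x k j) \<le> suminf E" for m
  proof -
    have "enorm n (\<lambda>j. \<Sum>k<m. x k j) \<le> (\<Sum>k<m. enorm n (x k))" by (rule enorm_sum_le) simp
    also have "\<dots> \<le> (\<Sum>k<m. E k)" using e by (intro sum_mono)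
    also have "\<dots> \<le> suminf E" using e order_trans[OF enorm_nonneg e] by (intro sum_le_suminf sm) auto
    finally show ?thesis .
  qed
  ultimately show ?thesis by (intro LIMSEQ_le_const2) auto
qed

lemma enorm_cmult: "enorm n (\<lambda>j. c * x j) = \<bar>c\<bar> * enorm n x"
proof -
  have "(\<Sum>j<n. (c * x j)\<^sup>2) = c\<^sup>2 * (\<Sum>j<n. (x j)\<^sup>2)" by (simp add: power_mult_distrib sum_distrib_left)
  thus ?thesis by (simp add: enorm_def L2_set_def real_sqrt_mult)
qed

locale taylor_setting = holder_driver +
  fixes n :: nat and V :: "nat \<Rightarrow> (nat \<Rightarrow> real) \<Rightarrow> (nat \<Rightarrow> real)" and x0 :: "nat \<Rightarrow> real" and \<gamma> M :: real
  assumes x0_Rn: "x0 \<in> Rn n" and V_lipschitz: "\<And>i. i \<le> d \<Longrightarrow> lipschitz_smooth_field n (V i)"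
    and gamma_range: "0 < \<gamma>" "\<gamma> < 1 - 2 * \<alpha>" and M_pos: "M > 0"
    and P_bound: "\<And>I. I \<noteq> [] \<Longrightarrow> set I \<subseteq> {..d} \<Longrightarrow>
      enorm n (P_word n V x0 I) \<le> Gamma (\<gamma> * real (length I)) * M ^ length I"
begin

sublocale driven_fields
proof
  show "coord_smooth n (\<lambda>x. V i x j)" if "i \<le> d" "j < n" for i j
    using V_lipschitz[OF that(1)] that(2) unfolding lipschitz_smooth_field_def by (auto intro: smooth_fun_coord_smooth)
qed (rule x0_Rn)

section \<open>Majorants for the expansion\<close>

definition word_rate :: "real \<Rightarrow> real" where
  "word_rate T = bielecki_const (1 - \<alpha>) * (holder_factor * \<Lambda> T)"

lemma word_rate_nonneg: "T > 0 \<Longrightarrow> word_rate T \<ge> 0"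
  using bielecki_const_pos[OF th_half] holder_factor_pos Lambda_nonneg by (simp add: word_rate_def)

text \<open>Number of words, times the bound on coefficients of words of length k + 1, times the
  weighted bound on iterated integrals of length k. The shift by one arises because a field
  component is itself a field applied to a coordinate.\<close>

definition coeff_bound :: "real \<Rightarrow> nat \<Rightarrow> real" where
  "coeff_bound T k = (real d + 1) ^ k * (Gamma (\<gamma> * real (Suc k)) * M ^ Suc k) * (word_rate T * real (Suc k) powr (- (1 - \<alpha>))) ^ k"

text \<open>On [0, T] the weight \<nu> = k + 1 is removed by means of \<open>exp (\<nu> * T)\<close>
  and \<open>\<nu> powr (1 - \<alpha>) \<le> \<nu>\<close>. The same number then bounds values and
  Hoelder constant.\<close>

definition growth :: "real \<Rightarrow> nat \<Rightarrow> real" where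
  "growth T k = coeff_bound T k * real (Suc k) * exp (real (Suc k) * T)"

lemma coeff_bound_nonneg: "T > 0 \<Longrightarrow> coeff_bound T k \<ge> 0"
  unfolding coeff_bound_def using gamma_range M_pos word_rate_nonneg[of T]
  by (intro mult_nonneg_nonneg zero_le_power Gamma_real_nonneg) auto

lemma growth_nonneg: "T > 0 \<Longrightarrow> growth T k \<ge> 0"
  unfolding growth_def using coeff_bound_nonneg[of T k] by (intro mult_nonneg_nonneg) auto

lemma growth_summable:
  assumes T: "T > 0" and R: "R \<ge> 0"
  shows "summable (\<lambda>k. growth T k * R ^ k)"
proof -
  define \<theta> where "\<theta> = 1 - \<alpha>"
  have th: "\<theta> > 0" "\<theta> \<le> 1" "\<gamma> < \<theta>" using al_half al_pos gamma_range by (auto simp: \<theta>_def)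
  define B where "B = word_rate T"
  have B0: "B \<ge> 0" using word_rate_nonneg[OF T] by (simp add: B_def)
  \<comment> \<open>All geometric factors at once. The 4 pays for l ^ 2: one factor l comes from
    \<open>growth\<close>, the other from raising the exponent k to l = k + 1.\<close>
  define A where "A = (real d + 1) * M * (1 + B) * exp T * (1 + R) * 4"
  have A0: "A \<ge> 0" using M_pos B0 R by (simp add: A_def)
  obtain K where K: "K > 0" "\<And>k::nat. k \<ge> 1 \<Longrightarrow> A ^ k * Gamma (\<gamma> * real k) * real k powr (- \<theta> * real k) \<le> K * (1/2) ^ k"
    using Gamma_superexponential_decay[OF gamma_range(1) th(3) A0] by blast
  have bd: "norm (growth T k * R ^ k) \<le> K * (1/2) ^ k" for k
  proof -
    define l where "l = Suc k"
    have l: "l \<ge> 1" by (simp add: l_def)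
    have G: "Gamma (\<gamma> * real l) \<ge> 0" using gamma_range by (intro Gamma_real_nonneg) (auto simp: l_def)
    have pw: "(real l powr (- \<theta>)) ^ k \<le> real l powr (- \<theta> * real l) * real l"
    proof -
      have "(real l powr (- \<theta>)) ^ k = real l powr (- \<theta> * real k)" using l by (simp add: powr_realpow[symmetric] powr_powr)
      also have "\<dots> = real l powr (- \<theta> * real l) * real l powr \<theta>" by (simp add: powr_add[symmetric] l_def algebra_simps)
      also have "\<dots> \<le> real l powr (- \<theta> * real l) * real l powr 1"
        using l th by (intro mult_left_mono powr_mono) auto
      finally show ?thesis using l by simp
    qed
    have "growth T k * R ^ k = (real d + 1) ^ k * (Gamma (\<gamma> * real l) * M ^ l) * (B ^ k * (real l powr (- \<theta>)) ^ k) * real l * exp (real l * T) * R ^ k"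
      by (simp add: growth_def coeff_bound_def l_def B_def \<theta>_def power_mult_distrib)
    also have "\<dots> \<le> (real d + 1) ^ l * (Gamma (\<gamma> * real l) * M ^ l) * ((1 + B) ^ l * (real l powr (- \<theta> * real l) * real l)) * real l * exp (real l * T) * (1 + R) ^ l"
    proof (intro mult_right_mono mult_mono pw)
      show "(real d + 1) ^ k \<le> (real d + 1) ^ l" by (intro power_increasing) (auto simp: l_def)
      have "B ^ k \<le> (1 + B) ^ k" using B0 by (intro power_mono) auto
      also have "\<dots> \<le> (1 + B) ^ l" using B0 by (intro power_increasing) (auto simp: l_def)
      finally show "B ^ k \<le> (1 + B) ^ l" .
      have "R ^ k \<le> (1 + R) ^ k" using R by (intro power_mono) auto
      also have "\<dots> \<le> (1 + R) ^ l" using R by (intro power_increasing) (auto simp: l_def)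
      finally show "R ^ k \<le> (1 + R) ^ l" .
    qed (use G M_pos B0 R in auto)
    also have "\<dots> = ((real d + 1) ^ l * M ^ l * (1 + B) ^ l * exp T ^ l * (1 + R) ^ l) * Gamma (\<gamma> * real l) * real l powr (- \<theta> * real l) * (real l)\<^sup>2"
      using exp_of_nat_mult[of l T] by (simp add: power2_eq_square mult_ac)
    also have "\<dots> \<le> ((real d + 1) ^ l * M ^ l * (1 + B) ^ l * exp T ^ l * (1 + R) ^ l) * Gamma (\<gamma> * real l) * real l powr (- \<theta> * real l) * 4 ^ l"
    proof (intro mult_left_mono)
      have "(real l)\<^sup>2 \<le> (2 ^ l)\<^sup>2" using of_nat_less_two_power[of l, where 'a = real] by (intro power_mono) auto
      also have "(2 ^ l)\<^sup>2 = (4::real) ^ l" by (simp add: power2_eq_square power_mult_distrib[symmetric])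
      finally show "(real l)\<^sup>2 \<le> 4 ^ l" .
    qed (use G M_pos B0 R in auto)
    also have "\<dots> = A ^ l * Gamma (\<gamma> * real l) * real l powr (- \<theta> * real l)"
      unfolding A_def power_mult_distrib by (simp only: mult_ac)
    also have "\<dots> \<le> K * (1/2) ^ l" by (rule K(2)[OF l])
    also have "\<dots> \<le> K * (1/2) ^ k" using K by (simp add: l_def)
    finally show ?thesis using growth_nonneg[OF T] R by simp
  qed
  show ?thesis
    by (rule summable_comparison_test'[of "\<lambda>k. K * (1/2) ^ k" 0]) (use bd in \<open>auto intro!: summable_mult summable_geometric\<close>)
qed

text \<open>The component j of V i is V i applied to the j-th coordinate, so the word I acting on it
  is \<open>I @ [i]\<close> acting on that coordinate.\<close>

lemma word_apply_field_bound:
  assumes i: "i \<le> d" and j: "j < n" and I: "I \<in> words d k"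
  shows "\<bar>word_apply n V I (\<lambda>x. V i x j) x0\<bar> \<le> Gamma (\<gamma> * real (Suc k)) * M ^ Suc k"
proof -
  have "word_apply n V I (\<lambda>x. V i x j) x0 = P_word n V x0 (I @ [i]) j"
    using field_apply_coord[OF j, of "V i"] by (simp add: word_apply_def P_word_def)
  also have "\<bar>\<dots>\<bar> \<le> enorm n (P_word n V x0 (I @ [i]))" by (rule abs_component_le_enorm[OF j])
  also have "\<dots> \<le> Gamma (\<gamma> * real (length (I @ [i]))) * M ^ length (I @ [i])"
    by (rule P_bound) (use I i in \<open>auto simp: words_def\<close>)
  finally show ?thesis using I by (simp add: words_def)
qed

text \<open>The weight k + 1 is positive also for k = 0. It grows with k so that each of the k
  letters gains \<open>(k + 1) powr (- (1 - \<alpha>))\<close>, which beats the Gamma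
  factor.\<close>

lemma bielecki_Phi_field:
  assumes T: "T > 0" and i: "i \<le> d" and j: "j < n"
  shows "bielecki (real (Suc k)) (1 - \<alpha>) (coeff_bound T k) T (Phi k (\<lambda>x. V i x j))"
proof -
  define L where "L = holder_factor * \<Lambda> T"
  have L0: "L \<ge> 0" using holder_factor_pos Lambda_nonneg T by (simp add: L_def)
  have "bielecki (real (Suc k)) (1 - \<alpha>) ((bielecki_const (1 - \<alpha>) * L * real (Suc k) powr (- (1 - \<alpha>))) ^ k) T (simplex_integral y I)"
    if I: "I \<in> words d k" for I
  proof -
    have "bielecki (real (Suc k)) (1 - \<alpha>) ((bielecki_const (1 - \<alpha>) * L * real (Suc k) powr (- (1 - \<alpha>))) ^ length I) T (simplex_integral y I)"
    proof (rule bielecki_simplex_integral[OF th_half _ L0])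
      show "holder_on 0 T (1 - \<alpha>) L (\<lambda>s. y s i')" if "i' \<in> set I" for i'
        unfolding L_def using holder_on_driver_Lambda[OF T, of i'] that I by (auto simp: words_def)
    qed simp
    thus ?thesis using I by (simp add: words_def)
  qed
  from bielecki_linear_combination[OF finite_words this word_apply_field_bound[OF i j]]
  have "bielecki (real (Suc k)) (1 - \<alpha>) (real (card (words d k)) * ((Gamma (\<gamma> * real (Suc k)) * M ^ Suc k) *
     (bielecki_const (1 - \<alpha>) * L * real (Suc k) powr (- (1 - \<alpha>))) ^ k)) T (Phi k (\<lambda>x. V i x j))"
    unfolding Phi_def[abs_def] using bielecki_const_pos[OF th_half] L0 by simp
  moreover have "real (card (words d k)) * ((Gamma (\<gamma> * real (Suc k)) * M ^ Suc k) *
     (bielecki_const (1 - \<alpha>) * L * real (Suc k) powr (- (1 - \<alpha>))) ^ k) = coeff_bound T k"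
    by (simp only: coeff_bound_def card_words word_rate_def L_def of_nat_power of_nat_add of_nat_1 mult.assoc)
  ultimately show ?thesis by (simp only:)
qed

lemma holder_on_growth:
  assumes T: "T > 0" and c: "c \<ge> 0" and b: "bielecki (real (Suc k)) (1 - \<alpha>) (c * coeff_bound T k) T f"
  shows "holder_on 0 T (1 - \<alpha>) (c * growth T k) f" and "\<And>u. 0 \<le> u \<Longrightarrow> u \<le> T \<Longrightarrow> \<bar>f u\<bar> \<le> c * growth T k"
proof -
  have b0: "c * coeff_bound T k \<ge> 0" using c coeff_bound_nonneg[OF T] by simp
  have le: "real (Suc k) powr (1 - \<alpha>) \<le> real (Suc k)"
    using powr_mono[of "1 - \<alpha>" 1 "real (Suc k)"] al_pos by simp
  have "holder_on 0 T (1 - \<alpha>) (c * coeff_bound T k * real (Suc k) powr (1 - \<alpha>) * exp (real (Suc k) * T)) f"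
    by (rule bielecki_hol[OF b b0]) auto
  moreover have "c * coeff_bound T k * real (Suc k) powr (1 - \<alpha>) * exp (real (Suc k) * T) \<le> c * coeff_bound T k * real (Suc k) * exp (real (Suc k) * T)"
    using b0 le by (intro mult_right_mono mult_left_mono) auto
  ultimately show "holder_on 0 T (1 - \<alpha>) (c * growth T k) f" by (auto intro: holder_on_mono simp: growth_def mult.assoc)
  fix u assume u: "0 \<le> u" "u \<le> T"
  have "\<bar>f u\<bar> \<le> c * coeff_bound T k * exp (real (Suc k) * u)" by (rule bieleckiD1[OF b u])
  also have "\<dots> = c * coeff_bound T k * 1 * exp (real (Suc k) * u)" by simp
  also have "\<dots> \<le> c * coeff_bound T k * real (Suc k) * exp (real (Suc k) * T)"
    using b0 u c coeff_bound_nonneg[OF T, of k] by (intro mult_mono) auto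
  finally show "\<bar>f u\<bar> \<le> c * growth T k" by (simp add: growth_def mult.assoc)
qed

lemma Phi_field_bounds:
  assumes T: "T > 0" and i: "i \<le> d" and j: "j < n"
  shows "holder_on 0 T (1 - \<alpha>) (growth T k) (Phi k (\<lambda>x. V i x j))"
    and "\<And>u. 0 \<le> u \<Longrightarrow> u \<le> T \<Longrightarrow> \<bar>Phi k (\<lambda>x. V i x j) u\<bar> \<le> growth T k"
  using holder_on_growth[OF T, of 1 k "Phi k (\<lambda>x. V i x j)"] bielecki_Phi_field[OF T i j] by auto

definition coord_factor :: "real \<Rightarrow> real" where "coord_factor T = (real d + 1) * word_rate T"

lemma Phi_coord_Suc:
  assumes "j < n" "t \<ge> 0"
  shows "Phi (Suc k) (\<lambda>x. x j) t = (\<Sum>i\<le>d. young_integral (Phi k (\<lambda>x. V i x j)) (\<lambda>s. y s i) 0 t)"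
  using Phi_Suc[OF assms(2), of k "\<lambda>x. x j"] by (simp add: field_apply_coord[OF assms(1)])

text \<open>The additional integration is carried out with the weight k + 1 of the field term. Its
  gain is estimated by 1, so only \<open>coord_factor\<close> remains and the index of
  \<open>growth\<close> stays at k.\<close>

lemma Phi_coord_bounds:
  assumes T: "T > 0" and j: "j < n"
  shows "holder_on 0 T (1 - \<alpha>) (coord_factor T * growth T k) (Phi (Suc k) (\<lambda>x. x j))"
    and "\<And>u. 0 \<le> u \<Longrightarrow> u \<le> T \<Longrightarrow> \<bar>Phi (Suc k) (\<lambda>x. x j) u\<bar> \<le> coord_factor T * growth T k"
proof -
  define L where "L = holder_factor * \<Lambda> T"
  have L0: "L \<ge> 0" using holder_factor_pos Lambda_nonneg T by (simp add: L_def)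
  define l where "l = real (Suc k)"
  have l: "l \<ge> 1" by (simp add: l_def)
  have b0: "coeff_bound T k \<ge> 0" by (rule coeff_bound_nonneg[OF T])
  define F where "F = (\<lambda>i t. young_integral (Phi k (\<lambda>x. V i x j)) (\<lambda>s. y s i) 0 t)"
  have bF: "bielecki l (1 - \<alpha>) (bielecki_const (1 - \<alpha>) * L * l powr (- (1 - \<alpha>)) * coeff_bound T k) T (F i)"
    if "i \<in> {..d}" for i
    unfolding F_def l_def L_def
    by (rule bielecki_young_integral[OF bielecki_Phi_field[OF T _ j] holder_on_driver_Lambda[OF T] th_half])
      (use that b0 in auto)
  have "bielecki l (1 - \<alpha>) (real (card {..d}) * (1 * (bielecki_const (1 - \<alpha>) * L * l powr (- (1 - \<alpha>)) * coeff_bound T k))) T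
      (\<lambda>t. \<Sum>i\<le>d. 1 * F i t)"
    by (rule bielecki_linear_combination[OF _ bF]) (use b0 L0 bielecki_const_pos[OF th_half] in auto)
  hence b: "bielecki l (1 - \<alpha>) (real (card {..d}) * (bielecki_const (1 - \<alpha>) * L * l powr (- (1 - \<alpha>)) * coeff_bound T k)) T
      (\<lambda>t. \<Sum>i\<le>d. F i t)"
    by (simp only: mult_1)
  have eq: "real (card {..d}) * (bielecki_const (1 - \<alpha>) * L * l powr (- (1 - \<alpha>)) * coeff_bound T k) = (coord_factor T * l powr (- (1 - \<alpha>))) * coeff_bound T k"
    by (simp add: coord_factor_def word_rate_def L_def)
  have c0: "0 \<le> coord_factor T * l powr (- (1 - \<alpha>))" using word_rate_nonneg[OF T] by (simp add: coord_factor_def)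
  have cle: "coord_factor T * l powr (- (1 - \<alpha>)) * growth T k \<le> coord_factor T * growth T k"
  proof -
    have "l powr (- (1 - \<alpha>)) \<le> l powr 0" using l al_half by (intro powr_mono) auto
    hence "coord_factor T * l powr (- (1 - \<alpha>)) \<le> coord_factor T * 1" using word_rate_nonneg[OF T] l by (intro mult_left_mono) (auto simp: coord_factor_def)
    thus ?thesis using growth_nonneg[OF T] by (intro mult_right_mono) auto
  qed
  note h = holder_on_growth[OF T c0, of k, folded l_def, OF b[unfolded eq]]
  have P: "Phi (Suc k) (\<lambda>x. x j) u = (\<Sum>i\<le>d. F i u)" if "0 \<le> u" for u
    unfolding F_def by (rule Phi_coord_Suc[OF j that])
  show "holder_on 0 T (1 - \<alpha>) (coord_factor T * growth T k) (Phi (Suc k) (\<lambda>x. x j))"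
    using holder_on_mono[OF h(1) cle] holder_on_cong[of 0 T "Phi (Suc k) (\<lambda>x. x j)" "\<lambda>u. \<Sum>i\<le>d. F i u"] P by auto
  show "\<bar>Phi (Suc k) (\<lambda>x. x j) u\<bar> \<le> coord_factor T * growth T k" if "0 \<le> u" "u \<le> T" for u
    using h(2)[OF that] cle P[OF that(1)] by simp
qed

lemma coord_factor_nonneg: "T > 0 \<Longrightarrow> coord_factor T \<ge> 0"
  using word_rate_nonneg by (simp add: coord_factor_def)

lemma entire_at_field:
  assumes "s \<ge> 0" "i \<le> d" "j < n"
  shows "entire_at s (\<lambda>x. V i x j)"
  unfolding entire_at_def
proof (intro allI impI)
  fix R :: real assume R: "R \<ge> 0"
  have T: "s + 1 > 0" using assms by simp
  show "summable (\<lambda>k. \<bar>Phi k (\<lambda>x. V i x j) s\<bar> * R ^ k)"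
    by (rule summable_comparison_test'[OF growth_summable[OF T R], of 0])
      (use Phi_field_bounds(2)[OF T assms(2,3)] assms R in \<open>auto simp: abs_mult intro!: mult_right_mono\<close>)
qed

lemma entire_at_coord:
  assumes "s \<ge> 0" "j < n"
  shows "entire_at s (\<lambda>x. x j)"
  unfolding entire_at_def
proof (intro allI impI)
  fix R :: real assume R: "R \<ge> 0"
  have T: "s + 1 > 0" using assms by simp
  have "summable (\<lambda>k. \<bar>Phi (Suc k) (\<lambda>x. x j) s\<bar> * R ^ Suc k)"
  proof (rule summable_comparison_test'[OF summable_mult[OF growth_summable[OF T R], of "coord_factor (s + 1) * R"], of 0])
    fix k
    have "\<bar>Phi (Suc k) (\<lambda>x. x j) s\<bar> * R ^ Suc k \<le> (coord_factor (s + 1) * growth (s + 1) k) * R ^ Suc k"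
      using Phi_coord_bounds(2)[OF T assms(2)] assms R by (intro mult_right_mono) auto
    thus "norm (\<bar>Phi (Suc k) (\<lambda>x. x j) s\<bar> * R ^ Suc k) \<le> coord_factor (s + 1) * R * (growth (s + 1) k * R ^ k)"
      using R by (simp add: mult_ac)
  qed
  thus "summable (\<lambda>k. \<bar>Phi k (\<lambda>x. x j) s\<bar> * R ^ k)"
    using summable_Suc_iff[of "\<lambda>k. \<bar>Phi k (\<lambda>x. x j) s\<bar> * R ^ k"] by simp
qed

definition taylor_vec :: "nat \<Rightarrow> real \<Rightarrow> nat \<Rightarrow> real" where
  "taylor_vec k s = g_term n d V x0 y k s"

lemma taylor_vec_eq: "taylor_vec k s j = Phi k (\<lambda>x. x j) s"
  by (simp add: taylor_vec_def g_term_eq)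

text \<open>The power of s, due to the vanishing at time 0, is what will make \<open>T_time\<close>
  positive. The factor n does no harm, as the bound is used only for summability and for the
  positivity or finiteness of sums.\<close>

lemma enorm_taylor_vec_le:
  assumes T: "T > 0" and s: "0 \<le> s" "s \<le> T"
  shows "enorm n (taylor_vec (Suc k) s) \<le> real n * (coord_factor T * growth T k) * s powr (1 - \<alpha>)"
proof -
  have "enorm n (taylor_vec (Suc k) s) \<le> (\<Sum>j<n. \<bar>taylor_vec (Suc k) s j\<bar>)" by (rule enorm_le_sum)
  also have "\<dots> \<le> (\<Sum>j<n. coord_factor T * growth T k * s powr (1 - \<alpha>))"
  proof (rule sum_mono)
    fix j assume "j \<in> {..<n}"
    hence j: "j < n" by simp
    show "\<bar>taylor_vec (Suc k) s j\<bar> \<le> coord_factor T * growth T k * s powr (1 - \<alpha>)"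
      using holder_onD[OF Phi_coord_bounds(1)[OF T j], of 0 s k] s by (simp add: taylor_vec_eq Phi_Suc_zero_time)
  qed
  finally show ?thesis by simp
qed

lemma taylor_sum_summable:
  assumes "0 \<le> s" "0 \<le> r"
  shows "summable (\<lambda>k. r ^ Suc k * enorm n (taylor_vec (Suc k) s))"
proof -
  have T: "s + 1 > 0" using assms by simp
  let ?c = "real n * coord_factor (s + 1) * s powr (1 - \<alpha>) * r"
  show ?thesis
  proof (rule summable_comparison_test'[OF summable_mult[OF growth_summable[OF T assms(2)], of ?c], of 0])
    fix k
    have "r ^ Suc k * enorm n (taylor_vec (Suc k) s) \<le> r ^ Suc k * (real n * (coord_factor (s + 1) * growth (s + 1) k) * s powr (1 - \<alpha>))"
      using enorm_taylor_vec_le[OF T, of s k] assms by (intro mult_left_mono) auto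
    thus "norm (r ^ Suc k * enorm n (taylor_vec (Suc k) s)) \<le> ?c * (growth (s + 1) k * r ^ k)"
      using assms by (simp add: abs_mult mult_ac)
  qed
qed

lemma taylor_sum_bound:
  assumes T: "T > 0" and r: "0 \<le> r"
  shows "\<exists>Q\<ge>0. \<forall>s. 0 \<le> s \<longrightarrow> s \<le> T \<longrightarrow> (\<Sum>k. r ^ Suc k * enorm n (taylor_vec (Suc k) s)) \<le> Q * s powr (1 - \<alpha>)"
proof -
  define Q where "Q = real n * coord_factor T * r * (\<Sum>k. growth T k * r ^ k)"
  have Q: "Q \<ge> 0" unfolding Q_def using coord_factor_nonneg[OF T] r growth_nonneg[OF T]
    by (intro mult_nonneg_nonneg suminf_nonneg growth_summable[OF T r]) auto
  have "(\<Sum>k. r ^ Suc k * enorm n (taylor_vec (Suc k) s)) \<le> Q * s powr (1 - \<alpha>)" if s: "0 \<le> s" "s \<le> T" for s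
  proof -
    let ?c = "real n * coord_factor T * r * s powr (1 - \<alpha>)"
    have "(\<Sum>k. r ^ Suc k * enorm n (taylor_vec (Suc k) s)) \<le> (\<Sum>k. ?c * (growth T k * r ^ k))"
    proof (rule suminf_le[OF _ taylor_sum_summable[OF s(1) r] summable_mult[OF growth_summable[OF T r]]])
      fix k
      have "r ^ Suc k * enorm n (taylor_vec (Suc k) s) \<le> r ^ Suc k * (real n * (coord_factor T * growth T k) * s powr (1 - \<alpha>))"
        using enorm_taylor_vec_le[OF T s] r by (intro mult_left_mono) auto
      thus "r ^ Suc k * enorm n (taylor_vec (Suc k) s) \<le> ?c * (growth T k * r ^ k)" by (simp add: mult_ac)
    qed
    also have "\<dots> = ?c * (\<Sum>k. growth T k * r ^ k)" by (rule suminf_mult[OF growth_summable[OF T r]])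
    finally show ?thesis by (simp add: Q_def mult_ac)
  qed
  thus ?thesis using Q by blast
qed

lemma path_point_sums:
  assumes s: "s \<ge> 0" and j: "j < n"
  shows "(\<lambda>k. Phi (Suc k) (\<lambda>x. x j) s * \<epsilon> ^ Suc k) sums (path_point s \<epsilon> j - x0 j)"
proof -
  have "(\<lambda>k. Phi k (\<lambda>x. x j) s * \<epsilon> ^ k) sums path_point s \<epsilon> j"
    using summable_sums[OF entire_at_summable[OF entire_at_coord[OF s j]], of \<epsilon>] j
    by (simp add: path_point_def real_series_def)
  thus ?thesis by (subst sums_Suc_iff) (simp add: Phi_0)
qed

text \<open>The assumed bound is on the sum that defines \<open>T_time\<close>, and its weights
  dominate the powers of \<epsilon>: this is how the stopping time keeps the whole curve inside the
  domain of analyticity.\<close>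

lemma path_point_in_ball:
  assumes s: "s \<ge> 0" and \<epsilon>: "\<bar>\<epsilon>\<bar> \<le> r" and C: "(\<Sum>k. r ^ Suc k * enorm n (taylor_vec (Suc k) s)) \<le> C"
  shows "path_point s \<epsilon> \<in> ecball n x0 C"
proof -
  have r: "r \<ge> 0" using \<epsilon> by linarith
  have "enorm n (\<lambda>j. path_point s \<epsilon> j - x0 j) \<le> (\<Sum>k. r ^ Suc k * enorm n (taylor_vec (Suc k) s))"
  proof (rule enorm_suminf_le[OF path_point_sums[OF s] _ taylor_sum_summable[OF s r]])
    fix k
    have "enorm n (\<lambda>j. \<epsilon> ^ Suc k * taylor_vec (Suc k) s j) = \<bar>\<epsilon>\<bar> ^ Suc k * enorm n (taylor_vec (Suc k) s)"
      unfolding enorm_cmult power_abs ..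
    also have "\<dots> \<le> r ^ Suc k * enorm n (taylor_vec (Suc k) s)"
      using \<epsilon> by (intro mult_right_mono power_mono) auto
    finally show "enorm n (\<lambda>j. Phi (Suc k) (\<lambda>x. x j) s * \<epsilon> ^ Suc k) \<le> r ^ Suc k * enorm n (taylor_vec (Suc k) s)"
      by (simp add: taylor_vec_eq mult.commute)
  qed
  thus ?thesis using C path_point_Rn by (simp add: ecball_def edist_def)
qed

lemma field_along_expansion:
  assumes s: "s \<ge> 0" and r: "r > 1" and C: "(\<Sum>k. r ^ Suc k * enorm n (taylor_vec (Suc k) s)) \<le> C"
    and an: "analytic_field_on n (V i) (ecball n x0 C)" and i: "i \<le> d" and j: "j < n"
  shows "V i (path_point s 1) j = (\<Sum>k. Phi k (\<lambda>x. V i x j) s)"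
proof -
  have "V i (path_point s 1) j = real_series s (\<lambda>x. V i x j) 1"
  proof (rule composition_identity[of s "\<lambda>x. V i x j" r 1])
    show "real_analytic_at n (\<lambda>x. V i x j) (path_point s \<epsilon>)" if "\<epsilon> \<in> {-r<..<r}" for \<epsilon>
      using an path_point_in_ball[OF s _ C, of \<epsilon>] that j unfolding analytic_field_on_def by auto
  qed (use s r i j entire_at_coord entire_at_field V_smooth in auto)
  thus ?thesis by (simp add: real_series_def)
qed

lemma expansion_solves:
  assumes t: "t > 0" and r: "r > 1"
    and C: "\<And>s. 0 \<le> s \<Longrightarrow> s \<le> t \<Longrightarrow> (\<Sum>k. r ^ Suc k * enorm n (taylor_vec (Suc k) s)) \<le> C"
    and an: "\<And>i. i \<le> d \<Longrightarrow> analytic_field_on n (V i) (ecball n x0 C)"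
    and j: "j < n" and u: "0 \<le> u" "u \<le> t"
  shows "path_point u 1 j = x0 j + (\<Sum>i\<le>d. young_integral (\<lambda>s. V i (path_point s 1) j) (\<lambda>s. y s i) 0 u)"
proof -
  have gs: "summable (growth t)" using growth_summable[OF t, of 1] by simp
  have "(\<lambda>k. young_integral (Phi k (\<lambda>x. V i x j)) (\<lambda>s. y s i) 0 u) sums
      young_integral (\<lambda>s. V i (path_point s 1) j) (\<lambda>s. y s i) 0 u" if i: "i \<le> d" for i
  proof -
    have "(\<lambda>k. young_integral (Phi k (\<lambda>x. V i x j)) (\<lambda>s. y s i) 0 u) sums
      young_integral (\<lambda>s. \<Sum>k. Phi k (\<lambda>x. V i x j) s) (\<lambda>s. y s i) 0 u"
    proof (rule young_integral_sums[OF u(1) th_half holder_on_subset[OF holder_on_driver_Lambda[OF t i]] _ _ gs])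
      show "holder_on 0 u (1 - \<alpha>) (growth t k) (Phi k (\<lambda>x. V i x j))" for k
        by (rule holder_on_subset[OF Phi_field_bounds(1)[OF t i j]]) (use u in auto)
      show "\<bar>Phi k (\<lambda>x. V i x j) s\<bar> \<le> growth t k" if "0 \<le> s" "s \<le> u" for k s
        by (rule Phi_field_bounds(2)[OF t i j]) (use u that in auto)
    qed (use u in auto)
    moreover have "young_integral (\<lambda>s. \<Sum>k. Phi k (\<lambda>x. V i x j) s) (\<lambda>s. y s i) 0 u
        = young_integral (\<lambda>s. V i (path_point s 1) j) (\<lambda>s. y s i) 0 u"
    proof (rule young_integral_cong)
      fix s assume s: "0 \<le> s" "s \<le> u"
      show "(\<Sum>k. Phi k (\<lambda>x. V i x j) s) = V i (path_point s 1) j"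
        using field_along_expansion[OF s(1) r C[of s] an[OF i] i j] s u by simp
    qed
    ultimately show ?thesis by simp
  qed
  hence "(\<lambda>k. \<Sum>i\<le>d. young_integral (Phi k (\<lambda>x. V i x j)) (\<lambda>s. y s i) 0 u) sums
      (\<Sum>i\<le>d. young_integral (\<lambda>s. V i (path_point s 1) j) (\<lambda>s. y s i) 0 u)"
    by (intro sums_sum) auto
  hence "(\<lambda>k. Phi (Suc k) (\<lambda>x. x j) u) sums (\<Sum>i\<le>d. young_integral (\<lambda>s. V i (path_point s 1) j) (\<lambda>s. y s i) 0 u)"
    using Phi_coord_Suc[OF j u(1)] by simp
  moreover have "(\<lambda>k. Phi (Suc k) (\<lambda>x. x j) u) sums (path_point u 1 j - x0 j)"
    using path_point_sums[OF u(1) j, of 1] by simp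
  ultimately show ?thesis using sums_unique2 by fastforce
qed

lemma holder_on_path_point:
  assumes t: "t > 0" and j: "j < n"
  shows "holder_on 0 t (1 - \<alpha>) (\<Sum>k. coord_factor t * growth t k) (\<lambda>u. path_point u 1 j)"
proof -
  have gs: "summable (\<lambda>k. coord_factor t * growth t k)" using growth_summable[OF t, of 1] by (intro summable_mult) simp
  have "holder_on 0 t (1 - \<alpha>) (\<Sum>k. coord_factor t * growth t k) (\<lambda>u. \<Sum>k. Phi (Suc k) (\<lambda>x. x j) u)"
    by (rule holder_on_suminf[OF Phi_coord_bounds[OF t j] gs])
  hence "holder_on 0 t (1 - \<alpha>) (0 + (\<Sum>k. coord_factor t * growth t k)) (\<lambda>u. x0 j + (\<Sum>k. Phi (Suc k) (\<lambda>x. x j) u))"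
    by (intro holder_on_add holder_on_const)
  moreover have "path_point u 1 j = x0 j + (\<Sum>k. Phi (Suc k) (\<lambda>x. x j) u)" if "0 \<le> u" for u
    using sums_unique[OF path_point_sums[OF that j, of 1]] by simp
  ultimately show ?thesis using holder_on_cong[of 0 t "\<lambda>u. path_point u 1 j"] by simp
qed

end

section \<open>Uniqueness of the solution and the remainder\<close>

lemma DERIV_abs_le_lipschitz:
  fixes f :: "real \<Rightarrow> real"
  assumes D: "(f has_real_derivative D) (at x)" and L: "\<And>s. \<bar>f s - f x\<bar> \<le> L * \<bar>s - x\<bar>"
  shows "\<bar>D\<bar> \<le> L"
proof -
  have "((\<lambda>h. \<bar>(f (x + h) - f x) / h\<bar>) \<longlongrightarrow> \<bar>D\<bar>) (at 0)"
    using D unfolding DERIV_def by (rule tendsto_rabs)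
  moreover have "\<forall>\<^sub>F h in at 0. \<bar>(f (x + h) - f x) / h\<bar> \<le> L"
    unfolding eventually_at
  proof (intro exI[of _ 1] conjI ballI impI)
    fix h :: real assume h: "h \<noteq> 0 \<and> dist h 0 < 1"
    show "\<bar>(f (x + h) - f x) / h\<bar> \<le> L" using L[of "x + h"] h by (simp add: abs_divide pos_divide_le_eq)
  qed simp
  ultimately show ?thesis by (rule tendsto_upperbound) simp
qed

text \<open>Interpolate between \<open>x\<close> and \<open>z\<close>, and simultaneously between \<open>x'\<close> and \<open>z'\<close>, one coordinate at a
  time, and apply the mean value theorem to the difference.\<close>

lemma four_point_estimate:
  assumes F: "coord_diff n F"
    and L0: "\<And>x j. x \<in> Rn n \<Longrightarrow> j < n \<Longrightarrow> \<bar>partial_deriv j F x\<bar> \<le> L0"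
    and L1: "\<And>x z j. x \<in> Rn n \<Longrightarrow> z \<in> Rn n \<Longrightarrow> j < n \<Longrightarrow>
      \<bar>partial_deriv j F x - partial_deriv j F z\<bar> \<le> L1 * edist n x z" and L1': "L1 \<ge> 0"
    and pts: "x \<in> Rn n" "z \<in> Rn n" "x' \<in> Rn n" "z' \<in> Rn n"
  shows "\<bar>(F x - F z) - (F x' - F z')\<bar> \<le> (\<Sum>j<n. L0 * \<bar>(x j - z j) - (x' j - z' j)\<bar> +
    L1 * (\<Sum>l<n. \<bar>x l - x' l\<bar> + \<bar>z l - z' l\<bar>) * \<bar>x' j - z' j\<bar>)"
proof -
  define w where "w = (\<lambda>(x::nat \<Rightarrow> real) z m l. if l < m then z l else x l)"
  have wR: "w x z m \<in> Rn n" if "x \<in> Rn n" "z \<in> Rn n" for x z m using that by (simp add: w_def Rn_iff)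
  have w0: "w x z 0 = x" for x z by (simp add: w_def)
  have wn: "w x z n = z" if "x \<in> Rn n" "z \<in> Rn n" for x z using that by (auto simp: w_def Rn_iff not_less)
  have tel: "F x - F z = (\<Sum>m<n. F (w x z m) - F (w x z (Suc m)))" if "x \<in> Rn n" "z \<in> Rn n" for x z
    using sum_lessThan_telescope'[of "\<lambda>m. F (w x z m)" n] w0 wn[OF that] by simp
  have one: "\<bar>(F (w x z m) - F (w x z (Suc m))) - (F (w x' z' m) - F (w x' z' (Suc m)))\<bar> \<le>
     L0 * \<bar>(x m - z m) - (x' m - z' m)\<bar> + L1 * (\<Sum>l<n. \<bar>x l - x' l\<bar> + \<bar>z l - z' l\<bar>) * \<bar>x' m - z' m\<bar>"
    if m: "m < n" for m
  proof -
    define a where "a = (\<lambda>x z \<tau>. (w x z m)(m := x m + \<tau> * (z m - x m)))"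
    have a0: "a x z 0 = w x z m" and a1: "a x z 1 = w x z (Suc m)" for x z
      by (auto simp: a_def w_def fun_eq_iff)
    have aR: "a x z \<tau> \<in> Rn n" if "x \<in> Rn n" "z \<in> Rn n" for x z \<tau>
      unfolding a_def by (intro Rn_fun_upd wR that m)
    have da: "((\<lambda>\<tau>. F (a x z \<tau>)) has_real_derivative partial_deriv m F (a x z \<tau>) * (z m - x m)) (at \<tau>)"
      if "x \<in> Rn n" "z \<in> Rn n" for x z \<tau>
    proof -
      have "((\<lambda>s. F ((a x z \<tau>)(m := s))) has_real_derivative partial_deriv m F (a x z \<tau>)) (at (a x z \<tau> m))"
        by (rule coord_diff_DERIV[OF F aR[OF that] m])
      hence "((\<lambda>s. F ((w x z m)(m := s))) has_real_derivative partial_deriv m F (a x z \<tau>)) (at (x m + \<tau> * (z m - x m)))"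
        by (simp add: a_def)
      note D = this
      have "((\<lambda>\<tau>. x m + \<tau> * (z m - x m)) has_real_derivative z m - x m) (at \<tau>)"
        by (auto intro!: derivative_eq_intros)
      from DERIV_chain2[where f = "\<lambda>s. F ((w x z m)(m := s))" and g = "\<lambda>\<tau>. x m + \<tau> * (z m - x m)", OF D this]
      show ?thesis by (simp add: a_def)
    qed
    \<comment> \<open>The mean value theorem is applied to the difference of the two interpolations,
      so that both derivatives are taken at the same \<tau>.\<close>
    have "\<exists>\<tau>>0. \<tau> < 1 \<and> (F (a x z 1) - F (a x' z' 1)) - (F (a x z 0) - F (a x' z' 0)) = (1 - 0) *
       (partial_deriv m F (a x z \<tau>) * (z m - x m) - partial_deriv m F (a x' z' \<tau>) * (z' m - x' m))"
      by (rule MVT2) (auto intro!: DERIV_diff da pts)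
    then obtain \<tau> where \<tau>: "0 < \<tau>" "\<tau> < 1" and eq: "(F (a x z 1) - F (a x' z' 1)) - (F (a x z 0) - F (a x' z' 0)) =
       partial_deriv m F (a x z \<tau>) * (z m - x m) - partial_deriv m F (a x' z' \<tau>) * (z' m - x' m)"
      by auto
    define p where "p = partial_deriv m F (a x z \<tau>)"
    define p' where "p' = partial_deriv m F (a x' z' \<tau>)"
    define E where "E = (\<Sum>l<n. \<bar>x l - x' l\<bar> + \<bar>z l - z' l\<bar>)"
    have ed: "edist n (a x z \<tau>) (a x' z' \<tau>) \<le> E"
    proof -
      have "edist n (a x z \<tau>) (a x' z' \<tau>) \<le> (\<Sum>l<n. \<bar>a x z \<tau> l - a x' z' \<tau> l\<bar>)"
        unfolding edist_def by (rule enorm_le_sum)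
      also have "\<dots> \<le> E" unfolding E_def
      proof (rule sum_mono)
        fix l
        show "\<bar>a x z \<tau> l - a x' z' \<tau> l\<bar> \<le> \<bar>x l - x' l\<bar> + \<bar>z l - z' l\<bar>"
        proof (cases "l = m")
          case True
          have "a x z \<tau> l - a x' z' \<tau> l = (1 - \<tau>) * (x m - x' m) + \<tau> * (z m - z' m)"
            using True by (simp add: a_def algebra_simps)
          also have "\<bar>\<dots>\<bar> \<le> (1 - \<tau>) * \<bar>x m - x' m\<bar> + \<tau> * \<bar>z m - z' m\<bar>"
            using \<tau> by (intro order_trans[OF abs_triangle_ineq]) (simp add: abs_mult)
          also have "\<dots> \<le> 1 * \<bar>x m - x' m\<bar> + 1 * \<bar>z m - z' m\<bar>"
            using \<tau> by (intro add_mono mult_right_mono) auto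
          finally show ?thesis using True by simp
        qed (auto simp: a_def w_def)
      qed
      finally show ?thesis .
    qed
    have pp: "\<bar>p - p'\<bar> \<le> L1 * E"
      using L1[OF aR[OF pts(1,2)] aR[OF pts(3,4)] m] mult_left_mono[OF ed L1'] unfolding p_def p'_def
      by (rule order_trans)
    have p0: "\<bar>p\<bar> \<le> L0" unfolding p_def by (rule L0[OF aR[OF pts(1,2)] m])
    have "(F (w x z m) - F (w x z (Suc m))) - (F (w x' z' m) - F (w x' z' (Suc m)))
        = p * ((x m - z m) - (x' m - z' m)) + (p - p') * (x' m - z' m)"
      using eq unfolding a0 a1 p_def[symmetric] p'_def[symmetric] by (simp add: algebra_simps)
    also have "\<bar>\<dots>\<bar> \<le> \<bar>p\<bar> * \<bar>(x m - z m) - (x' m - z' m)\<bar> + \<bar>p - p'\<bar> * \<bar>x' m - z' m\<bar>"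
      by (rule order_trans[OF abs_triangle_ineq]) (simp add: abs_mult)
    also have "\<dots> \<le> L0 * \<bar>(x m - z m) - (x' m - z' m)\<bar> + L1 * E * \<bar>x' m - z' m\<bar>"
      using p0 pp by (intro add_mono mult_right_mono) auto
    finally show ?thesis by (simp add: E_def)
  qed
  have eq: "(F x - F z) - (F x' - F z') = (\<Sum>m<n. (F (w x z m) - F (w x z (Suc m))) - (F (w x' z' m) - F (w x' z' (Suc m))))"
    unfolding tel[OF pts(1,2)] tel[OF pts(3,4)] sum_subtractf ..
  show ?thesis
    unfolding eq
  proof (rule order_trans[OF sum_abs sum_mono])
    fix m assume "m \<in> {..<n}"
    hence "m < n" by simp
    thus "\<bar>(F (w x z m) - F (w x z (Suc m))) - (F (w x' z' m) - F (w x' z' (Suc m)))\<bar> \<le>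
     L0 * \<bar>(x m - z m) - (x' m - z' m)\<bar> + L1 * (\<Sum>l<n. \<bar>x l - x' l\<bar> + \<bar>z l - z' l\<bar>) * \<bar>x' m - z' m\<bar>"
      by (rule one)
  qed
qed

context taylor_setting
begin

text \<open>There are finitely many fields, so sums of their constants serve them all. The partial
  derivatives are bounded by the Lipschitz constant of the field itself.\<close>

lemma field_lipschitz_constants:
  "\<exists>L0 L1. L0 \<ge> 0 \<and> L1 \<ge> 0 \<and> (\<forall>i\<le>d. \<forall>x\<in>Rn n. \<forall>z\<in>Rn n. \<forall>j<n. \<forall>m<n.
     \<bar>V i x j - V i z j\<bar> \<le> L0 * edist n x z \<and> \<bar>partial_deriv m (\<lambda>u. V i u j) x\<bar> \<le> L0 \<and>
     \<bar>partial_deriv m (\<lambda>u. V i u j) x - partial_deriv m (\<lambda>u. V i u j) z\<bar> \<le> L1 * edist n x z)"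
proof -
  have "\<forall>i\<in>{..d}. \<exists>L. \<forall>x\<in>Rn n. \<forall>z\<in>Rn n. edist n (V i x) (V i z) \<le> L * edist n x z"
    using V_lipschitz unfolding lipschitz_smooth_field_def by blast
  then obtain A where A: "\<And>i x z. i \<le> d \<Longrightarrow> x \<in> Rn n \<Longrightarrow> z \<in> Rn n \<Longrightarrow> edist n (V i x) (V i z) \<le> A i * edist n x z"
    by (metis atMost_iff)
  have "\<forall>i\<in>{..d}. \<exists>L. \<forall>x\<in>Rn n. \<forall>z\<in>Rn n. \<forall>m<n. \<forall>j<n.
      \<bar>partial_deriv m (\<lambda>u. V i u j) x - partial_deriv m (\<lambda>u. V i u j) z\<bar> \<le> L * edist n x z"
    using V_lipschitz unfolding lipschitz_smooth_field_def by blast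
  then obtain B where B: "\<And>i x z m j. i \<le> d \<Longrightarrow> x \<in> Rn n \<Longrightarrow> z \<in> Rn n \<Longrightarrow> m < n \<Longrightarrow> j < n \<Longrightarrow>
      \<bar>partial_deriv m (\<lambda>u. V i u j) x - partial_deriv m (\<lambda>u. V i u j) z\<bar> \<le> B i * edist n x z"
    by (metis atMost_iff)
  define L0 where "L0 = (\<Sum>i\<le>d. \<bar>A i\<bar>)"
  define L1 where "L1 = (\<Sum>i\<le>d. \<bar>B i\<bar>)"
  have Ai: "A i \<le> L0" and Bi: "B i \<le> L1" if "i \<le> d" for i
  proof -
    have "\<bar>A i\<bar> \<le> L0" unfolding L0_def by (rule member_le_sum) (use that in auto)
    thus "A i \<le> L0" by linarith
    have "\<bar>B i\<bar> \<le> L1" unfolding L1_def by (rule member_le_sum) (use that in auto)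
    thus "B i \<le> L1" by linarith
  qed
  have nn: "L0 \<ge> 0" "L1 \<ge> 0" unfolding L0_def L1_def by (auto intro: sum_nonneg)
  have 1: "\<bar>V i x j - V i z j\<bar> \<le> L0 * edist n x z" if "i \<le> d" "x \<in> Rn n" "z \<in> Rn n" "j < n" for i x z j
  proof -
    have "\<bar>V i x j - V i z j\<bar> \<le> edist n (V i x) (V i z)" by (rule abs_component_le_edist[OF that(4)])
    also have "\<dots> \<le> A i * edist n x z" by (rule A[OF that(1-3)])
    also have "\<dots> \<le> L0 * edist n x z" by (rule mult_right_mono[OF Ai[OF that(1)]]) simp
    finally show ?thesis .
  qed
  have 2: "\<bar>partial_deriv m (\<lambda>u. V i u j) x\<bar> \<le> L0" if "i \<le> d" "x \<in> Rn n" "m < n" "j < n" for i x m j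
  proof (rule DERIV_abs_le_lipschitz)
    show "((\<lambda>s. V i (x(m := s)) j) has_real_derivative partial_deriv m (\<lambda>u. V i u j) x) (at (x m))"
      by (rule coord_diff_DERIV[OF coord_smooth_coord_diff[OF V_smooth]]) (use that in auto)
    show "\<bar>V i (x(m := s)) j - V i (x(m := x m)) j\<bar> \<le> L0 * \<bar>s - x m\<bar>" for s
      using 1[OF that(1) Rn_fun_upd[OF that(2,3)] that(2,4), of s] edist_fun_upd[OF that(3), of x s] by simp
  qed
  have 3: "\<bar>partial_deriv m (\<lambda>u. V i u j) x - partial_deriv m (\<lambda>u. V i u j) z\<bar> \<le> L1 * edist n x z"
    if "i \<le> d" "x \<in> Rn n" "z \<in> Rn n" "m < n" "j < n" for i x z m j
    using order_trans[OF B[OF that] mult_right_mono[OF Bi[OF that(1)]]] by simp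
  show ?thesis using nn 1 2 3 by (intro exI[of _ L0] exI[of _ L1]) auto
qed

text \<open>The difference of the fields along two solutions has to be controlled in Hoelder norm,
  which is where the Lipschitz derivatives enter through the four-point estimate. For large \<nu>
  the integrated difference has half the weighted norm, and iteration sends it to 0.\<close>

lemma young_ode_unique:
  assumes t: "t > 0"
    and XR: "\<And>u. 0 \<le> u \<Longrightarrow> u \<le> t \<Longrightarrow> X u \<in> Rn n" and SR: "\<And>u. 0 \<le> u \<Longrightarrow> u \<le> t \<Longrightarrow> S u \<in> Rn n"
    and Xh: "\<And>j. j < n \<Longrightarrow> holder_on 0 t (1 - \<alpha>) (HX j) (\<lambda>u. X u j)"
    and Sh: "\<And>j. j < n \<Longrightarrow> holder_on 0 t (1 - \<alpha>) (HS j) (\<lambda>u. S u j)"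
    and Xs: "\<And>u j. 0 \<le> u \<Longrightarrow> u \<le> t \<Longrightarrow> j < n \<Longrightarrow>
      X u j = x0 j + (\<Sum>i\<le>d. young_integral (\<lambda>s. V i (X s) j) (\<lambda>s. y s i) 0 u)"
    and Ss: "\<And>u j. 0 \<le> u \<Longrightarrow> u \<le> t \<Longrightarrow> j < n \<Longrightarrow>
      S u j = x0 j + (\<Sum>i\<le>d. young_integral (\<lambda>s. V i (S s) j) (\<lambda>s. y s i) 0 u)"
    and u: "0 \<le> u" "u \<le> t" and j: "j < n"
  shows "X u j = S u j"
proof -
  define \<theta> where "\<theta> = 1 - \<alpha>"
  have th: "\<theta> > 1/2" "\<theta> > 0" using th_half by (auto simp: \<theta>_def)
  have tpos: "\<theta> > 0" "\<theta> > 0" "\<theta> + \<theta> > 1" using th by auto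
  obtain L0 L1 where L: "L0 \<ge> 0" "L1 \<ge> 0"
    and V0: "\<And>i x z j. i \<le> d \<Longrightarrow> x \<in> Rn n \<Longrightarrow> z \<in> Rn n \<Longrightarrow> j < n \<Longrightarrow> \<bar>V i x j - V i z j\<bar> \<le> L0 * edist n x z"
    and V1: "\<And>i x j m. i \<le> d \<Longrightarrow> x \<in> Rn n \<Longrightarrow> j < n \<Longrightarrow> m < n \<Longrightarrow> \<bar>partial_deriv m (\<lambda>u. V i u j) x\<bar> \<le> L0"
    and V2: "\<And>i x z j m. i \<le> d \<Longrightarrow> x \<in> Rn n \<Longrightarrow> z \<in> Rn n \<Longrightarrow> j < n \<Longrightarrow> m < n \<Longrightarrow>
      \<bar>partial_deriv m (\<lambda>u. V i u j) x - partial_deriv m (\<lambda>u. V i u j) z\<bar> \<le> L1 * edist n x z"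
    using field_lipschitz_constants by blast
  define E where "E = (\<Sum>l<n. HX l + HS l)"
  have E0: "E \<ge> 0" unfolding E_def using Xh[THEN holder_on_nonneg] Sh[THEN holder_on_nonneg] by (intro sum_nonneg) auto
  have incr: "(\<Sum>l<n. \<bar>X u l - X v l\<bar> + \<bar>S u l - S v l\<bar>) \<le> E * (u - v) powr \<theta>"
    if "0 \<le> v" "v \<le> u" "u \<le> t" for u v
    unfolding E_def sum_distrib_right
    by (rule sum_mono) (use holder_onD[OF Xh] holder_onD[OF Sh] that in \<open>auto simp: \<theta>_def distrib_right intro!: add_mono\<close>)
  \<comment> \<open>Stated for any Z whose increments are dominated by those of X and S together, so
    that it applies to both.\<close>
  have path_hol: "holder_on 0 t \<theta> (L0 * E) (\<lambda>u. V i (Z u) j)"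
    if ZR: "\<And>u. 0 \<le> u \<Longrightarrow> u \<le> t \<Longrightarrow> Z u \<in> Rn n"
      and Zi: "\<And>u v l. \<bar>Z u l - Z v l\<bar> \<le> \<bar>X u l - X v l\<bar> + \<bar>S u l - S v l\<bar>"
      and i: "i \<le> d" and j: "j < n" for Z i j
  proof (rule holder_onI)
    fix v u assume uv: "0 \<le> v" "v \<le> u" "u \<le> t"
    have "\<bar>V i (Z u) j - V i (Z v) j\<bar> \<le> L0 * edist n (Z u) (Z v)"
      by (rule V0[OF i ZR ZR j]) (use uv in auto)
    also have "edist n (Z u) (Z v) \<le> (\<Sum>l<n. \<bar>Z u l - Z v l\<bar>)" unfolding edist_def by (rule enorm_le_sum)
    also have "\<dots> \<le> (\<Sum>l<n. \<bar>X u l - X v l\<bar> + \<bar>S u l - S v l\<bar>)" by (rule sum_mono) (rule Zi)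
    also have "\<dots> \<le> E * (u - v) powr \<theta>" by (rule incr[OF uv])
    finally show "\<bar>V i (Z u) j - V i (Z v) j\<bar> \<le> L0 * E * (u - v) powr \<theta>"
      using L by (simp add: mult_left_mono mult.assoc)
  qed (use L E0 in simp)
  define D where "D = (\<lambda>j u. X u j - S u j)"
  define f where "f = (\<lambda>i j u. V i (X u) j - V i (S u) j)"
  have Dint: "D j u = (\<Sum>i\<le>d. young_integral (f i j) (\<lambda>s. y s i) 0 u)" if u: "0 \<le> u" "u \<le> t" and j: "j < n" for j u
  proof -
    have "young_integral (f i j) (\<lambda>s. y s i) 0 u = young_integral (\<lambda>s. V i (X s) j) (\<lambda>s. y s i) 0 u
        - young_integral (\<lambda>s. V i (S s) j) (\<lambda>s. y s i) 0 u" if i: "i \<le> d" for i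
    proof (rule young_integral_eqI[OF u(1)])
      have h1: "holder_on 0 u (1 - \<alpha>) (L0 * E) (\<lambda>u. V i (X u) j)" and h2: "holder_on 0 u (1 - \<alpha>) (L0 * E) (\<lambda>u. V i (S u) j)"
        using holder_on_subset[OF path_hol[OF XR _ i j]] holder_on_subset[OF path_hol[OF SR _ i j]] u by (auto simp: \<theta>_def)
      show "has_young_integral (f i j) (\<lambda>s. y s i) 0 u (young_integral (\<lambda>s. V i (X s) j) (\<lambda>s. y s i) 0 u
        - young_integral (\<lambda>s. V i (S s) j) (\<lambda>s. y s i) 0 u)"
        unfolding f_def
        by (intro has_young_integral_diff young_integral_exists_driver[OF h1 u(1) i] young_integral_exists_driver[OF h2 u(1) i])
    qed
    thus ?thesis unfolding D_def using Xs[OF u j] Ss[OF u j] by (simp add: sum_subtractf)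
  qed
  define Q where "Q = real n * L0 + real n * (L1 * E)"
  have Q0: "Q \<ge> 0" using L E0 by (simp add: Q_def)
  have fb: "bielecki \<nu> \<theta> (Q * N) t (f i j)"
    if DN: "\<And>j. j < n \<Longrightarrow> bielecki \<nu> \<theta> N t (D j)" and nu: "\<nu> \<ge> 1" and N: "N \<ge> 0" and i: "i \<le> d" and j: "j < n" for \<nu> N i j
    unfolding bielecki_def
  proof (intro conjI allI impI)
    fix u assume u: "0 \<le> u" "u \<le> t"
    have "\<bar>f i j u\<bar> \<le> L0 * edist n (X u) (S u)" unfolding f_def by (rule V0[OF i XR SR j]) (use u in auto)
    also have "edist n (X u) (S u) \<le> (\<Sum>l<n. \<bar>D l u\<bar>)" unfolding edist_def D_def by (rule enorm_le_sum)
    also have "\<dots> \<le> (\<Sum>l<n. N * exp (\<nu> * u))" by (rule sum_mono) (use bieleckiD1[OF DN u] in auto)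
    finally have "\<bar>f i j u\<bar> \<le> L0 * (real n * (N * exp (\<nu> * u)))" using L by (simp add: mult_left_mono)
    also have "\<dots> \<le> Q * N * exp (\<nu> * u)"
    proof -
      have "real n * L0 * (N * exp (\<nu> * u)) \<le> Q * (N * exp (\<nu> * u))"
        unfolding Q_def using L E0 N by (intro mult_right_mono) auto
      thus ?thesis by (simp add: mult_ac)
    qed
    finally show "\<bar>f i j u\<bar> \<le> Q * N * exp (\<nu> * u)" .
  next
    fix u v assume uv: "0 \<le> v" "v \<le> u" "u \<le> t"
    define P where "P = N * \<nu> powr \<theta> * exp (\<nu> * u) * (u - v) powr \<theta>"
    have cs: "coord_diff n (\<lambda>x. V i x j)" by (rule coord_smooth_coord_diff[OF V_smooth[OF i j]])
    have "\<bar>f i j u - f i j v\<bar> \<le> (\<Sum>m<n. L0 * \<bar>(X u m - S u m) - (X v m - S v m)\<bar> +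
      L1 * (\<Sum>l<n. \<bar>X u l - X v l\<bar> + \<bar>S u l - S v l\<bar>) * \<bar>X v m - S v m\<bar>)"
      unfolding f_def
      by (rule four_point_estimate[OF cs V1[OF i _ j] V2[OF i _ _ j] L(2)]) (use uv XR SR in auto)
    also have "\<dots> \<le> (\<Sum>m<n. L0 * P + L1 * E * P)"
    proof (rule sum_mono)
      fix m assume "m \<in> {..<n}"
      hence m: "m < n" by simp
      have a: "\<bar>(X u m - S u m) - (X v m - S v m)\<bar> \<le> P"
        using bieleckiD2[OF DN[OF m] uv] by (simp add: D_def P_def)
      have "\<bar>X v m - S v m\<bar> \<le> N * exp (\<nu> * v)"
        using bieleckiD1[OF DN[OF m], of v] uv by (simp add: D_def)
      also have "\<dots> \<le> N * 1 * exp (\<nu> * u)" using N uv nu by (simp add: mult_left_mono)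
      also have "\<dots> \<le> N * \<nu> powr \<theta> * exp (\<nu> * u)"
        using N nu th by (intro mult_right_mono mult_left_mono ge_one_powr_ge_zero) auto
      finally have b: "\<bar>X v m - S v m\<bar> \<le> N * \<nu> powr \<theta> * exp (\<nu> * u)" .
      \<comment> \<open>Here the Hoelder increment is supplied by the known regularity of X and S,
        and their difference enters by its size at v; \<open>\<nu> powr \<theta> \<ge> 1\<close>
        brings the product to the form P of the other term.\<close>
      have "L1 * (\<Sum>l<n. \<bar>X u l - X v l\<bar> + \<bar>S u l - S v l\<bar>) * \<bar>X v m - S v m\<bar>
         \<le> L1 * (E * (u - v) powr \<theta>) * (N * \<nu> powr \<theta> * exp (\<nu> * u))"
        using incr[OF uv] b L E0 by (intro mult_mono mult_left_mono) auto
      also have "\<dots> = L1 * E * P" by (simp add: P_def)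
      finally show "L0 * \<bar>(X u m - S u m) - (X v m - S v m)\<bar> +
         L1 * (\<Sum>l<n. \<bar>X u l - X v l\<bar> + \<bar>S u l - S v l\<bar>) * \<bar>X v m - S v m\<bar> \<le> L0 * P + L1 * E * P"
        using a L by (intro add_mono mult_left_mono) auto
    qed
    also have "\<dots> = Q * P" by (simp add: Q_def algebra_simps)
    finally show "\<bar>f i j u - f i j v\<bar> \<le> Q * N * \<nu> powr \<theta> * exp (\<nu> * u) * (u - v) powr \<theta>"
      by (simp add: P_def mult.assoc)
  qed
  define G where "G = (real d + 1) * (bielecki_const \<theta> * (holder_factor * \<Lambda> t) * Q)"
  have G0: "G \<ge> 0" using Q0 holder_factor_pos Lambda_nonneg t bielecki_const_pos[OF th(1)] by (simp add: G_def)
  \<comment> \<open>Then \<open>\<nu> powr \<theta> = 2 * G + 1\<close>, which gives both \<nu>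
    \<ge> 1 and \<open>G * \<nu> powr (- \<theta>) \<le> 1/2\<close>.\<close>
  define \<nu> where "\<nu> = (2 * G + 1) powr (1 / \<theta>)"
  have nu: "\<nu> \<ge> 1" unfolding \<nu>_def using G0 th by (intro ge_one_powr_ge_zero) auto
  have nuG: "G * \<nu> powr (- \<theta>) \<le> 1/2"
  proof -
    have "\<nu> powr \<theta> = 2 * G + 1" using G0 th by (simp add: \<nu>_def powr_powr)
    thus ?thesis using G0 by (simp add: powr_minus field_simps)
  qed
  have contract: "bielecki \<nu> \<theta> (N / 2) t (D j)"
    if DN: "\<And>j. j < n \<Longrightarrow> bielecki \<nu> \<theta> N t (D j)" and N: "N \<ge> 0" and j: "j < n" for N j
  proof -
    define N' where "N' = bielecki_const \<theta> * (holder_factor * \<Lambda> t) * \<nu> powr (- \<theta>) * (Q * N)"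
    have N'0: "N' \<ge> 0" using bielecki_const_pos[OF th(1)] holder_factor_pos Lambda_nonneg t Q0 N by (simp add: N'_def)
    have "bielecki \<nu> \<theta> N' t (\<lambda>u. young_integral (f i j) (\<lambda>s. y s i) 0 u)" if i: "i \<le> d" for i
      unfolding N'_def
      by (rule bielecki_young_integral[OF fb[OF DN nu N i j] _ th(1)])
        (use holder_on_driver_Lambda[OF t i] nu Q0 N in \<open>auto simp: \<theta>_def\<close>)
    hence "bielecki \<nu> \<theta> (real (card {..d}) * (1 * N')) t (\<lambda>u. \<Sum>i\<le>d. 1 * young_integral (f i j) (\<lambda>s. y s i) 0 u)"
      by (intro bielecki_linear_combination N'0) auto
    hence b: "bielecki \<nu> \<theta> (real (card {..d}) * N') t (\<lambda>u. \<Sum>i\<le>d. young_integral (f i j) (\<lambda>s. y s i) 0 u)"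
      by (simp only: mult_1)
    have le: "real (card {..d}) * N' \<le> N / 2"
    proof -
      have "real (card {..d}) * N' = (G * \<nu> powr (- \<theta>)) * N" by (simp add: G_def N'_def)
      also have "\<dots> \<le> 1/2 * N" using nuG N by (intro mult_right_mono)
      finally show ?thesis by simp
    qed
    show ?thesis
      unfolding bielecki_def
    proof (intro conjI allI impI)
      fix u assume u: "0 \<le> u" "u \<le> t"
      have "\<bar>D j u\<bar> \<le> (real (card {..d}) * N') * exp (\<nu> * u)" using bieleckiD1[OF b u] Dint[OF u j] by simp
      also have "\<dots> \<le> N / 2 * exp (\<nu> * u)" by (rule mult_right_mono[OF le]) simp
      finally show "\<bar>D j u\<bar> \<le> N / 2 * exp (\<nu> * u)" .
    next
      fix u v assume uv: "0 \<le> v" "v \<le> u" "u \<le> t"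
      have "\<bar>D j u - D j v\<bar> \<le> (real (card {..d}) * N') * \<nu> powr \<theta> * exp (\<nu> * u) * (u - v) powr \<theta>"
        using bieleckiD2[OF b uv] Dint[of u j] Dint[of v j] uv j by simp
      also have "\<dots> \<le> N / 2 * \<nu> powr \<theta> * exp (\<nu> * u) * (u - v) powr \<theta>"
        by (intro mult_right_mono le) auto
      finally show "\<bar>D j u - D j v\<bar> \<le> N / 2 * \<nu> powr \<theta> * exp (\<nu> * u) * (u - v) powr \<theta>" .
    qed
  qed
  \<comment> \<open>Both solutions start at x0, so the difference is at most
    \<open>E * t powr \<theta>\<close>; the summand 1 serves the increments.\<close>
  define N0 where "N0 = E * (t powr \<theta> + 1)"
  have N0: "N0 \<ge> 0" using E0 by (simp add: N0_def)
  have start: "bielecki \<nu> \<theta> N0 t (D j)" if j: "j < n" for j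
  proof -
    have hD: "holder_on 0 t \<theta> E (D j)"
    proof -
      have "HX j + HS j \<le> E" unfolding E_def
        by (rule member_le_sum) (use j Xh[THEN holder_on_nonneg] Sh[THEN holder_on_nonneg] in auto)
      thus ?thesis using holder_on_mono[OF holder_on_diff[OF Xh[OF j] Sh[OF j]]] by (simp add: D_def \<theta>_def)
    qed
    have D0: "D j 0 = 0" using Dint[of 0 j] t j by simp
    show ?thesis
      unfolding bielecki_def
    proof (intro conjI allI impI)
      fix u assume u: "0 \<le> u" "u \<le> t"
      have "\<bar>D j u\<bar> \<le> E * u powr \<theta>" using holder_onD[OF hD, of 0 u] u D0 by simp
      also have "\<dots> \<le> E * (t powr \<theta> + 1) * 1"
        using u E0 th powr_mono2[of \<theta> u t] by (simp add: mult_left_mono)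
      also have "\<dots> \<le> N0 * exp (\<nu> * u)" unfolding N0_def using E0 u nu by (intro mult_left_mono) auto
      finally show "\<bar>D j u\<bar> \<le> N0 * exp (\<nu> * u)" .
    next
      fix u v assume uv: "0 \<le> v" "v \<le> u" "u \<le> t"
      have "\<bar>D j u - D j v\<bar> \<le> E * 1 * 1 * 1 * (u - v) powr \<theta>" using holder_onD[OF hD, of v u] uv by simp
      also have "\<dots> \<le> E * (t powr \<theta> + 1) * \<nu> powr \<theta> * exp (\<nu> * u) * (u - v) powr \<theta>"
        using E0 nu th uv by (intro mult_right_mono mult_mono ge_one_powr_ge_zero) auto
      finally show "\<bar>D j u - D j v\<bar> \<le> N0 * \<nu> powr \<theta> * exp (\<nu> * u) * (u - v) powr \<theta>" by (simp add: N0_def)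
    qed
  qed
  have all: "bielecki \<nu> \<theta> (N0 / 2 ^ k) t (D j)" if "j < n" for k j
    using that
  proof (induction k arbitrary: j)
    case (Suc k)
    have "bielecki \<nu> \<theta> (N0 / 2 ^ k / 2) t (D j)" using Suc N0 by (intro contract) auto
    thus ?case by (simp add: field_simps)
  qed (use start in auto)
  have "(\<lambda>k. N0 * (1/2) ^ k * exp (\<nu> * u)) \<longlonglongrightarrow> N0 * 0 * exp (\<nu> * u)"
    by (rule tendsto_mult[OF tendsto_mult[OF tendsto_const LIMSEQ_power_zero] tendsto_const]) simp
  hence lim: "(\<lambda>k. N0 * (1/2) ^ k * exp (\<nu> * u)) \<longlonglongrightarrow> 0" by simp
  have "\<bar>D j u\<bar> \<le> N0 * (1/2) ^ k * exp (\<nu> * u)" for k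
    using bieleckiD1[OF all[OF j] u, of k] by (simp add: power_divide)
  hence "\<bar>D j u\<bar> \<le> 0" by (intro LIMSEQ_le_const[OF lim]) auto
  thus ?thesis by (simp add: D_def)
qed

text \<open>Only \<kappa> + \<beta> > 1 is known of the exponent \<kappa> of X, which may lie below
  1 - \<alpha>. Inserted into the equation, X acquires the exponent \<beta> of the driver, and
  \<beta> > 1 - \<alpha>. Positivity of \<kappa> follows from \<beta> \<le> 1.\<close>

lemma solution_hol:
  assumes sol: "young_solution n d \<beta> V x0 y X" and t: "t > 0" and j: "j < n"
  shows "\<exists>H. holder_on 0 t (1 - \<alpha>) H (\<lambda>u. X u j)"
proof -
  obtain \<kappa> where \<kappa>: "\<kappa> + \<beta> > 1" "holder_path n \<kappa> X" using sol unfolding young_solution_def by blast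
  have k0: "\<kappa> > 0" using \<kappa> be_one by simp
  have b0: "\<beta> > 0" using be_half by simp
  have XR: "X u \<in> Rn n" if "0 \<le> u" for u using sol that unfolding young_solution_def by blast
  obtain A where A: "\<And>s u. s \<in> {0..t} \<Longrightarrow> u \<in> {0..t} \<Longrightarrow> edist n (X s) (X u) \<le> A * \<bar>s - u\<bar> powr \<kappa>"
    using \<kappa>(2) t unfolding holder_path_def by (meson less_imp_le)
  obtain L0 where L0: "L0 \<ge> 0"
    "\<And>i x z j. i \<le> d \<Longrightarrow> x \<in> Rn n \<Longrightarrow> z \<in> Rn n \<Longrightarrow> j < n \<Longrightarrow> \<bar>V i x j - V i z j\<bar> \<le> L0 * edist n x z"
    using field_lipschitz_constants by blast
  define H where "H = L0 * \<bar>A\<bar>"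
  have hV: "holder_on 0 t \<kappa> H (\<lambda>u. V i (X u) j)" if i: "i \<le> d" for i
  proof (rule holder_onI)
    show "0 \<le> H" using L0 by (simp add: H_def)
    fix v u assume uv: "0 \<le> v" "v \<le> u" "u \<le> t"
    have "\<bar>V i (X u) j - V i (X v) j\<bar> \<le> L0 * edist n (X u) (X v)"
      by (rule L0(2)[OF i XR XR j]) (use uv in auto)
    also have "\<dots> \<le> L0 * (\<bar>A\<bar> * \<bar>u - v\<bar> powr \<kappa>)"
    proof (rule mult_left_mono[OF _ L0(1)])
      have "edist n (X u) (X v) \<le> A * \<bar>u - v\<bar> powr \<kappa>" by (rule A) (use uv in auto)
      also have "\<dots> \<le> \<bar>A\<bar> * \<bar>u - v\<bar> powr \<kappa>" by (intro mult_right_mono) auto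
      finally show "edist n (X u) (X v) \<le> \<bar>A\<bar> * \<bar>u - v\<bar> powr \<kappa>" .
    qed
    finally show "\<bar>V i (X u) j - V i (X v) j\<bar> \<le> H * (u - v) powr \<kappa>" using uv by (simp add: H_def)
  qed
  have "\<exists>K. holder_on 0 t \<beta> K (\<lambda>u. young_integral (\<lambda>s. V i (X s) j) (\<lambda>s. y s i) 0 u)" if i: "i \<le> d" for i
  proof -
    have hy: "holder_on 0 t \<beta> (holder_bound t) (\<lambda>s. y s i)" using holder_on_driver t i by simp
    from holder_on_young_integral[OF hV[OF i] hy k0 b0 \<kappa>(1) holder_on_bounded[OF hV[OF i] k0]]
    show ?thesis using holder_on_nonneg[OF hV[OF i]] by (intro exI) auto
  qed
  then obtain K where K: "\<And>i. i \<le> d \<Longrightarrow> holder_on 0 t \<beta> (K i) (\<lambda>u. young_integral (\<lambda>s. V i (X s) j) (\<lambda>s. y s i) 0 u)"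
    by metis
  have "holder_on 0 t \<beta> (0 + (\<Sum>i\<le>d. K i)) (\<lambda>u. x0 j + (\<Sum>i\<le>d. young_integral (\<lambda>s. V i (X s) j) (\<lambda>s. y s i) 0 u))"
    by (intro holder_on_add holder_on_const holder_on_sum K) auto
  moreover have "X u j = x0 j + (\<Sum>i\<le>d. young_integral (\<lambda>s. V i (X s) j) (\<lambda>s. y s i) 0 u)" if "0 \<le> u" for u
    using sol that j unfolding young_solution_def by blast
  ultimately have "holder_on 0 t \<beta> (\<Sum>i\<le>d. K i) (\<lambda>u. X u j)"
    using holder_on_cong[of 0 t "\<lambda>u. X u j"] by simp
  from holder_on_weaken[OF this, of "1 - \<alpha>"] show ?thesis using al_half be_al by auto
qed

theorem solution_expansion:
  assumes sol: "young_solution n d \<beta> V x0 y X" and t: "t > 0" and r: "r > 1"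
    and C: "\<And>s. 0 \<le> s \<Longrightarrow> s \<le> t \<Longrightarrow> (\<Sum>k. r ^ Suc k * enorm n (taylor_vec (Suc k) s)) \<le> C"
    and an: "\<And>i. i \<le> d \<Longrightarrow> analytic_field_on n (V i) (ecball n x0 C)"
    and j: "j < n"
  shows "(\<lambda>k. taylor_vec (Suc k) t j) sums (X t j - x0 j)"
proof -
  have "\<forall>j\<in>{..<n}. \<exists>H. holder_on 0 t (1 - \<alpha>) H (\<lambda>u. X u j)" using solution_hol[OF sol t] by auto
  then obtain HX where HX: "\<And>j. j < n \<Longrightarrow> holder_on 0 t (1 - \<alpha>) (HX j) (\<lambda>u. X u j)" by (metis lessThan_iff)
  have "X t j = path_point t 1 j"
  proof (rule young_ode_unique[OF t _ _ HX holder_on_path_point[OF t]])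
    show "X u \<in> Rn n" if "0 \<le> u" for u using sol that unfolding young_solution_def by blast
    show "X u j = x0 j + (\<Sum>i\<le>d. young_integral (\<lambda>s. V i (X s) j) (\<lambda>s. y s i) 0 u)" if "0 \<le> u" "j < n" for u j
      using sol that unfolding young_solution_def by blast
    show "path_point u 1 j = x0 j + (\<Sum>i\<le>d. young_integral (\<lambda>s. V i (path_point s 1) j) (\<lambda>s. y s i) 0 u)"
      if "0 \<le> u" "u \<le> t" "j < n" for u j
      by (rule expansion_solves[OF t r C an that(3) that(1,2)])
  qed (use t j path_point_Rn in auto)
  thus ?thesis using path_point_sums[of t j 1] t j by (simp add: taylor_vec_eq)
qed

text \<open>Norms are added over words, not over coordinates, so no factor n arises: the constant of
  the theorem must not depend on the dimension.\<close>

lemma enorm_taylor_vec_le_words: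
  assumes k: "k \<ge> 1" and B: "\<And>I. I \<in> words d k \<Longrightarrow> \<bar>simplex_integral y I t\<bar> \<le> B"
  shows "enorm n (taylor_vec k t) \<le> (real d + 1) ^ k * (B * (Gamma (\<gamma> * real k) * M ^ k))"
proof -
  have "taylor_vec k t = (\<lambda>j. \<Sum>I\<in>words d k. simplex_integral y I t * P_word n V x0 I j)"
    by (auto simp: taylor_vec_def g_term_def words_def mult.commute)
  hence "enorm n (taylor_vec k t) \<le> (\<Sum>I\<in>words d k. enorm n (\<lambda>j. simplex_integral y I t * P_word n V x0 I j))"
    using enorm_sum_le[OF finite_words[of d k], of n "\<lambda>I j. simplex_integral y I t * P_word n V x0 I j"] by simp
  also have "\<dots> \<le> (\<Sum>I\<in>words d k. B * (Gamma (\<gamma> * real k) * M ^ k))"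
  proof (rule sum_mono)
    fix I assume I: "I \<in> words d k"
    have "enorm n (P_word n V x0 I) \<le> Gamma (\<gamma> * real (length I)) * M ^ length I"
      by (rule P_bound) (use I k in \<open>auto simp: words_def\<close>)
    hence "enorm n (P_word n V x0 I) \<le> Gamma (\<gamma> * real k) * M ^ k" using I by (simp add: words_def)
    thus "enorm n (\<lambda>j. simplex_integral y I t * P_word n V x0 I j) \<le> B * (Gamma (\<gamma> * real k) * M ^ k)"
      unfolding enorm_cmult using B[OF I] by (intro mult_mono) auto
  qed
  also have "\<dots> = (real d + 1) ^ k * (B * (Gamma (\<gamma> * real k) * M ^ k))" by (simp add: card_words add.commute)
  finally show ?thesis .
qed

text \<open>The remainder is the tail of the series. Order N + 1 + m carries N + m factors
  \<open>\<Lambda> * C\<close>, which with as many factors M(d + 1) form z ^ N * z ^ m; the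
  remaining M(d + 1) goes into the constant. Its leading 2 is the sum of the series of (1/2) ^
  m.\<close>

lemma remainder_estimate:
  fixes K t :: real
  defines "c \<equiv> 1 - 2 * \<alpha> - \<gamma>" and "A \<equiv> (1 + bielecki_const (1 - \<alpha>) * word_const \<alpha>) * (4 * exp 1)"
  defines "z \<equiv> M * (real d + 1) * \<Lambda> t * C_const \<alpha> t"
  assumes K: "\<And>N m (z::real). N \<ge> 1 \<Longrightarrow> z \<ge> 0 \<Longrightarrow>
      A ^ (N + 1 + m) * Gamma (\<gamma> * real (N + 1 + m)) * real (N + 1 + m) powr (- (1 - \<alpha>) * real (N + 1 + m)) * z ^ m
     \<le> K / Gamma (c * real N) * exp (2 * z powr (1 / c)) * (1/2) ^ m"
    and t: "t > 0" and N: "N \<ge> 1" and s: "\<And>j. j < n \<Longrightarrow> (\<lambda>k. taylor_vec (Suc k) t j) sums (X j - x0 j)"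
  shows "edist n X (\<lambda>j. x0 j + (\<Sum>k=1..N. taylor_vec k t j)) \<le>
    (2 * (4 * word_const \<alpha> + 2) * M * (real d + 1) * K) * driver_norm t * (z ^ N / Gamma (c * real N)) * exp (2 * z powr (1 / c))"
proof -
  define Kw where "Kw = 4 * word_const \<alpha> + 2"
  define Z where "Z = \<Lambda> t * C_const \<alpha> t"
  have Z0: "Z \<ge> 0" using Lambda_nonneg C_const_nonneg t by (simp add: Z_def)
  have z: "z = M * (real d + 1) * Z" by (simp add: z_def Z_def)
  have z0: "z \<ge> 0" using Z0 M_pos by (simp add: z)
  have Kw0: "Kw \<ge> 0" using word_const_pos by (simp add: Kw_def)
  have P0: "driver_norm t \<ge> 0" using driver_norm_nonneg t by simp
  define W where "W = Kw * M * (real d + 1) * driver_norm t * z ^ N * (K / Gamma (c * real N) * exp (2 * z powr (1 / c)))"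
  have summand: "enorm n (taylor_vec (Suc (m + N)) t) \<le> W * (1/2) ^ m" for m
  proof -
    define k where "k = N + 1 + m"
    have k: "k \<ge> 1" "k - 1 = N + m" by (auto simp: k_def)
    define B where "B = Kw * driver_norm t * (A ^ k * Z ^ (k - 1) * real k powr (- (1 - \<alpha>) * real k))"
    have "enorm n (taylor_vec k t) \<le> (real d + 1) ^ k * (B * (Gamma (\<gamma> * real k) * M ^ k))"
    proof (rule enorm_taylor_vec_le_words[OF k(1)])
      fix I assume I: "I \<in> words d k"
      hence "I \<noteq> []" "set I \<subseteq> {..d}" "length I = k" using k by (auto simp: words_def)
      thus "\<bar>simplex_integral y I t\<bar> \<le> B"
        using simplex_integral_bound[OF t, of I] by (simp add: B_def Kw_def A_def Z_def)
    qed
    also have "\<dots> = Kw * M * (real d + 1) * driver_norm t * z ^ N *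
        (A ^ k * Gamma (\<gamma> * real k) * real k powr (- (1 - \<alpha>) * real k) * z ^ m)"
    proof -
      have "(real d + 1) ^ k * M ^ k * Z ^ (k - 1) = (M * (real d + 1)) * z ^ N * z ^ m"
      proof -
        have "(real d + 1) ^ k * M ^ k * Z ^ (k - 1) = (real d + 1) * M * ((real d + 1) ^ (N + m) * M ^ (N + m) * Z ^ (N + m))"
          by (simp add: k_def mult_ac)
        also have "(real d + 1) ^ (N + m) * M ^ (N + m) * Z ^ (N + m) = z ^ (N + m)"
          unfolding z power_mult_distrib by (simp only: mult_ac)
        finally show ?thesis by (simp add: power_add mult_ac)
      qed
      moreover have "(real d + 1) ^ k * (B * (Gamma (\<gamma> * real k) * M ^ k)) =
         ((real d + 1) ^ k * M ^ k * Z ^ (k - 1)) * (Kw * driver_norm t * (A ^ k * real k powr (- (1 - \<alpha>) * real k) * Gamma (\<gamma> * real k)))"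
        by (simp add: B_def mult_ac)
      ultimately show ?thesis by (simp only: mult_ac)
    qed
    also have "\<dots> \<le> Kw * M * (real d + 1) * driver_norm t * z ^ N * (K / Gamma (c * real N) * exp (2 * z powr (1 / c)) * (1/2) ^ m)"
      unfolding k_def using K[OF N z0, of m] Kw0 M_pos P0 z0 by (intro mult_left_mono) auto
    finally show ?thesis by (simp add: W_def k_def mult.assoc add.commute)
  qed
  have half: "summable (\<lambda>m. W * (1/2) ^ m :: real)" "(\<Sum>m. W * (1/2) ^ m) = W * 2"
    using suminf_mult[OF summable_geometric[of "1/2 :: real"], of W] suminf_geometric[of "1/2 :: real"]
    by (auto intro!: summable_mult summable_geometric)
  have "enorm n (\<lambda>j. X j - (x0 j + (\<Sum>k=1..N. taylor_vec k t j))) \<le> (\<Sum>m. W * (1/2) ^ m)"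
  proof (rule enorm_suminf_le[OF _ summand half(1)])
    fix j assume j: "j < n"
    have "(\<lambda>m. taylor_vec (Suc (m + N)) t j) sums ((X j - x0 j) - (\<Sum>k<N. taylor_vec (Suc k) t j))"
      by (rule sums_split_initial_segment[OF s[OF j]])
    thus "(\<lambda>m. taylor_vec (Suc (m + N)) t j) sums (X j - (x0 j + (\<Sum>k=1..N. taylor_vec k t j)))"
      by (simp add: sum.atLeast1_atMost_eq algebra_simps)
  qed
  moreover have "W * 2 = (2 * Kw * M * (real d + 1) * K) * driver_norm t * (z ^ N / Gamma (c * real N)) * exp (2 * z powr (1 / c))"
    by (simp add: W_def)
  ultimately show ?thesis unfolding edist_def half(2) Kw_def by (simp only:)
qed

end

section \<open>The Taylor expansion\<close>

context taylor_setting
begin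

lemma taylor_at:
  fixes K r C t :: real
  defines "c \<equiv> 1 - 2 * \<alpha> - \<gamma>" and "A \<equiv> (1 + bielecki_const (1 - \<alpha>) * word_const \<alpha>) * (4 * exp 1)"
  assumes K: "\<And>N m (z::real). N \<ge> 1 \<Longrightarrow> z \<ge> 0 \<Longrightarrow>
      A ^ (N + 1 + m) * Gamma (\<gamma> * real (N + 1 + m)) * real (N + 1 + m) powr (- (1 - \<alpha>) * real (N + 1 + m)) * z ^ m
     \<le> K / Gamma (c * real N) * exp (2 * z powr (1 / c)) * (1/2) ^ m"
    and sol: "young_solution n d \<beta> V x0 y X" and t: "t \<ge> 0" and r: "r > 1"
    and C: "\<And>s. 0 \<le> s \<Longrightarrow> s \<le> t \<Longrightarrow> (\<Sum>k. r ^ Suc k * enorm n (taylor_vec (Suc k) s)) \<le> C"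
    and an: "\<And>i. i \<le> d \<Longrightarrow> analytic_field_on n (V i) (ecball n x0 C)"
  shows "(\<forall>N\<ge>1. taylor_estimate (2 * (4 * word_const \<alpha> + 2) * M * (real d + 1) * K) \<alpha> \<gamma> M d n V x0 y X t N) \<and>
    taylor_expansion n d V x0 y X t"
proof (cases "t = 0")
  \<comment> \<open>Here \<open>Lambda_const\<close> is 0 by convention and N \<ge> 1, so the
    right-hand side is 0; on the left, all Taylor vectors of positive order vanish at time
    0.\<close>
  case True
  have X0: "X 0 j = x0 j" if "j < n" for j
    using sol that unfolding young_solution_def by simp
  have g0: "taylor_vec (Suc k) 0 j = 0" for k j by (simp add: taylor_vec_eq Phi_Suc_zero_time)
  have "taylor_expansion n d V x0 y X 0"
    unfolding taylor_expansion_def taylor_vec_def[symmetric] using X0 g0 by simp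
  moreover have "taylor_estimate K' \<alpha> \<gamma> M d n V x0 y X 0 N" if N: "N \<ge> 1" for K' N
  proof -
    have "(\<Sum>k=1..N. taylor_vec k 0 j) = 0" for j
      using g0 by (intro sum.neutral) (metis Suc_le_D atLeastAtMost_iff One_nat_def)
    hence "edist n (X 0) (\<lambda>j. x0 j + (\<Sum>k=1..N. taylor_vec k 0 j)) = 0"
      unfolding edist_def enorm_def L2_set_def using X0 by simp
    thus ?thesis using N by (cases N) (simp_all add: taylor_estimate_def Lambda_const_def taylor_vec_def)
  qed
  ultimately show ?thesis using True by simp
next
  case False
  hence tp: "t > 0" using t by simp
  have s: "(\<lambda>k. taylor_vec (Suc k) t j) sums (X t j - x0 j)" if "j < n" for j
    by (rule solution_expansion[OF sol tp r C an that])
  have "taylor_expansion n d V x0 y X t"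
    unfolding taylor_expansion_def using s by (simp add: taylor_vec_def)
  moreover have "taylor_estimate (2 * (4 * word_const \<alpha> + 2) * M * (real d + 1) * K) \<alpha> \<gamma> M d n V x0 y X t N"
    if N: "N \<ge> 1" for N
    using remainder_estimate[OF K[unfolded c_def A_def] tp N s]
    unfolding taylor_estimate_def Let_def taylor_vec_def driver_norm_def \<Lambda>_def .
  ultimately show ?thesis by blast
qed

lemma suminf_ereal_taylor_vec:
  assumes "0 \<le> s" "0 \<le> r"
  shows "(\<Sum>k. ereal (r ^ Suc k * enorm n (g_term n d V x0 y (Suc k) s))) = ereal (\<Sum>k. r ^ Suc k * enorm n (taylor_vec (Suc k) s))"
proof -
  have "(\<lambda>k. ereal (r ^ Suc k * enorm n (taylor_vec (Suc k) s))) sums ereal (\<Sum>k. r ^ Suc k * enorm n (taylor_vec (Suc k) s))"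
    unfolding sums_ereal by (rule summable_sums[OF taylor_sum_summable[OF assms]])
  thus ?thesis unfolding taylor_vec_def by (rule sums_unique[symmetric])
qed

text \<open>No s \<le> t belongs to the set whose infimum is taken. The bound thus holds at every
  intermediate time, as the termwise integration over [0, t] requires.\<close>

lemma before_T_time:
  assumes "ereal t < T_time n d V x0 y C r" "0 \<le> s" "s \<le> t" "0 \<le> r"
  shows "(\<Sum>k. r ^ Suc k * enorm n (taylor_vec (Suc k) s)) \<le> C"
proof (rule ccontr)
  assume "\<not> (\<Sum>k. r ^ Suc k * enorm n (taylor_vec (Suc k) s)) \<le> C"
  hence "ereal C \<le> (\<Sum>k. ereal (r ^ Suc k * enorm n (g_term n d V x0 y (Suc k) s)))"
    unfolding suminf_ereal_taylor_vec[OF assms(2,4)] by simp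
  hence "T_time n d V x0 y C r \<le> ereal s"
    unfolding T_time_def using assms(2) by (intro Inf_lower) blast
  also have "\<dots> \<le> ereal t" using assms by simp
  finally show False using assms(1) by simp
qed

text \<open>The weighted sum is of order \<open>s powr (1 - \<alpha>)\<close> near 0, so it stays
  below C on a nondegenerate interval.\<close>

lemma T_time_pos:
  assumes C: "C > 0" and r: "r \<ge> 0"
  shows "T_time n d V x0 y C r > 0"
proof -
  obtain Q where Q: "Q \<ge> 0"
    "\<And>s. 0 \<le> s \<Longrightarrow> s \<le> 1 \<Longrightarrow> (\<Sum>k. r ^ Suc k * enorm n (taylor_vec (Suc k) s)) \<le> Q * s powr (1 - \<alpha>)"
    using taylor_sum_bound[OF zero_less_one r] by blast
  obtain \<delta> where \<delta>: "\<delta> > 0" "Q * \<delta> powr (1 - \<alpha>) < C" using small_powr[OF Q(1) th_pos(1) C] by blast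
  have "ereal (min \<delta> 1) \<le> T_time n d V x0 y C r"
    unfolding T_time_def
  proof (rule Inf_greatest)
    fix x assume "x \<in> {ereal t |t. t \<ge> 0 \<and> (\<Sum>k. ereal (r ^ Suc k * enorm n (g_term n d V x0 y (Suc k) t))) \<ge> ereal C}"
    then obtain s where s: "x = ereal s" "s \<ge> 0"
      and "(\<Sum>k. ereal (r ^ Suc k * enorm n (g_term n d V x0 y (Suc k) s))) \<ge> ereal C" by blast
    hence g: "C \<le> (\<Sum>k. r ^ Suc k * enorm n (taylor_vec (Suc k) s))" unfolding suminf_ereal_taylor_vec[OF s(2) r] by simp
    have "\<not> s < min \<delta> 1"
    proof
      assume l: "s < min \<delta> 1"
      hence "C \<le> Q * s powr (1 - \<alpha>)" using Q(2)[of s] s g by simp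
      also have "\<dots> \<le> Q * \<delta> powr (1 - \<alpha>)"
        using l s Q(1) th_pos(1) by (intro mult_left_mono powr_mono2) auto
      finally show False using \<delta>(2) by simp
    qed
    hence "min \<delta> 1 \<le> s" by (simp only: not_less)
    thus "ereal (min \<delta> 1) \<le> x" unfolding s(1) ereal_less_eq(3) .
  qed
  moreover have "0 < ereal (min \<delta> 1)" using \<delta> by simp
  ultimately show ?thesis by (rule less_le_trans[rotated])
qed

text \<open>For globally analytic fields the radius of the ball is free, so any bound on [0, t] can
  play the part of C.\<close>

lemma taylor_sum_bounded_on:
  assumes "t \<ge> 0" "r \<ge> 0"
  shows "\<exists>C>0. \<forall>s. 0 \<le> s \<longrightarrow> s \<le> t \<longrightarrow> (\<Sum>k. r ^ Suc k * enorm n (taylor_vec (Suc k) s)) \<le> C"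
proof -
  have T: "t + 1 > 0" using assms by simp
  obtain Q where Q: "Q \<ge> 0"
    "\<And>s. 0 \<le> s \<Longrightarrow> s \<le> t + 1 \<Longrightarrow> (\<Sum>k. r ^ Suc k * enorm n (taylor_vec (Suc k) s)) \<le> Q * s powr (1 - \<alpha>)"
    using taylor_sum_bound[OF T assms(2)] by blast
  have "(\<Sum>k. r ^ Suc k * enorm n (taylor_vec (Suc k) s)) \<le> Q * (t + 1) powr (1 - \<alpha>) + 1" if s: "0 \<le> s" "s \<le> t" for s
  proof -
    have "(\<Sum>k. r ^ Suc k * enorm n (taylor_vec (Suc k) s)) \<le> Q * s powr (1 - \<alpha>)" using Q(2) s by simp
    also have "\<dots> \<le> Q * (t + 1) powr (1 - \<alpha>)" using s Q(1) th_pos(1) by (intro mult_left_mono powr_mono2) auto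
    finally show ?thesis by simp
  qed
  moreover have "Q * (t + 1) powr (1 - \<alpha>) + 1 > 0" using Q(1) by (intro add_nonneg_pos) auto
  ultimately show ?thesis by blast
qed

end

theorem theorem2p9:
  fixes \<alpha> \<gamma> M :: real and d :: nat
  assumes "\<alpha> < 1 / 2" and "M > 0" and "0 < \<gamma>" and "\<gamma> < 1 - 2 * \<alpha>"
  shows "\<exists>K>0. \<forall>(n::nat) (x0 :: nat \<Rightarrow> real)
      (V :: nat \<Rightarrow> (nat \<Rightarrow> real) \<Rightarrow> (nat \<Rightarrow> real)) (C::real) (\<beta>::real)
      (y :: real \<Rightarrow> nat \<Rightarrow> real) (X :: real \<Rightarrow> nat \<Rightarrow> real).
    n \<ge> 1 \<and> x0 \<in> Rn n \<and> C > 0 \<and>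
    (\<forall>i\<le>d. lipschitz_smooth_field n (V i) \<and> analytic_field_on n (V i) (ecball n x0 C)) \<and>
    1 / 2 < \<beta> \<and> \<beta> \<le> 1 \<and> 1 - \<beta> < \<alpha> \<and> holder_path (Suc d) \<beta> y \<and>
    young_solution n d \<beta> V x0 y X \<and>
    (\<forall>I. I \<noteq> [] \<and> set I \<subseteq> {..d} \<longrightarrow>
      enorm n (P_word n V x0 I) \<le> Gamma (\<gamma> * real (length I)) * M ^ length I)
    \<longrightarrow>
    (\<forall>r>1. T_time n d V x0 y C r > 0 \<and>
      (\<forall>t\<ge>0. ereal t < T_time n d V x0 y C r \<longrightarrow>
        (\<forall>N\<ge>1. taylor_estimate K \<alpha> \<gamma> M d n V x0 y X t N) \<and>
        taylor_expansion n d V x0 y X t)) \<and>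
    ((\<forall>i\<le>d. analytic_field_on n (V i) (Rn n)) \<longrightarrow>
      (\<forall>t\<ge>0. (\<forall>N\<ge>1. taylor_estimate K \<alpha> \<gamma> M d n V x0 y X t N) \<and>
        taylor_expansion n d V x0 y X t))"
proof (cases "\<alpha> > 0")
  case False
  \<comment> \<open>No \<open>\<beta> \<le> 1\<close> satisfies \<open>1 - \<beta> < \<alpha>\<close>.\<close>
  thus ?thesis by (intro exI[of _ 1]) auto
next
  case True
  define c where "c = 1 - 2 * \<alpha> - \<gamma>"
  define A where "A = (1 + bielecki_const (1 - \<alpha>) * word_const \<alpha>) * (4 * exp 1)"
  have w: "word_const \<alpha> > 0" unfolding word_const_def using True assms by simp
  have A0: "A \<ge> 0" using w bielecki_const_pos[of "1 - \<alpha>"] assms by (simp add: A_def)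
  obtain K0 where K0: "K0 > 0" and K: "\<And>N m (z::real). N \<ge> 1 \<Longrightarrow> z \<ge> 0 \<Longrightarrow>
      A ^ (N + 1 + m) * Gamma (\<gamma> * real (N + 1 + m)) * real (N + 1 + m) powr (- (1 - \<alpha>) * real (N + 1 + m)) * z ^ m
     \<le> K0 / Gamma (c * real N) * exp (2 * z powr (1 / c)) * (1/2) ^ m"
    using mittag_leffler_tail_term[of \<gamma> c "1 - \<alpha>" A] True assms A0 unfolding c_def by auto
  \<comment> \<open>No factor involves n, x0, V, C, \<beta>, y or X, so K can be fixed before
    them.\<close>
  define K where "K = 2 * (4 * word_const \<alpha> + 2) * M * (real d + 1) * K0"
  have Kpos: "K > 0" unfolding K_def using w K0 assms by (intro mult_pos_pos) auto
  show ?thesis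
  proof (intro exI[of _ K] conjI Kpos allI impI; (elim conjE)?)
    fix n :: nat and x0 V C \<beta> y X
    assume hyp: "n \<ge> 1" "x0 \<in> Rn n" "C > 0"
      "\<forall>i\<le>d. lipschitz_smooth_field n (V i) \<and> analytic_field_on n (V i) (ecball n x0 C)"
      "1 / 2 < \<beta>" "\<beta> \<le> 1" "1 - \<beta> < \<alpha>" "holder_path (Suc d) \<beta> y"
      "young_solution n d \<beta> V x0 y X"
      "\<forall>I. I \<noteq> [] \<and> set I \<subseteq> {..d} \<longrightarrow>
        enorm n (P_word n V x0 I) \<le> Gamma (\<gamma> * real (length I)) * M ^ length I"
    interpret taylor_setting d \<alpha> \<beta> y n V x0 \<gamma> M
      by unfold_locales (use hyp assms in auto)
    have at: "(\<forall>N\<ge>1. taylor_estimate K \<alpha> \<gamma> M d n V x0 y X t N) \<and> taylor_expansion n d V x0 y X t"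
      if "t \<ge> 0" "r > 1" "\<And>s. 0 \<le> s \<Longrightarrow> s \<le> t \<Longrightarrow> (\<Sum>k. r ^ Suc k * enorm n (taylor_vec (Suc k) s)) \<le> C'"
        "\<And>i. i \<le> d \<Longrightarrow> analytic_field_on n (V i) (ecball n x0 C')" for t r C' :: real
      unfolding K_def
      by (rule taylor_at[OF _ hyp(9) that]) (rule K[unfolded A_def c_def])
    show "T_time n d V x0 y C r > 0" if "r > 1" for r
      by (rule T_time_pos) (use hyp that in auto)
    show "taylor_estimate K \<alpha> \<gamma> M d n V x0 y X t N"
      if "r > 1" "t \<ge> 0" "ereal t < T_time n d V x0 y C r" "N \<ge> 1" for r t N
      using at[OF that(2,1) before_T_time[OF that(3)]] hyp(4) that by auto
    show "taylor_expansion n d V x0 y X t"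
      if "r > 1" "t \<ge> 0" "ereal t < T_time n d V x0 y C r" for r t
      using at[OF that(2,1) before_T_time[OF that(3)]] hyp(4) that by auto
    have global: "(\<forall>N\<ge>1. taylor_estimate K \<alpha> \<gamma> M d n V x0 y X t N) \<and> taylor_expansion n d V x0 y X t"
      if an: "\<forall>i\<le>d. analytic_field_on n (V i) (Rn n)" and t: "t \<ge> 0" for t
    proof -
      \<comment> \<open>The value 2 stands for any r > 1. That C' depends on t and on the path is
        harmless, as it does not enter K.\<close>
      obtain C' where C': "\<And>s. 0 \<le> s \<Longrightarrow> s \<le> t \<Longrightarrow> (\<Sum>k. 2 ^ Suc k * enorm n (taylor_vec (Suc k) s)) \<le> C'"
        using taylor_sum_bounded_on[OF t, of 2] by auto
      have "analytic_field_on n (V i) (ecball n x0 C')" if "i \<le> d" for i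
        using an that unfolding analytic_field_on_def ecball_def by blast
      thus ?thesis by (intro at[OF t _ C']) auto
    qed
    show "taylor_estimate K \<alpha> \<gamma> M d n V x0 y X t N"
      if "\<forall>i\<le>d. analytic_field_on n (V i) (Rn n)" "t \<ge> 0" "N \<ge> 1" for t N
      using global that by blast
    show "taylor_expansion n d V x0 y X t"
      if "\<forall>i\<le>d. analytic_field_on n (V i) (Rn n)" "t \<ge> 0" for t
      using global that by blast
  qed
qed

end
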